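(* Let $H$ be a split exact, $M_2$-stable functor from locally convex algebras to abelian groups. Then for all locally convex algebras $\mathcal{A}$ and $\mathcal{B}$ there is a product (homomorphism of abelian groups) $$K(\mathcal{A})\otimes H(\mathcal{B})\to H(\mathcal{A}\otimes_\pi\mathcal{B}),\qquad x\otimes b\mapsto x\cdot b,$$ such that: (i) if $\mathcal{A}=\mathbb{C}$ and $x=1\in K(\mathbb{C})$, then $x\cdot b=b$ for all $b\in H(\mathcal{B})$ (identifying $\mathbb{C}\otimes_\pi\mathcal{B}=\mathcal{B}$); (ii) if $f:\mathcal{A}_1\to\mathcal{A}_2$ and $g:\mathcal{B}_1\to\mathcal{B}_2$ are morphisms of locally convex algebras, $x_1\in K(\mathcal{A}_1)$ and $b_1\in H(\mathcal{B}_1)$, then $f_*(x_1)\cdot g_*(b_1)=(f\otimes g)_*(x_1\cdot b_1)$; (iii) if $\mathcal{C}$ is another locally convex algebra, $x\in K(\mathcal{A})$, $y\in K(\mathcal{B})$ and $c\in H(\mathcal{C})$, then $(x\cup y)\cdot c=x\cdot(y\cdot c)$.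
   Context: A locally convex algebra is a complete locally convex complex vector space with a jointly continuous associative multiplication; morphisms are continuous algebra homomorphisms; $\otimes_\pi$ is the completed projective tensor product. A functor $H$ (covariant) is split exact if it maps every short exact sequence of locally convex algebras that splits in the category of locally convex algebras to a short exact sequence. It is $M_2$-stable if the corner embedding $\mathcal{A}\to M_2(\mathcal{A})$ induces an isomorphism for every $\mathcal{A}$. $K(\mathcal{A})$ is the algebraic $K_0$-group: for unital $\mathcal{A}$ the Grothendieck group of classes of idempotents in matrices over $\mathcal{A}$, and $K(\mathcal{A})=\ker(K(\mathcal{A}^+)\to K(\mathbb{C}))$ in general, with $\mathcal{A}^+$ the unitisation. $\cup:K(\mathcal{A})\otimes K(\mathcal{B})\to K(\mathcal{A}\otimes_\pi\mathcal{B})$ is the outer product, given on idempotents by $[p]\cup[q]=[p\otimes q]$. *)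

theory Defs
  imports "HOL-Analysis.Analysis" "HOL-Algebra.Module" "HOL-Algebra.Exact_Sequence"
begin

section \<open>Locally convex algebras\<close>

definition complex_ring :: "complex ring" where
  "complex_ring = \<lparr>carrier = UNIV, mult = (*), one = 1, zero = 0, add = (+)\<rparr>"

text \<open>
  The \<open>one\<close> field inherited from the record of rings carries no information: algebras need not be
  unital and morphisms need not preserve it.
\<close>

record 'a lca = "(complex, 'a) module" +
  topo :: "'a topology"

definition seminorm :: "'a lca \<Rightarrow> ('a \<Rightarrow> real) \<Rightarrow> bool" where
  "seminorm A p \<longleftrightarrow>
     (\<forall>x\<in>carrier A. 0 \<le> p x) \<and>
     (\<forall>x\<in>carrier A. \<forall>y\<in>carrier A. p (x \<oplus>\<^bsub>A\<^esub> y) \<le> p x + p y) \<and>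
     (\<forall>c. \<forall>x\<in>carrier A. p (c \<odot>\<^bsub>A\<^esub> x) = cmod c * p x)"

definition cont_seminorms :: "'a lca \<Rightarrow> ('a \<Rightarrow> real) set" where
  "cont_seminorms A = {p. seminorm A p \<and> continuous_map (topo A) euclideanreal p}"

text \<open>The topology is generated by a family of seminorms; in particular its space is the carrier.\<close>

definition locally_convex :: "'a lca \<Rightarrow> bool" where
  "locally_convex A \<longleftrightarrow>
     (\<exists>\<Gamma>. (\<forall>p\<in>\<Gamma>. seminorm A p) \<and>
        (\<forall>U. openin (topo A) U \<longleftrightarrow>
           U \<subseteq> carrier A \<and>
           (\<forall>x\<in>U. \<exists>F \<epsilon>. finite F \<and> F \<subseteq> \<Gamma> \<and> 0 < \<epsilon> \<and>
              {y \<in> carrier A. \<forall>p\<in>F. p (y \<ominus>\<^bsub>A\<^esub> x) < \<epsilon>} \<subseteq> U)))"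

definition cauchy_filter_on :: "'a lca \<Rightarrow> 'a filter \<Rightarrow> bool" where
  "cauchy_filter_on A F \<longleftrightarrow>
     F \<noteq> bot \<and> F \<le> principal (carrier A) \<and>
     (\<forall>U. openin (topo A) U \<and> \<zero>\<^bsub>A\<^esub> \<in> U \<longrightarrow>
        (\<forall>\<^sub>F (x, y) in F \<times>\<^sub>F F. x \<ominus>\<^bsub>A\<^esub> y \<in> U))"

text \<open>Complete locally convex spaces are understood to be Hausdorff.\<close>

locale locally_convex_algebra = Module.module complex_ring A for A :: "'a lca" (structure) +
  assumes m_closed: "\<lbrakk>x \<in> carrier A; y \<in> carrier A\<rbrakk> \<Longrightarrow> x \<otimes> y \<in> carrier A"
    and m_assoc: "\<lbrakk>x \<in> carrier A; y \<in> carrier A; z \<in> carrier A\<rbrakk>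
      \<Longrightarrow> (x \<otimes> y) \<otimes> z = x \<otimes> (y \<otimes> z)"
    and l_distr: "\<lbrakk>x \<in> carrier A; y \<in> carrier A; z \<in> carrier A\<rbrakk>
      \<Longrightarrow> (x \<oplus> y) \<otimes> z = x \<otimes> z \<oplus> y \<otimes> z"
    and r_distr: "\<lbrakk>x \<in> carrier A; y \<in> carrier A; z \<in> carrier A\<rbrakk>
      \<Longrightarrow> z \<otimes> (x \<oplus> y) = z \<otimes> x \<oplus> z \<otimes> y"
    and smult_m_left: "\<lbrakk>x \<in> carrier A; y \<in> carrier A\<rbrakk> \<Longrightarrow> (c \<odot> x) \<otimes> y = c \<odot> (x \<otimes> y)"
    and smult_m_right: "\<lbrakk>x \<in> carrier A; y \<in> carrier A\<rbrakk> \<Longrightarrow> x \<otimes> (c \<odot> y) = c \<odot> (x \<otimes> y)"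
    and lc: "locally_convex A"
    and hausdorff: "Hausdorff_space (topo A)"
    and complete: "cauchy_filter_on A F \<Longrightarrow> \<exists>x. limitin (topo A) (\<lambda>y. y) x F"
    and m_continuous:
      "continuous_map (prod_topology (topo A) (topo A)) (topo A) (\<lambda>(x, y). x \<otimes> y)"

definition lca_hom :: "'a lca \<Rightarrow> 'b lca \<Rightarrow> ('a \<Rightarrow> 'b) set" where
  "lca_hom A B =
     {f \<in> hom A B. f \<in> hom (add_monoid A) (add_monoid B) \<and>
        (\<forall>c. \<forall>x\<in>carrier A. f (c \<odot>\<^bsub>A\<^esub> x) = c \<odot>\<^bsub>B\<^esub> f x) \<and>
        continuous_map (topo A) (topo B) f}"

definition lca_iso :: "'a lca \<Rightarrow> 'b lca \<Rightarrow> ('a \<Rightarrow> 'b) set" where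
  "lca_iso A B = {f \<in> lca_hom A B. homeomorphic_map (topo A) (topo B) f}"

definition complex_lca :: "complex lca" where
  "complex_lca = \<lparr>carrier = UNIV, mult = (*), one = 1, zero = 0, add = (+), smult = (*),
     topo = euclidean\<rparr>"

definition unitization :: "'a lca \<Rightarrow> (complex \<times> 'a) lca" where
  "unitization A = \<lparr>carrier = UNIV \<times> carrier A,
     mult = (\<lambda>(c, a) (d, b). (c * d, (c \<odot>\<^bsub>A\<^esub> b \<oplus>\<^bsub>A\<^esub> d \<odot>\<^bsub>A\<^esub> a) \<oplus>\<^bsub>A\<^esub> a \<otimes>\<^bsub>A\<^esub> b)),
     one = (1, \<zero>\<^bsub>A\<^esub>),
     zero = (0, \<zero>\<^bsub>A\<^esub>),
     add = (\<lambda>(c, a) (d, b). (c + d, a \<oplus>\<^bsub>A\<^esub> b)),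
     smult = (\<lambda>z (c, a). (z * c, z \<odot>\<^bsub>A\<^esub> a)),
     topo = prod_topology euclidean (topo A)\<rparr>"


section \<open>Matrices\<close>

definition mats :: "('a, 'm) ring_scheme \<Rightarrow> nat \<Rightarrow> nat \<Rightarrow> (nat \<times> nat \<Rightarrow> 'a) set" where
  "mats R m n = {..<m} \<times> {..<n} \<rightarrow>\<^sub>E carrier R"

definition mat_mult :: "('a, 'm) ring_scheme \<Rightarrow> nat \<Rightarrow> nat \<Rightarrow> nat
    \<Rightarrow> (nat \<times> nat \<Rightarrow> 'a) \<Rightarrow> (nat \<times> nat \<Rightarrow> 'a) \<Rightarrow> (nat \<times> nat \<Rightarrow> 'a)" where
  "mat_mult R l m n x y =
     (\<lambda>(i, k)\<in>{..<l} \<times> {..<n}. \<Oplus>\<^bsub>R\<^esub>j\<in>{..<m}. x (i, j) \<otimes>\<^bsub>R\<^esub> y (j, k))"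

definition mat_lca :: "nat \<Rightarrow> 'a lca \<Rightarrow> (nat \<times> nat \<Rightarrow> 'a) lca" where
  "mat_lca n A = \<lparr>carrier = mats A n n,
     mult = mat_mult A n n n,
     one = (\<lambda>(i, j)\<in>{..<n} \<times> {..<n}. if i = j then \<one>\<^bsub>A\<^esub> else \<zero>\<^bsub>A\<^esub>),
     zero = (\<lambda>_\<in>{..<n} \<times> {..<n}. \<zero>\<^bsub>A\<^esub>),
     add = (\<lambda>x y. \<lambda>ij\<in>{..<n} \<times> {..<n}. x ij \<oplus>\<^bsub>A\<^esub> y ij),
     smult = (\<lambda>c x. \<lambda>ij\<in>{..<n} \<times> {..<n}. c \<odot>\<^bsub>A\<^esub> x ij),
     topo = product_topology (\<lambda>_. topo A) ({..<n} \<times> {..<n})\<rparr>"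

definition corner :: "nat \<Rightarrow> 'a lca \<Rightarrow> 'a \<Rightarrow> (nat \<times> nat \<Rightarrow> 'a)" where
  "corner n A a = (\<lambda>(i, j)\<in>{..<n} \<times> {..<n}. if i = 0 \<and> j = 0 then a else \<zero>\<^bsub>A\<^esub>)"

definition block_diag :: "('a, 'm) ring_scheme \<Rightarrow> nat \<Rightarrow> nat
    \<Rightarrow> (nat \<times> nat \<Rightarrow> 'a) \<Rightarrow> (nat \<times> nat \<Rightarrow> 'a) \<Rightarrow> (nat \<times> nat \<Rightarrow> 'a)" where
  "block_diag R m n e f =
     (\<lambda>(i, j)\<in>{..<m + n} \<times> {..<m + n}.
        if i < m \<and> j < m then e (i, j)
        else if m \<le> i \<and> m \<le> j then f (i - m, j - m)
        else \<zero>\<^bsub>R\<^esub>)"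

definition mat_map :: "('a \<Rightarrow> 'b) \<Rightarrow> nat \<Rightarrow> (nat \<times> nat \<Rightarrow> 'a) \<Rightarrow> (nat \<times> nat \<Rightarrow> 'b)" where
  "mat_map f n e = (\<lambda>ij\<in>{..<n} \<times> {..<n}. f (e ij))"

text \<open>Kronecker product with respect to a bilinear map \<open>t\<close> on the entries.\<close>

definition mat_tensor :: "('a \<Rightarrow> 'b \<Rightarrow> 'c) \<Rightarrow> nat \<Rightarrow> nat
    \<Rightarrow> (nat \<times> nat \<Rightarrow> 'a) \<Rightarrow> (nat \<times> nat \<Rightarrow> 'b) \<Rightarrow> (nat \<times> nat \<Rightarrow> 'c)" where
  "mat_tensor t m n p q =
     (\<lambda>(i, j)\<in>{..<m * n} \<times> {..<m * n}.
        t (p (i div n, j div n)) (q (i mod n, j mod n)))"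


section \<open>The Grothendieck group of a commutative monoid\<close>

definition groth_rel :: "('a, 'm) monoid_scheme \<Rightarrow> (('a \<times> 'a) \<times> ('a \<times> 'a)) set" where
  "groth_rel M =
     {((a, b), (c, d)). a \<in> carrier M \<and> b \<in> carrier M \<and> c \<in> carrier M \<and> d \<in> carrier M \<and>
        (\<exists>k\<in>carrier M. (a \<otimes>\<^bsub>M\<^esub> d) \<otimes>\<^bsub>M\<^esub> k = (c \<otimes>\<^bsub>M\<^esub> b) \<otimes>\<^bsub>M\<^esub> k)}"

definition groth_class :: "('a, 'm) monoid_scheme \<Rightarrow> 'a \<Rightarrow> 'a \<Rightarrow> ('a \<times> 'a) set" where
  "groth_class M a b = groth_rel M `` {(a, b)}"

definition grothendieck :: "('a, 'm) monoid_scheme \<Rightarrow> ('a \<times> 'a) set monoid" where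
  "grothendieck M =
     \<lparr>carrier = (carrier M \<times> carrier M) // groth_rel M,
      mult = (\<lambda>X Y. \<Union>(a, b)\<in>X. \<Union>(c, d)\<in>Y. groth_class M (a \<otimes>\<^bsub>M\<^esub> c) (b \<otimes>\<^bsub>M\<^esub> d)),
      one = groth_class M \<one>\<^bsub>M\<^esub> \<one>\<^bsub>M\<^esub>\<rparr>"

definition groth_map :: "('b, 'n) monoid_scheme \<Rightarrow> ('a \<Rightarrow> 'b)
    \<Rightarrow> ('a \<times> 'a) set \<Rightarrow> ('b \<times> 'b) set" where
  "groth_map N \<phi> X = (\<Union>(a, b)\<in>X. groth_class N (\<phi> a) (\<phi> b))"

text \<open>
  Extension of a biadditive map \<open>\<beta>\<close> of monoids:
  \<open>([a] - [b], [c] - [d])\<close> goes to \<open>([\<beta> a c] + [\<beta> b d]) - ([\<beta> a d] + [\<beta> b c])\<close>.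
\<close>

definition groth_bimap :: "('c, 'n) monoid_scheme \<Rightarrow> ('a \<Rightarrow> 'b \<Rightarrow> 'c)
    \<Rightarrow> ('a \<times> 'a) set \<Rightarrow> ('b \<times> 'b) set \<Rightarrow> ('c \<times> 'c) set" where
  "groth_bimap N \<beta> X Y =
     (\<Union>(a, b)\<in>X. \<Union>(c, d)\<in>Y.
        groth_class N (\<beta> a c \<otimes>\<^bsub>N\<^esub> \<beta> b d) (\<beta> a d \<otimes>\<^bsub>N\<^esub> \<beta> b c))"


section \<open>Algebraic K-theory in degree zero\<close>

type_synonym 'a idem = "nat \<times> (nat \<times> nat \<Rightarrow> 'a)"
type_synonym 'a k0 = "('a idem set \<times> 'a idem set) set"

definition idems :: "('a, 'm) ring_scheme \<Rightarrow> 'a idem set" where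
  "idems R = {(n, e). e \<in> mats R n n \<and> mat_mult R n n n e e = e}"

definition idem_equiv :: "('a, 'm) ring_scheme \<Rightarrow> ('a idem \<times> 'a idem) set" where
  "idem_equiv R =
     {((m, e), (n, f)). (m, e) \<in> idems R \<and> (n, f) \<in> idems R \<and>
        (\<exists>x\<in>mats R m n. \<exists>y\<in>mats R n m.
           mat_mult R m n m x y = e \<and> mat_mult R n m n y x = f)}"

definition idem_class :: "('a, 'm) ring_scheme \<Rightarrow> 'a idem \<Rightarrow> 'a idem set" where
  "idem_class R p = idem_equiv R `` {p}"

definition idem_monoid :: "('a, 'm) ring_scheme \<Rightarrow> 'a idem set monoid" where
  "idem_monoid R =
     \<lparr>carrier = idems R // idem_equiv R,
      mult = (\<lambda>P Q. \<Union>(m, e)\<in>P. \<Union>(n, f)\<in>Q. idem_class R (m + n, block_diag R m n e f)),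
      one = idem_class R (0, \<lambda>_. undefined)\<rparr>"

definition idem_map :: "('b, 'n) ring_scheme \<Rightarrow> ('a \<Rightarrow> 'b) \<Rightarrow> 'a idem set \<Rightarrow> 'b idem set" where
  "idem_map S f P = (\<Union>(n, e)\<in>P. idem_class S (n, mat_map f n e))"

definition idem_tensor :: "('c, 'n) ring_scheme \<Rightarrow> ('a \<Rightarrow> 'b \<Rightarrow> 'c)
    \<Rightarrow> 'a idem set \<Rightarrow> 'b idem set \<Rightarrow> 'c idem set" where
  "idem_tensor T t P Q =
     (\<Union>(m, p)\<in>P. \<Union>(n, q)\<in>Q. idem_class T (m * n, mat_tensor t m n p q))"

definition K0 :: "('a, 'm) ring_scheme \<Rightarrow> 'a k0 monoid" where
  "K0 R = grothendieck (idem_monoid R)"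

definition K0_map :: "('b, 'n) ring_scheme \<Rightarrow> ('a \<Rightarrow> 'b) \<Rightarrow> 'a k0 \<Rightarrow> 'b k0" where
  "K0_map S f = groth_map (idem_monoid S) (idem_map S f)"

definition K0_cup :: "('c, 'n) ring_scheme \<Rightarrow> ('a \<Rightarrow> 'b \<Rightarrow> 'c) \<Rightarrow> 'a k0 \<Rightarrow> 'b k0 \<Rightarrow> 'c k0" where
  "K0_cup T t = groth_bimap (idem_monoid T) (idem_tensor T t)"

text \<open>
  \<open>K0\<close> is the group of a unital ring; \<open>KG A\<close> is the group \<open>K(A)\<close> of an arbitrary locally convex
  algebra, also if \<open>A\<close> happens to be unital.
\<close>

definition KG :: "'a lca \<Rightarrow> (complex \<times> 'a) k0 monoid" where
  "KG A = (K0 (unitization A))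
     \<lparr>carrier := kernel (K0 (unitization A)) (K0 complex_lca) (K0_map complex_lca fst)\<rparr>"

definition KG_map :: "'b lca \<Rightarrow> ('a \<Rightarrow> 'b) \<Rightarrow> (complex \<times> 'a) k0 \<Rightarrow> (complex \<times> 'b) k0" where
  "KG_map B f = K0_map (unitization B) (\<lambda>(c, a). (c, f a))"

text \<open>
  The class \<open>[p]\<close> in \<open>K(A)\<close> of an idempotent matrix \<open>p\<close> over \<open>A\<close>, via the inclusion of \<open>A\<close> into
  its unitisation.
\<close>

definition KG_class :: "'a lca \<Rightarrow> 'a idem \<Rightarrow> (complex \<times> 'a) k0" where
  "KG_class A p =
     groth_class (idem_monoid (unitization A))
       (idem_map (unitization A) (\<lambda>a. (0, a)) (idem_class A p)) \<one>\<^bsub>idem_monoid (unitization A)\<^esub>"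

definition KG_one :: "(complex \<times> complex) k0" where
  "KG_one = KG_class complex_lca (1, \<lambda>_\<in>{..<1} \<times> {..<1}. 1)"


section \<open>The completed projective tensor product\<close>

definition bilinear_on :: "'a lca \<Rightarrow> 'b lca \<Rightarrow> 'c lca \<Rightarrow> ('a \<Rightarrow> 'b \<Rightarrow> 'c) \<Rightarrow> bool" where
  "bilinear_on A B T t \<longleftrightarrow>
     (\<forall>a\<in>carrier A. \<forall>b\<in>carrier B. t a b \<in> carrier T) \<and>
     (\<forall>a\<in>carrier A. \<forall>a'\<in>carrier A. \<forall>b\<in>carrier B. t (a \<oplus>\<^bsub>A\<^esub> a') b = t a b \<oplus>\<^bsub>T\<^esub> t a' b) \<and>
     (\<forall>a\<in>carrier A. \<forall>b\<in>carrier B. \<forall>b'\<in>carrier B. t a (b \<oplus>\<^bsub>B\<^esub> b') = t a b \<oplus>\<^bsub>T\<^esub> t a b') \<and>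
     (\<forall>c. \<forall>a\<in>carrier A. \<forall>b\<in>carrier B.
        t (c \<odot>\<^bsub>A\<^esub> a) b = c \<odot>\<^bsub>T\<^esub> t a b \<and> t a (c \<odot>\<^bsub>B\<^esub> b) = c \<odot>\<^bsub>T\<^esub> t a b)"

definition lin_indep_family :: "'a lca \<Rightarrow> nat \<Rightarrow> (nat \<Rightarrow> 'a) \<Rightarrow> bool" where
  "lin_indep_family A n a \<longleftrightarrow>
     (\<forall>c. (\<Oplus>\<^bsub>A\<^esub>i\<in>{..<n}. c i \<odot>\<^bsub>A\<^esub> a i) = \<zero>\<^bsub>A\<^esub> \<longrightarrow> (\<forall>i<n. c i = 0))"

text \<open>The linear map from the algebraic tensor product of \<open>A\<close> and \<open>B\<close> induced by \<open>t\<close> is injective.\<close>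

definition tensor_injective :: "'a lca \<Rightarrow> 'b lca \<Rightarrow> 'c lca \<Rightarrow> ('a \<Rightarrow> 'b \<Rightarrow> 'c) \<Rightarrow> bool" where
  "tensor_injective A B T t \<longleftrightarrow>
     (\<forall>n. \<forall>a \<in> {..<n} \<rightarrow> carrier A. \<forall>b \<in> {..<n} \<rightarrow> carrier B.
        lin_indep_family A n a \<and> (\<Oplus>\<^bsub>T\<^esub>i\<in>{..<n}. t (a i) (b i)) = \<zero>\<^bsub>T\<^esub> \<longrightarrow>
        (\<forall>i<n. b i = \<zero>\<^bsub>B\<^esub>))"

text \<open>
  \<open>tensor_reps A B T t w\<close> collects the presentations of \<open>w\<close> as a finite sum of elementary tensors,
  and \<open>tensor_span A B T t\<close> is the image of the algebraic tensor product.
\<close>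

definition tensor_reps :: "'a lca \<Rightarrow> 'b lca \<Rightarrow> 'c lca \<Rightarrow> ('a \<Rightarrow> 'b \<Rightarrow> 'c) \<Rightarrow> 'c
    \<Rightarrow> (nat \<times> (nat \<Rightarrow> 'a) \<times> (nat \<Rightarrow> 'b)) set" where
  "tensor_reps A B T t w =
     {(n, a, b). a \<in> {..<n} \<rightarrow> carrier A \<and> b \<in> {..<n} \<rightarrow> carrier B \<and>
        w = (\<Oplus>\<^bsub>T\<^esub>i\<in>{..<n}. t (a i) (b i))}"

definition tensor_span :: "'a lca \<Rightarrow> 'b lca \<Rightarrow> 'c lca \<Rightarrow> ('a \<Rightarrow> 'b \<Rightarrow> 'c) \<Rightarrow> 'c set" where
  "tensor_span A B T t = {w. tensor_reps A B T t w \<noteq> {}}"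

definition proj_seminorm :: "'a lca \<Rightarrow> 'b lca \<Rightarrow> 'c lca \<Rightarrow> ('a \<Rightarrow> 'b \<Rightarrow> 'c)
    \<Rightarrow> ('a \<Rightarrow> real) \<Rightarrow> ('b \<Rightarrow> real) \<Rightarrow> 'c \<Rightarrow> real" where
  "proj_seminorm A B T t p q w =
     (INF (n, a, b)\<in>tensor_reps A B T t w. \<Sum>i<n. p (a i) * q (b i))"

text \<open>
  \<open>T\<close> together with \<open>t\<close> is the completion of the algebraic tensor product of \<open>A\<close> and \<open>B\<close> in the
  topology of the seminorms \<open>proj_seminorm\<close>, with the multiplication determined by
  \<open>(a \<otimes> b) (a' \<otimes> b') = a a' \<otimes> b b'\<close>. Single seminorms suffice to describe the topology of the span,
  since continuous seminorms are closed under finite maxima.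
\<close>

definition proj_tensor :: "'a lca \<Rightarrow> 'b lca \<Rightarrow> 'c lca \<Rightarrow> ('a \<Rightarrow> 'b \<Rightarrow> 'c) \<Rightarrow> bool" where
  "proj_tensor A B T t \<longleftrightarrow>
     locally_convex_algebra T \<and>
     bilinear_on A B T t \<and>
     (\<forall>a\<in>carrier A. \<forall>a'\<in>carrier A. \<forall>b\<in>carrier B. \<forall>b'\<in>carrier B.
        t a b \<otimes>\<^bsub>T\<^esub> t a' b' = t (a \<otimes>\<^bsub>A\<^esub> a') (b \<otimes>\<^bsub>B\<^esub> b')) \<and>
     tensor_injective A B T t \<and>
     (\<forall>U. openin (subtopology (topo T) (tensor_span A B T t)) U \<longleftrightarrow>
        U \<subseteq> tensor_span A B T t \<and>
        (\<forall>w\<in>U. \<exists>p\<in>cont_seminorms A. \<exists>q\<in>cont_seminorms B. \<exists>\<epsilon>>0.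
           {v \<in> tensor_span A B T t. proj_seminorm A B T t p q (v \<ominus>\<^bsub>T\<^esub> w) < \<epsilon>} \<subseteq> U)) \<and>
     topo T closure_of tensor_span A B T t = carrier T"

text \<open>
  In the next two definitions the morphism is unique on the carrier, because the elementary tensors
  span a dense subspace.
\<close>

definition tensor_lift :: "'a lca \<Rightarrow> 'b lca \<Rightarrow> 'c lca \<Rightarrow> ('a \<Rightarrow> 'b \<Rightarrow> 'c) \<Rightarrow> 'd lca
    \<Rightarrow> ('a \<Rightarrow> 'b \<Rightarrow> 'd) \<Rightarrow> ('c \<Rightarrow> 'd)" where
  "tensor_lift A B T t V \<beta> =
     (SOME h. h \<in> lca_hom T V \<and> (\<forall>a\<in>carrier A. \<forall>b\<in>carrier B. h (t a b) = \<beta> a b))"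

definition tensor_assoc :: "('a lca \<Rightarrow> 'a lca \<Rightarrow> 'a lca) \<Rightarrow> ('a lca \<Rightarrow> 'a lca \<Rightarrow> 'a \<Rightarrow> 'a \<Rightarrow> 'a)
    \<Rightarrow> 'a lca \<Rightarrow> 'a lca \<Rightarrow> 'a lca \<Rightarrow> ('a \<Rightarrow> 'a)" where
  "tensor_assoc tens tm A B C =
     (SOME h. h \<in> lca_iso (tens (tens A B) C) (tens A (tens B C)) \<and>
        (\<forall>a\<in>carrier A. \<forall>b\<in>carrier B. \<forall>c\<in>carrier C.
           h (tm (tens A B) C (tm A B a b) c) = tm A (tens B C) a (tm B C b c)))"

text \<open>
  The outer product \<open>K(A) \<otimes> K(B) \<rightarrow> K(T)\<close>, where \<open>T\<close> is the completed projective tensor product.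
  On unital algebras it is \<open>K0_cup\<close>, that is \<open>([p], [q]) \<mapsto> [p \<otimes> q]\<close>. In general it is obtained by
  restricting \<open>K0_cup\<close> for the unitisations: by excision for split extensions, \<open>K(T)\<close> embeds into
  \<open>K0\<close> of the tensor product \<open>R\<close> of the unitisations of \<open>A\<close> and \<open>B\<close>, and the products of elements of
  \<open>K(A)\<close> and \<open>K(B)\<close> lie in its image. Here \<open>j\<close> is the unital extension to the unitisation of \<open>T\<close> of the
  canonical morphism from \<open>T\<close> to \<open>R\<close>; \<open>R\<close> is unique up to isomorphism.
\<close>

definition KG_cup :: "'a lca \<Rightarrow> 'a lca \<Rightarrow> 'a lca \<Rightarrow> ('a \<Rightarrow> 'a \<Rightarrow> 'a)
    \<Rightarrow> (complex \<times> 'a) k0 \<Rightarrow> (complex \<times> 'a) k0 \<Rightarrow> (complex \<times> 'a) k0" where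
  "KG_cup A B T t x y =
     (THE z. z \<in> carrier (KG T) \<and>
        (\<exists>(R :: 'a lca) r j.
           proj_tensor (unitization A) (unitization B) R r \<and>
           j \<in> lca_hom (unitization T) R \<and>
           (\<forall>c. \<forall>a\<in>carrier A. \<forall>b\<in>carrier B.
              j (c, t a b) =
                c \<odot>\<^bsub>R\<^esub> r \<one>\<^bsub>unitization A\<^esub> \<one>\<^bsub>unitization B\<^esub> \<oplus>\<^bsub>R\<^esub> r (0, a) (0, b)) \<and>
           K0_map R j z = K0_cup R r x y))"


section \<open>Categories of locally convex algebras and functors on them\<close>

text \<open>
  There is no type of all locally convex algebras. The category is therefore given by a class \<open>Obj\<close>
  of locally convex algebras with carriers in an arbitrary type, which plays the role of a universe:
  it contains, up to isomorphism, the complex numbers and the unitisation and the algebra of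
  2-by-2 matrices of each of its members, and \<open>tens A B\<close> with \<open>tm A B\<close> is a choice
  of the completed projective tensor product of \<open>A\<close> and \<open>B\<close> in \<open>Obj\<close>. All morphisms between members
  of \<open>Obj\<close> are admitted. The class of all locally convex algebras that are small with respect to a
  set-theoretic universe is an instance.
\<close>

locale lca_universe =
  fixes Obj :: "'u lca set"
    and tens :: "'u lca \<Rightarrow> 'u lca \<Rightarrow> 'u lca"
    and tm :: "'u lca \<Rightarrow> 'u lca \<Rightarrow> 'u \<Rightarrow> 'u \<Rightarrow> 'u"
  assumes obj_lca: "A \<in> Obj \<Longrightarrow> locally_convex_algebra A"
    and obj_complex: "\<exists>C\<in>Obj. lca_iso C complex_lca \<noteq> {}"
    and obj_unitization: "A \<in> Obj \<Longrightarrow> \<exists>U\<in>Obj. lca_iso U (unitization A) \<noteq> {}"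
    and obj_mat: "A \<in> Obj \<Longrightarrow> \<exists>M\<in>Obj. lca_iso M (mat_lca 2 A) \<noteq> {}"
    and obj_tens: "\<lbrakk>A \<in> Obj; B \<in> Obj\<rbrakk> \<Longrightarrow> tens A B \<in> Obj"
    and proj_tensor_tens: "\<lbrakk>A \<in> Obj; B \<in> Obj\<rbrakk> \<Longrightarrow> proj_tensor A B (tens A B) (tm A B)"

text \<open>
  Abelian groups are written multiplicatively. Maps that agree on the carrier of the source
  represent the same morphism, whence the congruence axiom.
\<close>

locale lca_functor =
  fixes Obj :: "'u lca set"
    and H :: "'u lca \<Rightarrow> 'h monoid"
    and Hmap :: "'u lca \<Rightarrow> 'u lca \<Rightarrow> ('u \<Rightarrow> 'u) \<Rightarrow> 'h \<Rightarrow> 'h"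
  assumes obj_group: "A \<in> Obj \<Longrightarrow> comm_group (H A)"
    and map_hom: "\<lbrakk>A \<in> Obj; B \<in> Obj; f \<in> lca_hom A B\<rbrakk> \<Longrightarrow> Hmap A B f \<in> hom (H A) (H B)"
    and map_cong: "\<lbrakk>A \<in> Obj; B \<in> Obj; f \<in> lca_hom A B; g \<in> lca_hom A B;
        \<And>a. a \<in> carrier A \<Longrightarrow> f a = g a; x \<in> carrier (H A)\<rbrakk> \<Longrightarrow> Hmap A B f x = Hmap A B g x"
    and map_id: "\<lbrakk>A \<in> Obj; x \<in> carrier (H A)\<rbrakk> \<Longrightarrow> Hmap A A (\<lambda>a. a) x = x"
    and map_comp: "\<lbrakk>A \<in> Obj; B \<in> Obj; C \<in> Obj; f \<in> lca_hom A B; g \<in> lca_hom B C;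
        x \<in> carrier (H A)\<rbrakk> \<Longrightarrow> Hmap A C (g \<circ> f) x = Hmap B C g (Hmap A B f x)"

text \<open>
  A short exact sequence \<open>0 \<rightarrow> I \<rightarrow> E \<rightarrow> Q \<rightarrow> 0\<close> of locally convex algebras (\<open>i\<close> is an
  isomorphism onto the kernel of \<open>q\<close>) with a splitting \<open>s\<close> that is a morphism. The existence of \<open>s\<close>
  makes \<open>q\<close> surjective and a quotient map.
\<close>

definition split_extension :: "'a lca \<Rightarrow> 'b lca \<Rightarrow> 'c lca
    \<Rightarrow> ('a \<Rightarrow> 'b) \<Rightarrow> ('b \<Rightarrow> 'c) \<Rightarrow> ('c \<Rightarrow> 'b) \<Rightarrow> bool" where
  "split_extension I E Q i q s \<longleftrightarrow>
     i \<in> lca_hom I E \<and> q \<in> lca_hom E Q \<and> s \<in> lca_hom Q E \<and>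
     embedding_map (topo I) (topo E) i \<and>
     i ` carrier I = {x \<in> carrier E. q x = \<zero>\<^bsub>Q\<^esub>} \<and>
     (\<forall>x\<in>carrier Q. q (s x) = x)"

text \<open>Note the order of the arguments of \<^const>\<open>short_exact_sequence\<close>: the quotient comes first.\<close>

definition split_exact :: "'u lca set \<Rightarrow> ('u lca \<Rightarrow> 'h monoid)
    \<Rightarrow> ('u lca \<Rightarrow> 'u lca \<Rightarrow> ('u \<Rightarrow> 'u) \<Rightarrow> 'h \<Rightarrow> 'h) \<Rightarrow> bool" where
  "split_exact Obj H Hmap \<longleftrightarrow>
     (\<forall>I\<in>Obj. \<forall>E\<in>Obj. \<forall>Q\<in>Obj. \<forall>i q s. split_extension I E Q i q s \<longrightarrow>
        short_exact_sequence (H Q) (H E) (H I) (Hmap E Q q) (Hmap I E i))"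

text \<open>\<open>M\<close> runs over the copies in \<open>Obj\<close> of the matrix algebra, \<open>e\<close> is the corner embedding into \<open>M\<close>.\<close>

definition M2_stable :: "'u lca set \<Rightarrow> ('u lca \<Rightarrow> 'h monoid)
    \<Rightarrow> ('u lca \<Rightarrow> 'u lca \<Rightarrow> ('u \<Rightarrow> 'u) \<Rightarrow> 'h \<Rightarrow> 'h) \<Rightarrow> bool" where
  "M2_stable Obj H Hmap \<longleftrightarrow>
     (\<forall>A\<in>Obj. \<forall>M\<in>Obj. \<forall>\<phi>\<in>lca_iso M (mat_lca 2 A). \<forall>e\<in>lca_hom A M.
        (\<forall>a\<in>carrier A. \<phi> (e a) = corner 2 A a) \<longrightarrow>
        Hmap A M e \<in> iso (H A) (H M))"

text \<open>Biadditive maps, that is, homomorphisms from the tensor product of abelian groups.\<close>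

definition biadditive :: "('a, 'l) monoid_scheme \<Rightarrow> ('b, 'm) monoid_scheme
    \<Rightarrow> ('c, 'n) monoid_scheme \<Rightarrow> ('a \<Rightarrow> 'b \<Rightarrow> 'c) \<Rightarrow> bool" where
  "biadditive G H L \<beta> \<longleftrightarrow>
     (\<forall>x\<in>carrier G. \<beta> x \<in> hom H L) \<and> (\<forall>y\<in>carrier H. (\<lambda>x. \<beta> x y) \<in> hom G L)"

end

theory Submission
  imports Defs
begin

text \<open>
 An idempotent \<open>e\<close> in \<open>M\<^sub>n(A)\<close> gives a morphism \<open>b \<mapsto> e \<otimes> b\<close> from \<open>B\<close> to \<open>M\<^sub>n(A \<otimes> B)\<close>, and
 \<open>M\<^sub>2\<close>-stability turns it into a map \<open>H(B) \<rightarrow> H(A \<otimes> B)\<close>. Equivalent idempotents give the same map, as both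
 morphisms are restrictions of one morphism on \<open>M\<^sub>2(B)\<close>; orthogonal sums give sums of maps, by split exactness
 for \<open>\<complex>\<^sup>+ \<otimes> B \<rightarrow> B\<close>. This is a product with \<open>K\<^sub>0(A\<^sup>+)\<close>, and split exactness for \<open>A\<^sup>+ \<otimes> B \<rightarrow> B\<close> cuts it down
 to \<open>K(A)\<close>. Associativity is compared in \<open>H(A\<^sup>+ \<otimes> (B\<^sup>+ \<otimes> C))\<close>, where \<open>K(A \<otimes> B)\<close> enters through
 excision for \<open>K\<^sub>0\<close> of split extensions.
\<close>

\<comment> \<open>This is why universal examples appear: matrices over \<open>B\<close> for an
  equivalence, and for a sum the unitisation of the complex numbers, which is a product of two
  copies of them. Exactness has to survive tensoring with a further algebra. The extensions
  therefore carry a continuous linear retraction onto the kernel: identities between continuous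
  linear maps pass to tensor products by density, while exactness as such does not. The universe
  contains unitisations and matrix algebras only up to isomorphism, and among matrices only those of
  size two. Hence the chosen copies \<open>UU A\<close>, the sizes \<open>2 ^ k\<close>, and the
  proof that neither the size nor the position of a matrix block matters. The tensor product is
  described by its seminorms, so its universal property has to be derived. The excision used for
  \<open>K0\<close> is purely algebraic: it lifts the matrices that realise an equivalence along a
  multiplicative splitting.\<close>
syntax "_sub_index" :: "logic => index" ("\<^sub>_" [1000] 1000)
translations (index) "\<^sub>x" \<rightharpoonup> (index) "\<^bsub>x\<^esub>"

abbreviation "LCA \<equiv> locally_convex_algebra"
abbreviation "mx \<equiv> mat_mult"
abbreviation "unz \<equiv> unitization"
abbreviation "CL \<equiv> complex_lca"
abbreviation "CS \<equiv> cont_seminorms"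

section \<open>Rings without unit and their matrices\<close>

text \<open>The \<open>one\<close> field of an algebra carries no information, so matrices and
  idempotents are treated over rings in which a unit is neither assumed nor named.\<close>

locale nring = abelian_group R for R (structure) +
 assumes m_closed: "[|x : carrier R; y : carrier R|] ==> x \<otimes> y : carrier R"
  and m_assoc: "[|x : carrier R; y : carrier R; z : carrier R|]
   ==> (x \<otimes> y) \<otimes> z = x \<otimes> (y \<otimes> z)"
  and l_distr: "[|x : carrier R; y : carrier R; z : carrier R|]
   ==> (x \<oplus> y) \<otimes> z = x \<otimes> z \<oplus> y \<otimes> z"
  and r_distr: "[|x : carrier R; y : carrier R; z : carrier R|]
   ==> z \<otimes> (x \<oplus> y) = z \<otimes> x \<oplus> z \<otimes> y"

lemma foldSetD_congr:
 assumes "(A, y) : foldSetD D F e" "!!x. x : A ==> F x = F' x" shows "(A, y) : foldSetD D F' e"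
 using assms
proof induction
 case emptyI
 show ?case using emptyI(1) by (rule foldSetD.emptyI)
next
 case (insertI x A y)
 then show ?case using foldSetD.insertI[of x A F' y D e] by auto
qed

text \<open>Unlike the congruence rules of the library, this one needs no closedness condition.\<close>

lemma finsum_congr:
 assumes "A = B" "!!i. i : B ==> f i = g i" shows "finsum G f A = finsum G g B"
proof -
 have "(B, y) : foldSetD D (mult (add_monoid G) \<circ> f) e \<longleftrightarrow> (B, y) : foldSetD D (mult (add_monoid G) \<circ> g) e" for y D e
  using assms(2) foldSetD_congr[of B y D "mult (add_monoid G) \<circ> f" e "mult (add_monoid G) \<circ> g"]
   foldSetD_congr[of B y D "mult (add_monoid G) \<circ> g" e "mult (add_monoid G) \<circ> f"] by auto
 then show ?thesis unfolding finsum_def finprod_def foldD_def by (simp add: assms(1))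
qed

lemma fsum_congr:
 "[|A = B; !!i. i : B =simp=> f i = g i|] ==> finsum G f A = finsum G g B"
 unfolding simp_implies_def by (rule finsum_congr)

section \<open>Finite sums over initial segments and their reindexing\<close>

lemma (in abelian_group) finsum_swap:
 assumes "finite A" "finite B" "!!i j. i : A ==> j : B ==> f i j : carrier G"
 shows "(\<Oplus>i\<in>A. \<Oplus>j\<in>B. f i j) = (\<Oplus>j\<in>B. \<Oplus>i\<in>A. f i j)" using assms(1,3)
proof (induction A)
 case empty
 then show ?case by (simp add: finsum_zero)
next
 case (insert a A)
 then have "(\<Oplus>j\<in>B. \<Oplus>i\<in>insert a A. f i j) = (\<Oplus>j\<in>B. f a j \<oplus> (\<Oplus>i\<in>A. f i j))"
  by (intro finsum_cong' refl) (auto simp: Pi_def)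
 also have "... = (\<Oplus>j\<in>B. f a j) \<oplus> (\<Oplus>j\<in>B. \<Oplus>i\<in>A. f i j)"
  using insert by (intro finsum_addf) (auto simp: Pi_def)
 finally show ?case using insert by (simp add: Pi_def)
qed

lemma (in abelian_group) finsum_lessThan_add:
 fixes m n :: nat
 assumes "!!i. i < m + n ==> f i : carrier G"
 shows "(\<Oplus>i\<in>{..<m + n}. f i) = (\<Oplus>i\<in>{..<m}. f i) \<oplus> (\<Oplus>i\<in>{..<n}. f (m + i))"
proof -
 have eq: "{..<m + n} = {..<m} \<union> (+) m ` {..<n}"
 proof (intro equalityI subsetI)
  fix i assume "i : {..<m + n}"
  then show "i : {..<m} \<union> (+) m ` {..<n}" by (cases "i < m") (auto intro!: image_eqI[of i _ "i - m"])
 qed auto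
 have "(\<Oplus>i\<in>{..<m + n}. f i) = (\<Oplus>i\<in>{..<m}. f i) \<oplus> (\<Oplus>i\<in>(+) m ` {..<n}. f i)"
  unfolding eq using assms by (intro finsum_Un_disjoint) auto
 also have "(\<Oplus>i\<in>(+) m ` {..<n}. f i) = (\<Oplus>i\<in>{..<n}. f (m + i))"
  using assms by (intro finsum_reindex) auto
 finally show ?thesis .
qed

text \<open>The numbers below \<open>m * n\<close> enumerate the pairs
  \<open>(k div n, k mod n)\<close> in lexicographic order. This is the numbering of rows and
  columns in a Kronecker product.\<close>

lemma (in abelian_group) finsum_lessThan_times:
 fixes m n :: nat
 assumes "!!i j. i < m ==> j < n ==> f i j : carrier G"
 shows "(\<Oplus>k\<in>{..<m * n}. f (k div n) (k mod n)) = (\<Oplus>i\<in>{..<m}. \<Oplus>j\<in>{..<n}. f i j)"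
 using assms
proof (induction m)
 case 0
 then show ?case by simp
next
 case (Suc m)
 have dm: "k div n < Suc m" "k mod n < n" if "k < Suc m * n" for k
  using that by (cases n; auto simp: less_mult_imp_div_less simp del: mult_Suc)+
 have "(\<Oplus>k\<in>{..<Suc m * n}. f (k div n) (k mod n)) =
   (\<Oplus>k\<in>{..<m * n + n}. f (k div n) (k mod n))" by (simp add: add.commute)
 also have "... = (\<Oplus>k\<in>{..<m * n}. f (k div n) (k mod n)) \<oplus> (\<Oplus>j\<in>{..<n}. f ((m * n + j) div n) ((m * n + j) mod n))"
  by (intro finsum_lessThan_add Suc.prems dm) (simp_all add: add.commute)
 also have "(\<Oplus>j\<in>{..<n}. f ((m * n + j) div n) ((m * n + j) mod n)) = (\<Oplus>j\<in>{..<n}. f m j)"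
  using Suc.prems by (intro finsum_cong') auto
 also have "(\<Oplus>k\<in>{..<m * n}. f (k div n) (k mod n)) = (\<Oplus>i\<in>{..<m}. \<Oplus>j\<in>{..<n}. f i j)"
  using Suc by auto
 also have "... \<oplus> (\<Oplus>j\<in>{..<n}. f m j) = (\<Oplus>i\<in>{..<Suc m}. \<Oplus>j\<in>{..<n}. f i j)"
  using Suc.prems by (subst lessThan_Suc, subst finsum_insert) (auto simp: Pi_def a_comm)
 finally show ?case .
qed

lemma (in abelian_group) finsum_inj_support:
 assumes "inj_on \<rho> A" "\<rho> ` A \<subseteq> B" "finite B" "!!i. i : B ==> f i : carrier G"
  "!!i. i : B ==> i \<notin> \<rho> ` A ==> f i = \<zero>"
 shows "(\<Oplus>i\<in>A. f (\<rho> i)) = (\<Oplus>i\<in>B. f i)"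
proof -
 have "(\<Oplus>i\<in>\<rho> ` A. f i) = (\<Oplus>i\<in>A. f (\<rho> i))" using assms by (intro finsum_reindex) auto
 moreover have "(\<Oplus>i\<in>\<rho> ` A. f i) = (\<Oplus>i\<in>B. f i)"
  using assms by (intro add.finprod_mono_neutral_cong_left) auto
 ultimately show ?thesis by simp
qed

lemma (in abelian_group) finsum_single:
 assumes "i : A" "finite A" "!!j. j : A ==> j ~= i ==> f j = \<zero>" "f i : carrier G"
 shows "(\<Oplus>j\<in>A. f j) = f i"
proof -
 have "(\<Oplus>j\<in>{i}. f j) = (\<Oplus>j\<in>A. f j)"
  using assms by (intro add.finprod_mono_neutral_cong_left) (auto, metis zero_closed)
 then show ?thesis using assms by simp
qed

section \<open>Homomorphisms of rings without unit\<close>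

definition nring_hom :: "('a, 'm) ring_scheme => ('b, 'n) ring_scheme => ('a => 'b) set" where
 "nring_hom R S = {f : hom R S. f : hom (add_monoid R) (add_monoid S)}"

lemma add_hom_group_hom:
 assumes "abelian_group R" "abelian_group S" "f : hom (add_monoid R) (add_monoid S)"
 shows "group_hom (add_monoid R) (add_monoid S) f"
 using assms by (simp add: abelian_group.a_group group_hom_axioms.intro group_hom_def)

lemma add_hom_zero:
 assumes "abelian_group R" "abelian_group S" "f : hom (add_monoid R) (add_monoid S)"
 shows "f \<zero>\<^sub>R = \<zero>\<^sub>S" using group_hom.hom_one[OF add_hom_group_hom[OF assms]] by simp

lemma add_hom_minus:
 assumes "abelian_group R" "abelian_group S" "f : hom (add_monoid R) (add_monoid S)"
  "x : carrier R" "y : carrier R" shows "f (x \<ominus>\<^sub>R y) = f x \<ominus>\<^sub>S f y"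
proof -
 interpret group_hom "add_monoid R" "add_monoid S" f by (rule add_hom_group_hom) (use assms in auto)
 show ?thesis using assms hom_mult[of x "\<ominus>\<^sub>R y"] hom_inv[of y] G.inv_closed[of y]
  by (simp add: a_minus_def a_inv_def)
qed

lemma add_hom_finsum:
 assumes "abelian_group R" "abelian_group S" "f : hom (add_monoid R) (add_monoid S)"
  "finite A" "!!i. i : A ==> g i : carrier R"
 shows "f (\<Oplus>\<^sub>R i\<in>A. g i) = (\<Oplus>\<^sub>S i\<in>A. f (g i))"
proof -
 interpret R: abelian_group R by fact
 interpret S: abelian_group S by fact
 have add: "f (x \<oplus>\<^sub>R y) = f x \<oplus>\<^sub>S f y" if "x : carrier R" "y : carrier R" for x y
  using that assms(3) by (auto simp: hom_def)
 have cl: "f x : carrier S" if "x : carrier R" for x using that assms(3) by (auto simp: hom_def)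
 show ?thesis using assms(4,5)
 proof (induction A)
  case empty
  then show ?case by (simp add: add_hom_zero[OF assms(1-3)])
 next
  case (insert a A)
  then show ?case by (simp add: add cl Pi_def)
 qed
qed

lemma nring_homD:
 assumes "f : nring_hom R S" shows "f : hom (add_monoid R) (add_monoid S)"
  "x : carrier R ==> f x : carrier S"
  "[|x : carrier R; y : carrier R|] ==> f (x \<otimes>\<^sub>R y) = f x \<otimes>\<^sub>S f y"
  "[|x : carrier R; y : carrier R|] ==> f (x \<oplus>\<^sub>R y) = f x \<oplus>\<^sub>S f y"
 using assms by (auto simp: nring_hom_def hom_def)

lemma nring_hom_comp: "[|f : nring_hom R S; g : nring_hom S T|] ==> g \<circ> f : nring_hom R T"
 by (fastforce simp: nring_hom_def hom_def Pi_iff)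

context nring
begin

lemma l_null: "x : carrier R ==> \<zero> \<otimes> x = \<zero>"
 by (metis add.l_cancel_one add.one_closed l_distr l_zero m_closed)

lemma r_null: "x : carrier R ==> x \<otimes> \<zero> = \<zero>"
 by (metis add.l_cancel_one add.one_closed r_distr l_zero m_closed)

lemma finsum_ldistr:
 assumes "finite A" "a : carrier R" "!!i. i : A ==> f i : carrier R"
 shows "(\<Oplus>i\<in>A. f i) \<otimes> a = (\<Oplus>i\<in>A. f i \<otimes> a)" using assms(1,3)
 by (induction A) (simp_all add: assms(2) l_null l_distr m_closed Pi_def)

lemma finsum_rdistr:
 assumes "finite A" "a : carrier R" "!!i. i : A ==> f i : carrier R"
 shows "a \<otimes> (\<Oplus>i\<in>A. f i) = (\<Oplus>i\<in>A. a \<otimes> f i)" using assms(1,3)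
 by (induction A) (simp_all add: assms(2) r_null r_distr m_closed Pi_def)

end

section \<open>Rectangular matrices and block matrices\<close>

lemma matsD: "[|x : mats R m n; i < m; j < n|] ==> x (i, j) : carrier R"
 by (auto simp: mats_def PiE_def Pi_def)

lemma matsI:
 "(!!i j. [|i < m; j < n|] ==> f (i, j) : carrier R) ==> restrict f ({..<m} \<times> {..<n}) : mats R m n"
 by (auto simp: mats_def)

lemma mats_eqI:
 assumes "x : mats R m n" "y : mats R' m n" "!!i j. [|i < m; j < n|] ==> x (i, j) = y (i, j)" shows "x = y"
proof (rule extensionalityI[of _ "{..<m} \<times> {..<n}"])
qed (use assms in \<open>auto simp: mats_def PiE_def\<close>)

lemma mm_app:
 "[|i < l; k < n|] ==> mx R l m n x y (i, k) = (\<Oplus>\<^sub>R j\<in>{..<m}. x (i, j) \<otimes>\<^sub>R y (j, k))"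
 by (simp add: mat_mult_def)

definition mat_add :: "('a, 'm) ring_scheme => nat => nat
  => (nat \<times> nat => 'a) => (nat \<times> nat => 'a) => (nat \<times> nat => 'a)" where
 "mat_add R m n x y = (\<lambda>ij\<in>{..<m} \<times> {..<n}. x ij \<oplus>\<^sub>R y ij)"

definition mat_zero :: "('a, 'm) ring_scheme => nat => nat => (nat \<times> nat => 'a)" where
 "mat_zero R m n = (\<lambda>_\<in>{..<m} \<times> {..<n}. \<zero>\<^sub>R)"

definition mat_scalar :: "('a, 'm) ring_scheme => 'a => nat => (nat \<times> nat => 'a)" where
 "mat_scalar R u n = (\<lambda>(i, j)\<in>{..<n} \<times> {..<n}. if i = j then u else \<zero>\<^sub>R)"

text \<open>Rectangular blocks are needed because an equivalence between idempotents of different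
  sizes is realised by rectangular matrices; sizes zero are allowed and yield single block rows and
  columns.\<close>

definition blk :: "nat => nat => nat => nat => (nat \<times> nat => 'a) => (nat \<times> nat => 'a)
  => (nat \<times> nat => 'a) => (nat \<times> nat => 'a) => (nat \<times> nat => 'a)" where
 "blk m m' n n' a b c d = (\<lambda>(i, j)\<in>{..<m + m'} \<times> {..<n + n'}.
  if i < m then (if j < n then a (i, j) else b (i, j - n))
  else (if j < n then c (i - m, j) else d (i - m, j - n)))"

text \<open>The rectangular form of \<open>mat_tensor\<close>, so that Kronecker products of the
  matrices realising two equivalences can be formed.\<close>

definition kron :: "('a => 'b => 'c) => nat => nat => nat => nat
  => (nat \<times> nat => 'a) => (nat \<times> nat => 'b) => (nat \<times> nat => 'c)" where
 "kron t m m' n n' p q = (\<lambda>(i, j)\<in>{..<m * n} \<times> {..<m' * n'}.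
  t (p (i div n, j div n')) (q (i mod n, j mod n')))"

lemma mat_tensor_kron: "mat_tensor t m n p q = kron t m m n n p q" by (simp add: mat_tensor_def kron_def)

definition rmap :: "('a => 'b) => nat => nat => (nat \<times> nat => 'a) => (nat \<times> nat => 'b)" where
 "rmap f m n e = (\<lambda>ij\<in>{..<m} \<times> {..<n}. f (e ij))"

lemma mat_map_rmap: "mat_map f n e = rmap f n n e" by (simp add: mat_map_def rmap_def)

lemma rmap_mats: "[|x : mats R m n; !!a. a : carrier R ==> f a : carrier S|] ==> rmap f m n x : mats S m n"
 unfolding rmap_def by (intro matsI) (auto dest: matsD)

lemma rmap_app: "i < m ==> j < n ==> rmap f m n e (i, j) = f (e (i, j))" by (simp add: rmap_def)

lemma rmap_rmap: "rmap g m n (rmap f m n e) = rmap (g \<circ> f) m n e" by (auto simp: rmap_def)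

lemma rmap_ident:
 "[|e : mats R m n; !!a. a : carrier R ==> f a = a|] ==> rmap f m n e = e"
 by (auto intro!: mats_eqI[of _ R m n _ R] rmap_mats simp: rmap_app dest: matsD)

lemma rmap_cong:
 "[|e : mats R m n; !!a. a : carrier R ==> f a = g a|] ==> rmap f m n e = rmap g m n e"
 unfolding rmap_def by (intro restrict_ext) (auto dest: matsD)

lemma blk_ul: "i < m ==> j < n ==> blk m m' n n' a b c d (i, j) = a (i, j)"
 and blk_ur: "i < m ==> j < n' ==> blk m m' n n' a b c d (i, n + j) = b (i, j)"
 and blk_ll: "i < m' ==> j < n ==> blk m m' n n' a b c d (m + i, j) = c (i, j)"
 and blk_lr: "i < m' ==> j < n' ==> blk m m' n n' a b c d (m + i, n + j) = d (i, j)" by (auto simp: blk_def)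

lemmas blk_app = blk_ul blk_ur blk_ll blk_lr

lemma blk_mats:
 assumes "a : mats R m n" "b : mats R m n'" "c : mats R m' n" "d : mats R m' n'"
 shows "blk m m' n n' a b c d : mats R (m + m') (n + n')"
 unfolding blk_def by (intro matsI) (use assms[THEN matsD] in auto)

lemma less_add_cases:
 assumes "(i::nat) < m + m'"
 obtains "i < m" | i' where "i = m + i'" "i' < m'" by (metis add_less_cancel_left assms le_add_diff_inverse not_less)

lemma block_diag_blk: "block_diag R m n e f = blk m n m n e (mat_zero R m n) (mat_zero R n m) f"
 unfolding block_diag_def blk_def mat_zero_def by (rule restrict_ext) auto

lemma block_eqI:
 assumes "x : mats R (m + m') (n + n')" "y : mats R' (m + m') (n + n')"
  "!!i j. [|i < m; j < n|] ==> x (i, j) = y (i, j)"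
  "!!i j. [|i < m; j < n'|] ==> x (i, n + j) = y (i, n + j)"
  "!!i j. [|i < m'; j < n|] ==> x (m + i, j) = y (m + i, j)"
  "!!i j. [|i < m'; j < n'|] ==> x (m + i, n + j) = y (m + i, n + j)" shows "x = y"
 using assms(1,2) by (rule mats_eqI) (metis assms(3-6) less_add_cases)

lemma rmap_blk:
 fixes S :: "('c, 's) ring_scheme"
 assumes "a : mats R m n" "b : mats R m n'" "c : mats R m' n" "d : mats R m' n'"
  "!!a. a : carrier R ==> f a : carrier S" shows "rmap f (m + m') (n + n') (blk m m' n n' a b c d) =
  blk m m' n n' (rmap f m n a) (rmap f m n' b) (rmap f m' n c) (rmap f m' n' d)"
 by (rule block_eqI[of _ S m m' n n' _ S])
  (use assms in \<open>auto intro!: rmap_mats[of _ R] blk_mats simp: rmap_app blk_app\<close>)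

lemma rmap_mat_zero:
 assumes "f \<zero>\<^sub>R = \<zero>\<^sub>S" shows "rmap f m n (mat_zero R m n) = mat_zero S m n"
 by (auto simp: rmap_def mat_zero_def assms)

lemma rmap_mat_scalar:
 assumes "f \<zero>\<^sub>R = \<zero>\<^sub>S" shows "rmap f n n (mat_scalar R u n) = mat_scalar S (f u) n"
 by (auto simp: rmap_def mat_scalar_def assms)

context nring
begin

lemma mm_mats: "[|x : mats R l m; y : mats R m n|] ==> mx R l m n x y : mats R l n"
 unfolding mat_mult_def by (intro matsI) (auto intro!: finsum_closed m_closed dest: matsD)

lemma mat_add_mats: "[|x : mats R m n; y : mats R m n|] ==> mat_add R m n x y : mats R m n"
 unfolding mat_add_def by (intro matsI) (auto dest: matsD)

lemma mz_mats: "mat_zero R m n : mats R m n" unfolding mat_zero_def by (intro matsI) auto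

lemma mat_scalar_mats: "u : carrier R ==> mat_scalar R u n : mats R n n"
 unfolding mat_scalar_def by (intro matsI) auto

lemma mat_mult_assoc:
 assumes "x : mats R k l" "y : mats R l m" "z : mats R m n"
 shows "mx R k m n (mx R k l m x y) z = mx R k l n x (mx R l m n y z)"
proof (rule mats_eqI[of _ R k n _ R])
 fix i j assume ij: "i < k" "j < n"
 note [simp] = matsD[OF assms(1) ij(1)] matsD[OF assms(2)] matsD[OF assms(3) _ ij(2)] m_closed
 have "(\<Oplus>b\<in>{..<m}. (\<Oplus>a\<in>{..<l}. x (i, a) \<otimes> y (a, b)) \<otimes> z (b, j)) =
   (\<Oplus>b\<in>{..<m}. \<Oplus>a\<in>{..<l}. x (i, a) \<otimes> (y (a, b) \<otimes> z (b, j)))"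
  by (intro finsum_congr refl, subst finsum_ldistr) (auto intro!: finsum_congr simp: m_assoc)
 also have "... = (\<Oplus>a\<in>{..<l}. \<Oplus>b\<in>{..<m}. x (i, a) \<otimes> (y (a, b) \<otimes> z (b, j)))"
  by (intro finsum_swap) auto
 also have "... = (\<Oplus>a\<in>{..<l}. x (i, a) \<otimes> (\<Oplus>b\<in>{..<m}. y (a, b) \<otimes> z (b, j)))"
  by (intro finsum_congr refl, subst finsum_rdistr) auto
 finally show "mx R k m n (mx R k l m x y) z (i, j) =
   mx R k l n x (mx R l m n y z) (i, j)" using ij by (simp add: mm_app cong: fsum_congr)
qed (use assms in \<open>auto intro: mm_mats\<close>)

end

lemma rmap_mm:
 assumes "nring R" "nring S" "f : nring_hom R S" "x : mats R l m" "y : mats R m n"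
 shows "rmap f l n (mx R l m n x y) = mx S l m n (rmap f l m x) (rmap f m n y)"
proof -
 interpret R: nring R by fact
 interpret S: nring S by fact
 note f = nring_homD[OF assms(3)]
 have "f (\<Oplus>\<^sub>R j\<in>{..<m}. x (i, j) \<otimes>\<^sub>R y (j, k)) = (\<Oplus>\<^sub>S j\<in>{..<m}. f (x (i, j)) \<otimes>\<^sub>S f (y (j, k)))"
  if "i < l" "k < n" for i k
 proof -
  have "f (\<Oplus>\<^sub>R j\<in>{..<m}. x (i, j) \<otimes>\<^sub>R y (j, k)) = (\<Oplus>\<^sub>S j\<in>{..<m}. f (x (i, j) \<otimes>\<^sub>R y (j, k)))"
   using that assms(4,5) by (intro add_hom_finsum R.abelian_group_axioms S.abelian_group_axioms f(1))
    (auto intro!: R.m_closed dest: matsD)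
  also have "... = (\<Oplus>\<^sub>S j\<in>{..<m}. f (x (i, j)) \<otimes>\<^sub>S f (y (j, k)))"
   using that assms(4,5) by (intro S.finsum_cong') (auto intro!: S.m_closed f(2,3) dest: matsD)
  finally show ?thesis .
 qed
 then show ?thesis by (intro mats_eqI[of _ S l n _ S])
   (use assms(4,5) in \<open>auto simp: mm_app rmap_app intro!: rmap_mats[of _ R] f(2) S.finsum_cong'
    R.mm_mats S.mm_mats S.m_closed dest: matsD\<close>)
qed

lemma mat_zero_app: "[|i < m; j < n|] ==> mat_zero R m n (i, j) = \<zero>\<^sub>R" by (simp add: mat_zero_def)

lemma mat_add_app: "[|i < m; j < n|] ==> mat_add R m n x y (i, j) = x (i, j) \<oplus>\<^sub>R y (i, j)"
 by (simp add: mat_add_def)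

context nring
begin

lemma mat_mult_blk:
 assumes "a : mats R l m" "b : mats R l m'" "c : mats R l' m" "d : mats R l' m'"
  "a' : mats R m n" "b' : mats R m n'" "c' : mats R m' n" "d' : mats R m' n'"
 shows "mx R (l + l') (m + m') (n + n') (blk l l' m m' a b c d) (blk m m' n n' a' b' c' d') =
  blk l l' n n'
   (mat_add R l n (mx R l m n a a') (mx R l m' n b c'))
   (mat_add R l n' (mx R l m n' a b') (mx R l m' n' b d'))
   (mat_add R l' n (mx R l' m n c a') (mx R l' m' n d c'))
   (mat_add R l' n' (mx R l' m n' c b') (mx R l' m' n' d d'))" (is "?L = ?R")
proof -
 note [intro] = assms matsD[OF assms(1)] matsD[OF assms(2)] matsD[OF assms(3)] matsD[OF assms(4)]
  matsD[OF assms(5)] matsD[OF assms(6)] matsD[OF assms(7)] matsD[OF assms(8)]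
 have cl: "blk l l' m m' a b c d : mats R (l + l') (m + m')"
  "blk m m' n n' a' b' c' d' : mats R (m + m') (n + n')" by (auto intro: blk_mats)
 define Z where "Z = ?L"
 have Z: "Z : mats R (l + l') (n + n')" unfolding Z_def using cl by (rule mm_mats)
 have L: "Z (i, k) = (\<Oplus>j\<in>{..<m}. blk l l' m m' a b c d (i, j) \<otimes> blk m m' n n' a' b' c' d' (j, k)) \<oplus>
   (\<Oplus>j\<in>{..<m'}. blk l l' m m' a b c d (i, m + j) \<otimes> blk m m' n n' a' b' c' d' (m + j, k))"
  if "i < l + l'" "k < n + n'" for i k using that unfolding Z_def
  by (simp add: mm_app) (intro finsum_lessThan_add m_closed matsD[OF cl(1)] matsD[OF cl(2)])
 show ?thesis unfolding Z_def[symmetric] using Z by (rule block_eqI[of _ R l l' n n' _ R])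
   (auto simp: L blk_app mat_add_app mm_app cong: fsum_congr
    intro!: blk_mats mat_add_mats mm_mats)
qed

lemma mat_add_zero:
 assumes "x : mats R m n" shows "mat_add R m n (mat_zero R m n) x = x" "mat_add R m n x (mat_zero R m n) = x"
 by (rule mats_eqI[of _ R m n _ R]; use assms in \<open>auto intro!: mat_add_mats mz_mats simp: mat_add_app mat_zero_app dest: matsD\<close>)+

lemma mat_mult_zero:
 assumes "x : mats R l m" shows "mx R l m n x (mat_zero R m n) = mat_zero R l n"
 by (rule mats_eqI[of _ R l n _ R])
  (use assms in \<open>auto intro!: mm_mats mz_mats add.finprod_one_eqI r_null[OF matsD] simp: mm_app mat_zero_app cong: fsum_congr dest: matsD\<close>)

lemma mat_zero_mult:
 assumes "x : mats R m n" shows "mx R l m n (mat_zero R l m) x = mat_zero R l n"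
 by (rule mats_eqI[of _ R l n _ R])
  (use assms in \<open>auto intro!: mm_mats mz_mats add.finprod_one_eqI l_null[OF matsD] simp: mm_app mat_zero_app cong: fsum_congr dest: matsD\<close>)

text \<open>The inner sum is empty. This makes block rows and block columns degenerate cases of
  \<open>blk\<close>, and it identifies a zero idempotent of any size with the empty one.\<close>

lemma mat_mult_through_zero:
 assumes "x : mats R l 0" "y : mats R 0 n" shows "mx R l 0 n x y = mat_zero R l n"
 by (rule mats_eqI[of _ R l n _ R])
  (use assms in \<open>auto intro!: mm_mats mz_mats simp: mm_app mat_zero_app cong: fsum_congr\<close>)

lemma mat_mult_one:
 assumes "x : mats R m n" "u : carrier R" "!!a. a : carrier R ==> u \<otimes> a = a"
 shows "mx R m m n (mat_scalar R u m) x = x"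
proof (rule mats_eqI[of _ R m n _ R])
 fix i j assume ij: "i < m" "j < n"
 have "(\<Oplus>k\<in>{..<m}. (if i = k then u else \<zero>) \<otimes> x (k, j)) = (if i = i then u else \<zero>) \<otimes> x (i, j)"
  using ij assms by (intro finsum_single) (auto simp: l_null m_closed dest: matsD)
 then show "mx R m m n (mat_scalar R u m) x (i, j) = x (i, j)"
  using ij assms by (auto simp: mm_app mat_scalar_def cong: fsum_congr dest: matsD)
qed (use assms in \<open>auto intro!: mm_mats mat_scalar_mats\<close>)

lemma mat_one_mult:
 assumes "x : mats R m n" "u : carrier R" "!!a. a : carrier R ==> a \<otimes> u = a"
 shows "mx R m n n x (mat_scalar R u n) = x"
proof (rule mats_eqI[of _ R m n _ R])
 fix i j assume ij: "i < m" "j < n"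
 have "(\<Oplus>k\<in>{..<n}. x (i, k) \<otimes> (if k = j then u else \<zero>)) = x (i, j) \<otimes> (if j = j then u else \<zero>)"
  using ij assms by (intro finsum_single) (auto simp: r_null m_closed dest: matsD)
 then show "mx R m n n x (mat_scalar R u n) (i, j) = x (i, j)"
  using ij assms by (auto simp: mm_app mat_scalar_def cong: fsum_congr dest: matsD)
qed (use assms in \<open>auto intro!: mm_mats mat_scalar_mats\<close>)

lemma mat_mult_add:
 assumes "x : mats R l m" "y : mats R m n" "z : mats R m n"
 shows "mx R l m n x (mat_add R m n y z) = mat_add R l n (mx R l m n x y) (mx R l m n x z)"
proof (rule mats_eqI[of _ R l n _ R])
 fix i j assume ij: "i < l" "j < n"
 note [simp] = matsD[OF assms(1) ij(1)] matsD[OF assms(2) _ ij(2)] matsD[OF assms(3) _ ij(2)]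
 have "(\<Oplus>k\<in>{..<m}. x (i, k) \<otimes> (y (k, j) \<oplus> z (k, j))) = (\<Oplus>k\<in>{..<m}. x (i, k) \<otimes> y (k, j) \<oplus> x (i, k) \<otimes> z (k, j))"
  by (intro finsum_congr refl) (simp add: r_distr)
 also have "... = (\<Oplus>k\<in>{..<m}. x (i, k) \<otimes> y (k, j)) \<oplus> (\<Oplus>k\<in>{..<m}. x (i, k) \<otimes> z (k, j))"
  by (intro finsum_addf) (auto intro: m_closed)
 finally show "mx R l m n x (mat_add R m n y z) (i, j) = mat_add R l n (mx R l m n x y) (mx R l m n x z) (i, j)"
  using ij by (simp add: mm_app mat_add_def cong: fsum_congr)
qed (use assms in \<open>auto intro!: mm_mats mat_add_mats\<close>)

lemma mat_add_mult:
 assumes "x : mats R m n" "y : mats R l m" "z : mats R l m"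
 shows "mx R l m n (mat_add R l m y z) x = mat_add R l n (mx R l m n y x) (mx R l m n z x)"
proof (rule mats_eqI[of _ R l n _ R])
 fix i j assume ij: "i < l" "j < n"
 note [simp] = matsD[OF assms(1) _ ij(2)] matsD[OF assms(2) ij(1)] matsD[OF assms(3) ij(1)]
 have "(\<Oplus>k\<in>{..<m}. (y (i, k) \<oplus> z (i, k)) \<otimes> x (k, j)) = (\<Oplus>k\<in>{..<m}. y (i, k) \<otimes> x (k, j) \<oplus> z (i, k) \<otimes> x (k, j))"
  by (intro finsum_congr refl) (simp add: l_distr)
 also have "... = (\<Oplus>k\<in>{..<m}. y (i, k) \<otimes> x (k, j)) \<oplus> (\<Oplus>k\<in>{..<m}. z (i, k) \<otimes> x (k, j))"
  by (intro finsum_addf) (auto intro: m_closed)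
 finally show "mx R l m n (mat_add R l m y z) x (i, j) = mat_add R l n (mx R l m n y x) (mx R l m n z x) (i, j)"
  using ij by (simp add: mm_app mat_add_def cong: fsum_congr)
qed (use assms in \<open>auto intro!: mm_mats mat_add_mats\<close>)

end

section \<open>Kronecker products for a multiplicative pairing\<close>

lemma divmod_less:
 assumes "(i::nat) < m * n" shows "i div n < m" "i mod n < n"
 using assms by (cases n; auto simp: less_mult_imp_div_less)+

text \<open>Abstracts from elementary tensors so as to cover scalar multiplication as well: a
  character applied to one factor of a tensor product of unitisations turns the tensor pairing into
  a pairing with the complex numbers.\<close>

locale mpairing = R: nring R + S: nring S + T: nring T
 for R :: "('a, 'l) ring_scheme" and S :: "('b, 'm) ring_scheme" and T :: "('c, 'n) ring_scheme" +
 fixes t :: "'a => 'b => 'c"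
 assumes t_closed: "[|a : carrier R; b : carrier S|] ==> t a b : carrier T"
  and t_add_left: "[|a : carrier R; a' : carrier R; b : carrier S|]
   ==> t (a \<oplus>\<^sub>R a') b = t a b \<oplus>\<^sub>T t a' b"
  and t_add_right: "[|a : carrier R; b : carrier S; b' : carrier S|]
   ==> t a (b \<oplus>\<^sub>S b') = t a b \<oplus>\<^sub>T t a b'"
  and t_mult: "[|a : carrier R; a' : carrier R; b : carrier S; b' : carrier S|]
   ==> t a b \<otimes>\<^sub>T t a' b' = t (a \<otimes>\<^sub>R a') (b \<otimes>\<^sub>S b')"
begin

lemma t_hom_left: "b : carrier S ==> (%a. t a b) : hom (add_monoid R) (add_monoid T)"
 by (auto simp: hom_def t_closed t_add_left)

lemma t_hom_right: "a : carrier R ==> t a : hom (add_monoid S) (add_monoid T)"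
 by (auto simp: hom_def t_closed t_add_right)

lemma t_zero_left: "b : carrier S ==> t \<zero>\<^sub>R b = \<zero>\<^sub>T"
 using add_hom_zero[OF R.abelian_group_axioms T.abelian_group_axioms t_hom_left] by simp

lemma t_zero_right: "a : carrier R ==> t a \<zero>\<^sub>S = \<zero>\<^sub>T"
 using add_hom_zero[OF S.abelian_group_axioms T.abelian_group_axioms t_hom_right] by simp

lemma t_finsum_left:
 assumes "finite A" "b : carrier S" "!!i. i : A ==> f i : carrier R"
 shows "t (\<Oplus>\<^sub>R i\<in>A. f i) b = (\<Oplus>\<^sub>T i\<in>A. t (f i) b)"
 using add_hom_finsum[OF R.abelian_group_axioms T.abelian_group_axioms t_hom_left, of b A f] assms by simp

lemma t_finsum_right:
 assumes "finite A" "a : carrier R" "!!i. i : A ==> f i : carrier S"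
 shows "t a (\<Oplus>\<^sub>S i\<in>A. f i) = (\<Oplus>\<^sub>T i\<in>A. t a (f i))"
 using add_hom_finsum[OF S.abelian_group_axioms T.abelian_group_axioms t_hom_right, of a A f] assms by simp

lemma kron_app: "[|i < m * n; j < m' * n'|] ==>
  kron t m m' n n' p q (i, j) = t (p (i div n, j div n')) (q (i mod n, j mod n'))" by (simp add: kron_def)

lemma kron_mats: "[|p : mats R m m'; q : mats S n n'|] ==> kron t m m' n n' p q : mats T (m * n) (m' * n')"
 unfolding kron_def by (intro matsI) (auto intro!: t_closed matsD dest: divmod_less)

text \<open>Entrywise, \<open>t_mult\<close> splits each summand into its two factors; the inner sum
  over \<open>m * m'\<close> is a double sum, and biadditivity moves each single sum into its
  argument.\<close>

lemma mat_mult_kron: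
 assumes "x : mats R l m" "y : mats R m n" "v : mats S l' m'" "w : mats S m' n'"
 shows "mx T (l * l') (m * m') (n * n') (kron t l m l' m' x v) (kron t m n m' n' y w) =
  kron t l n l' n' (mx R l m n x y) (mx S l' m' n' v w)"
proof (rule mats_eqI[of _ T "l * l'" "n * n'" _ T])
 fix i k assume ik: "i < l * l'" "k < n * n'"
 note [simp] = matsD[OF assms(1) divmod_less(1)[OF ik(1)]] matsD[OF assms(2) _ divmod_less(1)[OF ik(2)]]
  matsD[OF assms(3) divmod_less(2)[OF ik(1)]] matsD[OF assms(4) _ divmod_less(2)[OF ik(2)]]
  R.m_closed S.m_closed T.m_closed t_closed
 let ?f = "%a b. t (x (i div l', a) \<otimes>\<^sub>R y (a, k div n')) (v (i mod l', b) \<otimes>\<^sub>S w (b, k mod n'))"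
 have "mx T (l * l') (m * m') (n * n') (kron t l m l' m' x v) (kron t m n m' n' y w) (i, k) =
   (\<Oplus>\<^sub>T j\<in>{..<m * m'}. ?f (j div m') (j mod m'))" using ik unfolding mm_app[OF ik]
  by (intro finsum_congr refl) (auto simp: kron_app t_mult divmod_less)
 also have "... = (\<Oplus>\<^sub>T a\<in>{..<m}. \<Oplus>\<^sub>T b\<in>{..<m'}. ?f a b)"
  by (rule T.finsum_lessThan_times) simp
 also have "... = (\<Oplus>\<^sub>T a\<in>{..<m}. t (x (i div l', a) \<otimes>\<^sub>R y (a, k div n'))
   (\<Oplus>\<^sub>S b\<in>{..<m'}. v (i mod l', b) \<otimes>\<^sub>S w (b, k mod n')))"
  by (intro finsum_congr refl, subst t_finsum_right) auto
 also have "... = t (\<Oplus>\<^sub>R a\<in>{..<m}. x (i div l', a) \<otimes>\<^sub>R y (a, k div n'))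
   (\<Oplus>\<^sub>S b\<in>{..<m'}. v (i mod l', b) \<otimes>\<^sub>S w (b, k mod n'))"
  by (subst t_finsum_left) (auto intro!: S.finsum_closed)
 also have "... = kron t l n l' n' (mx R l m n x y) (mx S l' m' n' v w) (i, k)"
  using ik by (simp add: kron_app mm_app divmod_less)
 finally show "mx T (l * l') (m * m') (n * n') (kron t l m l' m' x v) (kron t m n m' n' y w) (i, k) =
  kron t l n l' n' (mx R l m n x y) (mx S l' m' n' v w) (i, k)" .
qed (use assms in \<open>auto intro!: kron_mats R.mm_mats S.mm_mats T.mm_mats[of _ _ "m * m'"]\<close>)

end

section \<open>The monoid of idempotents\<close>

lemma idemsD: "(n, e) : idems R ==> e : mats R n n" "(n, e) : idems R ==> mx R n n n e e = e"
 by (auto simp: idems_def)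

text \<open>Operations on classes are unions over all representatives; once the representatives are
  known to give the same class, the union is that class.\<close>

lemma UN_const: "[|x0 : X; !!x. x : X ==> F x = c|] ==> (\<Union>x\<in>X. F x) = c" by auto

context nring
begin

lemma idem_equivI:
 assumes "(m, e) : idems R" "(n, f) : idems R" "x : mats R m n" "y : mats R n m"
  "mx R m n m x y = e" "mx R n m n y x = f" shows "((m, e), (n, f)) : idem_equiv R"
 using assms by (auto simp: idem_equiv_def)

text \<open>The maps realising an equivalence can be chosen in the corners cut out by the idempotents.\<close>

lemma idem_equivE:
 assumes "((m, e), (n, f)) : idem_equiv R"
 obtains x y where "(m, e) : idems R" "(n, f) : idems R" "x : mats R m n" "y : mats R n m"
  "mx R m n m x y = e" "mx R n m n y x = f"
  "mx R m m n e x = x" "mx R n n m f y = y"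
  "mx R m n n x f = x" "mx R n m m y e = y"
proof -
 from assms obtain x y where e: "(m, e) : idems R" and f: "(n, f) : idems R"
  and x: "x : mats R m n" and y: "y : mats R n m"
  and xy: "mx R m n m x y = e" and yx: "mx R n m n y x = f" by (auto simp: idem_equiv_def)
 note em = idemsD[OF e] and fm = idemsD[OF f]
 \<comment> \<open>Since \<open>e x = x y x = x f\<close>, cutting \<open>x\<close> down by
   \<open>e\<close> on the left is the same as cutting it down by \<open>f\<close> on the right;
   likewise for \<open>y\<close>.\<close>
 define x' where "x' = mx R m m n e x"
 define y' where "y' = mx R n n m f y"
 have x'm: "x' : mats R m n" and y'm: "y' : mats R n m"
  using x y em fm by (auto simp: x'_def y'_def intro: mm_mats)
 have x'alt: "x' = mx R m n n x f"
  using x y by (simp add: x'_def xy[symmetric] yx[symmetric] mat_mult_assoc mm_mats)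
 have y'alt: "y' = mx R n m m y e"
  using x y by (simp add: y'_def xy[symmetric] yx[symmetric] mat_mult_assoc mm_mats)
 have 1: "mx R m n m x' y' = e"
 proof -
  have "mx R m n m x' y' = mx R m m m e (mx R m n m x (mx R n m m y e))"
   unfolding y'alt x'_def using x y em by (intro mat_mult_assoc mm_mats)
  also have "mx R m n m x (mx R n m m y e) = mx R m m m e e"
   using x y em by (simp add: mat_mult_assoc[symmetric] xy)
  finally show ?thesis by (simp add: em)
 qed
 have 2: "mx R n m n y' x' = f"
 proof -
  have "mx R n m n y' x' = mx R n n n f (mx R n m n y (mx R m n n x f))"
   unfolding x'alt y'_def using x y fm by (intro mat_mult_assoc mm_mats)
  also have "mx R n m n y (mx R m n n x f) = mx R n n n f f"
   using x y fm by (simp add: mat_mult_assoc[symmetric] yx)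
  finally show ?thesis by (simp add: fm)
 qed
 have 3: "mx R m m n e x' = x'" "mx R n n m f y' = y'"
  using x y em fm by (simp_all add: x'_def y'_def mat_mult_assoc[symmetric])
 have 4: "mx R m n n x' f = x'" "mx R n m m y' e = y'"
  using x y em fm by (simp_all add: x'alt y'alt mat_mult_assoc)
 show thesis by (rule that[OF e f x'm y'm 1 2 3 4])
qed

lemma equiv_idem: "equiv (idems R) (idem_equiv R)"
proof (rule equivI)
 show "idem_equiv R \<subseteq> idems R \<times> idems R" by (auto simp: idem_equiv_def)
 show "refl_on (idems R) (idem_equiv R)" by (auto simp: refl_on_def idems_def idem_equiv_def)
 show "sym (idem_equiv R)" by (auto simp: sym_def idem_equiv_def)
 show "trans (idem_equiv R)"
 proof (rule transI, safe)
  fix l e m f n g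
  assume 1: "((l, e), (m, f)) : idem_equiv R" and 2: "((m, f), (n, g)) : idem_equiv R"
  from 1 obtain x y where xy: "(l, e) : idems R" "x : mats R l m" "y : mats R m l"
   "mx R l m l x y = e" "mx R m l m y x = f" "mx R l m m x f = x" by (rule idem_equivE)
  from 2 obtain v w where vw: "(n, g) : idems R" "v : mats R m n" "w : mats R n m"
   "mx R m n m v w = f" "mx R n m n w v = g" "mx R n m m w f = w" by (rule idem_equivE)
  \<comment> \<open>In the middle of \<open>x v w y\<close> the product \<open>v w\<close> is
    \<open>f\<close>, which disappears because \<open>x f = x\<close> by the choice made in
    \<open>idem_equivE\<close>.\<close>
  have "mx R l n l (mx R l m n x v) (mx R n m l w y) = mx R l m l (mx R l m m x (mx R m n m v w)) y"
   using xy(2,3) vw(2,3) by (simp add: mat_mult_assoc mm_mats)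
  then have A: "mx R l n l (mx R l m n x v) (mx R n m l w y) = e" using xy vw by simp
  have "mx R n l n (mx R n m l w y) (mx R l m n x v) = mx R n m n (mx R n m m w (mx R m l m y x)) v"
   using xy(2,3) vw(2,3) by (simp add: mat_mult_assoc mm_mats)
  then have B: "mx R n l n (mx R n m l w y) (mx R l m n x v) = g" using xy vw by simp
  show "((l, e), (n, g)) : idem_equiv R" using xy(1-3) vw(1-3) A B
   by (intro idem_equivI[of _ _ _ _ "mx R l m n x v" "mx R n m l w y"]) (auto intro: mm_mats)
 qed
qed

lemma idem_class_eq_iff: "[|p : idems R; q : idems R|] ==> idem_class R p = idem_class R q \<longleftrightarrow> (p, q) : idem_equiv R"
 unfolding idem_class_def by (rule eq_equiv_class_iff[OF equiv_idem])

lemma idem_class_self: "p : idems R ==> p : idem_class R p"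
 unfolding idem_class_def by (rule equiv_class_self[OF equiv_idem])

lemma idem_class_mem: "q : idem_class R p ==> q : idems R & (p, q) : idem_equiv R"
 by (auto simp: idem_class_def idem_equiv_def)

lemma idem_carrier: "carrier (idem_monoid R) = idem_class R ` idems R"
 by (auto simp: idem_monoid_def quotient_def idem_class_def)

lemma cls_carrier: "p : idems R ==> idem_class R p : carrier (idem_monoid R)" by (simp add: idem_carrier)

text \<open>Columns of \<open>e\<close> outside the image of \<open>\<rho>\<close> vanish, so every
  product with \<open>e\<close> on the left can be summed over the selected indices alone. Used for
  permutations: of the blocks of a direct sum, and of the two factors of a Kronecker
  product.\<close>

lemma idem_equiv_reindex:
 assumes e: "(n, e) : idems R" and f: "f : mats R m m"
  and \<rho>: "inj_on \<rho> {..<m}" "\<rho> ` {..<m} \<subseteq> {..<n}"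
  and ef: "!!i j. [|i < m; j < m|] ==> f (i, j) = e (\<rho> i, \<rho> j)"
  and z: "!!i j. [|i < n; j < n; j \<notin> \<rho> ` {..<m}|] ==> e (i, j) = \<zero>"
 shows "(m, f) : idems R & ((n, e), (m, f)) : idem_equiv R"
proof -
 note em = idemsD[OF e]
 have r: "\<rho> i < n" if "i < m" for i using \<rho> that by auto
 have ee: "(\<Oplus>j\<in>{..<n}. e (i, j) \<otimes> e (j, k)) = e (i, k)" if "i < n" "k < n" for i k
  using em(2) that by (metis mm_app)
 have red: "(\<Oplus>j\<in>{..<m}. e (i, \<rho> j) \<otimes> e (\<rho> j, k)) = e (i, k)" if "i < n" "k < n" for i k
 proof -
  have "(\<Oplus>j\<in>{..<m}. e (i, \<rho> j) \<otimes> e (\<rho> j, k)) = (\<Oplus>j\<in>{..<n}. e (i, j) \<otimes> e (j, k))"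
   using that \<rho> em(1) by (intro finsum_inj_support) (auto simp: z l_null matsD[OF em(1)] m_closed)
  then show ?thesis using ee that by simp
 qed
 \<comment> \<open>\<open>x\<close> collects the selected columns of \<open>e\<close> and
   \<open>y\<close> the selected rows. Then \<open>x y = e\<close> because the omitted columns
   vanish, and \<open>y x = f\<close> because \<open>e e = e\<close>.\<close>
 define x where "x = restrict (%(i, j). e (i, \<rho> j)) ({..<n} \<times> {..<m})"
 define y where "y = restrict (%(i, j). e (\<rho> i, j)) ({..<m} \<times> {..<n})"
 have xy: "x : mats R n m" "y : mats R m n"
  unfolding x_def y_def by (rule matsI; simp add: matsD[OF em(1)] r)+
 have xa: "x (i, j) = e (i, \<rho> j)" if "i < n" "j < m" for i j using that by (simp add: x_def)
 have ya: "y (i, j) = e (\<rho> i, j)" if "i < m" "j < n" for i j using that by (simp add: y_def)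
 have ff: "mx R m m m f f = f"
  by (rule mats_eqI[of _ R m m _ R]) (auto intro!: mm_mats f simp: mm_app ef red r cong: fsum_congr)
 have 1: "mx R n m n x y = e"
  by (rule mats_eqI[of _ R n n _ R]) (auto intro!: mm_mats xy em simp: mm_app xa ya red r cong: fsum_congr)
 have 2: "mx R m n m y x = f"
  by (rule mats_eqI[of _ R m m _ R]) (auto intro!: mm_mats xy f simp: mm_app xa ya ee ef r cong: fsum_congr)
 show ?thesis using idem_equivI[OF e _ xy 1 2] ff f by (auto simp: idems_def)
qed

lemma block_diag_mats: "[|e : mats R m m; f : mats R n n|] ==> block_diag R m n e f : mats R (m + n) (m + n)"
 unfolding block_diag_blk by (intro blk_mats mz_mats)

lemma blk_diag_mult:
 assumes "x : mats R l m" "y : mats R m n" "x' : mats R l' m'" "y' : mats R m' n'"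
 shows "mx R (l + l') (m + m') (n + n') (blk l l' m m' x (mat_zero R l m') (mat_zero R l' m) x')
  (blk m m' n n' y (mat_zero R m n') (mat_zero R m' n) y') =
  blk l l' n n' (mx R l m n x y) (mat_zero R l n') (mat_zero R l' n) (mx R l' m' n' x' y')" using assms
 by (subst mat_mult_blk[OF assms(1) mz_mats mz_mats assms(3) assms(2) mz_mats mz_mats assms(4)])
  (simp add: mat_mult_zero[of _ _ _] mat_zero_mult mat_add_zero mz_mats mm_mats)

lemma block_diag_idems: "[|(m, e) : idems R; (n, f) : idems R|] ==> (m + n, block_diag R m n e f) : idems R"
 by (auto simp: idems_def block_diag_mats) (simp add: block_diag_blk blk_diag_mult)

lemma block_diag_equiv:
 assumes "((m, e), (m', e')) : idem_equiv R" "((n, f), (n', f')) : idem_equiv R"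
 shows "((m + n, block_diag R m n e f), (m' + n', block_diag R m' n' e' f')) : idem_equiv R"
proof -
 from assms(1) obtain x y where xy: "(m, e) : idems R" "(m', e') : idems R" "x : mats R m m'" "y : mats R m' m"
  "mx R m m' m x y = e" "mx R m' m m' y x = e'" by (rule idem_equivE)
 from assms(2) obtain v w where vw: "(n, f) : idems R" "(n', f') : idems R" "v : mats R n n'" "w : mats R n' n"
  "mx R n n' n v w = f" "mx R n' n n' w v = f'" by (rule idem_equivE)
 show ?thesis
 proof (rule idem_equivI[of _ _ _ _ "blk m n m' n' x (mat_zero R m n') (mat_zero R n m') v"
     "blk m' n' m n y (mat_zero R m' n) (mat_zero R n' m) w"])
 qed (use xy(1-4) vw(1-4) in \<open>auto intro!: block_diag_idems blk_mats mz_mats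
   simp: blk_diag_mult xy(5,6) vw(5,6)\<close>, simp_all add: block_diag_blk)
qed

lemma idem_class_mult:
 assumes "(m, e) : idems R" "(n, f) : idems R"
 shows "idem_class R (m, e) \<otimes>\<^bsub>idem_monoid R\<^esub> idem_class R (n, f) = idem_class R (m + n, block_diag R m n e f)"
proof -
 have "idem_class R (m' + n', block_diag R m' n' e' f') = idem_class R (m + n, block_diag R m n e f)"
  if "(m', e') : idem_class R (m, e)" "(n', f') : idem_class R (n, f)" for m' e' n' f'
  using that[THEN idem_class_mem] assms block_diag_equiv[of m e m' e' n f n' f']
  by (subst idem_class_eq_iff) (auto intro!: block_diag_idems simp: idem_equiv_def)
 then show ?thesis unfolding idem_monoid_def monoid.simps
  by (intro UN_const[OF idem_class_self[OF assms(1)]], clarsimp)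
   (intro UN_const[OF idem_class_self[OF assms(2)]], clarsimp)
qed

text \<open>Matrices are extensional functions, so the everywhere undefined function is the only
  matrix of size zero. Its class is the neutral element.\<close>

lemma idem_zero_idems: "(0, %_. undefined) : idems R" by (auto simp: idems_def mats_def mat_mult_def)

lemma block_diag_zero_left:
 "e : mats R n n ==> block_diag R 0 n f e = e"
 by (rule mats_eqI[of _ R n n _ R]) (auto simp: block_diag_def mats_def PiE_def Pi_def)

lemma idem_comm_monoid: "comm_monoid (idem_monoid R)"
proof (rule comm_monoidI)
 show "\<one>\<^bsub>idem_monoid R\<^esub> : carrier (idem_monoid R)"
  by (simp add: idem_monoid_def idem_carrier[unfolded idem_monoid_def, simplified] idem_zero_idems)
 have cl: "idem_class R p \<otimes>\<^bsub>idem_monoid R\<^esub> idem_class R q : carrier (idem_monoid R)"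
  if "p : idems R" "q : idems R" for p q
  using that by (cases p; cases q) (auto simp: idem_class_mult intro!: cls_carrier block_diag_idems)
 show "x \<otimes>\<^bsub>idem_monoid R\<^esub> y : carrier (idem_monoid R)"
  if "x : carrier (idem_monoid R)" "y : carrier (idem_monoid R)" for x y
  using that cl by (auto simp: idem_carrier)
 show "\<one>\<^bsub>idem_monoid R\<^esub> \<otimes>\<^bsub>idem_monoid R\<^esub> x = x" if "x : carrier (idem_monoid R)" for x
 proof -
  obtain n e where e: "(n, e) : idems R" "x = idem_class R (n, e)" using \<open>x : _\<close> by (auto simp: idem_carrier)
  have "\<one>\<^bsub>idem_monoid R\<^esub> = idem_class R (0, %_. undefined)" by (simp add: idem_monoid_def)
  then show ?thesis
   using e idemsD[OF e(1)] by (simp add: idem_class_mult[OF idem_zero_idems e(1)] block_diag_zero_left)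
 qed
 show "(x \<otimes>\<^bsub>idem_monoid R\<^esub> y) \<otimes>\<^bsub>idem_monoid R\<^esub> z = x \<otimes>\<^bsub>idem_monoid R\<^esub> (y \<otimes>\<^bsub>idem_monoid R\<^esub> z)"
  if xyz: "x : carrier (idem_monoid R)" "y : carrier (idem_monoid R)" "z : carrier (idem_monoid R)" for x y z
 proof -
  obtain p q r where "p : idems R" "x = idem_class R p" "q : idems R" "y = idem_class R q"
   "r : idems R" "z = idem_class R r" using xyz unfolding idem_carrier by blast
  then obtain l e m f n g where e: "(l, e) : idems R" "x = idem_class R (l, e)" "(m, f) : idems R" "y = idem_class R (m, f)"
   "(n, g) : idems R" "z = idem_class R (n, g)" by (metis surj_pair)
  have "block_diag R (l + m) n (block_diag R l m e f) g = block_diag R l (m + n) e (block_diag R m n f g)"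
   unfolding block_diag_def by (rule ext) (auto simp: restrict_def add.assoc)
  then show ?thesis using e by (simp add: idem_class_mult block_diag_idems add.assoc)
 qed
 show "x \<otimes>\<^bsub>idem_monoid R\<^esub> y = y \<otimes>\<^bsub>idem_monoid R\<^esub> x"
  if xyz: "x : carrier (idem_monoid R)" "y : carrier (idem_monoid R)" for x y
 proof -
  obtain p q where "p : idems R" "x = idem_class R p" "q : idems R" "y = idem_class R q"
   using xyz unfolding idem_carrier by blast
  then obtain m f n g where e: "(m, f) : idems R" "x = idem_class R (m, f)"
   "(n, g) : idems R" "y = idem_class R (n, g)" by (metis surj_pair)
  \<comment> \<open>The permutation that moves the second block in front of the first.\<close>
  let ?\<rho> = "%i. if i < n then m + i else i - n"
  have "((m + n, block_diag R m n f g), (n + m, block_diag R n m g f)) : idem_equiv R"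
  proof (rule conjunct2[OF idem_equiv_reindex[where \<rho> = ?\<rho>]])
   show "inj_on ?\<rho> {..<n + m}" by (auto simp: inj_on_def)
   have "?\<rho> ` {..<n + m} = {..<m + n}"
   proof (intro equalityI subsetI)
    fix i assume "i : {..<m + n}"
    then show "i : ?\<rho> ` {..<n + m}"
     by (cases "i < m") (auto intro!: image_eqI[of i _ "if i < m then n + i else i - m"])
   qed auto
   then show "?\<rho> ` {..<n + m} \<subseteq> {..<m + n}"
    "!!i j. [|i < m + n; j < m + n; j \<notin> ?\<rho> ` {..<n + m}|] ==> block_diag R m n f g (i, j) = \<zero>"
    by auto
   show "block_diag R n m g f (i, j) = block_diag R m n f g (?\<rho> i, ?\<rho> j)" if "i < n + m" "j < n + m" for i j
    using that by (auto simp: block_diag_def)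
  qed (use e in \<open>auto intro!: block_diag_idems block_diag_mats idemsD\<close>)
  then show ?thesis using e by (simp add: idem_class_mult idem_class_eq_iff block_diag_idems)
 qed
qed

end

section \<open>Grothendieck groups\<close>

context comm_monoid
begin

lemma groth_relI: "[|a : carrier G; b : carrier G; c : carrier G; d : carrier G; k : carrier G;
  a \<otimes> d \<otimes> k = c \<otimes> b \<otimes> k|] ==> ((a, b), (c, d)) : groth_rel G"
 unfolding groth_rel_def by blast

lemma equiv_groth: "equiv (carrier G \<times> carrier G) (groth_rel G)"
proof (rule equivI)
 show "groth_rel G \<subseteq> (carrier G \<times> carrier G) \<times> (carrier G \<times> carrier G)"
  by (auto simp: groth_rel_def)
 show "refl_on (carrier G \<times> carrier G) (groth_rel G)" by (auto simp: refl_on_def groth_rel_def)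
 show "sym (groth_rel G)" unfolding sym_def groth_rel_def by force
 show "trans (groth_rel G)"
 proof (rule transI)
  fix x y z assume "(x, y) : groth_rel G" "(y, z) : groth_rel G"
  then obtain a b c d e f k l where xyz: "x = (a, b)" "y = (c, d)" "z = (e, f)"
   and cl [simp]: "a : carrier G" "b : carrier G" "c : carrier G" "d : carrier G"
   "e : carrier G" "f : carrier G" "k : carrier G" "l : carrier G"
   and k: "a \<otimes> d \<otimes> k = c \<otimes> b \<otimes> k" and l: "c \<otimes> f \<otimes> l = e \<otimes> d \<otimes> l"
   by (auto simp: groth_rel_def)
  \<comment> \<open>There is no cancellation in \<open>G\<close>, so the intermediate
    \<open>d\<close> is absorbed into the witness \<open>d \<otimes> k \<otimes> l\<close>.\<close>
  have "a \<otimes> f \<otimes> (d \<otimes> k \<otimes> l) = (a \<otimes> d \<otimes> k) \<otimes> (f \<otimes> l)" by (simp add: m_ac)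
  also have "... = b \<otimes> k \<otimes> (c \<otimes> f \<otimes> l)" by (simp add: k m_ac)
  also have "... = e \<otimes> b \<otimes> (d \<otimes> k \<otimes> l)" unfolding l by (simp add: m_ac)
  finally show "(x, z) : groth_rel G" unfolding xyz by (intro groth_relI) simp_all
 qed
qed

lemma groth_eq_iff:
 assumes "a : carrier G" "b : carrier G" "c : carrier G" "d : carrier G"
 shows "groth_class G a b = groth_class G c d \<longleftrightarrow> (\<exists>k\<in>carrier G. a \<otimes> d \<otimes> k = c \<otimes> b \<otimes> k)"
 unfolding groth_class_def
 by (subst eq_equiv_class_iff[OF equiv_groth]) (use assms in \<open>auto simp: groth_rel_def\<close>)

lemma groth_class_self: "[|a : carrier G; b : carrier G|] ==> (a, b) : groth_class G a b"
 unfolding groth_class_def by (rule equiv_class_self[OF equiv_groth]) simp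

lemma groth_class_mem:
 assumes "(c, d) : groth_class G a b"
 shows "a : carrier G" "b : carrier G" "c : carrier G" "d : carrier G"
  "groth_class G c d = groth_class G a b" "\<exists>k\<in>carrier G. a \<otimes> d \<otimes> k = c \<otimes> b \<otimes> k"
proof -
 have r: "((a, b), (c, d)) : groth_rel G" using assms by (simp add: groth_class_def)
 then show "a : carrier G" "b : carrier G" "c : carrier G" "d : carrier G"
  "\<exists>k\<in>carrier G. a \<otimes> d \<otimes> k = c \<otimes> b \<otimes> k" by (auto simp: groth_rel_def)
 show "groth_class G c d = groth_class G a b"
  unfolding groth_class_def using equiv_class_eq[OF equiv_groth r] by simp
qed

lemma groth_carrier: "carrier (grothendieck G) = {groth_class G a b | a b. a : carrier G & b : carrier G}"
 by (auto simp: grothendieck_def quotient_def groth_class_def)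

lemma groth_class_carrier: "[|a : carrier G; b : carrier G|] ==> groth_class G a b : carrier (grothendieck G)"
 by (auto simp: groth_carrier)

lemma groth_one: "\<one>\<^bsub>grothendieck G\<^esub> = groth_class G \<one> \<one>" by (simp add: grothendieck_def)

lemma groth_mult:
 assumes [simp]: "a : carrier G" "b : carrier G" "c : carrier G" "d : carrier G"
 shows "groth_class G a b \<otimes>\<^bsub>grothendieck G\<^esub> groth_class G c d = groth_class G (a \<otimes> c) (b \<otimes> d)"
proof -
 have "groth_class G (a' \<otimes> c') (b' \<otimes> d') = groth_class G (a \<otimes> c) (b \<otimes> d)"
  if 1: "(a', b') : groth_class G a b" and 2: "(c', d') : groth_class G c d" for a' b' c' d'
 proof -
  note [simp] = groth_class_mem(3,4)[OF 1] groth_class_mem(3,4)[OF 2]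
  obtain k l where [simp]: "k : carrier G" "l : carrier G"
   and k: "a \<otimes> b' \<otimes> k = a' \<otimes> b \<otimes> k" and l: "c \<otimes> d' \<otimes> l = c' \<otimes> d \<otimes> l"
   using groth_class_mem(6)[OF 1] groth_class_mem(6)[OF 2] by blast
  have "a' \<otimes> c' \<otimes> (b \<otimes> d) \<otimes> (k \<otimes> l) = (a' \<otimes> b \<otimes> k) \<otimes> (c' \<otimes> d \<otimes> l)" by (simp add: m_ac)
  also have "... = a \<otimes> c \<otimes> (b' \<otimes> d') \<otimes> (k \<otimes> l)" unfolding k[symmetric] l[symmetric] by (simp add: m_ac)
  finally show ?thesis by (subst groth_eq_iff) (auto intro!: bexI[of _ "k \<otimes> l"])
 qed
 then show ?thesis unfolding grothendieck_def monoid.simps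
  by (intro UN_const[OF groth_class_self], simp, simp, clarsimp)
   (intro UN_const[OF groth_class_self], auto)
qed

lemma groth_comm_group: "comm_group (grothendieck G)"
proof (rule comm_groupI)
 show "\<exists>y\<in>carrier (grothendieck G). y \<otimes>\<^bsub>grothendieck G\<^esub> x = \<one>\<^bsub>grothendieck G\<^esub>"
  if xc: "x : carrier (grothendieck G)" for x
 proof -
  obtain a b where [simp]: "a : carrier G" "b : carrier G" and x: "x = groth_class G a b"
   using xc unfolding groth_carrier by blast
  have "groth_class G b a \<otimes>\<^bsub>grothendieck G\<^esub> x = \<one>\<^bsub>grothendieck G\<^esub>"
   unfolding x groth_one by (subst groth_mult) (auto simp: groth_eq_iff m_comm)
  then show ?thesis by (intro bexI[of _ "groth_class G b a"]) (auto intro: groth_class_carrier)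
 qed
next
 show "x \<otimes>\<^bsub>grothendieck G\<^esub> y : carrier (grothendieck G)"
  if "x : carrier (grothendieck G)" "y : carrier (grothendieck G)" for x y
  using that by (auto simp: groth_carrier groth_mult) (metis m_closed)
 show "\<one>\<^bsub>grothendieck G\<^esub> : carrier (grothendieck G)"
  by (simp add: groth_one groth_class_carrier)
qed (auto simp: groth_carrier groth_mult groth_one m_ac)

lemma groth_inv:
 assumes [simp]: "a : carrier G" "b : carrier G"
 shows "inv\<^bsub>grothendieck G\<^esub> (groth_class G a b) = groth_class G b a"
proof -
 interpret K: comm_group "grothendieck G" by (rule groth_comm_group)
 show ?thesis
  by (rule K.inv_equality) (auto simp: groth_mult groth_one groth_eq_iff m_comm intro: groth_class_carrier)
qed

lemma groth_map_class:
 assumes N: "comm_monoid N" and \<phi>: "\<phi> : hom G N" and [simp]: "a : carrier G" "b : carrier G"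
 shows "groth_map N \<phi> (groth_class G a b) = groth_class N (\<phi> a) (\<phi> b)"
proof -
 interpret N: comm_monoid N by fact
 note [simp] = hom_in_carrier[OF \<phi>] hom_mult[OF \<phi>]
 have "groth_class N (\<phi> c) (\<phi> d) = groth_class N (\<phi> a) (\<phi> b)" if 1: "(c, d) : groth_class G a b" for c d
 proof -
  note [simp] = groth_class_mem(3,4)[OF 1]
  obtain k where [simp]: "k : carrier G" and k: "a \<otimes> d \<otimes> k = c \<otimes> b \<otimes> k"
   using groth_class_mem(6)[OF 1] by blast
  have "\<phi> c \<otimes>\<^sub>N \<phi> b \<otimes>\<^sub>N \<phi> k = \<phi> a \<otimes>\<^sub>N \<phi> d \<otimes>\<^sub>N \<phi> k"
   using arg_cong[OF k, of \<phi>] by simp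
  then show ?thesis by (subst N.groth_eq_iff) (auto intro!: bexI[of _ "\<phi> k"])
 qed
 then show ?thesis unfolding groth_map_def by (intro UN_const[OF groth_class_self]) auto
qed

lemma groth_map_hom:
 assumes N: "comm_monoid N" and \<phi>: "\<phi> : hom G N"
 shows "groth_map N \<phi> : hom (grothendieck G) (grothendieck N)"
proof -
 interpret N: comm_monoid N by fact
 note [simp] = hom_in_carrier[OF \<phi>] hom_mult[OF \<phi>] groth_map_class[OF assms]
 show ?thesis by (rule homI) (auto simp: groth_carrier groth_mult N.groth_mult intro!: N.groth_class_carrier)
qed

end

text \<open>Independence of the representative in one variable, with the other pair
  \<open>(c, d)\<close> held fixed; the second variable follows by exchanging the arguments of
  \<open>\<beta>\<close>. The witness is the sum of \<open>\<beta> k c\<close> and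
  \<open>\<beta> k d\<close>, where \<open>k\<close> witnesses the given equality.\<close>

lemma groth_bimap_left:
 assumes M: "comm_monoid M" and N: "comm_monoid N" and ab: "(a', b') : groth_class M a b"
  and c: "(%a. \<beta> a c) : hom M N" and d: "(%a. \<beta> a d) : hom M N"
 shows "groth_class N (\<beta> a' c \<otimes>\<^sub>N \<beta> b' d) (\<beta> a' d \<otimes>\<^sub>N \<beta> b' c) = groth_class N (\<beta> a c \<otimes>\<^sub>N \<beta> b d) (\<beta> a d \<otimes>\<^sub>N \<beta> b c)"
proof -
 interpret M: comm_monoid M by fact
 interpret N: comm_monoid N by fact
 note [simp] = M.groth_class_mem(1-4)[OF ab] hom_in_carrier[OF c] hom_in_carrier[OF d]
 obtain k where [simp]: "k : carrier M" and k: "a \<otimes>\<^sub>M b' \<otimes>\<^sub>M k = a' \<otimes>\<^sub>M b \<otimes>\<^sub>M k"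
  using M.groth_class_mem(6)[OF ab] by blast
 have k': "\<beta> a x \<otimes>\<^sub>N \<beta> b' x \<otimes>\<^sub>N \<beta> k x = \<beta> a' x \<otimes>\<^sub>N \<beta> b x \<otimes>\<^sub>N \<beta> k x" if "(%a. \<beta> a x) : hom M N" for x
  using arg_cong[OF k, of "%z. \<beta> z x"] by (simp add: hom_mult[OF that])
 have "(\<beta> a' c \<otimes>\<^sub>N \<beta> b' d) \<otimes>\<^sub>N (\<beta> a d \<otimes>\<^sub>N \<beta> b c) \<otimes>\<^sub>N (\<beta> k c \<otimes>\<^sub>N \<beta> k d) =
   (\<beta> a' c \<otimes>\<^sub>N \<beta> b c \<otimes>\<^sub>N \<beta> k c) \<otimes>\<^sub>N (\<beta> a d \<otimes>\<^sub>N \<beta> b' d \<otimes>\<^sub>N \<beta> k d)"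
  by (simp add: N.m_ac)
 also have "... = (\<beta> a c \<otimes>\<^sub>N \<beta> b d) \<otimes>\<^sub>N (\<beta> a' d \<otimes>\<^sub>N \<beta> b' c) \<otimes>\<^sub>N (\<beta> k c \<otimes>\<^sub>N \<beta> k d)"
  unfolding k'[OF c, symmetric] k'[OF d] by (simp add: N.m_ac)
 finally show ?thesis by (subst N.groth_eq_iff) (auto intro!: bexI[of _ "\<beta> k c \<otimes>\<^sub>N \<beta> k d"])
qed

lemma groth_bimap_class:
 assumes "comm_monoid M" "comm_monoid L" "comm_monoid N"
  and \<beta>: "!!a. a : carrier M ==> \<beta> a : hom L N" "!!c. c : carrier L ==> (%a. \<beta> a c) : hom M N"
  and [simp]: "a : carrier M" "b : carrier M" "c : carrier L" "d : carrier L"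
 shows "groth_bimap N \<beta> (groth_class M a b) (groth_class L c d) =
  groth_class N (\<beta> a c \<otimes>\<^sub>N \<beta> b d) (\<beta> a d \<otimes>\<^sub>N \<beta> b c)"
proof -
 interpret M: comm_monoid M by fact
 interpret L: comm_monoid L by fact
 interpret N: comm_monoid N by fact
 have "groth_class N (\<beta> a' c' \<otimes>\<^sub>N \<beta> b' d') (\<beta> a' d' \<otimes>\<^sub>N \<beta> b' c') = groth_class N (\<beta> a c \<otimes>\<^sub>N \<beta> b d) (\<beta> a d \<otimes>\<^sub>N \<beta> b c)"
  if ab: "(a', b') : groth_class M a b" and cd: "(c', d') : groth_class L c d" for a' b' c' d'
 proof -
  note [simp] = L.groth_class_mem(3,4)[OF cd] hom_in_carrier[OF \<beta>(1)]
  note [simp] = M.groth_class_mem(3,4)[OF ab]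
  have "groth_class N (\<beta> a' c' \<otimes>\<^sub>N \<beta> b' d') (\<beta> a' d' \<otimes>\<^sub>N \<beta> b' c') = groth_class N (\<beta> a c' \<otimes>\<^sub>N \<beta> b d') (\<beta> b c' \<otimes>\<^sub>N \<beta> a d')"
   using groth_bimap_left[OF assms(1,3) ab, where \<beta> = \<beta> and c = c' and d = d'] \<beta>(2) by (simp add: N.m_comm[of "\<beta> b _"])
  also have "... = groth_class N (\<beta> a c \<otimes>\<^sub>N \<beta> b d) (\<beta> a d \<otimes>\<^sub>N \<beta> b c)"
   using groth_bimap_left[OF assms(2,3) cd, where \<beta> = "%c a. \<beta> a c" and c = a and d = b] \<beta>(1) by (simp add: N.m_comm[of "\<beta> b _"])
  finally show ?thesis .
 qed
 then show ?thesis unfolding groth_bimap_def by (intro UN_const[OF M.groth_class_self], simp, simp, clarsimp)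
   (intro UN_const[OF L.groth_class_self], auto)
qed

text \<open>The extension of a monoid homomorphism into a group that the universal property of the
  Grothendieck group provides. It will be applied, for fixed \<open>b\<close>, to the map that sends
  the class of \<open>p\<close> to \<open>Phi A B p b\<close>.\<close>

definition groth_lift :: "('a, 'm) monoid_scheme => ('g, 'n) monoid_scheme => ('a => 'g) => ('a \<times> 'a) set => 'g" where
 "groth_lift M L \<phi> X = (THE g. \<exists>a b. a : carrier M & b : carrier M & X = groth_class M a b & g = \<phi> a \<otimes>\<^sub>L inv\<^bsub>L\<^esub> \<phi> b)"

lemma (in comm_group) diff_eq_iff:
 assumes [simp]: "a : carrier G" "b : carrier G" "c : carrier G" "d : carrier G"
 shows "a \<otimes> inv b = c \<otimes> inv d \<longleftrightarrow> a \<otimes> d = c \<otimes> b"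
proof
 assume *: "a \<otimes> inv b = c \<otimes> inv d"
 have "a \<otimes> d = (a \<otimes> inv b) \<otimes> (b \<otimes> d)" by (simp add: m_assoc) (simp add: m_assoc[symmetric])
 also have "... = c \<otimes> b" unfolding * by (simp add: m_ac)
 finally show "a \<otimes> d = c \<otimes> b" .
next
 assume *: "a \<otimes> d = c \<otimes> b"
 have "c \<otimes> inv d \<otimes> b = (c \<otimes> b) \<otimes> inv d" by (simp add: m_ac)
 also have "... = a" unfolding *[symmetric] by (simp add: m_assoc)
 finally show "a \<otimes> inv b = c \<otimes> inv d" using inv_solve_right[of "c \<otimes> inv d" a b] by simp
qed

lemma groth_lift_class:
 assumes "comm_monoid M" "comm_group L" and \<phi>: "\<phi> : hom M L" and [simp]: "a : carrier M" "b : carrier M"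
 shows "groth_lift M L \<phi> (groth_class M a b) = \<phi> a \<otimes>\<^sub>L inv\<^bsub>L\<^esub> \<phi> b"
 unfolding groth_lift_def
proof (rule the_equality)
 interpret M: comm_monoid M by fact
 interpret L: comm_group L by fact
 note [simp] = hom_in_carrier[OF \<phi>] hom_mult[OF \<phi>]
 fix g assume "\<exists>c d. c : carrier M & d : carrier M & groth_class M a b = groth_class M c d & g = \<phi> c \<otimes>\<^sub>L inv\<^bsub>L\<^esub> \<phi> d"
 then obtain c d where [simp]: "c : carrier M" "d : carrier M" and *: "groth_class M a b = groth_class M c d"
  and g: "g = \<phi> c \<otimes>\<^sub>L inv\<^bsub>L\<^esub> \<phi> d" by blast
 obtain k where [simp]: "k : carrier M" and k: "a \<otimes>\<^sub>M d \<otimes>\<^sub>M k = c \<otimes>\<^sub>M b \<otimes>\<^sub>M k"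
  using * by (auto simp: M.groth_eq_iff)
 have "\<phi> a \<otimes>\<^sub>L \<phi> d \<otimes>\<^sub>L \<phi> k = \<phi> c \<otimes>\<^sub>L \<phi> b \<otimes>\<^sub>L \<phi> k" using arg_cong[OF k, of \<phi>] by simp
 then show "g = \<phi> a \<otimes>\<^sub>L inv\<^bsub>L\<^esub> \<phi> b" unfolding g by (simp add: L.diff_eq_iff)
qed (use assms(4,5) in blast)

lemma groth_lift_hom:
 assumes "comm_monoid M" "comm_group L" and \<phi>: "\<phi> : hom M L"
 shows "groth_lift M L \<phi> : hom (grothendieck M) L"
proof -
 interpret M: comm_monoid M by fact
 interpret L: comm_group L by fact
 note [simp] = hom_in_carrier[OF \<phi>] hom_mult[OF \<phi>] groth_lift_class[OF assms]
 show ?thesis by (rule homI) (auto simp: M.groth_carrier M.groth_mult L.inv_mult L.m_ac)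
qed

section \<open>The group of idempotents\<close>

lemma equiv_sym: "equiv A r ==> sym r" by (simp add: equiv_def)

text \<open>\<open>bsum\<close>, \<open>imap\<close> and \<open>itens\<close> act on
  representatives, pairs of a size and a matrix, so that identities between classes reduce to
  equalities or equivalences of such pairs.\<close>

definition bsum :: "('a, 'm) ring_scheme => 'a idem => 'a idem => 'a idem" where
 "bsum R p q = (fst p + fst q, block_diag R (fst p) (fst q) (snd p) (snd q))"

definition imap :: "('a => 'b) => 'a idem => 'b idem" where
 "imap f p = (fst p, rmap f (fst p) (fst p) (snd p))"

definition itens :: "('a => 'b => 'c) => 'a idem => 'b idem => 'c idem" where
 "itens t p q = (fst p * fst q, kron t (fst p) (fst p) (fst q) (fst q) (snd p) (snd q))"

text \<open>The formal difference \<open>[p] - [q]\<close>.\<close>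

definition kcls :: "('a, 'm) ring_scheme => 'a idem => 'a idem => 'a k0" where
 "kcls R p q = groth_class (idem_monoid R) (idem_class R p) (idem_class R q)"

lemma imap_idems:
 assumes "nring R" "nring S" "f : nring_hom R S" "p : idems R" shows "imap f p : idems S"
proof -
 obtain n e where p: "p = (n, e)" by force
 note e = idemsD[OF assms(4)[unfolded p]]
 show ?thesis using rmap_mm[OF assms(1-3) e(1) e(1)] nring_homD(2)[OF assms(3)]
  by (simp add: p imap_def idems_def e rmap_mats[OF e(1)])
qed

lemma imap_equiv:
 assumes "nring R" "nring S" "f : nring_hom R S" "(p, q) : idem_equiv R"
 shows "(imap f p, imap f q) : idem_equiv S"
proof -
 interpret R: nring R by fact
 interpret S: nring S by fact
 obtain m e n g where pq: "p = (m, e)" "q = (n, g)" by force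
 obtain x y where xy: "(m, e) : idems R" "(n, g) : idems R" "x : mats R m n" "y : mats R n m"
  "mx R m n m x y = e" "mx R n m n y x = g" using assms(4) unfolding pq by (rule R.idem_equivE)
 have *: "imap f (m, e) : idems S" "imap f (n, g) : idems S"
  using xy by (auto intro: imap_idems[OF assms(1-3)])
 show ?thesis unfolding pq imap_def fst_conv snd_conv
  by (rule S.idem_equivI[of _ _ _ _ "rmap f m n x" "rmap f n m y"])
   (use xy * nring_homD(2)[OF assms(3)] in \<open>auto simp: imap_def rmap_mm[OF assms(1-3), symmetric]
    intro!: rmap_mats[of _ R]\<close>)
qed

lemma imap_comp: "imap g (imap f p) = imap (g \<circ> f) p" by (simp add: imap_def rmap_rmap)

lemma imap_cong: "[|p : idems R; !!a. a : carrier R ==> f a = g a|] ==> imap f p = imap g p"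
 by (cases p) (auto simp: imap_def idems_def intro: rmap_cong)

lemma imap_ident: "[|p : idems R; !!a. a : carrier R ==> f a = a|] ==> imap f p = p"
 by (cases p) (auto simp: imap_def idems_def intro: rmap_ident)

lemma imap_bsum:
 assumes "nring R" "nring S" "f : nring_hom R S" "p : idems R" "q : idems R"
 shows "imap f (bsum R p q) = bsum S (imap f p) (imap f q)"
proof -
 interpret R: nring R by fact
 interpret S: nring S by fact
 have z: "f \<zero>\<^sub>R = \<zero>\<^sub>S"
  by (rule add_hom_zero[OF R.abelian_group_axioms S.abelian_group_axioms nring_homD(1)[OF assms(3)]])
 show ?thesis using assms(4,5) nring_homD(2)[OF assms(3)]
  by (cases p; cases q) (auto simp: imap_def bsum_def block_diag_blk rmap_mat_zero[of f R S, OF z]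
    dest!: idemsD(1) intro!: trans[OF rmap_blk[of _ R _ _ _ _ _ _ _ _ S]] R.mz_mats)
qed

context nring
begin

lemma bsum_idems: "[|p : idems R; q : idems R|] ==> bsum R p q : idems R"
 by (cases p; cases q) (simp add: bsum_def block_diag_idems)

lemma bsum_equiv: "[|(p, p') : idem_equiv R; (q, q') : idem_equiv R|] ==> (bsum R p q, bsum R p' q') : idem_equiv R"
 by (cases p; cases q; cases p'; cases q') (simp add: bsum_def block_diag_equiv)

lemma cls_bsum: "[|p : idems R; q : idems R|]
  ==> idem_class R p \<otimes>\<^bsub>idem_monoid R\<^esub> idem_class R q = idem_class R (bsum R p q)"
 by (cases p; cases q) (simp add: bsum_def idem_class_mult)

lemma K0_comm_group: "comm_group (K0 R)" unfolding K0_def by (rule comm_monoid.groth_comm_group[OF idem_comm_monoid])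

lemma kcls_carrier: "[|p : idems R; q : idems R|] ==> kcls R p q : carrier (K0 R)"
 unfolding kcls_def K0_def by (intro comm_monoid.groth_class_carrier[OF idem_comm_monoid] cls_carrier)

lemma K0_cases:
 assumes "X : carrier (K0 R)"
 obtains p q where "p : idems R" "q : idems R" "X = kcls R p q"
 using assms unfolding K0_def comm_monoid.groth_carrier[OF idem_comm_monoid] idem_carrier kcls_def by blast

lemma kcls_mult: "[|p : idems R; q : idems R; p' : idems R; q' : idems R|]
  ==> kcls R p q \<otimes>\<^bsub>K0 R\<^esub> kcls R p' q' = kcls R (bsum R p p') (bsum R q q')"
 by (simp add: kcls_def K0_def comm_monoid.groth_mult[OF idem_comm_monoid] cls_carrier cls_bsum)

lemma kcls_self: "p : idems R ==> kcls R p p = \<one>\<^bsub>K0 R\<^esub>"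
proof -
 assume p: "p : idems R"
 interpret M: comm_monoid "idem_monoid R" by (rule idem_comm_monoid)
 show ?thesis using cls_carrier[OF p] by (simp add: kcls_def K0_def M.groth_one M.groth_eq_iff) blast
qed

lemma kcls_eqI_stable:
 assumes "p : idems R" "q : idems R" "r : idems R" shows "kcls R (bsum R p r) (bsum R q r) = kcls R p q"
proof -
 interpret K: comm_group "K0 R" by (rule K0_comm_group)
 show ?thesis using assms by (simp add: kcls_mult[symmetric] kcls_self kcls_carrier)
qed

lemma kcls_cong: "[|(p, p') : idem_equiv R; (q, q') : idem_equiv R|] ==> kcls R p q = kcls R p' q'"
 unfolding kcls_def by (metis idem_class_def equiv_class_eq[OF equiv_idem])

end

lemma idem_map_class:
 assumes "nring R" "nring S" "f : nring_hom R S" "p : idems R"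
 shows "idem_map S f (idem_class R p) = idem_class S (imap f p)"
proof -
 interpret R: nring R by fact
 interpret S: nring S by fact
 have "idem_class S (imap f q) = idem_class S (imap f p)" if "q : idem_class R p" for q
  using that[THEN R.idem_class_mem] assms(4) imap_equiv[OF assms(1-3), of p q]
  by (subst S.idem_class_eq_iff) (auto intro!: imap_idems[OF assms(1-3)] intro: symD[OF equiv_sym[OF S.equiv_idem]])
 then have "(\<Union>(n, e)\<in>idem_class R p. idem_class S (imap f (n, e))) = idem_class S (imap f p)"
  by (intro UN_const[OF R.idem_class_self[OF assms(4)]]) auto
 then show ?thesis unfolding idem_map_def by (simp add: imap_def mat_map_rmap)
qed

lemma idem_map_hom:
 assumes "nring R" "nring S" "f : nring_hom R S" shows "idem_map S f : hom (idem_monoid R) (idem_monoid S)"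
 by (rule homI) (auto simp: nring.idem_carrier[OF assms(1)] idem_map_class[OF assms] nring.cls_bsum[OF assms(1)]
   nring.bsum_idems[OF assms(1)] nring.cls_bsum[OF assms(2)] imap_bsum[OF assms] imap_idems[OF assms]
   intro!: nring.cls_carrier[OF assms(2)])

lemma K0_map_kcls:
 assumes "nring R" "nring S" "f : nring_hom R S" "p : idems R" "q : idems R"
 shows "K0_map S f (kcls R p q) = kcls S (imap f p) (imap f q)" unfolding K0_map_def kcls_def
 by (subst comm_monoid.groth_map_class[OF nring.idem_comm_monoid[OF assms(1)] nring.idem_comm_monoid[OF assms(2)] idem_map_hom[OF assms(1-3)]])
  (simp_all add: nring.cls_carrier[OF assms(1)] assms idem_map_class[OF assms(1-3)])

lemma K0_map_hom:
 assumes "nring R" "nring S" "f : nring_hom R S" shows "K0_map S f : hom (K0 R) (K0 S)"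
 unfolding K0_map_def K0_def
 by (rule comm_monoid.groth_map_hom[OF nring.idem_comm_monoid[OF assms(1)] nring.idem_comm_monoid[OF assms(2)] idem_map_hom[OF assms]])

lemma K0_map_comp:
 assumes "nring R" "nring S" "nring T" "f : nring_hom R S" "g : nring_hom S T" "X : carrier (K0 R)"
 shows "K0_map T g (K0_map S f X) = K0_map T (g \<circ> f) X"
proof -
 obtain p q where "p : idems R" "q : idems R" "X = kcls R p q" using nring.K0_cases[OF assms(1,6)] by blast
 then show ?thesis
  using assms by (simp add: K0_map_kcls[of R S] K0_map_kcls[of S T] K0_map_kcls[of R T] imap_idems[of R S]
    imap_comp nring_hom_comp[OF assms(4,5)])
qed

lemma K0_map_cong:
 assumes "nring R" "nring S" "f : nring_hom R S" "g : nring_hom R S" "!!a. a : carrier R ==> f a = g a"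
  "X : carrier (K0 R)" shows "K0_map S f X = K0_map S g X"
proof -
 obtain p q where "p : idems R" "q : idems R" "X = kcls R p q" using nring.K0_cases[OF assms(1,6)] by blast
 then show ?thesis using assms imap_cong[of _ R f g] by (simp add: K0_map_kcls[of R S])
qed

lemma K0_map_ident:
 assumes "nring R" "f : nring_hom R R" "!!a. a : carrier R ==> f a = a" "X : carrier (K0 R)"
 shows "K0_map R f X = X"
proof -
 obtain p q where "p : idems R" "q : idems R" "X = kcls R p q" using nring.K0_cases[OF assms(1,4)] by blast
 then show ?thesis using assms imap_ident[of _ R f] by (simp add: K0_map_kcls[of R R])
qed

section \<open>Tensor products of idempotents and the cup product on \<open>K0\<close>\<close>

context mpairing
begin

lemma itens_idems: "[|p : idems R; q : idems S|] ==> itens t p q : idems T"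
 by (cases p; cases q) (auto simp: itens_def idems_def kron_mats mat_mult_kron)

lemma itens_equiv:
 assumes "(p, p') : idem_equiv R" "(q, q') : idem_equiv S"
 shows "(itens t p q, itens t p' q') : idem_equiv T"
proof -
 obtain m e n f m' e' n' f' where pq: "p = (m, e)" "p' = (m', e')" "q = (n, f)" "q' = (n', f')" by force
 from assms(1) obtain x y where xy: "(m, e) : idems R" "(m', e') : idems R" "x : mats R m m'" "y : mats R m' m"
  "mx R m m' m x y = e" "mx R m' m m' y x = e'" unfolding pq by (rule R.idem_equivE)
 from assms(2) obtain v w where vw: "(n, f) : idems S" "(n', f') : idems S" "v : mats S n n'" "w : mats S n' n"
  "mx S n n' n v w = f" "mx S n' n n' w v = f'" unfolding pq by (rule S.idem_equivE)
 have *: "itens t p q : idems T" "itens t p' q' : idems T"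
  using xy(1,2) vw(1,2) by (auto simp: pq intro!: itens_idems)
 show ?thesis using * unfolding pq itens_def fst_conv snd_conv
  by (rule T.idem_equivI[of _ _ _ _ "kron t m m' n n' x v" "kron t m' m n' n y w"])
   (auto simp: mat_mult_kron xy(3-) vw(3-) intro!: kron_mats)
qed

text \<open>An equality of matrices: in the Kronecker numbering the left factor supplies the outer
  index, so a block sum there remains a block sum. On the right a permutation intervenes and only an
  equivalence is left, see \<open>itens_bsum_right\<close>.\<close>

lemma itens_bsum_left:
 assumes "p : idems R" "p' : idems R" "q : idems S"
 shows "itens t (bsum R p p') q = bsum T (itens t p q) (itens t p' q)"
proof -
 obtain m e n f m' e' where pq: "p = (m, e)" "p' = (m', e')" "q = (n, f)" by force
 note em = idemsD(1)[OF assms(1)[unfolded pq]] idemsD(1)[OF assms(2)[unfolded pq]] idemsD(1)[OF assms(3)[unfolded pq]]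
 have "kron t (m + m') (m + m') n n (block_diag R m m' e e') f =
  block_diag T (m * n) (m' * n) (kron t m m n n e f) (kron t m' m' n n e' f)" (is "?L = ?R")
 proof (rule block_eqI[of _ T "m * n" "m' * n" "m * n" "m' * n" _ T])
  \<comment> \<open>Shifting an index by \<open>m * n\<close> shifts its quotient by
    \<open>m\<close> only for positive \<open>n\<close>; the existence of an index provides
    this.\<close>
  have n0: "n > 0" if "i < m * n \<or> i < m' * n" for i using that by (cases n) auto
  note [simp] = divmod_less matsD[OF em(3)] t_zero_left
  have 1: "?L (i, j) = t (block_diag R m m' e e' (i div n, j div n)) (f (i mod n, j mod n))"
   if "i < m * n + m' * n" "j < m * n + m' * n" for i j using that by (simp add: kron_def add_mult_distrib)
  show "?L (i, j) = ?R (i, j)" if "i < m * n" "j < m * n" for i j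
   using that by (simp add: 1) (simp add: block_diag_blk blk_app kron_app)
  show "?L (i, m * n + j) = ?R (i, m * n + j)" if "i < m * n" "j < m' * n" for i j
   using that n0[of i] by (simp add: 1) (simp add: block_diag_blk blk_app mat_zero_app)
  show "?L (m * n + i, j) = ?R (m * n + i, j)" if "i < m' * n" "j < m * n" for i j
   using that n0[of i] by (simp add: 1) (simp add: block_diag_blk blk_app mat_zero_app)
  show "?L (m * n + i, m * n + j) = ?R (m * n + i, m * n + j)" if "i < m' * n" "j < m' * n" for i j
   using that n0[of i] by (simp add: 1) (simp add: block_diag_blk blk_app kron_app)
  show "?L : mats T (m * n + m' * n) (m * n + m' * n)"
   using kron_mats[OF R.block_diag_mats[OF em(1,2)] em(3)] by (simp add: add_mult_distrib)
 qed (use em in \<open>auto intro!: T.block_diag_mats kron_mats\<close>)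
 then show ?thesis by (simp add: pq itens_def bsum_def add_mult_distrib)
qed

lemma flip: "mpairing S R T (%b a. t a b)"
 by (intro mpairing.intro mpairing_axioms.intro R.nring_axioms S.nring_axioms T.nring_axioms)
  (auto simp: t_closed t_add_left t_add_right t_mult)

text \<open>The two Kronecker products differ by the permutation
  \<open>i mod n * m + i div n\<close>, which exchanges inner and outer index, so
  \<open>idem_equiv_reindex\<close> applies.\<close>

lemma itens_flip:
 assumes p: "p : idems R" and q: "q : idems S"
 shows "(itens (%b a. t a b) q p, itens t p q) : idem_equiv T"
proof -
 obtain m e n f where pq: "p = (m, e)" "q = (n, f)" by (cases p; cases q)
 interpret F: mpairing S R T "%b a. t a b" by (rule flip)
 define \<rho> where "\<rho> i = i mod n * m + i div n" for i
 have \<rho>: "\<rho> i div m = i mod n" "\<rho> i mod m = i div n" "\<rho> i < n * m" if "i < m * n" for i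
 proof -
  note lt = divmod_less[OF that]
  show "\<rho> i div m = i mod n" "\<rho> i mod m = i div n" using lt by (auto simp: \<rho>_def)
  have "\<rho> i < Suc (i mod n) * m" using lt by (simp add: \<rho>_def)
  also have "... <= n * m" using lt by (intro mult_right_mono) auto
  finally show "\<rho> i < n * m" .
 qed
 have inj: "inj_on \<rho> {..<m * n}" by (rule inj_onI) (metis \<rho>(1,2) div_mod_decomp lessThan_iff)
 have "\<rho> ` {..<m * n} \<subseteq> {..<n * m}" using \<rho>(3) by auto
 moreover from this have "\<rho> ` {..<m * n} = {..<n * m}" by (intro card_subset_eq) (auto simp: card_image[OF inj])
 ultimately have im: "\<rho> ` {..<m * n} = {..<n * m}" by simp
 have "(m * n, kron t m m n n e f) : idems T &
  ((n * m, kron (%b a. t a b) n n m m f e), (m * n, kron t m m n n e f)) : idem_equiv T"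
 proof (rule T.idem_equiv_reindex[OF _ _ inj])
  show "(n * m, kron (%b a. t a b) n n m m f e) : idems T" using F.itens_idems[OF q p] by (simp add: pq itens_def)
  show "kron t m m n n e f : mats T (m * n) (m * n)"
   by (rule kron_mats[OF idemsD(1)[OF p[unfolded pq]] idemsD(1)[OF q[unfolded pq]]])
 qed (use im \<rho> in \<open>simp_all add: kron_app F.kron_app\<close>)
 then show ?thesis by (simp add: pq itens_def)
qed

text \<open>Flip, distribute over the sum on the left, and flip each summand back.\<close>

lemma itens_bsum_right:
 assumes p: "p : idems R" and q: "q : idems S" "q' : idems S"
 shows "(itens t p (bsum S q q'), bsum T (itens t p q) (itens t p q')) : idem_equiv T"
proof -
 have "trans (idem_equiv T)" using T.equiv_idem by (simp add: equiv_def)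
 note f = itens_flip[OF p] and tr = transD[OF this] and sy = symD[OF equiv_sym[OF T.equiv_idem]]
 show ?thesis by (rule tr[OF sy[OF f[OF S.bsum_idems[OF q]]]])
   (simp add: mpairing.itens_bsum_left[OF flip q p] T.bsum_equiv f q)
qed

lemma idem_tensor_class:
 assumes "p : idems R" "q : idems S"
 shows "idem_tensor T t (idem_class R p) (idem_class S q) = idem_class T (itens t p q)"
proof -
 have "idem_class T (itens t p' q') = idem_class T (itens t p q)"
  if "p' : idem_class R p" "q' : idem_class S q" for p' q'
  using R.idem_class_mem[OF that(1)] S.idem_class_mem[OF that(2)] assms itens_equiv[of p p' q q']
  by (subst T.idem_class_eq_iff) (auto intro!: itens_idems intro: symD[OF equiv_sym[OF T.equiv_idem]])
 then have "(\<Union>(n, q')\<in>idem_class S q. idem_class T (itens t p' (n, q'))) = idem_class T (itens t p q)"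
  if "p' : idem_class R p" for p' using that by (intro UN_const[OF S.idem_class_self[OF assms(2)]]) auto
 then have "(\<Union>(m, p')\<in>idem_class R p. \<Union>(n, q')\<in>idem_class S q. idem_class T (itens t (m, p') (n, q'))) =
   idem_class T (itens t p q)" by (intro UN_const[OF R.idem_class_self[OF assms(1)]]) auto
 then show ?thesis unfolding idem_tensor_def by (simp add: itens_def mat_tensor_kron)
qed

lemma K0_cup_kcls:
 assumes "p : idems R" "p' : idems R" "q : idems S" "q' : idems S"
 shows "K0_cup T t (kcls R p p') (kcls S q q') =
  kcls T (bsum T (itens t p q) (itens t p' q')) (bsum T (itens t p q') (itens t p' q))"
proof -
 have 1: "idem_tensor T t a : hom (idem_monoid S) (idem_monoid T)" if a: "a : carrier (idem_monoid R)" for a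
 proof -
  obtain x where x: "x : idems R" "a = idem_class R x" using a unfolding R.idem_carrier by blast
  have "idem_class T (itens t x (bsum S y z)) = idem_class T (bsum T (itens t x y) (itens t x z))"
   if "y : idems S" "z : idems S" for y z using itens_bsum_right[OF x(1) that] x(1) that
   by (subst T.idem_class_eq_iff) (auto intro: itens_idems T.bsum_idems S.bsum_idems)
  then show ?thesis using x by (intro homI) (auto simp: S.idem_carrier idem_tensor_class S.cls_bsum S.bsum_idems
     T.cls_bsum itens_idems intro!: T.cls_carrier)
 qed
 have 2: "(%a. idem_tensor T t a c) : hom (idem_monoid R) (idem_monoid T)" if c: "c : carrier (idem_monoid S)" for c
  using c by (intro homI) (auto simp: S.idem_carrier R.idem_carrier idem_tensor_class R.cls_bsum R.bsum_idems
     T.cls_bsum itens_idems itens_bsum_left intro!: T.cls_carrier)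
 show ?thesis unfolding K0_cup_def kcls_def
  by (subst groth_bimap_class[OF R.idem_comm_monoid S.idem_comm_monoid T.idem_comm_monoid 1 2])
   (use assms in \<open>simp_all add: R.cls_carrier S.cls_carrier idem_tensor_class T.cls_bsum itens_idems\<close>)
qed

lemma K0_cup_carrier:
 assumes "X : carrier (K0 R)" "Y : carrier (K0 S)" shows "K0_cup T t X Y : carrier (K0 T)"
 by (rule R.K0_cases[OF assms(1)], rule S.K0_cases[OF assms(2)])
  (simp add: K0_cup_kcls T.kcls_carrier T.bsum_idems itens_idems)

text \<open>With the neutral element written as \<open>[z] - [z]\<close>, the positive and the
  negative part of the product are literally the same idempotent.\<close>

lemma K0_cup_one_right:
 assumes "X : carrier (K0 R)" shows "K0_cup T t X \<one>\<^bsub>K0 S\<^esub> = \<one>\<^bsub>K0 T\<^esub>"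
proof -
 obtain p p' where p: "p : idems R" "p' : idems R" "X = kcls R p p'" using R.K0_cases[OF assms] by blast
 have z: "(0, %_. undefined) : idems S" by (rule S.idem_zero_idems)
 show ?thesis using p z by (simp add: S.kcls_self[OF z, symmetric] K0_cup_kcls T.kcls_self T.bsum_idems itens_idems)
qed

lemma K0_cup_one_left:
 assumes "Y : carrier (K0 S)" shows "K0_cup T t \<one>\<^bsub>K0 R\<^esub> Y = \<one>\<^bsub>K0 T\<^esub>"
proof -
 obtain p p' where p: "p : idems S" "p' : idems S" "Y = kcls S p p'" using S.K0_cases[OF assms] by blast
 have z: "(0, %_. undefined) : idems R" by (rule R.idem_zero_idems)
 have "kcls T (bsum T (itens t (0, %_. undefined) p) (itens t (0, %_. undefined) p'))
  (bsum T (itens t (0, %_. undefined) p') (itens t (0, %_. undefined) p)) = \<one>\<^bsub>K0 T\<^esub>"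
 proof -
  \<comment> \<open>Here the two parts list \<open>p\<close> and \<open>p'\<close> in different
    order; they still agree because every product with the empty idempotent is the empty
    matrix.\<close>
  have "itens t (0, %_. undefined) p = itens t (0, %_. undefined) p'" by (auto simp: itens_def kron_def)
  then show ?thesis using p z by (simp add: T.kcls_self T.bsum_idems itens_idems)
 qed
 then show ?thesis using p z by (simp add: R.kcls_self[OF z, symmetric] K0_cup_kcls)
qed

end

lemma itens_imap:
 assumes "p : idems R" "q : idems S" "!!a b. [|a : carrier R; b : carrier S|] ==> h (t a b) = t' (f a) (g b)"
 shows "imap h (itens t p q) = itens t' (imap f p) (imap g q)"
proof -
 obtain m e n f' where pq: "p = (m, e)" "q = (n, f')" by force
 note em = idemsD(1)[OF assms(1)[unfolded pq]] idemsD(1)[OF assms(2)[unfolded pq]]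
 have "h (kron t m m n n e f' (i, j)) = kron t' m m n n (rmap f m m e) (rmap g n n f') (i, j)"
  if "i < m * n" "j < m * n" for i j using divmod_less[OF that(1)] divmod_less[OF that(2)] that em
  by (simp add: kron_def rmap_def assms(3) matsD)
 then show ?thesis by (auto simp: pq imap_def itens_def rmap_def kron_def)
qed

text \<open>The pairings are linked only through \<open>h (t a b) = t' (f a) (g b)\<close>. So this
  covers morphisms of algebras, and also a character on one factor, where \<open>t'\<close> becomes
  scalar multiplication.\<close>

lemma K0_cup_natural:
 assumes "mpairing R S T t" "mpairing R' S' T' t'"
  and "h : nring_hom T T'" "f : nring_hom R R'" "g : nring_hom S S'"
  and "!!a b. [|a : carrier R; b : carrier S|] ==> h (t a b) = t' (f a) (g b)"
  and "X : carrier (K0 R)" "Y : carrier (K0 S)"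
 shows "K0_map T' h (K0_cup T t X Y) = K0_cup T' t' (K0_map R' f X) (K0_map S' g Y)"
proof -
 interpret A: mpairing R S T t by fact
 interpret B: mpairing R' S' T' t' by fact
 obtain p p' q q' where pq: "p : idems R" "p' : idems R" "X = kcls R p p'" "q : idems S" "q' : idems S" "Y = kcls S q q'"
  using A.R.K0_cases[OF assms(7)] A.S.K0_cases[OF assms(8)] by metis
 note h = A.T.nring_axioms B.T.nring_axioms assms(3)
 note f = A.R.nring_axioms B.R.nring_axioms assms(4)
 note g = A.S.nring_axioms B.S.nring_axioms assms(5)
 note hi = itens_imap[of _ R _ S h t t' f g, OF _ _ assms(6)]
 show ?thesis using pq
  by (simp add: A.K0_cup_kcls B.K0_cup_kcls K0_map_kcls[OF h] K0_map_kcls[OF f] K0_map_kcls[OF g] hi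
    A.T.bsum_idems A.itens_idems imap_idems[OF f] imap_idems[OF g] imap_bsum[OF h])
qed

section \<open>Excision for split extensions\<close>

text \<open>The unit is a parameter because it cannot be read off the \<open>one\<close> field of an
  algebra; in a copy \<open>UU A\<close> it is the image of \<open>(1, 0)\<close>.\<close>

definition is_unit :: "('a, 'm) ring_scheme => 'a => bool" where
 "is_unit R u \<longleftrightarrow> u : carrier R & (\<forall>a\<in>carrier R. u \<otimes>\<^sub>R a = a & a \<otimes>\<^sub>R u = a)"

definition ione :: "('a, 'm) ring_scheme => 'a => nat => 'a idem" where
 "ione R u n = (n, mat_scalar R u n)"

text \<open>\<open>row\<close> is the block row \<open>(a b)\<close> and \<open>col\<close>, below,
  the block column. As block matrices with an empty second row or column they inherit the
  multiplication rule \<open>mat_mult_blk\<close>.\<close>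

definition row :: "('a, 'm) ring_scheme => nat => nat => nat => (nat \<times> nat => 'a) => (nat \<times> nat => 'a) => (nat \<times> nat => 'a)" where
 "row R m n n' a b = blk m 0 n n' a b (mat_zero R 0 n) (mat_zero R 0 n')"

definition col :: "('a, 'm) ring_scheme => nat => nat => nat => (nat \<times> nat => 'a) => (nat \<times> nat => 'a) => (nat \<times> nat => 'a)" where
 "col R m m' n a b = blk m m' n 0 a (mat_zero R m 0) b (mat_zero R m' 0)"

lemma blk_0: "a : mats R m n ==> blk m 0 n 0 a b c d = a"
 by (rule mats_eqI[of _ R m n _ R]) (auto simp: blk_def mats_def PiE_def Pi_def)

locale uring = nring R for R :: "('a, 'm) ring_scheme" (structure) +
 fixes u assumes unit: "is_unit R u"
begin

lemma u_carrier: "u : carrier R"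
 and u_left: "a : carrier R ==> u \<otimes> a = a"
 and u_right: "a : carrier R ==> a \<otimes> u = a" using unit by (auto simp: is_unit_def)

abbreviation "mone n \<equiv> mat_scalar R u n"

lemma mone_mats: "mone n : mats R n n" by (rule mat_scalar_mats[OF u_carrier])

lemma mone_left: "x : mats R m n ==> mx R m m n (mone m) x = x"
 by (rule mat_mult_one) (auto simp: u_carrier u_left)

lemma mone_right: "x : mats R m n ==> mx R m n n x (mone n) = x"
 by (rule mat_one_mult) (auto simp: u_carrier u_right)

lemma ione_idems: "ione R u n : idems R" by (simp add: ione_def idems_def mone_mats mone_left)

lemma bsum_ione: "bsum R (ione R u m) (ione R u n) = ione R u (m + n)"
 unfolding bsum_def ione_def fst_conv snd_conv block_diag_blk
 by (intro arg_cong[of _ _ "Pair (m + n)"] block_eqI[of _ R m n m n _ R])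
  (auto intro!: blk_mats mz_mats mone_mats simp: blk_app mat_zero_app, auto simp: mat_scalar_def)

lemma row_mats: "[|a : mats R m n; b : mats R m n'|] ==> row R m n n' a b : mats R m (n + n')"
 using blk_mats[of a R m n b n' _ 0] by (simp add: row_def mz_mats)

lemma col_mats: "[|a : mats R m n; b : mats R m' n|] ==> col R m m' n a b : mats R (m + m') n"
 using blk_mats[of a R m n _ 0 b m'] by (simp add: col_def mz_mats)

lemma row_col:
 assumes [simp]: "a : mats R l m" "b : mats R l m'" "c : mats R m n" "d : mats R m' n"
 shows "mx R l (m + m') n (row R l m m' a b) (col R m m' n c d) =
  mat_add R l n (mx R l m n a c) (mx R l m' n b d)"
proof -
 have "mat_add R l n (mx R l m n a c) (mx R l m' n b d) : mats R l n"
  by (intro mat_add_mats mm_mats[of _ _ m] mm_mats[of _ _ m']) simp_all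
 from blk_0[OF this] show ?thesis
 using mat_mult_blk[of a l m b m' "mat_zero R 0 m" 0 "mat_zero R 0 m'" c n "mat_zero R m 0" 0 d "mat_zero R m' 0"]
  by (simp add: row_def col_def mz_mats)
qed

lemma col_row:
 assumes [simp]: "a : mats R l m" "b : mats R l' m" "c : mats R m n" "d : mats R m n'"
 shows "mx R (l + l') m (n + n') (col R l l' m a b) (row R m n n' c d) =
  blk l l' n n' (mx R l m n a c) (mx R l m n' a d) (mx R l' m n b c) (mx R l' m n' b d)"
 using mat_mult_blk[of a l m "mat_zero R l 0" 0 b l' "mat_zero R l' 0" c n d n' "mat_zero R 0 n" "mat_zero R 0 n'"]
 by (simp add: row_def col_def mz_mats mat_mult_through_zero mat_add_zero mm_mats)

lemma mat_mult_row:
 assumes [simp]: "x : mats R l m" "c : mats R m n" "d : mats R m n'"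
 shows "mx R l m (n + n') x (row R m n n' c d) = row R l n n' (mx R l m n x c) (mx R l m n' x d)"
proof -
 have "col R l 0 m x (mat_zero R 0 m) = x" unfolding col_def by (rule blk_0[of _ R]) simp
 with col_row[of x l m "mat_zero R 0 m" 0 c n d n'] show ?thesis by (simp add: row_def mz_mats mat_zero_mult)
qed

lemma mat_mult_col:
 assumes [simp]: "a : mats R l m" "b : mats R l' m" "x : mats R m n"
 shows "mx R (l + l') m n (col R l l' m a b) x = col R l l' n (mx R l m n a x) (mx R l' m n b x)"
proof -
 have "row R m n 0 x (mat_zero R m 0) = x" unfolding row_def by (rule blk_0[of _ R]) simp
 with col_row[of a l m b l' x n "mat_zero R m 0" 0] show ?thesis by (simp add: col_def mz_mats mat_mult_zero)
qed

text \<open>For \<open>c = 1 - e\<close> everything follows from \<open>e + c = 1\<close>: multiply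
  by \<open>e\<close> from either side, or by \<open>c\<close>, and cancel.\<close>

lemma complement:
 assumes e: "e : mats R n n" "mx R n n n e e = e"
 obtains c where "c : mats R n n" "mx R n n n c c = c" "mat_add R n n e c = mone n"
  "mx R n n n e c = mat_zero R n n" "mx R n n n c e = mat_zero R n n"
proof -
 define c where "c = restrict (%ij. mone n ij \<ominus> e ij) ({..<n} \<times> {..<n})"
 have c: "c : mats R n n" unfolding c_def by (intro matsI minus_closed matsD[OF mone_mats] matsD[OF e(1)])
 have ec: "mat_add R n n e c = mone n"
 proof (rule mats_eqI[of _ R n n _ R])
  fix i j assume ij: "i < n" "j < n"
  have "e (i, j) \<oplus> (mone n (i, j) \<ominus> e (i, j)) = mone n (i, j)"
   using matsD[OF e(1) ij] matsD[OF mone_mats ij] by (simp add: a_minus_def a_lcomm[of "e (i, j)" "mone n (i, j)"] r_neg)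
  then show "mat_add R n n e c (i, j) = mone n (i, j)" using ij by (simp add: mat_add_app c_def)
 qed (auto intro: mat_add_mats e c mone_mats)
 have canc: "y = mat_zero R n n" if "x : mats R n n" "y : mats R n n" "mat_add R n n x y = x" for x y
 proof (rule mats_eqI[of _ R n n _ R])
  fix i j assume ij: "i < n" "j < n"
  have "x (i, j) \<oplus> y (i, j) = x (i, j)" using fun_cong[OF that(3), of "(i, j)"] ij by (simp add: mat_add_app)
  then show "y (i, j) = mat_zero R n n (i, j)"
   using matsD[OF that(1) ij] matsD[OF that(2) ij] ij by (simp add: mat_zero_app)
 qed (use that mz_mats in auto)
 have "mat_add R n n (mx R n n n e e) (mx R n n n e c) = mx R n n n e (mone n)"
  using mat_mult_add[OF e(1) e(1) c] by (simp add: ec)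
 then have 1: "mx R n n n e c = mat_zero R n n"
  using e c by (intro canc[OF e(1)]) (auto simp: mone_right intro: mm_mats)
 have "mat_add R n n (mx R n n n e e) (mx R n n n c e) = mx R n n n (mone n) e"
  using mat_add_mult[OF e(1) e(1) c] by (simp add: ec)
 then have 2: "mx R n n n c e = mat_zero R n n"
  using e c by (intro canc[OF e(1)]) (auto simp: mone_left intro: mm_mats)
 have "mat_add R n n (mx R n n n e c) (mx R n n n c c) = mx R n n n (mone n) c"
  using mat_add_mult[OF c e(1) c] by (simp add: ec)
 then have "mx R n n n c c = c" using c by (simp add: 1 mat_add_zero mm_mats mone_left)
 then show thesis using that c ec 1 2 by blast
qed

lemma idem_equiv_refl: "p : idems R ==> (p, p) : idem_equiv R"
 using equiv_idem by (simp add: equiv_def refl_on_def)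

text \<open>Realised by the block row and the block column with entries \<open>e\<close> and
  \<open>c = 1 - e\<close>: row times column is \<open>e + c = 1\<close>, and column times row is
  block diagonal since \<open>e c = c e = 0\<close>.\<close>

lemma idem_complement:
 assumes "p : idems R"
 obtains q where "q : idems R" "(bsum R p q, ione R u (fst p)) : idem_equiv R"
proof -
 obtain n e where p: "p = (n, e)" by force
 note e = idemsD[OF assms[unfolded p]]
 obtain c where c: "c : mats R n n" "mx R n n n c c = c" "mat_add R n n e c = mone n"
  "mx R n n n e c = mat_zero R n n" "mx R n n n c e = mat_zero R n n" using complement[OF e] .
 have q: "(n, c) : idems R" using c by (simp add: idems_def)
 have "(bsum R p (n, c), ione R u n) : idem_equiv R" unfolding bsum_def ione_def p fst_conv snd_conv
 proof (rule idem_equivI[of _ _ _ _ "col R n n n e c" "row R n n n e c"])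
  show "mx R (n + n) n (n + n) (col R n n n e c) (row R n n n e c) = block_diag R n n e c"
   by (simp add: col_row e c block_diag_blk)
  show "mx R n (n + n) n (row R n n n e c) (col R n n n e c) = mat_scalar R u n" by (simp add: row_col e c)
 qed (use e c q assms ione_idems[of n] in \<open>auto intro!: row_mats col_mats block_diag_idems simp: p ione_def\<close>)
 then show thesis using that q p by auto
qed

text \<open>Add a complement of \<open>q\<close> to both terms of \<open>[p] - [q]\<close>; the
  negative term becomes an identity matrix.\<close>

lemma K0_unit_cases:
 assumes "X : carrier (K0 R)"
 obtains p n where "p : idems R" "X = kcls R p (ione R u n)"
proof -
 obtain p q where pq: "p : idems R" "q : idems R" "X = kcls R p q" using K0_cases[OF assms] .
 obtain r where r: "r : idems R" "(bsum R q r, ione R u (fst q)) : idem_equiv R" using idem_complement[OF pq(2)] .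
 have "X = kcls R (bsum R p r) (bsum R q r)" using kcls_eqI_stable pq r by simp
 also have "... = kcls R (bsum R p r) (ione R u (fst q))"
  using r pq by (intro kcls_cong) (auto intro: bsum_idems idem_equiv_refl)
 finally show thesis using that bsum_idems pq r by blast
qed

text \<open>Equality in the Grothendieck group is equality after adding some \<open>r\<close>. A
  complement of \<open>r\<close> completes it to an identity matrix, and larger identity matrices
  serve as well. That all large \<open>l\<close> are allowed makes it possible to use one
  \<open>l\<close> for two different rings.\<close>

lemma kcls_oneD:
 assumes "p : idems R" "kcls R p (ione R u n) = \<one>\<^bsub>K0 R\<^esub>"
 shows "\<exists>k. \<forall>l\<ge>k. (bsum R p (ione R u l), ione R u (n + l)) : idem_equiv R"
proof -
 interpret M: comm_monoid "idem_monoid R" by (rule idem_comm_monoid)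
 note cc = cls_carrier[OF assms(1)] cls_carrier[OF ione_idems]
 obtain k where "k : carrier (idem_monoid R)"
  "idem_class R p \<otimes>\<^bsub>idem_monoid R\<^esub> k = idem_class R (ione R u n) \<otimes>\<^bsub>idem_monoid R\<^esub> k"
  using assms(2) cc by (auto simp: kcls_def K0_def M.groth_one M.groth_eq_iff)
 then obtain r where r: "r : idems R"
  "idem_class R p \<otimes>\<^bsub>idem_monoid R\<^esub> idem_class R r = idem_class R (ione R u n) \<otimes>\<^bsub>idem_monoid R\<^esub> idem_class R r"
  by (auto simp: idem_carrier)
 obtain r' where r': "r' : idems R" "(bsum R r r', ione R u (fst r)) : idem_equiv R" using idem_complement[OF r(1)] .
 note cr = cls_carrier[OF r(1)] cls_carrier[OF r'(1)]
 have rr: "idem_class R r \<otimes>\<^bsub>idem_monoid R\<^esub> idem_class R r' = idem_class R (ione R u (fst r))"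
  using r r' by (simp add: cls_bsum idem_class_eq_iff bsum_idems ione_idems)
 have "(bsum R p (ione R u l), ione R u (n + l)) : idem_equiv R" if "l \<ge> fst r" for l
 proof -
  have l: "ione R u l = bsum R (ione R u (fst r)) (ione R u (l - fst r))" using that by (simp add: bsum_ione)
  have il: "idem_class R (ione R u l) = idem_class R r \<otimes>\<^bsub>idem_monoid R\<^esub> idem_class R r' \<otimes>\<^bsub>idem_monoid R\<^esub> idem_class R (ione R u (l - fst r))"
   unfolding l rr by (simp add: cls_bsum ione_idems)
  have "idem_class R p \<otimes>\<^bsub>idem_monoid R\<^esub> idem_class R (ione R u l) = idem_class R (ione R u n) \<otimes>\<^bsub>idem_monoid R\<^esub> idem_class R (ione R u l)"
   unfolding il using cc cr r(2) by (simp add: M.m_assoc[symmetric])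
  then show ?thesis using assms(1) by (simp add: cls_bsum ione_idems idem_class_eq_iff bsum_idems bsum_ione)
 qed
 then show ?thesis by blast
qed

lemma kcls_ione_stable:
 assumes "p : idems R" shows "kcls R (bsum R p (ione R u k)) (ione R u (n + k)) = kcls R p (ione R u n)"
 using kcls_eqI_stable[OF assms ione_idems[of n] ione_idems[of k]] by (simp add: bsum_ione)

end

text \<open>
 \<open>S0\<close> is the preimage in \<open>S\<close> of the scalars \<open>C0\<close> in the quotient \<open>S'\<close>, that is, the unitisation
 of the kernel of the split surjection \<open>\<pi>\<close>.
\<close>

locale split_square = S0: uring S0 u0 + S: uring S u + S': uring S' u' + C0: uring C0 w
 for S0 :: "('a, 'k) ring_scheme" and u0 and S :: "('b, 'l) ring_scheme" and u
  and S' :: "('c, 'm) ring_scheme" and u' and C0 :: "('d, 'n) ring_scheme" and w +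
 fixes j \<pi> s ch k
 assumes j: "j : nring_hom S0 S" and \<pi>: "\<pi> : nring_hom S S'" and s: "s : nring_hom S' S"
  and ch: "ch : nring_hom S0 C0" and k: "k : nring_hom C0 S'"
  and units: "j u0 = u" "\<pi> u = u'" "s u' = u" "ch u0 = w" "k w = u'"
  and \<pi>s: "!!x. x : carrier S' ==> \<pi> (s x) = x"
  and \<pi>j: "!!x. x : carrier S0 ==> \<pi> (j x) = k (ch x)"
  and j_inj: "inj_on j (carrier S0)" and k_inj: "inj_on k (carrier C0)"
  and j_image: "!!x c. [|x : carrier S; c : carrier C0; \<pi> x = k c|] ==> x : j ` carrier S0"
begin

lemmas hj = S0.nring_axioms S.nring_axioms j
lemmas h\<pi> = S.nring_axioms S'.nring_axioms \<pi>
lemmas hs = S'.nring_axioms S.nring_axioms s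
lemmas hch = S0.nring_axioms C0.nring_axioms ch
lemmas hk = C0.nring_axioms S'.nring_axioms k

lemma hom_zeros: "j \<zero>\<^sub>S0 = \<zero>\<^sub>S" "\<pi> \<zero>\<^sub>S = \<zero>\<^sub>S'" "s \<zero>\<^sub>S' = \<zero>\<^sub>S" "ch \<zero>\<^sub>S0 = \<zero>\<^sub>C0" "k \<zero>\<^sub>C0 = \<zero>\<^sub>S'"
 using add_hom_zero[OF _ _ nring_homD(1)] S0.abelian_group_axioms S.abelian_group_axioms S'.abelian_group_axioms
  C0.abelian_group_axioms j \<pi> s ch k by blast+

lemma imap_ione: "imap j (ione S0 u0 n) = ione S u n" "imap \<pi> (ione S u n) = ione S' u' n"
 "imap s (ione S' u' n) = ione S u n" "imap ch (ione S0 u0 n) = ione C0 w n" "imap k (ione C0 w n) = ione S' u' n"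
 by (simp_all add: imap_def ione_def rmap_mat_scalar hom_zeros units)

lemma rmap_inj:
 assumes "inj_on h (carrier Q)" "x : mats Q m n" "y : mats Q m n" "rmap h m n x = rmap h m n y" shows "x = y"
proof (rule mats_eqI[OF assms(2,3)])
 fix i l assume il: "i < m" "l < n"
 then have "h (x (i, l)) = h (y (i, l))" using fun_cong[OF assms(4), of "(i, l)"] by (simp add: rmap_app)
 then show "x (i, l) = y (i, l)" using assms(1-3) il by (auto dest!: inj_onD intro: matsD)
qed

lemma lift_mats:
 assumes "x : mats S m n" "c : mats C0 m n" "rmap \<pi> m n x = rmap k m n c"
 obtains y where "y : mats S0 m n" "rmap j m n y = x"
proof -
 have "x (i, l) : j ` carrier S0" if "i < m" "l < n" for i l
  using fun_cong[OF assms(3), of "(i, l)"] that assms(1,2)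
  by (intro j_image[of _ "c (i, l)"]) (auto simp: rmap_app intro: matsD)
 then have *: "\<exists>y. y : carrier S0 & j y = x (i, l)" if "i < m" "l < n" for i l
  using that by (metis imageE)
 define y where "y = restrict (%il. SOME z. z : carrier S0 & j z = x il) ({..<m} \<times> {..<n})"
 have y: "y (i, l) : carrier S0 & j (y (i, l)) = x (i, l)" if "i < m" "l < n" for i l
  using someI_ex[OF *[OF that]] that by (simp add: y_def)
 have ym: "y : mats S0 m n" using y unfolding y_def by (intro matsI) auto
 have "rmap j m n y = x"
  by (rule mats_eqI[of _ S m n _ S]) (use y assms(1) in \<open>auto simp: rmap_app intro!: rmap_mats[OF ym] nring_homD(2)[OF j]\<close>)
 with ym show thesis by (rule that)
qed

lemma \<pi>_rmap_s: "x : mats S' m n ==> rmap \<pi> m n (rmap s m n x) = x"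
 unfolding rmap_rmap by (rule rmap_ident) (auto simp: \<pi>s)

lemma \<pi>_rmap_j: "x : mats S0 m n ==> rmap \<pi> m n (rmap j m n x) = rmap k m n (rmap ch m n x)"
 unfolding rmap_rmap by (rule rmap_cong) (auto simp: \<pi>j)

text \<open>After stabilisation the idempotent is trivial over \<open>S\<close>, by \<open>x\<close>
  and \<open>y\<close>, and over \<open>C0\<close>, by \<open>\<alpha>\<close> and
  \<open>\<beta>\<close>. Over \<open>S'\<close> the two trivialisations differ by an invertible
  matrix, and the splitting lifts it together with its inverse. Correcting \<open>x\<close> and
  \<open>y\<close> by the lift makes their images in \<open>S'\<close> come from \<open>C0\<close>,
  so the corrected matrices come from \<open>S0\<close> and trivialise there.\<close>

lemma K0_split_injective:
 assumes X: "X : carrier (K0 S0)" and chX: "K0_map C0 ch X = \<one>\<^bsub>K0 C0\<^esub>" and jX: "K0_map S j X = \<one>\<^bsub>K0 S\<^esub>"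
 shows "X = \<one>\<^bsub>K0 S0\<^esub>"
proof -
 obtain p n where p: "p : idems S0" and Xp: "X = kcls S0 p (ione S0 u0 n)" using S0.K0_unit_cases[OF X] .
 have 1: "kcls C0 (imap ch p) (ione C0 w n) = \<one>\<^bsub>K0 C0\<^esub>"
  using chX by (simp add: Xp K0_map_kcls[OF hch] p S0.ione_idems imap_ione)
 have 2: "kcls S (imap j p) (ione S u n) = \<one>\<^bsub>K0 S\<^esub>"
  using jX by (simp add: Xp K0_map_kcls[OF hj] p S0.ione_idems imap_ione)
 obtain k1 where k1: "!!l. l \<ge> k1 ==> (bsum C0 (imap ch p) (ione C0 w l), ione C0 w (n + l)) : idem_equiv C0"
  using C0.kcls_oneD[OF imap_idems[OF hch p] 1] by blast
 obtain k2 where k2: "!!l. l \<ge> k2 ==> (bsum S (imap j p) (ione S u l), ione S u (n + l)) : idem_equiv S"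
  using S.kcls_oneD[OF imap_idems[OF hj p] 2] by blast
 \<comment> \<open>A common stabilisation for the equivalences over \<open>C0\<close> and over
   \<open>S\<close>.\<close>
 define l where "l = max k1 k2"
 define N where "N = n + l"
 define q where "q = bsum S0 p (ione S0 u0 l)"
 have q: "q : idems S0" by (simp add: q_def p S0.ione_idems S0.bsum_idems)
 have Xq: "X = kcls S0 q (ione S0 u0 N)" by (simp add: Xp q_def N_def S0.kcls_ione_stable p)
 obtain M e where qe: "q = (M, e)" by force
 have e: "e : mats S0 M M" "mx S0 M M M e e = e" using q by (auto simp: qe idems_def)
 have "(imap ch q, ione C0 w N) : idem_equiv C0"
  using k1[of l] by (simp add: q_def N_def imap_bsum[OF hch] p S0.ione_idems imap_ione l_def)
 then have "((M, rmap ch M M e), (N, mat_scalar C0 w N)) : idem_equiv C0" by (simp add: qe imap_def ione_def)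
 then obtain \<alpha> \<beta> where \<alpha>: "\<alpha> : mats C0 M N" and \<beta>: "\<beta> : mats C0 N M"
  and \<alpha>\<beta>: "mx C0 M N M \<alpha> \<beta> = rmap ch M M e" and \<beta>\<alpha>: "mx C0 N M N \<beta> \<alpha> = mat_scalar C0 w N"
  by (rule C0.idem_equivE)
 have "(imap j q, ione S u N) : idem_equiv S"
  using k2[of l] by (simp add: q_def N_def imap_bsum[OF hj] p S0.ione_idems imap_ione l_def)
 then have "((M, rmap j M M e), (N, mat_scalar S u N)) : idem_equiv S" by (simp add: qe imap_def ione_def)
 then obtain x y where x: "x : mats S M N" and y: "y : mats S N M"
  and xy: "mx S M N M x y = rmap j M M e" and yx: "mx S N M N y x = mat_scalar S u N"
  by (rule S.idem_equivE)
 let ?\<pi> = "rmap \<pi>" and ?s = "rmap s" and ?k = "rmap k" and ?j = "rmap j"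
 have m [simp]: "?\<pi> M N x : mats S' M N" "?\<pi> N M y : mats S' N M" "?k M N \<alpha> : mats S' M N" "?k N M \<beta> : mats S' N M"
  using x y \<alpha> \<beta> nring_homD(2)[OF \<pi>] nring_homD(2)[OF k] by (auto intro: rmap_mats)
 have sm: "?s a b z : mats S a b" if "z : mats S' a b" for a b z
  using that nring_homD(2)[OF s] by (auto intro: rmap_mats)
 define d where "d = ?k M M (rmap ch M M e)"
 have d1: "mx S' M N M (?\<pi> M N x) (?\<pi> N M y) = d"
  using rmap_mm[OF h\<pi> x y] by (simp add: xy \<pi>_rmap_j e d_def)
 have d2: "mx S' M N M (?k M N \<alpha>) (?k N M \<beta>) = d"
  using rmap_mm[OF hk \<alpha> \<beta>] by (simp add: \<alpha>\<beta> d_def)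
 have o1: "mx S' N M N (?\<pi> N M y) (?\<pi> M N x) = mat_scalar S' u' N"
  using rmap_mm[OF h\<pi> y x] by (simp add: yx rmap_mat_scalar hom_zeros units)
 have o2: "mx S' N M N (?k N M \<beta>) (?k M N \<alpha>) = mat_scalar S' u' N"
  using rmap_mm[OF hk \<beta> \<alpha>] by (simp add: \<beta>\<alpha> rmap_mat_scalar hom_zeros units)
 \<comment> \<open>The transition matrix between the two trivialisations over \<open>S'\<close>;
   \<open>h\<close> is its inverse.\<close>
 define g where "g = mx S' N M N (?\<pi> N M y) (?k M N \<alpha>)"
 define h where "h = mx S' N M N (?k N M \<beta>) (?\<pi> M N x)"
 have gm [simp]: "g : mats S' N N" "h : mats S' N N" by (auto simp: g_def h_def intro!: S'.mm_mats[of _ N M])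
 note A' = S'.mat_mult_assoc and A = S.mat_mult_assoc
 have gh: "mx S' N N N g h = mat_scalar S' u' N"
 proof -
  have "mx S' N N N g h = mx S' N M N (mx S' N M M (?\<pi> N M y) (mx S' M N M (?k M N \<alpha>) (?k N M \<beta>))) (?\<pi> M N x)"
   by (simp add: g_def h_def A' S'.mm_mats)
  also have "... = mx S' N N N (mx S' N M N (?\<pi> N M y) (?\<pi> M N x)) (mx S' N M N (?\<pi> N M y) (?\<pi> M N x))"
   unfolding d2 d1[symmetric] by (simp add: A' S'.mm_mats)
  finally show ?thesis by (simp add: o1 S'.mone_left S'.mone_mats)
 qed
 have hg: "mx S' N N N h g = mat_scalar S' u' N"
 proof -
  have "mx S' N N N h g = mx S' N M N (mx S' N M M (?k N M \<beta>) (mx S' M N M (?\<pi> M N x) (?\<pi> N M y))) (?k M N \<alpha>)"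
   by (simp add: g_def h_def A' S'.mm_mats)
  also have "... = mx S' N N N (mx S' N M N (?k N M \<beta>) (?k M N \<alpha>)) (mx S' N M N (?k N M \<beta>) (?k M N \<alpha>))"
   unfolding d1 d2[symmetric] by (simp add: A' S'.mm_mats)
  finally show ?thesis by (simp add: o2 S'.mone_left S'.mone_mats)
 qed
 have sgh: "mx S N N N (?s N N g) (?s N N h) = mat_scalar S u N" "mx S N N N (?s N N h) (?s N N g) = mat_scalar S u N"
  using rmap_mm[OF hs, of g N N h N] rmap_mm[OF hs, of h N N g N]
  by (simp_all add: gh hg rmap_mat_scalar hom_zeros units)
 \<comment> \<open>The image of \<open>x'\<close> in \<open>S'\<close> is
   \<open>x y \<alpha> = d \<alpha> = \<alpha>\<close>, and that of \<open>y'\<close> is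
   \<open>\<beta> x y = \<beta> d = \<beta>\<close>; both come from \<open>C0\<close>.\<close>
 define x' where "x' = mx S M N N x (?s N N g)"
 define y' where "y' = mx S N N M (?s N N h) y"
 have xm: "x' : mats S M N" "y' : mats S N M"
  by (auto simp: x'_def y'_def x y sm intro!: S.mm_mats[of _ _ N])
 have "?\<pi> M N x' = mx S' M N N (?\<pi> M N x) g" by (simp add: x'_def rmap_mm[OF h\<pi> x sm] \<pi>_rmap_s)
 also have "... = mx S' M M N d (?k M N \<alpha>)" by (simp add: g_def A'[symmetric] d1)
 also have "... = ?k M N \<alpha>" unfolding d2[symmetric] by (simp add: A' o2 S'.mone_right)
 finally obtain x0 where x0: "x0 : mats S0 M N" "?j M N x0 = x'" using lift_mats[OF xm(1) \<alpha>] by blast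
 have "?\<pi> N M y' = mx S' N N M h (?\<pi> N M y)" by (simp add: y'_def rmap_mm[OF h\<pi> sm y] \<pi>_rmap_s)
 also have "... = mx S' N M M (?k N M \<beta>) d" by (simp add: h_def A' d1)
 also have "... = ?k N M \<beta>" unfolding d2[symmetric] by (simp add: A'[symmetric] o2 S'.mone_left)
 finally obtain y0 where y0: "y0 : mats S0 N M" "?j N M y0 = y'" using lift_mats[OF xm(2) \<beta>] by blast
 have "mx S M N M x' y' = mx S M N M (mx S M N N x (mx S N N N (?s N N g) (?s N N h))) y"
  by (simp add: x'_def y'_def A x y sm S.mm_mats)
 then have "?j M M (mx S0 M N M x0 y0) = ?j M M e"
  by (simp add: rmap_mm[OF hj x0(1) y0(1)] x0 y0 sgh S.mone_right x xy)
 then have 3: "mx S0 M N M x0 y0 = e"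
  by (rule rmap_inj[OF j_inj, rotated 2]) (use x0 y0 e in \<open>auto intro: S0.mm_mats\<close>)
 have "mx S N M N y' x' = mx S N N N (?s N N h) (mx S N N N (mx S N M N y x) (?s N N g))"
  by (simp add: x'_def y'_def A x y sm S.mm_mats)
 then have "?j N N (mx S0 N M N y0 x0) = ?j N N (mat_scalar S0 u0 N)"
  by (simp add: rmap_mm[OF hj y0(1) x0(1)] x0 y0 sgh S.mone_left sm yx rmap_mat_scalar hom_zeros units)
 then have 4: "mx S0 N M N y0 x0 = mat_scalar S0 u0 N"
  by (rule rmap_inj[OF j_inj, rotated 2]) (use x0 y0 in \<open>auto intro: S0.mm_mats S0.mone_mats\<close>)
 have "(q, ione S0 u0 N) : idem_equiv S0" unfolding qe ione_def using q S0.ione_idems[of N] x0 y0 3 4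
  by (intro S0.idem_equivI[of _ _ _ _ x0 y0]) (auto simp: qe ione_def)
 then have "X = kcls S0 (ione S0 u0 N) (ione S0 u0 N)"
  unfolding Xq by (rule S0.kcls_cong) (auto intro: S0.idem_equiv_refl S0.ione_idems)
 then show ?thesis by (simp add: S0.kcls_self S0.ione_idems)
qed

text \<open>Over \<open>S'\<close> the idempotent \<open>e\<close> becomes equivalent to an identity
  matrix of size \<open>n\<close>, by \<open>x\<close> and \<open>y\<close>. The lifts of
  \<open>x\<close> and \<open>y\<close> along \<open>s\<close> do not fit \<open>e\<close> itself
  but only \<open>g = s (\<pi> e)\<close>. Completing them by \<open>c = 1 - g\<close> gives
  matrices that replace \<open>e\<close> by an equivalent idempotent \<open>f\<close> whose image in
  \<open>S'\<close> is the diagonal matrix with blocks \<open>1\<close> and \<open>0\<close>; such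
  an \<open>f\<close> comes from \<open>S0\<close>.\<close>

lemma K0_split_surjective:
 assumes X: "X : carrier (K0 S)" and \<pi>X: "K0_map S' \<pi> X = \<one>\<^bsub>K0 S'\<^esub>"
 shows "\<exists>Y\<in>carrier (K0 S0). K0_map C0 ch Y = \<one>\<^bsub>K0 C0\<^esub> & K0_map S j Y = X"
proof -
 obtain p n' where p: "p : idems S" and Xp: "X = kcls S p (ione S u n')" using S.K0_unit_cases[OF X] .
 have 1: "kcls S' (imap \<pi> p) (ione S' u' n') = \<one>\<^bsub>K0 S'\<^esub>"
  using \<pi>X by (simp add: Xp K0_map_kcls[OF h\<pi>] p S.ione_idems imap_ione)
 obtain l where l: "(bsum S' (imap \<pi> p) (ione S' u' l), ione S' u' (n' + l)) : idem_equiv S'"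
  using S'.kcls_oneD[OF imap_idems[OF h\<pi> p] 1] by blast
 define n where "n = n' + l"
 define q where "q = bsum S p (ione S u l)"
 have q: "q : idems S" by (simp add: q_def p S.ione_idems S.bsum_idems)
 have Xq: "X = kcls S q (ione S u n)" by (simp add: Xp q_def n_def S.kcls_ione_stable p)
 obtain m e where qe: "q = (m, e)" by force
 have e: "e : mats S m m" "mx S m m m e e = e" using q by (auto simp: qe idems_def)
 have "(imap \<pi> q, ione S' u' n) : idem_equiv S'"
  using l by (simp add: q_def n_def imap_bsum[OF h\<pi>] p S.ione_idems imap_ione)
 then have "((m, rmap \<pi> m m e), (n, mat_scalar S' u' n)) : idem_equiv S'" by (simp add: qe imap_def ione_def)
 then obtain x y where x: "x : mats S' m n" and y: "y : mats S' n m"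
  and xy: "mx S' m n m x y = rmap \<pi> m m e" and yx: "mx S' n m n y x = mat_scalar S' u' n"
  by (rule S'.idem_equivE)
 have sx: "rmap s m n x : mats S m n" and sy: "rmap s n m y : mats S n m"
  using x y nring_homD(2)[OF s] by (auto intro: rmap_mats)
 define g' where "g' = mx S' m n m x y"
 define g where "g = rmap s m m g'"
 have g'm: "g' : mats S' m m" using x y by (auto simp: g'_def intro: S'.mm_mats)
 have gm: "g : mats S m m" using g'm nring_homD(2)[OF s] by (auto simp: g_def intro: rmap_mats)
 have g: "g = mx S m n m (rmap s m n x) (rmap s n m y)" by (simp add: g_def g'_def rmap_mm[OF hs x y])
 have g'g': "mx S' m m m g' g' = g'" using rmap_mm[OF h\<pi> e(1) e(1)] by (simp add: g'_def xy e)
 then have gg: "mx S m m m g g = g" using rmap_mm[OF hs g'm g'm] by (simp add: g_def)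
 obtain c where c: "c : mats S m m" "mx S m m m c c = c" "mat_add S m m g c = mat_scalar S u m"
  "mx S m m m g c = mat_zero S m m" "mx S m m m c g = mat_zero S m m" using S.complement[OF gm gg] .
 \<comment> \<open>\<open>W V = g + c c = 1\<close>, so \<open>f = V e W\<close> is an idempotent
   equivalent to \<open>e\<close>, although \<open>V\<close> and \<open>W\<close> are not inverse to
   each other.\<close>
 define V where "V = col S n m m (rmap s n m y) c"
 define W where "W = row S m n m (rmap s m n x) c"
 have Vm: "V : mats S (n + m) m" and Wm: "W : mats S m (n + m)"
  using sx sy c by (auto simp: V_def W_def intro: S.col_mats S.row_mats)
 have WV: "mx S m (n + m) m W V = mat_scalar S u m"
  unfolding V_def W_def using sx sy c by (simp add: S.row_col g[symmetric])
 define f where "f = mx S (n + m) m (n + m) (mx S (n + m) m m V e) W"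
 have Ve: "mx S (n + m) m m V e : mats S (n + m) m" and eW: "mx S m m (n + m) e W : mats S m (n + m)"
  using Vm Wm e by (auto intro: S.mm_mats)
 have fm: "f : mats S (n + m) (n + m)" unfolding f_def using Ve Wm by (rule S.mm_mats)
 note A = S.mat_mult_assoc and A' = S'.mat_mult_assoc
 have ef: "mx S m (n + m) m (mx S m m (n + m) e W) (mx S (n + m) m m V e) = e"
 proof -
  have "mx S m (n + m) m (mx S m m (n + m) e W) (mx S (n + m) m m V e) =
   mx S m m m e (mx S m m m (mx S m (n + m) m W V) e)"
   using Vm Wm e Ve by (simp add: A S.mm_mats[of _ m "n + m" _ m])
  then show ?thesis using e by (simp add: WV S.mone_left)
 qed
 have fe: "mx S (n + m) m (n + m) (mx S (n + m) m m V e) (mx S m m (n + m) e W) = f"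
 proof -
  have "mx S (n + m) m (n + m) (mx S (n + m) m m V e) (mx S m m (n + m) e W) =
   mx S (n + m) m (n + m) (mx S (n + m) m m V (mx S m m m e e)) W"
   using Vm Wm e(1) by (simp add: A S.mm_mats[of _ _ m])
  then show ?thesis unfolding e(2) f_def .
 qed
 have "mx S (n + m) (n + m) (n + m) f f = mx S (n + m) m (n + m) (mx S (n + m) m m V e)
   (mx S m m (n + m) (mx S m (n + m) m (mx S m m (n + m) e W) (mx S (n + m) m m V e)) (mx S m m (n + m) e W))"
  unfolding fe[symmetric] using Ve eW by (simp add: A S.mm_mats[of _ "n + m" m] S.mm_mats[of _ m "n + m"])
 moreover have "mx S m m (n + m) e (mx S m m (n + m) e W) = mx S m m (n + m) e W"
  using Wm e by (simp add: A[symmetric])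
 ultimately have ff: "mx S (n + m) (n + m) (n + m) f f = f" by (simp only: ef fe)
 have fi: "(n + m, f) : idems S" using fm ff by (simp add: idems_def)
 have "(q, (n + m, f)) : idem_equiv S"
  unfolding qe using q fi eW Ve ef fe by (intro S.idem_equivI) (auto simp: qe)
 then have Xf: "X = kcls S (n + m, f) (ione S u n)"
  unfolding Xq by (rule S.kcls_cong) (auto intro: S.idem_equiv_refl S.ione_idems)
 have \<pi>e: "rmap \<pi> m m e = g'" by (simp add: g'_def xy)
 have \<pi>g: "rmap \<pi> m m g = g'" by (simp add: g_def \<pi>_rmap_s g'm)
 \<comment> \<open>Over \<open>S'\<close> both \<open>e\<close> and \<open>g\<close> become
   \<open>g' = x y\<close>, which annihilates \<open>c'\<close>. Of the blocks of
   \<open>V e W\<close> only \<open>y g' x = y x = 1\<close> survives.\<close>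
 define c' where "c' = rmap \<pi> m m c"
 have c'm: "c' : mats S' m m" using c nring_homD(2)[OF \<pi>] by (auto simp: c'_def intro: rmap_mats)
 have gc: "mx S' m m m g' c' = mat_zero S' m m" "mx S' m m m c' g' = mat_zero S' m m"
  using rmap_mm[OF h\<pi> gm c(1)] rmap_mm[OF h\<pi> c(1) gm]
  by (simp_all add: \<pi>g c'_def c rmap_mat_zero[of \<pi> S S'] hom_zeros)
 have \<pi>V: "rmap \<pi> (n + m) m V = col S' n m m y c'"
  using rmap_blk[of "rmap s n m y" S n m _ 0 c m _ \<pi> S'] sy c nring_homD(2)[OF \<pi>]
  by (simp add: V_def col_def S.mz_mats rmap_mat_zero[of \<pi> S S'] hom_zeros \<pi>_rmap_s y c'_def)
 have \<pi>W: "rmap \<pi> m (n + m) W = row S' m n m x c'"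
  using rmap_blk[of "rmap s m n x" S m n c m _ 0 _ \<pi> S'] sx c nring_homD(2)[OF \<pi>]
  by (simp add: W_def row_def S.mz_mats rmap_mat_zero[of \<pi> S S'] hom_zeros \<pi>_rmap_s x c'_def)
 have yg: "mx S' n m m y g' = y" unfolding g'_def using x y by (simp add: A'[symmetric] yx S'.mone_left)
 have gx: "mx S' m m n g' x = x" unfolding g'_def using x y by (simp add: A' yx S'.mone_right)
 have "rmap \<pi> (n + m) (n + m) f = mx S' (n + m) m (n + m) (mx S' (n + m) m m (col S' n m m y c') g') (mx S' m m (n + m) g' (row S' m n m x c'))"
  using rmap_mm[OF h\<pi> Ve eW] rmap_mm[OF h\<pi> Vm e(1)] rmap_mm[OF h\<pi> e(1) Wm]
  by (simp add: fe \<pi>V \<pi>W \<pi>e)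
 also have "... = blk n m n m (mat_scalar S' u' n) (mat_zero S' n m) (mat_zero S' m n) (mat_zero S' m m)"
  using x y c'm g'm S'.mz_mats
  by (simp add: S'.mat_mult_col S'.mat_mult_row yg gx gc S'.col_row yx S'.mat_mult_zero S'.mat_zero_mult)
 also have "... = rmap k (n + m) (n + m) (blk n m n m (mat_scalar C0 w n) (mat_zero C0 n m) (mat_zero C0 m n) (mat_zero C0 m m))"
  using nring_homD(2)[OF k] by (subst rmap_blk[of _ C0 _ _ _ _ _ _ _ _ S'])
   (simp_all add: C0.mone_mats C0.mz_mats rmap_mat_zero[of k C0 S'] rmap_mat_scalar[of k C0 S'] hom_zeros units)
 finally have \<pi>f: "rmap \<pi> (n + m) (n + m) f = rmap k (n + m) (n + m) (block_diag C0 n m (mat_scalar C0 w n) (mat_zero C0 m m))"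
  by (simp add: block_diag_blk)
 let ?D = "block_diag C0 n m (mat_scalar C0 w n) (mat_zero C0 m m)"
 have z: "(m, mat_zero C0 m m) : idems C0" by (simp add: idems_def C0.mz_mats C0.mat_mult_zero)
 have Dm: "?D : mats C0 (n + m) (n + m)" by (intro C0.block_diag_mats C0.mone_mats C0.mz_mats)
 obtain f0 where f0: "f0 : mats S0 (n + m) (n + m)" "rmap j (n + m) (n + m) f0 = f"
  using lift_mats[OF fm Dm \<pi>f] .
 have "rmap j (n + m) (n + m) (mx S0 (n + m) (n + m) (n + m) f0 f0) = rmap j (n + m) (n + m) f0"
  by (simp add: rmap_mm[OF hj f0(1) f0(1)] f0 ff)
 then have "mx S0 (n + m) (n + m) (n + m) f0 f0 = f0"
  by (rule rmap_inj[OF j_inj, rotated 2]) (use f0 in \<open>auto intro: S0.mm_mats\<close>)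
 then have f0i: "(n + m, f0) : idems S0" using f0 by (simp add: idems_def)
 have "rmap k (n + m) (n + m) (rmap ch (n + m) (n + m) f0) = rmap k (n + m) (n + m) ?D"
  using \<pi>_rmap_j[OF f0(1)] by (simp add: f0 \<pi>f)
 then have chf: "rmap ch (n + m) (n + m) f0 = ?D"
  by (rule rmap_inj[OF k_inj, rotated 2]) (use f0 Dm nring_homD(2)[OF ch] in \<open>auto intro: rmap_mats\<close>)
 define Y where "Y = kcls S0 (n + m, f0) (ione S0 u0 n)"
 \<comment> \<open>The zero block of size \<open>m\<close> counts for nothing, so the diagonal
   matrix has the class of the identity of size \<open>n\<close> and the difference vanishes over
   \<open>C0\<close>.\<close>
 have z0: "idem_class C0 (m, mat_zero C0 m m) = \<one>\<^bsub>idem_monoid C0\<^esub>"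
 proof -
  have "((m, mat_zero C0 m m), (0, %_. undefined)) : idem_equiv C0"
   by (rule C0.idem_equivI[of _ _ _ _ "mat_zero C0 m 0" "mat_zero C0 0 m"])
    (auto simp: z C0.idem_zero_idems C0.mz_mats C0.mat_mult_through_zero C0.mat_mult_zero, auto simp: mat_zero_def)
  then show ?thesis using z C0.idem_zero_idems by (simp add: idem_monoid_def C0.idem_class_eq_iff)
 qed
 interpret M: comm_monoid "idem_monoid C0" by (rule C0.idem_comm_monoid)
 have "kcls C0 (bsum C0 (ione C0 w n) (m, mat_zero C0 m m)) (ione C0 w n) = \<one>\<^bsub>K0 C0\<^esub>"
  using C0.cls_bsum[OF C0.ione_idems z, of n, symmetric] C0.kcls_self[OF C0.ione_idems, of n]
  by (simp add: kcls_def z0 C0.cls_carrier C0.ione_idems)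
 then have "K0_map C0 ch Y = \<one>\<^bsub>K0 C0\<^esub>"
  by (simp add: Y_def K0_map_kcls[OF hch] f0i S0.ione_idems imap_ione)
   (simp add: imap_def chf bsum_def ione_def)
 moreover have "K0_map S j Y = X"
  by (simp add: Y_def K0_map_kcls[OF hj] f0i S0.ione_idems imap_ione) (simp add: imap_def f0 Xf)
 moreover have "Y : carrier (K0 S0)" by (simp add: Y_def S0.kcls_carrier f0i S0.ione_idems)
 ultimately show ?thesis by blast
qed

end

section \<open>Locally convex algebras and continuous linear maps\<close>

text \<open>Kept apart from \<open>lca_hom\<close>: the retraction of a unitisation onto the algebra
  and sums of morphisms are in general continuous and linear but not multiplicative, and uniqueness
  by density concerns linear maps.\<close>

definition clin :: "'a lca => 'b lca => ('a => 'b) set" where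
 "clin A B = {f : hom (add_monoid A) (add_monoid B).
  (\<forall>c. \<forall>x\<in>carrier A. f (c \<odot>\<^sub>A x) = c \<odot>\<^sub>B f x) & continuous_map (topo A) (topo B) f}"

lemma lca_hom_iff: "f : lca_hom A B \<longleftrightarrow> f : clin A B &
  (\<forall>x\<in>carrier A. \<forall>y\<in>carrier A. f (x \<otimes>\<^sub>A y) = f x \<otimes>\<^sub>B f y)"
 by (auto simp: lca_hom_def clin_def hom_def)

lemma nring_hom_of: "f : lca_hom A B ==> f : nring_hom A B" by (auto simp: lca_hom_def nring_hom_def)

lemma clinD:
 assumes "f : clin A B"
 shows "f : hom (add_monoid A) (add_monoid B)" "x : carrier A ==> f x : carrier B"
  "[|x : carrier A; y : carrier A|] ==> f (x \<oplus>\<^sub>A y) = f x \<oplus>\<^sub>B f y"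
  "x : carrier A ==> f (c \<odot>\<^sub>A x) = c \<odot>\<^sub>B f x" "continuous_map (topo A) (topo B) f"
 using assms by (auto simp: clin_def hom_def)

lemma homD:
 assumes "f : lca_hom A B"
 shows "f : clin A B" "f : hom (add_monoid A) (add_monoid B)" "x : carrier A ==> f x : carrier B"
  "[|x : carrier A; y : carrier A|] ==> f (x \<oplus>\<^sub>A y) = f x \<oplus>\<^sub>B f y"
  "x : carrier A ==> f (c \<odot>\<^sub>A x) = c \<odot>\<^sub>B f x" "continuous_map (topo A) (topo B) f"
  "[|x : carrier A; y : carrier A|] ==> f (x \<otimes>\<^sub>A y) = f x \<otimes>\<^sub>B f y"
 using assms clinD by (auto simp: lca_hom_iff hom_def clin_def)

lemma clin_comp: "[|f : clin A B; g : clin B C|] ==> g \<circ> f : clin A C"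
 by (fastforce simp: clin_def hom_def Pi_iff intro: continuous_map_compose)

lemma hom_comp: "[|f : lca_hom A B; g : lca_hom B C|] ==> g \<circ> f : lca_hom A C"
 unfolding lca_hom_iff using clin_comp[of f A B g C] clinD(2)[of f A B] by auto

lemma clin_ident: "(%x. x) : clin A A" by (auto simp: clin_def hom_def)

lemma hom_ident: "(%x. x) : lca_hom A A" by (auto simp: lca_hom_iff clin_ident)

section \<open>Continuous seminorms and the topology they describe\<close>

lemma seminormD:
 assumes "seminorm A p" shows "x : carrier A ==> 0 <= p x"
  "[|x : carrier A; y : carrier A|] ==> p (x \<oplus>\<^sub>A y) <= p x + p y"
  "x : carrier A ==> p (c \<odot>\<^sub>A x) = cmod c * p x" using assms by (auto simp: seminorm_def)

lemma csD:
 assumes "p : CS A"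
 shows "seminorm A p" "continuous_map (topo A) euclideanreal p" "x : carrier A ==> 0 <= p x"
  "[|x : carrier A; y : carrier A|] ==> p (x \<oplus>\<^sub>A y) <= p x + p y"
  "x : carrier A ==> p (c \<odot>\<^sub>A x) = cmod c * p x"
 using assms seminormD by (auto simp: cont_seminorms_def)

lemma cs_add: "[|p : CS A; q : CS A|] ==> (%x. p x + q x) : CS A"
 unfolding cont_seminorms_def seminorm_def by (auto intro!: continuous_map_add simp: algebra_simps) (smt (verit))

lemma cs_zero: "(%x. 0) : CS A" by (auto simp: cont_seminorms_def seminorm_def)

lemma cs_scale: "[|p : CS A; 0 <= r|] ==> (%x. r * p x) : CS A" unfolding cont_seminorms_def seminorm_def
 by (auto intro!: continuous_map_real_mult_left simp: mult_left_mono simp flip: distrib_left)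

lemma cs_sum: "finite F ==> F \<subseteq> CS A ==> (%x. \<Sum>p\<in>F. p x) : CS A"
 by (induction F rule: finite_induct) (auto intro: cs_add cs_zero)

context locally_convex_algebra
begin

lemmas lca_axioms = locally_convex_algebra_axioms

lemma nring: "nring A"
proof -
 have "abelian_group A" ..
 then show ?thesis by (intro nring.intro nring_axioms.intro) (auto intro: m_closed m_assoc l_distr r_distr)
qed

sublocale N: nring A by (rule nring)

lemma sm_closed: "x : carrier A ==> c \<odot> x : carrier A"
 using smult_closed[of c x] by (simp add: complex_ring_def)

lemma sm_add_left: "x : carrier A ==> (c + d) \<odot> x = c \<odot> x \<oplus> d \<odot> x"
 using smult_l_distr[of c d x] by (simp add: complex_ring_def)

lemma sm_add_right: "[|x : carrier A; y : carrier A|] ==> c \<odot> (x \<oplus> y) = c \<odot> x \<oplus> c \<odot> y"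
 using smult_r_distr[of c x y] by (simp add: complex_ring_def)

lemma sm_assoc: "x : carrier A ==> (c * d) \<odot> x = c \<odot> (d \<odot> x)"
 using smult_assoc1[of c d x] by (simp add: complex_ring_def)

lemma sm_one: "x : carrier A ==> 1 \<odot> x = x" using smult_one[of x] by (simp add: complex_ring_def)

lemma sm_zero_left: "x : carrier A ==> 0 \<odot> x = \<zero>"
 using sm_add_left[of x 0 0] sm_closed[of x 0] M.add.l_cancel_one[of "0 \<odot> x" "0 \<odot> x"] by simp

lemma sm_zero_right: "c \<odot> \<zero> = \<zero>"
 using sm_add_right[of \<zero> \<zero> c] sm_closed[of \<zero> c] M.add.l_cancel_one[of "c \<odot> \<zero>" "c \<odot> \<zero>"] by simp

lemma sm_minus_one: "x : carrier A ==> (- 1) \<odot> x = \<ominus> x"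
 using sm_add_left[of x "-1" 1] sm_closed[of x "-1"] M.minus_equality[of "(-1) \<odot> x" x]
 by (simp add: sm_one sm_zero_left)

lemma sm_hom: "(%x. c \<odot> x) : hom (add_monoid A) (add_monoid A)"
 by (auto simp: hom_def sm_closed sm_add_right)

lemma sm_finsum: "[|finite I; !!i. i : I ==> f i : carrier A|] ==> c \<odot> (\<Oplus>i\<in>I. f i) = (\<Oplus>i\<in>I. c \<odot> f i)"
 by (rule add_hom_finsum[OF M.abelian_group_axioms M.abelian_group_axioms sm_hom])

lemma minus_sm: "[|x : carrier A; y : carrier A|] ==> c \<odot> (x \<ominus> y) = c \<odot> x \<ominus> c \<odot> y"
 by (rule add_hom_minus[OF M.abelian_group_axioms M.abelian_group_axioms sm_hom])

lemma sm_cancel: "[|x : carrier A; c ~= 0|] ==> c \<odot> (inverse c \<odot> x) = x"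
 by (simp add: sm_assoc[symmetric] sm_one)

lemma minus_split: "[|x : carrier A; y : carrier A; z : carrier A|] ==> x \<ominus> z = (x \<ominus> y) \<oplus> (y \<ominus> z)"
 by (simp add: a_minus_def M.a_assoc) (simp add: M.a_assoc[symmetric] M.l_neg)

lemma minus_minus_minus: "[|x : carrier A; y : carrier A|] ==> \<ominus> (x \<ominus> y) = y \<ominus> x"
 by (simp add: a_minus_def M.minus_add M.a_comm)

lemma add_diff_cancel: "[|x : carrier A; y : carrier A|] ==> (x \<ominus> y) \<oplus> y = x"
 by (simp add: a_minus_def M.a_assoc M.l_neg)

lemma add_minus_add: "[|x : carrier A; y : carrier A; x' : carrier A; y' : carrier A|] ==>
  (x \<oplus> y) \<ominus> (x' \<oplus> y') = (x \<ominus> x') \<oplus> (y \<ominus> y')"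
 by (simp add: a_minus_def M.minus_add M.a_ac)

lemma minus_zero: "x : carrier A ==> x \<ominus> \<zero> = x" by (simp add: a_minus_def)

lemma minus_eq_zero: "[|x : carrier A; y : carrier A; x \<ominus> y = \<zero>|] ==> x = y"
 using add_diff_cancel[of x y] by simp

lemma minus_self: "x : carrier A ==> x \<ominus> x = \<zero>" by (simp add: a_minus_def M.r_neg)

lemma cs_null: "p : CS A ==> p \<zero> = 0" using csD(5)[of p A \<zero> 0] sm_zero_left[of \<zero>] by simp

lemma cs_minus: "[|p : CS A; x : carrier A|] ==> p (\<ominus> x) = p x"
 using csD(5)[of p A x "-1"] by (simp add: sm_minus_one)

lemma cs_minus_commute: "[|p : CS A; x : carrier A; y : carrier A|] ==> p (x \<ominus> y) = p (y \<ominus> x)"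
 using cs_minus[of p "x \<ominus> y"] minus_minus_minus[of x y] by simp

lemma cs_triangle: "[|p : CS A; x : carrier A; y : carrier A; z : carrier A|]
  ==> p (x \<ominus> z) <= p (x \<ominus> y) + p (y \<ominus> z)"
 using csD(4)[of p A "x \<ominus> y" "y \<ominus> z"] minus_split[of x y z] by simp

lemma cs_finsum_le:
 assumes "p : CS A" "finite I" "!!i. i : I ==> f i : carrier A"
 shows "p (\<Oplus>i\<in>I. f i) <= (\<Sum>i\<in>I. p (f i))" using assms(2,3)
proof (induction I)
 case (insert i I)
 then have "p (f i \<oplus> (\<Oplus>i\<in>I. f i)) <= p (f i) + p (\<Oplus>i\<in>I. f i)"
  by (intro csD(4)[OF assms(1)]) auto
 with insert show ?case by (simp add: Pi_def)
qed (simp add: cs_null[OF assms(1)])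

lemma lc_generators:
 obtains \<Gamma> where "\<forall>p\<in>\<Gamma>. seminorm A p" "\<forall>U. openin (topo A) U \<longleftrightarrow> U \<subseteq> carrier A &
   (\<forall>x\<in>U. \<exists>F \<epsilon>. finite F & F \<subseteq> \<Gamma> & 0 < \<epsilon> & {y : carrier A. \<forall>p\<in>F. p (y \<ominus> x) < \<epsilon>} \<subseteq> U)"
 using lc unfolding locally_convex_def by (elim exE conjE) (rule that)

lemma topspace: "topspace (topo A) = carrier A"
proof -
 obtain \<Gamma> where "\<forall>p\<in>\<Gamma>. seminorm A p" and \<Gamma>': "\<forall>U. openin (topo A) U \<longleftrightarrow> U \<subseteq> carrier A &
   (\<forall>x\<in>U. \<exists>F \<epsilon>. finite F & F \<subseteq> \<Gamma> & 0 < \<epsilon> & {y : carrier A. \<forall>p\<in>F. p (y \<ominus> x) < \<epsilon>} \<subseteq> U)"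
  using lc_generators .
 note \<Gamma> = spec[OF \<Gamma>']
 have "openin (topo A) (carrier A)" unfolding \<Gamma> by (auto intro!: exI[of _ "{}"] exI[of _ "1::real"])
 moreover have "openin (topo A) (topspace (topo A))" by simp
 ultimately show ?thesis using \<Gamma>[of "topspace (topo A)"] openin_subset[of "topo A" "carrier A"] by blast
qed

text \<open>Replaces an unknown generating family by all continuous seminorms, which are closed
  under finite sums and positive multiples; a single seminorm with radius one then suffices for each
  neighbourhood.\<close>

lemma openin_iff:
 "openin (topo A) U \<longleftrightarrow> U \<subseteq> carrier A & (\<forall>x\<in>U. \<exists>p\<in>CS A. {y : carrier A. p (y \<ominus> x) < 1} \<subseteq> U)"
proof -
 obtain \<Gamma> where s: "\<forall>p\<in>\<Gamma>. seminorm A p" and \<Gamma>': "\<forall>U. openin (topo A) U \<longleftrightarrow> U \<subseteq> carrier A &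
   (\<forall>x\<in>U. \<exists>F \<epsilon>. finite F & F \<subseteq> \<Gamma> & 0 < \<epsilon> & {y : carrier A. \<forall>p\<in>F. p (y \<ominus> x) < \<epsilon>} \<subseteq> U)"
  using lc_generators .
 note \<Gamma> = spec[OF \<Gamma>']
 have cs: "p : CS A" if p: "p : \<Gamma>" for p
 proof -
  note sp = seminormD[OF s[rule_format, OF p]]
  have diff: "\<bar>p y - p x\<bar> <= p (y \<ominus> x)" if "x : carrier A" "y : carrier A" for x y
  proof -
   have "p (x \<ominus> y) = p (y \<ominus> x)"
    using sp(3)[of "y \<ominus> x" "-1"] that by (simp add: sm_minus_one minus_minus_minus)
   then show ?thesis
    using sp(2)[of "y \<ominus> x" x] sp(2)[of "x \<ominus> y" y] that by (simp add: add_diff_cancel)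
  qed
  have "openin (topo A) {x : topspace (topo A). p x : V}" if V: "open V" for V unfolding \<Gamma> topspace
  proof (intro conjI ballI)
   fix x assume x: "x : {x : carrier A. p x : V}"
   then obtain e where e: "e > 0" "!!r. \<bar>r - p x\<bar> < e ==> r : V"
    using V by (auto simp: open_dist dist_real_def)
   show "\<exists>F \<epsilon>. finite F & F \<subseteq> \<Gamma> & 0 < \<epsilon> & {y : carrier A. \<forall>p\<in>F. p (y \<ominus> x) < \<epsilon>} \<subseteq> {x : carrier A. p x : V}"
    using e p x diff by (intro exI[of _ "{p}"] exI[of _ e]) (auto, smt (verit))
  qed auto
  then show ?thesis using s p by (auto simp: cont_seminorms_def continuous_map topspace)
 qed
 show ?thesis
 proof (intro iffI conjI ballI)
  fix x assume U: "openin (topo A) U" and x: "x : U"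
  then obtain F \<epsilon> where F: "finite F" "F \<subseteq> \<Gamma>" "0 < \<epsilon>" "{y : carrier A. \<forall>p\<in>F. p (y \<ominus> x) < \<epsilon>} \<subseteq> U"
   unfolding \<Gamma> by blast
  have xc: "x : carrier A" using U x \<Gamma> by blast
  \<comment> \<open>The sum of the finitely many seminorms dominates each of them, and dividing by
    \<open>\<epsilon>\<close> normalises the radius.\<close>
  show "\<exists>p\<in>CS A. {y : carrier A. p (y \<ominus> x) < 1} \<subseteq> U"
  proof (rule bexI[of _ "%y. (1/\<epsilon>) * (\<Sum>p\<in>F. p y)", OF subset_trans[OF subsetI F(4)] cs_scale[OF cs_sum]])
   fix y assume y: "y : {y : carrier A. 1 / \<epsilon> * (\<Sum>p\<in>F. p (y \<ominus> x)) < 1}"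
   have "p (y \<ominus> x) <= (\<Sum>p\<in>F. p (y \<ominus> x))" if "p : F" for p
    using F that y xc cs by (intro member_le_sum) (auto intro!: csD(3)[of _ A])
   then show "y : {y : carrier A. \<forall>p\<in>F. p (y \<ominus> x) < \<epsilon>}" using y F(3) by (force simp: field_simps)
  qed (use F cs in auto)
 next
  assume R: "U \<subseteq> carrier A & (\<forall>x\<in>U. \<exists>p\<in>CS A. {y : carrier A. p (y \<ominus> x) < 1} \<subseteq> U)"
  show "openin (topo A) U" unfolding \<Gamma>
  proof (intro conjI ballI)
   fix x assume x: "x : U"
   then obtain p where p: "p : CS A" "{y : carrier A. p (y \<ominus> x) < 1} \<subseteq> U" using R by blast
   \<comment> \<open>Continuity of \<open>p\<close> is used at zero only; translation carries the
     basic neighbourhood found there to \<open>x\<close>.\<close>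
   have "openin (topo A) {y : topspace (topo A). p y : {..<1}}"
    using csD(2)[OF p(1)] openin_continuous_map_preimage[of "topo A" euclideanreal p "{..<1}"] by simp
   then obtain F \<epsilon> where F: "finite F" "F \<subseteq> \<Gamma>" "0 < \<epsilon>"
    "{y : carrier A. \<forall>p\<in>F. p (y \<ominus> \<zero>) < \<epsilon>} \<subseteq> {y : carrier A. p y < 1}"
    unfolding \<Gamma> topspace by (auto simp: cs_null[OF p(1)])
   show "\<exists>F \<epsilon>. finite F & F \<subseteq> \<Gamma> & 0 < \<epsilon> & {y : carrier A. \<forall>p\<in>F. p (y \<ominus> x) < \<epsilon>} \<subseteq> U"
   proof (intro exI conjI subset_trans[OF _ p(2)] subsetI)
    fix y assume y: "y : {y : carrier A. \<forall>p\<in>F. p (y \<ominus> x) < \<epsilon>}"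
    then have "y \<ominus> x : {y : carrier A. \<forall>p\<in>F. p (y \<ominus> \<zero>) < \<epsilon>}" using x R by (auto simp: minus_zero)
    with F(4) y show "y : {y : carrier A. p (y \<ominus> x) < 1}" by auto
   qed (use F in auto)
  qed (use R in blast)
 next
  show "openin (topo A) U ==> U \<subseteq> carrier A" using \<Gamma> by blast
 qed
qed

lemma openin_ball:
 assumes p: "p : CS A" and x: "x : carrier A"
 shows "openin (topo A) {y : carrier A. p (y \<ominus> x) < e}" unfolding openin_iff
proof (intro conjI ballI)
 fix y assume y: "y : {y : carrier A. p (y \<ominus> x) < e}"
 define d where "d = e - p (y \<ominus> x)"
 have d: "d > 0" using y by (simp add: d_def)
 have "p (z \<ominus> x) < e" if z: "z : carrier A" "(1/d) * p (z \<ominus> y) < 1" for z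
  using cs_triangle[OF p z(1) _ x, of y] z y d by (simp add: field_simps d_def)
 then show "\<exists>q\<in>CS A. {z : carrier A. q (z \<ominus> y) < 1} \<subseteq> {y : carrier A. p (y \<ominus> x) < e}"
  using d by (intro bexI[of _ "%z. (1/d) * p z", OF _ cs_scale[OF p]]) auto
qed auto

lemma hausdorff_cs:
 assumes x: "x : carrier A" and z: "!!p. p : CS A ==> p x = 0" shows "x = \<zero>"
proof (rule ccontr)
 assume "x ~= \<zero>"
 then obtain U V where UV: "openin (topo A) U" "openin (topo A) V" "\<zero> : U" "x : V" "disjnt U V"
  using hausdorff x unfolding Hausdorff_space_def topspace by (metis M.zero_closed)
 then obtain p where "p : CS A" "{y : carrier A. p (y \<ominus> \<zero>) < 1} \<subseteq> U"
  unfolding openin_iff by blast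
 then have "x : U" using x z[of p] by (auto simp: minus_zero)
 with UV show False by (auto simp: disjnt_def)
qed

lemma hausdorff_eq:
 assumes "x : carrier A" "y : carrier A" "!!p e. [|p : CS A; 0 < e|] ==> p (x \<ominus> y) <= e"
 shows "x = y"
proof (rule minus_eq_zero[OF assms(1,2)], rule hausdorff_cs)
 fix p assume p: "p : CS A"
 have "p (x \<ominus> y) <= 0"
 proof (rule field_le_epsilon)
  fix e :: real assume "0 < e"
  then show "p (x \<ominus> y) <= 0 + e" unfolding add_0 by (rule assms(3)[OF p])
 qed
 then show "p (x \<ominus> y) = 0" using csD(3)[OF p, of "x \<ominus> y"] assms by simp
qed (use assms in auto)

lemma dense_approx:
 assumes "topo A closure_of D = carrier A" "w : carrier A" "p : CS A" "0 < e"
 obtains v where "v : D" "v : carrier A" "p (w \<ominus> v) < e"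
proof -
 have "\<forall>T. w : T & openin (topo A) T \<longrightarrow> (\<exists>y. y : D & y : T)"
  using assms(1,2) in_closure_of[of w "topo A" D] by simp
 moreover have "w : {y : carrier A. p (y \<ominus> w) < e}" using assms by (simp add: minus_self cs_null)
 ultimately obtain v where "v : D" "v : {y : carrier A. p (y \<ominus> w) < e}"
  using openin_ball[OF assms(3,2), of e] by meson
 then have "v : carrier A" "p (w \<ominus> v) < e" using cs_minus_commute[OF assms(3), of w v] assms(2) by auto
 with \<open>v : D\<close> show thesis by (rule that)
qed

end

section \<open>Continuous linear maps and extension by density\<close>

lemma clin_bound:
 assumes "f : clin A B" "s : CS B" shows "(%x. s (f x)) : CS A"
 using clinD[OF assms(1)] csD[OF assms(2)] continuous_map_compose[of "topo A" "topo B" f euclideanreal s]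
 unfolding cont_seminorms_def seminorm_def by (auto simp: o_def)

lemma clinI:
 assumes A: "LCA A" and B: "LCA B"
  and f: "f : hom (add_monoid A) (add_monoid B)" and sm: "!!c x. x : carrier A ==> f (c \<odot>\<^sub>A x) = c \<odot>\<^sub>B f x"
  and bd: "!!s. s : CS B ==> \<exists>p\<in>CS A. \<forall>x\<in>carrier A. s (f x) <= p x"
 shows "f : clin A B"
proof -
 interpret A: locally_convex_algebra A by fact
 interpret B: locally_convex_algebra B by fact
 have cl: "f x : carrier B" if "x : carrier A" for x using f that by (auto simp: hom_def)
 have mi: "f (x \<ominus>\<^sub>A y) = f x \<ominus>\<^sub>B f y" if "x : carrier A" "y : carrier A" for x y
  by (rule add_hom_minus[OF A.M.abelian_group_axioms B.M.abelian_group_axioms f that])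
 have "openin (topo A) {x : carrier A. f x : U}" if U: "openin (topo B) U" for U unfolding A.openin_iff
 proof (intro conjI ballI)
  fix x assume x: "x : {x : carrier A. f x : U}"
  then obtain s where s: "s : CS B" "{y : carrier B. s (y \<ominus>\<^sub>B f x) < 1} \<subseteq> U"
   using U unfolding B.openin_iff by blast
  obtain p where p: "p : CS A" "\<forall>x\<in>carrier A. s (f x) <= p x" using bd[OF s(1)] by blast
  have "f y : U" if "y : carrier A" "p (y \<ominus>\<^sub>A x) < 1" for y
   using p(2)[rule_format, of "y \<ominus>\<^sub>A x"] that x s(2) by (auto simp: mi cl)
  then show "\<exists>p\<in>CS A. {y : carrier A. p (y \<ominus>\<^sub>A x) < 1} \<subseteq> {x : carrier A. f x : U}"
   using p(1) by (intro bexI[of _ p]) auto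
 qed auto
 then have "continuous_map (topo A) (topo B) f" by (auto simp: continuous_map A.topspace B.topspace cl)
 with f sm show ?thesis by (simp add: clin_def)
qed

lemma clin_add:
 assumes A: "LCA A" and V: "LCA V" and f: "f : clin A V" and g: "g : clin A V"
 shows "(%x. f x \<oplus>\<^sub>V g x) : clin A V"
proof (rule clinI[OF A V])
 interpret V: locally_convex_algebra V by fact
 note fD = clinD[OF f] and gD = clinD[OF g]
 show "(%x. f x \<oplus>\<^sub>V g x) : hom (add_monoid A) (add_monoid V)"
  using fD(2,3) gD(2,3) by (auto simp: hom_def V.M.a_ac)
 show "f (c \<odot>\<^sub>A x) \<oplus>\<^sub>V g (c \<odot>\<^sub>A x) = c \<odot>\<^sub>V (f x \<oplus>\<^sub>V g x)" if "x : carrier A" for c x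
  using that fD(2,4) gD(2,4) by (simp add: V.sm_add_right)
 fix s assume s: "s : CS V"
 show "\<exists>p\<in>CS A. \<forall>x\<in>carrier A. s (f x \<oplus>\<^sub>V g x) <= p x"
  using cs_add[OF clin_bound[OF f s] clin_bound[OF g s]] csD(4)[OF s] fD(2) gD(2)
  by (intro bexI[of _ "%x. s (f x) + s (g x)"]) auto
qed

lemma zero_clin:
 assumes "LCA A" "LCA V" shows "(%_. \<zero>\<^sub>V) : clin A V"
proof -
 interpret V: locally_convex_algebra V by fact
 show ?thesis by (rule clinI[OF assms]) (auto simp: hom_def V.sm_zero_right V.cs_null intro: cs_zero)
qed

lemma clin_zero:
 assumes "LCA A" "LCA B" "f : clin A B" shows "f \<zero>\<^sub>A = \<zero>\<^sub>B"
proof -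
 interpret A: locally_convex_algebra A by fact
 interpret B: locally_convex_algebra B by fact
 show ?thesis by (rule add_hom_zero[OF A.M.abelian_group_axioms B.M.abelian_group_axioms clinD(1)[OF assms(3)]])
qed

lemma clin_minus:
 assumes "LCA A" "LCA B" "f : clin A B" "x : carrier A" "y : carrier A"
 shows "f (x \<ominus>\<^sub>A y) = f x \<ominus>\<^sub>B f y"
proof -
 interpret A: locally_convex_algebra A by fact
 interpret B: locally_convex_algebra B by fact
 show ?thesis by (rule add_hom_minus[OF A.M.abelian_group_axioms B.M.abelian_group_axioms clinD(1)[OF assms(3)] assms(4,5)])
qed

lemma clin_eq_dense:
 assumes A: "LCA A" and B: "LCA B" and f: "f : clin A B" and g: "g : clin A B"
  and D: "topo A closure_of D = carrier A" and eq: "!!x. [|x : D; x : carrier A|] ==> f x = g x" and w: "w : carrier A"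
 shows "f w = g w"
proof -
 interpret A: locally_convex_algebra A by fact
 interpret B: locally_convex_algebra B by fact
 note [simp] = clinD(2)[OF f] clinD(2)[OF g] w
 show ?thesis
 proof (rule B.hausdorff_eq)
  fix s and e :: real assume s: "s : CS B" and e: "0 < e"
  \<comment> \<open>One seminorm controls both maps, so a single approximation \<open>v\<close>
    serves for both.\<close>
  have p: "(%x. s (f x) + s (g x)) : CS A" using clin_bound[OF f s] clin_bound[OF g s] by (rule cs_add)
  obtain v where v: "v : D" "v : carrier A" "s (f (w \<ominus>\<^sub>A v)) + s (g (w \<ominus>\<^sub>A v)) < e"
   using A.dense_approx[OF D w p e] .
  have "s (f w \<ominus>\<^sub>B g w) <= s (f w \<ominus>\<^sub>B f v) + s (f v \<ominus>\<^sub>B g w)"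
   using v by (intro B.cs_triangle[OF s]) simp_all
  also have "s (f v \<ominus>\<^sub>B g w) = s (g w \<ominus>\<^sub>B g v)"
   using v by (simp add: eq B.cs_minus_commute[OF s])
  finally show "s (f w \<ominus>\<^sub>B g w) <= e" using v by (simp add: clin_minus[OF A B f] clin_minus[OF A B g])
 qed simp_all
qed

text \<open>Extension by continuity, with the value at \<open>w\<close> described by a relation
  instead of a limit of nets: the value is the point approached by \<open>h v\<close> as
  \<open>v\<close> approaches \<open>w\<close>. The bounds make it unique in a Hausdorff space, and
  completeness provides it.\<close>

lemma clin_extension:
 assumes A: "LCA A" and V: "LCA V"
  and D: "topo A closure_of D = carrier A" and Dc: "D \<subseteq> carrier A"
  and Dadd: "!!x y. [|x : D; y : D|] ==> x \<oplus>\<^sub>A y : D" and Dsm: "!!c x. x : D ==> c \<odot>\<^sub>A x : D"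
  and hcl: "!!x. x : D ==> h x : carrier V"
  and hadd: "!!x y. [|x : D; y : D|] ==> h (x \<oplus>\<^sub>A y) = h x \<oplus>\<^sub>V h y"
  and hsm: "!!c x. x : D ==> h (c \<odot>\<^sub>A x) = c \<odot>\<^sub>V h x"
  and bd: "!!s. s : CS V ==> \<exists>p\<in>CS A. \<forall>x\<in>D. s (h x) <= p x"
 obtains f where "f : clin A V" "!!x. x : D ==> f x = h x"
proof -
 interpret A: locally_convex_algebra A by fact
 interpret V: locally_convex_algebra V by fact
 have Dmin: "x \<ominus>\<^sub>A y : D & h (x \<ominus>\<^sub>A y) = h x \<ominus>\<^sub>V h y" if "x : D" "y : D" for x y
 proof -
  have "\<ominus>\<^sub>A y = (-1) \<odot>\<^sub>A y" "\<ominus>\<^sub>V h y = (-1) \<odot>\<^sub>V h y"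
   using that Dc by (auto simp: A.sm_minus_one V.sm_minus_one hcl)
  then show ?thesis unfolding a_minus_def using that by (simp add: Dadd Dsm hadd hsm)
 qed
 note [simp] = hcl A.sm_closed V.sm_closed
 have [simp]: "x : carrier A" if "x : D" for x using Dc that by blast
 define B where "B s p \<longleftrightarrow> s : CS V & p : CS A & (\<forall>x\<in>D. s (h x) <= p x)" for s p
 \<comment> \<open>Approximation is required for every pair of seminorms at once, without a bound
   linking \<open>s\<close> and \<open>p\<close>; this is what lets the relation be added and
   scaled.\<close>
 define G where "G w x \<longleftrightarrow> x : carrier V & (\<forall>s\<in>CS V. \<forall>p\<in>CS A. \<forall>e>0. \<exists>v\<in>D. p (v \<ominus>\<^sub>A w) < e & s (h v \<ominus>\<^sub>V x) < e)" for w x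
 have GD: "\<exists>v\<in>D. p (v \<ominus>\<^sub>A w) < e & s (h v \<ominus>\<^sub>V x) < e" if "G w x" "B s p" "e > 0" for w x s p e
  using that by (auto simp: G_def B_def)
 have Bex: "\<exists>p. B s p" if "s : CS V" for s using bd[OF that] that by (auto simp: B_def)
 have Bh: "s (h u \<ominus>\<^sub>V h v) <= p (u \<ominus>\<^sub>A w) + p (v \<ominus>\<^sub>A w)" if "B s p" "u : D" "v : D" "w : carrier A" for s p u v w
 proof -
  have p: "p : CS A" "s (h (u \<ominus>\<^sub>A v)) <= p (u \<ominus>\<^sub>A v)" using that(1) Dmin[OF that(2,3)] unfolding B_def by blast+
  then show ?thesis using A.cs_triangle[OF p(1), of u w v] A.cs_minus_commute[OF p(1), of w v] Dmin that by simp
 qed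
 have Gh: "G v (h v)" if "v : D" for v using that unfolding G_def
  by (intro conjI ballI allI impI bexI[of _ v]) (auto simp: A.minus_self V.minus_self A.cs_null V.cs_null)
 have G_unique: "x = y" if wxy: "w : carrier A" "G w x" "G w y" for w x y
 proof (rule V.hausdorff_eq)
  show xy: "x : carrier V" "y : carrier V" using wxy by (auto simp: G_def)
  fix s and e :: real assume s: "s : CS V" "0 < e"
  obtain p where p: "B s p" using Bex[OF s(1)] by blast
  obtain u v where uv: "u : D" "p (u \<ominus>\<^sub>A w) < e/4" "s (h u \<ominus>\<^sub>V x) < e/4" "v : D" "p (v \<ominus>\<^sub>A w) < e/4" "s (h v \<ominus>\<^sub>V y) < e/4"
   using GD[OF wxy(2) p, of "e/4"] GD[OF wxy(3) p, of "e/4"] s(2) by auto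
  have "s (x \<ominus>\<^sub>V y) <= s (x \<ominus>\<^sub>V h u) + (s (h u \<ominus>\<^sub>V h v) + s (h v \<ominus>\<^sub>V y))"
   using V.cs_triangle[OF s(1), of x "h u" y] V.cs_triangle[OF s(1), of "h u" "h v" y] uv xy by simp
  also have "s (x \<ominus>\<^sub>V h u) = s (h u \<ominus>\<^sub>V x)" using uv xy by (intro V.cs_minus_commute[OF s(1)]) auto
  finally show "s (x \<ominus>\<^sub>V y) <= e" using Bh[OF p uv(1,4) wxy(1)] uv by simp
 qed
 have G_exists: "\<exists>x. G w x" if w: "w : carrier A" for w
 proof -
  \<comment> \<open>The trace on \<open>D\<close> of the neighbourhood filter of \<open>w\<close>.
    Density makes it proper, and by \<open>Bh\<close> its image under \<open>h\<close> is
    Cauchy.\<close>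
  define N where "N = inf (nhdsin (topo A) w) (principal D)"
  have ev: "eventually P N \<longleftrightarrow> (\<exists>U. openin (topo A) U & w : U & (\<forall>v\<in>U \<inter> D. P v))" for P
   using w unfolding N_def eventually_inf_principal by (auto simp: eventually_nhdsin A.topspace)
  have evp: "eventually (%v. v : D & p (v \<ominus>\<^sub>A w) < e) N" if "p : CS A" "0 < e" for p e
   unfolding ev using that w
   by (intro exI[of _ "{v : carrier A. p (v \<ominus>\<^sub>A w) < e}"] conjI A.openin_ball) (auto simp: A.minus_self A.cs_null)
  have "\<exists>v. v : U \<inter> D" if "openin (topo A) U" "w : U" for U
   using that w D unfolding set_eq_iff in_closure_of by blast
  then have "\<not> eventually (%v. False) N" unfolding ev by blast
  then have Nbot: "N ~= bot" by auto
  have "cauchy_filter_on V (filtermap h N)" unfolding cauchy_filter_on_def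
  proof (intro conjI allI impI)
   show "filtermap h N ~= bot" using Nbot by (simp add: filtermap_bot_iff)
   show "filtermap h N <= principal (carrier V)"
    unfolding le_principal eventually_filtermap by (rule eventually_mono[OF evp[OF cs_zero, of 1]]) auto
   fix U assume "openin (topo V) U & \<zero>\<^sub>V : U"
   then obtain s where s: "s : CS V" "{y : carrier V. s (y \<ominus>\<^sub>V \<zero>\<^sub>V) < 1} \<subseteq> U"
    unfolding V.openin_iff by blast
   obtain p where p: "B s p" using Bex[OF s(1)] by blast
   let ?P = "%x. \<exists>v\<in>D. x = h v & p (v \<ominus>\<^sub>A w) < 1/2"
   have "p : CS A" using p by (simp add: B_def)
   then have P: "eventually ?P (filtermap h N)"
    unfolding eventually_filtermap by (rule eventually_mono[OF evp[of p "1/2"]]) auto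
   show "\<forall>\<^sub>F (x, y) in filtermap h N \<times>\<^sub>F filtermap h N. x \<ominus>\<^sub>V y : U"
    unfolding eventually_prod_filter
   proof (rule exI[of _ ?P], rule exI[of _ ?P], intro conjI P allI impI)
    fix x y assume "?P x" "?P y"
    then obtain v v' where v: "v : D" "x = h v" "p (v \<ominus>\<^sub>A w) < 1/2" "v' : D" "y = h v'" "p (v' \<ominus>\<^sub>A w) < 1/2" by blast
    then have "s (x \<ominus>\<^sub>V y) < 1" using Bh[OF p v(1,4) w] by simp
    then show "case (x, y) of (x, y) => x \<ominus>\<^sub>V y : U" using s(2) v by (auto simp: V.minus_zero)
   qed
  qed
  then obtain x where lim: "limitin (topo V) (%y. y) x (filtermap h N)" using V.complete by blast
  then have x: "x : carrier V" by (auto simp: limitin_def V.topspace)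
  have "\<exists>v\<in>D. p (v \<ominus>\<^sub>A w) < e & s (h v \<ominus>\<^sub>V x) < e" if s: "s : CS V" and p: "p : CS A" and e: "e > 0" for s p e
  proof -
   have "eventually (%y. y : {y : carrier V. s (y \<ominus>\<^sub>V x) < e}) (filtermap h N)"
    using lim V.openin_ball[OF s x, of e] x e by (auto simp: limitin_def V.minus_self V.cs_null[OF s])
   then have "eventually (%v. s (h v \<ominus>\<^sub>V x) < e) N" by (simp add: eventually_filtermap eventually_conj_iff)
   then have "eventually (%v. s (h v \<ominus>\<^sub>V x) < e & v : D & p (v \<ominus>\<^sub>A w) < e) N"
    using evp[OF p e] by (auto intro: eventually_conj)
   then show ?thesis using eventually_happens Nbot by blast
  qed
  then show ?thesis using x unfolding G_def by blast
 qed
 define f where "f w = (THE x. G w x)" for w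
 have fG: "G w (f w)" if "w : carrier A" for w
  unfolding f_def using G_exists[OF that] G_unique[OF that] by (metis theI)
 have fI: "f w = x" if "w : carrier A" "G w x" for w x using G_unique[OF that(1) fG[OF that(1)] that(2)] .
 have fcl: "f w : carrier V" if "w : carrier A" for w using fG[OF that] by (simp add: G_def)
 have fadd: "f (w \<oplus>\<^sub>A w') = f w \<oplus>\<^sub>V f w'" if w: "w : carrier A" "w' : carrier A" for w w'
 proof (rule fI, simp add: w, unfold G_def, intro conjI ballI allI impI)
  fix s p and e :: real assume sp: "s : CS V" "p : CS A" and e: "0 < e"
  have G2: "\<exists>v\<in>D. p (v \<ominus>\<^sub>A w) < e/2 & s (h v \<ominus>\<^sub>V f w) < e/2" if "w : carrier A" for w
   using fG[OF that] sp e unfolding G_def by (meson half_gt_zero)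
  obtain u v where uv: "u : D" "p (u \<ominus>\<^sub>A w) < e/2" "s (h u \<ominus>\<^sub>V f w) < e/2" "v : D" "p (v \<ominus>\<^sub>A w') < e/2" "s (h v \<ominus>\<^sub>V f w') < e/2"
   using G2[OF w(1)] G2[OF w(2)] by blast
  have "p ((u \<oplus>\<^sub>A v) \<ominus>\<^sub>A (w \<oplus>\<^sub>A w')) < e"
   using csD(4)[OF sp(2), of "u \<ominus>\<^sub>A w" "v \<ominus>\<^sub>A w'"] uv w by (simp add: A.add_minus_add)
  moreover have "s ((h u \<oplus>\<^sub>V h v) \<ominus>\<^sub>V (f w \<oplus>\<^sub>V f w')) < e"
   using csD(4)[OF sp(1), of "h u \<ominus>\<^sub>V f w" "h v \<ominus>\<^sub>V f w'"] uv w fcl by (simp add: V.add_minus_add)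
  ultimately show "\<exists>v\<in>D. p (v \<ominus>\<^sub>A (w \<oplus>\<^sub>A w')) < e & s (h v \<ominus>\<^sub>V (f w \<oplus>\<^sub>V f w')) < e"
   using uv by (intro bexI[of _ "u \<oplus>\<^sub>A v"]) (auto simp: hadd Dadd)
 qed (use w fcl in auto)
 have fsm: "f (c \<odot>\<^sub>A w) = c \<odot>\<^sub>V f w" if w: "w : carrier A" for w c
 proof (rule fI, simp add: w, unfold G_def, intro conjI ballI allI impI)
  fix s p and e :: real assume sp: "s : CS V" "p : CS A" and e: "0 < e"
  \<comment> \<open>The added one covers \<open>c = 0\<close>.\<close>
  have "0 < e / (cmod c + 1)" using e by (simp add: add_nonneg_pos)
  then obtain v where v: "v : D" "p (v \<ominus>\<^sub>A w) < e / (cmod c + 1)" "s (h v \<ominus>\<^sub>V f w) < e / (cmod c + 1)"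
   using fG[OF w] sp unfolding G_def by blast
  have lt: "cmod c * r < e" if "0 <= r" "r < e / (cmod c + 1)" for r
  proof -
   have "cmod c * r <= (cmod c + 1) * r" using that by (intro mult_right_mono) auto
   also have "... < e" using that by (simp add: pos_less_divide_eq add_nonneg_pos mult.commute)
   finally show ?thesis .
  qed
  show "\<exists>v\<in>D. p (v \<ominus>\<^sub>A c \<odot>\<^sub>A w) < e & s (h v \<ominus>\<^sub>V c \<odot>\<^sub>V f w) < e"
   using v w fcl lt csD(3)[OF sp(1), of "h v \<ominus>\<^sub>V f w"] csD(3)[OF sp(2), of "v \<ominus>\<^sub>A w"]
   by (intro bexI[of _ "c \<odot>\<^sub>A v"]) (auto simp: Dsm hsm A.minus_sm[symmetric] V.minus_sm[symmetric] csD(5)[OF sp(1)] csD(5)[OF sp(2)])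
 qed (use w fcl in auto)
 have "f : clin A V"
 proof (rule clinI[OF A V])
  show "f : hom (add_monoid A) (add_monoid V)" by (auto simp: hom_def fcl fadd)
  fix s assume s: "s : CS V"
  obtain p where p: "B s p" using Bex[OF s] by blast
  then have pc: "p : CS A" by (simp add: B_def)
  have "s (f w) <= p w" if w: "w : carrier A" for w
  proof (rule field_le_epsilon)
   fix e :: real assume e: "0 < e"
   obtain v where v: "v : D" "p (v \<ominus>\<^sub>A w) < e/2" "s (h v \<ominus>\<^sub>V f w) < e/2" using GD[OF fG[OF w] p, of "e/2"] e by auto
   have "s (f w) <= s (f w \<ominus>\<^sub>V h v) + s (h v)" "p v <= p (v \<ominus>\<^sub>A w) + p w"
    using csD(4)[OF s, of "f w \<ominus>\<^sub>V h v" "h v"] csD(4)[OF pc, of "v \<ominus>\<^sub>A w" w] v w fcl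
    by (simp_all add: A.add_diff_cancel V.add_diff_cancel)
   moreover have "s (f w \<ominus>\<^sub>V h v) = s (h v \<ominus>\<^sub>V f w)" using v w fcl by (intro V.cs_minus_commute[OF s]) auto
   moreover have "s (h v) <= p v" using p v by (simp add: B_def)
   ultimately show "s (f w) <= p w + e" using v by simp
  qed
  then show "\<exists>p\<in>CS A. \<forall>x\<in>carrier A. s (f x) <= p x" using pc by blast
 qed (rule fsm)
 then show thesis by (rule that) (auto intro: fI Gh)
qed

section \<open>The completed projective tensor product\<close>

lemma bilD:
 assumes "bilinear_on A B V \<gamma>"
 shows "[|a : carrier A; b : carrier B|] ==> \<gamma> a b : carrier V"
  "[|a : carrier A; a' : carrier A; b : carrier B|] ==> \<gamma> (a \<oplus>\<^sub>A a') b = \<gamma> a b \<oplus>\<^sub>V \<gamma> a' b"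
  "[|a : carrier A; b : carrier B; b' : carrier B|] ==> \<gamma> a (b \<oplus>\<^sub>B b') = \<gamma> a b \<oplus>\<^sub>V \<gamma> a b'"
  "[|a : carrier A; b : carrier B|] ==> \<gamma> (c \<odot>\<^sub>A a) b = c \<odot>\<^sub>V \<gamma> a b"
  "[|a : carrier A; b : carrier B|] ==> \<gamma> a (c \<odot>\<^sub>B b) = c \<odot>\<^sub>V \<gamma> a b"
 using assms by (auto simp: bilinear_on_def)

text \<open>Joint continuity of a bilinear map in terms of seminorms; one seminorm on each factor
  suffices because continuous seminorms may be added.\<close>

definition bdd_bil_on :: "'a lca => 'b lca => 'c lca => ('a => 'b => 'c) => bool" where
 "bdd_bil_on A B V \<beta> \<longleftrightarrow> bilinear_on A B V \<beta> &
  (\<forall>s\<in>CS V. \<exists>p\<in>CS A. \<exists>q\<in>CS B.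
   \<forall>a\<in>carrier A. \<forall>b\<in>carrier B. s (\<beta> a b) <= p a * q b)"

locale bilinear_lca = A: locally_convex_algebra A + B: locally_convex_algebra B + V: locally_convex_algebra V
 for A :: "'a lca" and B :: "'b lca" and V :: "'c lca" +
 fixes \<gamma> assumes bilinear: "bilinear_on A B V \<gamma>"
begin

lemmas closed = bilD(1)[OF bilinear]

lemma hom_left: "b : carrier B ==> (%a. \<gamma> a b) : hom (add_monoid A) (add_monoid V)"
 using bilD(1,2)[OF bilinear] by (auto simp: hom_def)

lemma hom_right: "a : carrier A ==> \<gamma> a : hom (add_monoid B) (add_monoid V)"
 using bilD(1,3)[OF bilinear] by (auto simp: hom_def)

lemma finsum_left: "[|finite I; b : carrier B; !!i. i : I ==> f i : carrier A|] ==>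
  \<gamma> (\<Oplus>\<^sub>A i\<in>I. f i) b = (\<Oplus>\<^sub>V i\<in>I. \<gamma> (f i) b)"
 using add_hom_finsum[OF A.M.abelian_group_axioms V.M.abelian_group_axioms hom_left, of b I f] by simp

lemma null_right: "a : carrier A ==> \<gamma> a \<zero>\<^sub>B = \<zero>\<^sub>V"
 using add_hom_zero[OF B.M.abelian_group_axioms V.M.abelian_group_axioms hom_right] by simp

text \<open>A first factor that depends linearly on the others is removed by redistributing its
  second factor. The new second factors are the same for every bilinear map, so relations can be
  transferred from one bilinear map to another.\<close>

lemma eliminate:
 assumes I: "finite I" "k : I" and a: "!!i. i : I ==> a i : carrier A" and b: "!!i. i : I ==> b i : carrier B"
  and ak: "a k = (\<Oplus>\<^sub>A i\<in>I - {k}. d i \<odot>\<^sub>A a i)"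
 shows "(\<Oplus>\<^sub>V i\<in>I. \<gamma> (a i) (b i)) = (\<Oplus>\<^sub>V i\<in>I - {k}. \<gamma> (a i) (b i \<oplus>\<^sub>B d i \<odot>\<^sub>B b k))"
proof -
 have "(\<Oplus>\<^sub>V i\<in>I - {k}. \<gamma> (a i) (b i \<oplus>\<^sub>B d i \<odot>\<^sub>B b k)) =
   (\<Oplus>\<^sub>V i\<in>I - {k}. \<gamma> (a i) (b i) \<oplus>\<^sub>V \<gamma> (d i \<odot>\<^sub>A a i) (b k))"
  using a b I by (intro finsum_congr) (auto simp: bilD[OF bilinear] B.sm_closed)
 also have "... = (\<Oplus>\<^sub>V i\<in>I - {k}. \<gamma> (a i) (b i)) \<oplus>\<^sub>V (\<Oplus>\<^sub>V i\<in>I - {k}. \<gamma> (d i \<odot>\<^sub>A a i) (b k))"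
  using a b I by (intro V.M.finsum_addf) (auto intro!: closed A.sm_closed)
 also have "(\<Oplus>\<^sub>V i\<in>I - {k}. \<gamma> (d i \<odot>\<^sub>A a i) (b k)) = \<gamma> (a k) (b k)"
  unfolding ak using a b I by (intro finsum_left[symmetric]) (auto intro: A.sm_closed)
 also have "(\<Oplus>\<^sub>V i\<in>I - {k}. \<gamma> (a i) (b i)) \<oplus>\<^sub>V \<gamma> (a k) (b k) = (\<Oplus>\<^sub>V i\<in>insert k (I - {k}). \<gamma> (a i) (b i))"
  using a b I by (subst V.M.finsum_insert) (auto intro!: closed V.M.finsum_closed V.M.a_comm)
 finally show ?thesis using I by (simp add: insert_absorb)
qed

end

definition app_fun :: "nat => (nat => 'a) => (nat => 'a) => nat => 'a" where
 "app_fun n f g i = (if i < n then f i else g (i - n))"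

lemma app_fun_Pi: "[|f : {..<n} \<rightarrow> S; g : {..<m} \<rightarrow> S|] ==> app_fun n f g : {..<n + m} \<rightarrow> S"
 by (auto simp: app_fun_def Pi_iff)

lemma (in abelian_group) finsum_append:
 assumes "!!i. i < n ==> F (f i) (f' i) : carrier G" "!!i. i < m ==> F (g i) (g' i) : carrier G"
 shows "(\<Oplus>i\<in>{..<n + m}. F (app_fun n f g i) (app_fun n f' g' i)) =
  (\<Oplus>i\<in>{..<n}. F (f i) (f' i)) \<oplus> (\<Oplus>i\<in>{..<m}. F (g i) (g' i))"
proof -
 have "(\<Oplus>i\<in>{..<n + m}. F (app_fun n f g i) (app_fun n f' g' i)) =
  (\<Oplus>i\<in>{..<n}. F (app_fun n f g i) (app_fun n f' g' i)) \<oplus>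
  (\<Oplus>i\<in>{..<m}. F (app_fun n f g (n + i)) (app_fun n f' g' (n + i)))"
  by (rule finsum_lessThan_add) (use assms in \<open>auto simp: app_fun_def\<close>)
 then show ?thesis by (simp add: app_fun_def cong: fsum_congr)
qed

lemma sum_append: "(\<Sum>i<n + m. p (app_fun n f g i) * q (app_fun n f' g' i)) =
  (\<Sum>i<n. p (f i) * q (f' i)) + (\<Sum>i<m. p (g i) * q (g' i) :: real)"
 by (induction m) (simp_all add: app_fun_def)

locale tpair = A: locally_convex_algebra A + B: locally_convex_algebra B + T: locally_convex_algebra T
 for A :: "'a lca" and B :: "'b lca" and T :: "'c lca" +
 fixes t assumes proj: "proj_tensor A B T t"
begin

lemma t_bilinear: "bilinear_on A B T t" using proj by (simp add: proj_tensor_def)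

lemmas t_closed = bilD(1)[OF t_bilinear]

sublocale tb: bilinear_lca A B T t by unfold_locales (rule t_bilinear)

lemma t_mult: "[|a : carrier A; a' : carrier A; b : carrier B; b' : carrier B|] ==>
  t a b \<otimes>\<^sub>T t a' b' = t (a \<otimes>\<^sub>A a') (b \<otimes>\<^sub>B b')"
 using proj by (simp add: proj_tensor_def)

lemma mpairing: "mpairing A B T t" by (intro mpairing.intro A.nring B.nring T.nring mpairing_axioms.intro)
  (simp_all add: bilD[OF t_bilinear] t_mult)

abbreviation "tspan \<equiv> tensor_span A B T t"
abbreviation "reps \<equiv> tensor_reps A B T t"

lemma repsD:
 assumes "(n, a, b) : reps w"
 shows "a : {..<n} \<rightarrow> carrier A" "b : {..<n} \<rightarrow> carrier B" "w = (\<Oplus>\<^sub>T i\<in>{..<n}. t (a i) (b i))"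
  "i < n ==> a i : carrier A" "i < n ==> b i : carrier B" using assms by (auto simp: tensor_reps_def)

lemma repsI: "[|a : {..<n} \<rightarrow> carrier A; b : {..<n} \<rightarrow> carrier B; w = (\<Oplus>\<^sub>T i\<in>{..<n}. t (a i) (b i))|]
  ==> (n, a, b) : reps w" by (auto simp: tensor_reps_def)

lemma reps_append:
 assumes "(n, a, b) : reps v" "(m, a', b') : reps w"
 shows "(n + m, app_fun n a a', app_fun n b b') : reps (v \<oplus>\<^sub>T w)"
 using repsD[OF assms(1)] repsD[OF assms(2)]
 by (intro repsI app_fun_Pi) (auto simp: T.M.finsum_append[where F = t] t_closed)

lemma reps_scale:
 assumes "(n, a, b) : reps w" shows "(n, %i. c \<odot>\<^sub>A a i, b) : reps (c \<odot>\<^sub>T w)"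
proof -
 note ab = repsD[OF assms]
 have "c \<odot>\<^sub>T w = (\<Oplus>\<^sub>T i\<in>{..<n}. c \<odot>\<^sub>T t (a i) (b i))"
  unfolding ab(3) using ab by (intro T.sm_finsum) (auto simp: t_closed)
 then show ?thesis using ab by (intro repsI) (auto simp: A.sm_closed bilD(4)[OF t_bilinear] cong: fsum_congr)
qed

lemma span_iff: "w : tspan \<longleftrightarrow> (\<exists>n a b. (n, a, b) : reps w)"
 by (auto simp: tensor_span_def)

lemma reps_carrier: "(n, a, b) : reps w ==> w : carrier T"
 using repsD[of n a b w] by (auto intro!: T.M.finsum_closed t_closed)

lemma span_carrier: "tspan \<subseteq> carrier T" using reps_carrier by (auto simp: span_iff)

lemma span_add: "[|v : tspan; w : tspan|] ==> v \<oplus>\<^sub>T w : tspan"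
 unfolding span_iff by (metis reps_append)

lemma span_scale: "w : tspan ==> c \<odot>\<^sub>T w : tspan" unfolding span_iff by (metis reps_scale)

lemma span_minus: "[|v : tspan; w : tspan|] ==> v \<ominus>\<^sub>T w : tspan"
 using span_add[of v "(-1) \<odot>\<^sub>T w"] span_scale[of w "-1"] span_carrier by (auto simp: a_minus_def T.sm_minus_one)

lemma reps_zero: "(0, a, b) : reps \<zero>\<^sub>T" by (auto simp: tensor_reps_def)

lemma reps_single: "[|a : carrier A; b : carrier B|] ==> (1, %_. a, %_. b) : reps (t a b)"
 by (intro repsI) (auto simp: t_closed lessThan_Suc)

lemma span_single: "[|a : carrier A; b : carrier B|] ==> t a b : tspan"
 using reps_single span_iff by blast

lemma span_dense: "topo T closure_of tspan = carrier T" using proj by (simp add: proj_tensor_def)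

lemma openin_span: "openin (subtopology (topo T) tspan) U \<longleftrightarrow> U \<subseteq> tspan &
  (\<forall>w\<in>U. \<exists>p\<in>CS A. \<exists>q\<in>CS B. \<exists>\<epsilon>>0.
   {v : tspan. proj_seminorm A B T t p q (v \<ominus>\<^sub>T w) < \<epsilon>} \<subseteq> U)"
 using proj unfolding proj_tensor_def by (elim conjE) (erule spec)

lemma pq_nonneg:
 assumes "p : CS A" "q : CS B" "(n, a, b) : reps w" shows "0 <= (\<Sum>i<n. p (a i) * q (b i))"
 using csD(3)[OF assms(1)] csD(3)[OF assms(2)] repsD[OF assms(3)] by (intro sum_nonneg mult_nonneg_nonneg) auto

lemma pseminorm_le:
 assumes "p : CS A" "q : CS B" "(n, a, b) : reps w"
 shows "proj_seminorm A B T t p q w <= (\<Sum>i<n. p (a i) * q (b i))"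
proof -
 have "bdd_below ((%(n, a, b). \<Sum>i<n. p (a i) * q (b i)) ` reps w)"
  by (rule bdd_belowI[of _ 0]) (auto intro: pq_nonneg[OF assms(1,2)])
 from cINF_lower[OF this assms(3)] show ?thesis by (simp add: proj_seminorm_def)
qed

lemma pseminorm_less:
 assumes "w : tspan" "proj_seminorm A B T t p q w < e"
 obtains n a b where "(n, a, b) : reps w" "(\<Sum>i<n. p (a i) * q (b i)) < e"
proof -
 have "(%(n, a, b). \<Sum>i<n. p (a i) * q (b i)) ` reps w ~= {}" using assms(1) by (auto simp: tensor_span_def)
 from cInf_lessD[OF this assms(2)[unfolded proj_seminorm_def]]
 obtain x where x: "x : reps w" "(case x of (n, a, b) => \<Sum>i<n. p (a i) * q (b i)) < e"
  by (elim bexE imageE) simp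
 obtain n a b where "x = (n, a, b)" by (cases x)
 with x show thesis using that by simp
qed

text \<open>The elements that have some presentation of cost below one form an open set in the span,
  by the description of its topology. It is the trace of an open set of \<open>T\<close>, which
  contains the unit ball of a continuous seminorm.\<close>

lemma span_seminorm:
 assumes p: "p : CS A" and q: "q : CS B"
 obtains s where "s : CS T"
  "!!w. [|w : tspan; s w < 1|] ==> \<exists>n a b. (n, a, b) : reps w & (\<Sum>i<n. p (a i) * q (b i)) < 1"
proof -
 define U where "U = {w : tspan. \<exists>n a b. (n, a, b) : reps w & (\<Sum>i<n. p (a i) * q (b i)) < 1}"
 have "openin (subtopology (topo T) tspan) U" unfolding openin_span
 proof (intro conjI ballI)
  fix w assume "w : U"
  then obtain n a b where w: "w : tspan" "(n, a, b) : reps w" "(\<Sum>i<n. p (a i) * q (b i)) < 1"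
   unfolding U_def by blast
  \<comment> \<open>The slack left by the presentation of \<open>w\<close>: a presentation of the
    difference with cost below \<open>d\<close> may be appended to it.\<close>
  define d where "d = 1 - (\<Sum>i<n. p (a i) * q (b i))"
  have "v : U" if v: "v : tspan" "proj_seminorm A B T t p q (v \<ominus>\<^sub>T w) < d" for v
  proof -
   obtain m a' b' where m: "(m, a', b') : reps (v \<ominus>\<^sub>T w)" "(\<Sum>i<m. p (a' i) * q (b' i)) < d"
    using pseminorm_less[OF span_minus[OF v(1) w(1)] v(2)] .
   have "(v \<ominus>\<^sub>T w) \<oplus>\<^sub>T w = v" using v w span_carrier by (intro T.add_diff_cancel) auto
   then have "(m + n, app_fun m a' a, app_fun m b' b) : reps v" using reps_append[OF m(1) w(2)] by simp
   moreover have "(\<Sum>i<m + n. p (app_fun m a' a i) * q (app_fun m b' b i)) < 1"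
    using m(2) by (simp add: sum_append d_def)
   ultimately show ?thesis using v by (auto simp: U_def)
  qed
  then show "\<exists>p\<in>CS A. \<exists>q\<in>CS B. \<exists>\<epsilon>>0.
   {v : tspan. proj_seminorm A B T t p q (v \<ominus>\<^sub>T w) < \<epsilon>} \<subseteq> U"
   using p q w(3) by (intro bexI[OF _ p] bexI[OF _ q] exI[of _ d]) (auto simp: d_def)
 qed (auto simp: U_def)
 then obtain W where W: "openin (topo T) W" "U = W \<inter> tspan" by (auto simp: openin_subtopology)
 have "\<zero>\<^sub>T : U" using reps_zero by (force simp: U_def span_iff)
 then obtain s where s: "s : CS T" "{y : carrier T. s (y \<ominus>\<^sub>T \<zero>\<^sub>T) < 1} \<subseteq> W"
  using W unfolding T.openin_iff by blast
 show thesis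
 proof (rule that[OF s(1)])
  fix w assume w: "w : tspan" "s w < 1"
  then have "w : carrier T" using span_carrier by blast
  then have "w : U" using w s W by (auto simp: T.minus_zero)
  then show "\<exists>n a b. (n, a, b) : reps w & (\<Sum>i<n. p (a i) * q (b i)) < 1" by (auto simp: U_def)
 qed
qed

text \<open>The seminorm \<open>s\<close> is fixed before \<open>F\<close> and \<open>K\<close>.
  This uniformity is the point: with a further variable in \<open>F\<close> and its seminorm as
  \<open>K\<close>, the estimate becomes joint continuity, see
  \<open>trilinear_lift\<close>.\<close>

lemma span_bound:
 assumes p: "p : CS A" and q: "q : CS B"
 shows "\<exists>s\<in>CS T. \<forall>F K. 0 <= K & (\<forall>w\<in>tspan. \<forall>c. F (c \<odot>\<^sub>T w) = cmod c * F w) &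
   (\<forall>n a b w. (n, a, b) : reps w \<longrightarrow> F w <= K * (\<Sum>i<n. p (a i) * q (b i))) \<longrightarrow> (\<forall>w\<in>tspan. F w <= K * s w)"
proof -
 obtain s where s: "s : CS T"
  "!!w. [|w : tspan; s w < 1|] ==> \<exists>n a b. (n, a, b) : reps w & (\<Sum>i<n. p (a i) * q (b i)) < 1"
  using span_seminorm[OF p q] by metis
 show ?thesis
 proof (intro bexI[OF _ s(1)] allI impI ballI)
  fix F :: "'c => real" and K :: real and w
  assume F: "0 <= K & (\<forall>w\<in>tspan. \<forall>c. F (c \<odot>\<^sub>T w) = cmod c * F w) &
   (\<forall>n a b w. (n, a, b) : reps w \<longrightarrow> F w <= K * (\<Sum>i<n. p (a i) * q (b i)))" and w: "w : tspan"
  then have K: "0 <= K" and hom: "!!w c. w : tspan ==> F (c \<odot>\<^sub>T w) = cmod c * F w"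
   and le: "!!n a b w. (n, a, b) : reps w ==> F w <= K * (\<Sum>i<n. p (a i) * q (b i))" by auto
  have wc: "w : carrier T" using w span_carrier by blast
  have *: "F w <= K * r" if r: "s w < r" for r
  proof -
   have r0: "r > 0" using r csD(3)[OF s(1) wc] by simp
   let ?c = "complex_of_real (1 / r)"
   have "s (?c \<odot>\<^sub>T w) < 1" using csD(5)[OF s(1) wc, of ?c] r r0 by (simp add: norm_divide)
   then obtain n a b where n: "(n, a, b) : reps (?c \<odot>\<^sub>T w)" "(\<Sum>i<n. p (a i) * q (b i)) < 1"
    using s(2) span_scale[OF w] by blast
   have "F (?c \<odot>\<^sub>T w) <= K * (\<Sum>i<n. p (a i) * q (b i))" by (rule le[OF n(1)])
   also have "... <= K * 1" using n K by (intro mult_left_mono) auto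
   also have "F (?c \<odot>\<^sub>T w) = F w / r" using hom[OF w, of ?c] r0 by (simp add: norm_divide)
   finally show ?thesis using r0 by (simp add: field_simps)
  qed
  show "F w <= K * s w"
  proof (rule field_le_epsilon)
   fix e :: real assume e: "0 < e"
   \<comment> \<open>Dividing by \<open>K + 1\<close> instead of \<open>K\<close> covers
     \<open>K = 0\<close>.\<close>
   have "F w <= K * (s w + e / (K + 1))" using e K by (intro *) simp
   also have "... <= K * s w + e" using e K by (simp add: field_simps)
   finally show "F w <= K * s w + e" .
  qed
 qed
qed

text \<open>The unit ball of \<open>s\<close> meets the span in an open set, which contains a ball
  of some projective seminorm of radius \<open>\<epsilon>\<close>. An elementary tensor is its own
  presentation, so scaling its first factor gives the bound with constant
  \<open>1 / \<epsilon>\<close>.\<close>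

lemma t_bounded: "bdd_bil_on A B T t" unfolding bdd_bil_on_def
proof (intro conjI t_bilinear ballI)
 fix s assume s: "s : CS T"
 define U where "U = {w : tspan. s w < 1}"
 have "U = {y : carrier T. s (y \<ominus>\<^sub>T \<zero>\<^sub>T) < 1} \<inter> tspan"
  using span_carrier by (auto simp: U_def T.minus_zero)
 then have "openin (subtopology (topo T) tspan) U"
  using T.openin_ball[OF s T.M.zero_closed, of 1] by (auto simp: openin_subtopology)
 moreover have "\<zero>\<^sub>T : U" using reps_zero by (force simp: U_def span_iff T.cs_null[OF s])
 ultimately obtain p q \<epsilon> where pq: "p : CS A" "q : CS B" "\<epsilon> > 0"
  "{v : tspan. proj_seminorm A B T t p q (v \<ominus>\<^sub>T \<zero>\<^sub>T) < \<epsilon>} \<subseteq> U"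
  unfolding openin_span by blast
 have "s (t a b) <= (1/\<epsilon>) * p a * q b" if ab: "a : carrier A" "b : carrier B" for a b
 \<comment> \<open>Numbers \<open>r\<close> above the bound are used because the bound itself may be
   zero and could not serve for scaling.\<close>
 proof (rule dense_ge)
  fix r assume r: "1 / \<epsilon> * p a * q b < r"
  have pq0: "0 <= p a * q b" using csD(3)[OF pq(1) ab(1)] csD(3)[OF pq(2) ab(2)] by simp
  have "0 <= 1 / \<epsilon> * p a * q b" using pq0 pq(3) by (simp add: field_simps)
  with r have r0: "r > 0" by simp
  let ?c = "complex_of_real (1 / r)"
  have tc: "t (?c \<odot>\<^sub>A a) b : tspan" using ab by (intro span_single A.sm_closed)
  have "proj_seminorm A B T t p q (t (?c \<odot>\<^sub>A a) b) <= (\<Sum>i<1::nat. p (?c \<odot>\<^sub>A a) * q b)"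
   using pseminorm_le[OF pq(1,2) reps_single[of "?c \<odot>\<^sub>A a" b]] ab by (simp add: A.sm_closed)
  also have "... = p a * q b / r" using csD(5)[OF pq(1) ab(1), of ?c] r0 by (simp add: norm_divide)
  also have "... < \<epsilon>" using r r0 pq(3) by (simp add: field_simps)
  finally have "t (?c \<odot>\<^sub>A a) b : {v : tspan. proj_seminorm A B T t p q (v \<ominus>\<^sub>T \<zero>\<^sub>T) < \<epsilon>}"
   using tc span_carrier T.minus_zero[of "t (?c \<odot>\<^sub>A a) b"] by (auto simp: subset_iff)
  with pq(4) have "t (?c \<odot>\<^sub>A a) b : U" by blast
  then have "s (?c \<odot>\<^sub>T t a b) < 1" using ab by (simp add: U_def bilD(4)[OF t_bilinear])
  then have "s (t a b) / r < 1" using csD(5)[OF s t_closed[OF ab], of ?c] r0 by (simp add: norm_divide)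
  then show "s (t a b) <= r" using r0 by (simp add: field_simps)
 qed
 then show "\<exists>p\<in>CS A. \<exists>q\<in>CS B. \<forall>a\<in>carrier A. \<forall>b\<in>carrier B. s (t a b) <= p a * q b"
  using pq by (intro bexI[of _ "%a. (1/\<epsilon>) * p a", OF _ cs_scale] bexI[OF _ pq(2)]) auto
qed

lemma clin_unique:
 assumes V: "LCA V" and f: "f : clin T V" and g: "g : clin T V"
  and eq: "!!a b. [|a : carrier A; b : carrier B|] ==> f (t a b) = g (t a b)" and w: "w : carrier T"
 shows "f w = g w"
proof (rule clin_eq_dense[OF T.lca_axioms V f g span_dense _ w])
 interpret V: locally_convex_algebra V by fact
 fix x assume "x : tspan"
 then obtain n a b where x: "(n, a, b) : reps x" by (auto simp: span_iff)
 note ab = repsD[OF x]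
 have "f x = (\<Oplus>\<^sub>V i\<in>{..<n}. f (t (a i) (b i)))" unfolding ab(3)
  by (rule add_hom_finsum[OF T.M.abelian_group_axioms V.M.abelian_group_axioms clinD(1)[OF f]]) (auto intro: t_closed ab)
 also have "... = (\<Oplus>\<^sub>V i\<in>{..<n}. g (t (a i) (b i)))" using ab eq by (intro finsum_congr) auto
 also have "... = g x" unfolding ab(3)
  by (rule add_hom_finsum[OF T.M.abelian_group_axioms V.M.abelian_group_axioms clinD(1)[OF g], symmetric]) (auto intro: t_closed ab)
 finally show "f x = g x" .
qed

text \<open>Relations between elementary tensors in \<open>T\<close> are those of the algebraic
  tensor product. Induction on the number of terms: if the first factors are independent,
  injectivity makes all second factors vanish; otherwise one term is eliminated, in the same way for
  \<open>t\<close> and for \<open>\<beta>\<close>.\<close>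

lemma tensor_relation:
 assumes "bilinear_lca A B V \<beta>" "finite (I :: nat set)"
  "!!i. i : I ==> a i : carrier A" "!!i. i : I ==> b i : carrier B"
  "(\<Oplus>\<^sub>T i\<in>I. t (a i) (b i)) = \<zero>\<^sub>T"
 shows "(\<Oplus>\<^sub>V i\<in>I. \<beta> (a i) (b i)) = \<zero>\<^sub>V"
proof -
 interpret \<beta>: bilinear_lca A B V \<beta> by fact
 show ?thesis using assms(2-)
 proof (induction "card I" arbitrary: I b rule: less_induct)
  case less
  note I = less.prems(1) and a = less.prems(2) and b = less.prems(3) and rel = less.prems(4)
  define n where "n = card I"
  \<comment> \<open>Independence is stated for families over an initial segment, while the induction
    removes arbitrary indices from \<open>I\<close>.\<close>
  obtain g where g: "bij_betw g {..<n} I" using ex_bij_betw_nat_finite[OF I] by (auto simp: n_def lessThan_atLeast0)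
  have gI: "g i : I" if "i < n" for i using g that by (auto simp: bij_betw_def)
  have reindex: "(\<Oplus>\<^sub>G i\<in>{..<n}. F (g i)) = (\<Oplus>\<^sub>G i\<in>I. F i)"
   if "abelian_group G" "!!i. i : I ==> F i : carrier G" for G :: "('z, 'k) ring_scheme" and F
  proof -
   interpret G: abelian_group G by fact
   show ?thesis using G.finsum_reindex[of F g "{..<n}"] g that(2) by (auto simp: bij_betw_def)
  qed
  show ?case
  proof (cases "lin_indep_family A n (%i. a (g i))")
   case True
   have inj: "tensor_injective A B T t" using proj by (simp add: proj_tensor_def)
   have rel': "(\<Oplus>\<^sub>T i\<in>{..<n}. t (a (g i)) (b (g i))) = \<zero>\<^sub>T"
    using reindex[OF T.M.abelian_group_axioms, of "%i. t (a i) (b i)"] a b rel by (simp add: t_closed)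
   have "(%i. a (g i)) : {..<n} \<rightarrow> carrier A" "(%i. b (g i)) : {..<n} \<rightarrow> carrier B"
    using a b gI by auto
   from inj[unfolded tensor_injective_def, THEN spec[of _ n], THEN bspec, OF this(1), THEN bspec, OF this(2),
     THEN mp, OF conjI[OF True rel']]
   have "\<forall>i<n. b (g i) = \<zero>\<^sub>B" .
   then have "b i = \<zero>\<^sub>B" if "i : I" for i
    using that g unfolding bij_betw_def by (metis imageE lessThan_iff)
   then show ?thesis using a by (intro \<beta>.V.M.add.finprod_one_eqI) (simp add: \<beta>.null_right)
  next
   case False
   then obtain c k0 where c: "(\<Oplus>\<^sub>A i\<in>{..<n}. c i \<odot>\<^sub>A a (g i)) = \<zero>\<^sub>A" "k0 < n" "c k0 ~= 0"
    by (auto simp: lin_indep_family_def)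
   define e where "e i = c (inv_into {..<n} g i)" for i
   define k where "k = g k0"
   have eg: "e (g i) = c i" if "i < n" for i using g that by (simp add: e_def bij_betw_def)
   have k: "k : I" "e k ~= 0" using gI c eg by (auto simp: k_def)
   have "(\<Oplus>\<^sub>A i\<in>{..<n}. e (g i) \<odot>\<^sub>A a (g i)) = \<zero>\<^sub>A"
    using c(1) by (simp add: eg cong: fsum_congr)
   then have "(\<Oplus>\<^sub>A i\<in>I. e i \<odot>\<^sub>A a i) = \<zero>\<^sub>A"
    using reindex[OF A.M.abelian_group_axioms, of "%i. e i \<odot>\<^sub>A a i"] a by (simp add: A.sm_closed)
   then have sum0: "e k \<odot>\<^sub>A a k \<oplus>\<^sub>A (\<Oplus>\<^sub>A i\<in>I - {k}. e i \<odot>\<^sub>A a i) = \<zero>\<^sub>A"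
    using A.M.finsum_insert[of "I - {k}" k "%i. e i \<odot>\<^sub>A a i"] I k a by (simp add: insert_absorb A.sm_closed Pi_iff)
   define S where "S = (\<Oplus>\<^sub>A i\<in>I - {k}. e i \<odot>\<^sub>A a i)"
   have S: "S : carrier A" using a by (auto simp: S_def intro!: A.M.finsum_closed A.sm_closed)
   have ak: "a k : carrier A" using a k by simp
   have "a k \<oplus>\<^sub>A (inverse (e k)) \<odot>\<^sub>A S = inverse (e k) \<odot>\<^sub>A (e k \<odot>\<^sub>A a k \<oplus>\<^sub>A S)"
    using S ak k by (simp add: A.sm_add_right A.sm_closed A.sm_assoc[symmetric] A.sm_one)
   also have "... = \<zero>\<^sub>A" using sum0 by (simp add: S_def A.sm_zero_right)
   finally have "\<ominus>\<^sub>A (inverse (e k) \<odot>\<^sub>A S) = a k"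
    using ak S by (intro A.M.minus_equality) (auto simp: A.sm_closed)
   then have "a k = (- inverse (e k)) \<odot>\<^sub>A S"
    using A.sm_minus_one[of "inverse (e k) \<odot>\<^sub>A S"] A.sm_assoc[OF S, of "-1" "inverse (e k)"] S by (simp add: A.sm_closed)
   also have "... = (\<Oplus>\<^sub>A i\<in>I - {k}. (- inverse (e k)) \<odot>\<^sub>A (e i \<odot>\<^sub>A a i))"
    unfolding S_def using I a by (intro A.sm_finsum) (auto simp: A.sm_closed)
   also have "... = (\<Oplus>\<^sub>A i\<in>I - {k}. (- inverse (e k) * e i) \<odot>\<^sub>A a i)"
    using a by (intro finsum_congr) (auto simp: A.sm_assoc[symmetric])
   finally have ak': "a k = (\<Oplus>\<^sub>A i\<in>I - {k}. (- inverse (e k) * e i) \<odot>\<^sub>A a i)" .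
   define b' where "b' i = b i \<oplus>\<^sub>B (- inverse (e k) * e i) \<odot>\<^sub>B b k" for i
   have "(\<Oplus>\<^sub>T i\<in>I - {k}. t (a i) (b' i)) = \<zero>\<^sub>T"
    using tb.eliminate[OF I k(1) a b ak'] rel by (simp add: b'_def)
   then have "(\<Oplus>\<^sub>V i\<in>I - {k}. \<beta> (a i) (b' i)) = \<zero>\<^sub>V"
    using I k a b by (intro less.hyps card_Diff1_less) (auto simp: b'_def B.sm_closed)
   then show ?thesis using \<beta>.eliminate[OF I k(1) a b ak'] by (simp add: b'_def)
  qed
 qed
qed

text \<open>The universal property of the completed projective tensor product. On the span the value
  is computed from a chosen presentation; \<open>tensor_relation\<close> makes it independent of the
  choice, the projective seminorms bound it, and completeness of \<open>V\<close> extends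
  it.\<close>

lemma lift_exists:
 assumes V: "LCA V" and \<beta>: "bdd_bil_on A B V \<beta>"
 shows "\<exists>h\<in>clin T V. \<forall>a\<in>carrier A. \<forall>b\<in>carrier B. h (t a b) = \<beta> a b"
proof -
 interpret \<beta>: bilinear_lca A B V \<beta>
  using V \<beta> by (intro bilinear_lca.intro bilinear_lca_axioms.intro A.lca_axioms
    B.lca_axioms) (auto simp: bdd_bil_on_def)
 define S where "S x = (case x of (n, a, b) => (\<Oplus>\<^sub>V i\<in>{..<n::nat}. \<beta> (a i) (b i)))" for x
 define h where "h w = S (SOME x. x : reps w)" for w
 have Scl: "S (n, a, b) : carrier V" if "(n, a, b) : reps w" for n a b w
  using repsD[OF that] by (auto simp: S_def intro!: \<beta>.V.M.finsum_closed \<beta>.closed)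
 have Sapp: "S (n + m, app_fun n a a', app_fun n b b') = S (n, a, b) \<oplus>\<^sub>V S (m, a', b')"
  if "(n, a, b) : reps w" "(m, a', b') : reps w'" for n a b w m a' b' w'
  using repsD[OF that(1)] repsD[OF that(2)] by (simp add: S_def \<beta>.V.M.finsum_append[where F = \<beta>] \<beta>.closed)
 have Ssc: "S (n, %i. c \<odot>\<^sub>A a i, b) = c \<odot>\<^sub>V S (n, a, b)" if "(n, a, b) : reps w" for n a b w c
 proof -
  note ab = repsD[OF that]
  have "c \<odot>\<^sub>V S (n, a, b) = (\<Oplus>\<^sub>V i\<in>{..<n}. c \<odot>\<^sub>V \<beta> (a i) (b i))"
   unfolding S_def prod.case using ab by (intro \<beta>.V.sm_finsum) (auto simp: \<beta>.closed)
  then show ?thesis using ab by (simp add: S_def bilD(4)[OF \<beta>.bilinear] cong: fsum_congr)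
 qed
 have S_eq: "S (n, a, b) = S (m, a', b')" if 1: "(n, a, b) : reps w" and 2: "(m, a', b') : reps w" for n a b m a' b' w
 proof -
  have w: "w : carrier T" using 1 by (rule reps_carrier)
  \<comment> \<open>A presentation of \<open>w - w = 0\<close> that combines the two given
    presentations of \<open>w\<close>.\<close>
  note 3 = reps_append[OF 1 reps_scale[OF 2, of "-1"]]
  have "w \<oplus>\<^sub>T (-1) \<odot>\<^sub>T w = \<zero>\<^sub>T" using w by (simp add: T.sm_minus_one T.M.r_neg)
  then have "S (n + m, app_fun n a (%i. (-1) \<odot>\<^sub>A a' i), app_fun n b b') = \<zero>\<^sub>V"
   using repsD[OF 3] unfolding S_def prod.case by (intro tensor_relation[OF \<beta>.bilinear_lca_axioms]) auto
  then have "S (n, a, b) \<oplus>\<^sub>V (-1) \<odot>\<^sub>V S (m, a', b') = \<zero>\<^sub>V"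
   using Sapp[OF 1 reps_scale[OF 2, of "-1"]] Ssc[OF 2, of "-1"] by simp
  then have "S (n, a, b) \<ominus>\<^sub>V S (m, a', b') = \<zero>\<^sub>V"
   using Scl[OF 2] by (simp add: \<beta>.V.sm_minus_one a_minus_def)
  then show ?thesis using Scl[OF 1] Scl[OF 2] by (rule \<beta>.V.minus_eq_zero[rotated 2])
 qed
 have h: "h w = S (n, a, b)" if "(n, a, b) : reps w" for n a b w
 proof -
  have "(SOME x. x : reps w) : reps w" using that by (rule someI)
  then show ?thesis unfolding h_def using S_eq that by (metis prod_cases3)
 qed
 have hadd: "h (v \<oplus>\<^sub>T w) = h v \<oplus>\<^sub>V h w" if vw: "v : tspan" "w : tspan" for v w
  using vw unfolding span_iff by (auto simp: h Sapp h[OF reps_append])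
 have hsm: "h (c \<odot>\<^sub>T w) = c \<odot>\<^sub>V h w" if "w : tspan" for w c
  using that unfolding span_iff by (auto simp: h h[OF reps_scale] Ssc)
 have hcl: "h w : carrier V" if "w : tspan" for w using that unfolding span_iff by (auto simp: h Scl)
 have bd: "\<exists>r\<in>CS T. \<forall>x\<in>tspan. s (h x) <= r x" if s: "s : CS V" for s
 proof -
  obtain p q where pq: "p : CS A" "q : CS B"
   "\<forall>a\<in>carrier A. \<forall>b\<in>carrier B. s (\<beta> a b) <= p a * q b"
   using \<beta> s unfolding bdd_bil_on_def by blast
  obtain r where r: "r : CS T"
   "\<forall>F K. 0 <= K & (\<forall>w\<in>tspan. \<forall>c. F (c \<odot>\<^sub>T w) = cmod c * F w) &
   (\<forall>n a b w. (n, a, b) : reps w \<longrightarrow> F w <= K * (\<Sum>i<n. p (a i) * q (b i))) \<longrightarrow> (\<forall>w\<in>tspan. F w <= K * r w)"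
   using span_bound[OF pq(1,2)] by (elim bexE) (rule that)
  have "\<forall>w\<in>tspan. s (h w) <= 1 * r w"
  proof (rule r(2)[THEN spec, of "%w. s (h w)", THEN spec, of 1, THEN mp], intro conjI allI impI ballI)
   fix n a b w assume n: "(n, a, b) : reps w"
   note ab = repsD[OF n]
   have "s (h w) <= (\<Sum>i<n. s (\<beta> (a i) (b i)))"
    unfolding h[OF n] S_def prod.case using ab by (intro \<beta>.V.cs_finsum_le[OF s]) (auto simp: \<beta>.closed)
   also have "... <= (\<Sum>i<n. p (a i) * q (b i))" using ab pq(3) by (intro sum_mono) auto
   finally show "s (h w) <= 1 * (\<Sum>i<n. p (a i) * q (b i))" by simp
  qed (use hsm hcl in \<open>auto simp: csD(5)[OF s]\<close>)
  then show ?thesis using r(1) by auto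
 qed
 have "\<exists>f\<in>clin T V. \<forall>x\<in>tspan. f x = h x"
  by (rule clin_extension[OF T.lca_axioms V span_dense span_carrier span_add span_scale hcl hadd hsm bd]) auto
 then obtain f where f: "f : clin T V" "!!x. x : tspan ==> f x = h x" by auto
 have "f (t a b) = \<beta> a b" if "a : carrier A" "b : carrier B" for a b
  using f(2)[OF span_single[OF that]] h[OF reps_single[OF that]] that by (simp add: S_def lessThan_Suc \<beta>.closed)
 with f(1) show ?thesis by blast
qed

end

lemma (in locally_convex_algebra) mult_clin_left:
 assumes "x : carrier A" shows "(%y. x \<otimes> y) : clin A A"
proof -
 have "continuous_map (topo A) (prod_topology (topo A) (topo A)) (%y. (x, y))"
  using assms by (intro continuous_map_pairedI) (auto simp: topspace)
 from continuous_map_compose[OF this m_continuous] show ?thesis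
  using assms by (auto simp: clin_def hom_def m_closed r_distr smult_m_right o_def)
qed

lemma (in locally_convex_algebra) mult_clin_right:
 assumes "x : carrier A" shows "(%y. y \<otimes> x) : clin A A"
proof -
 have "continuous_map (topo A) (prod_topology (topo A) (topo A)) (%y. (y, x))"
  using assms by (intro continuous_map_pairedI) (auto simp: topspace)
 from continuous_map_compose[OF this m_continuous] show ?thesis
  using assms by (auto simp: clin_def hom_def m_closed l_distr smult_m_left o_def)
qed

text \<open>One factor at a time: with the other fixed, both sides are continuous and linear, so
  elementary tensors decide.\<close>

lemma (in tpair) lift_multiplicative:
 assumes V: "LCA V" and h: "h : clin T V"
  and mult: "!!a b a' b'. [|a : carrier A; b : carrier B; a' : carrier A; b' : carrier B|] ==>
   h (t (a \<otimes>\<^sub>A a') (b \<otimes>\<^sub>B b')) = h (t a b) \<otimes>\<^sub>V h (t a' b')"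
 shows "h : lca_hom T V"
proof -
 interpret V: locally_convex_algebra V by fact
 note hc = clinD(2)[OF h]
 have 1: "h (w \<otimes>\<^sub>T t a' b') = h w \<otimes>\<^sub>V h (t a' b')" if "w : carrier T" "a' : carrier A" "b' : carrier B" for w a' b'
  using clin_unique[OF V clin_comp[OF T.mult_clin_right h] clin_comp[OF h V.mult_clin_right], of "t a' b'" "h (t a' b')" w]
   that by (simp add: o_def t_closed hc t_mult mult)
 have "h (w \<otimes>\<^sub>T w') = h w \<otimes>\<^sub>V h w'" if "w : carrier T" "w' : carrier T" for w w'
  using clin_unique[OF V clin_comp[OF T.mult_clin_left h] clin_comp[OF h V.mult_clin_left], of w "h w" w']
   that by (simp add: o_def t_closed hc 1)
 then show ?thesis using h by (auto simp: lca_hom_iff)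
qed

section \<open>Constructions with tensor products\<close>

lemma bdd_bilD:
 assumes "bdd_bil_on A B V \<beta>" shows "bilinear_on A B V \<beta>"
  "s : CS V ==> \<exists>p\<in>CS A. \<exists>q\<in>CS B. \<forall>a\<in>carrier A. \<forall>b\<in>carrier B. s (\<beta> a b) <= p a * q b"
 using assms by (auto simp: bdd_bil_on_def)

lemma bdd_bil_flip:
 assumes "bdd_bil_on A B V \<beta>" shows "bdd_bil_on B A V (%b a. \<beta> a b)"
proof -
 have "\<exists>q\<in>CS B. \<exists>p\<in>CS A. \<forall>b\<in>carrier B. \<forall>a\<in>carrier A. s (\<beta> a b) <= q b * p a"
  if s: "s : CS V" for s
 proof -
  obtain p q where "p : CS A" "q : CS B" "\<forall>a\<in>carrier A. \<forall>b\<in>carrier B. s (\<beta> a b) <= p a * q b"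
   using bdd_bilD(2)[OF assms s] by blast
  then show ?thesis by (intro bexI[of _ q] bexI[of _ p]) (auto simp: mult.commute)
 qed
 then show ?thesis using assms by (auto simp: bdd_bil_on_def bilinear_on_def)
qed

lemma bdd_bil_comp:
 assumes \<beta>: "bdd_bil_on A' B' V \<beta>" and f: "f : clin A A'" and g: "g : clin B B'"
 shows "bdd_bil_on A B V (%a b. \<beta> (f a) (g b))" unfolding bdd_bil_on_def
proof (intro conjI ballI)
 show "bilinear_on A B V (%a b. \<beta> (f a) (g b))" using bilD[OF bdd_bilD(1)[OF \<beta>]] clinD[OF f] clinD[OF g]
  unfolding bilinear_on_def by simp
 fix s assume "s : CS V"
 then obtain p q where pq: "p : CS A'" "q : CS B'"
  "\<forall>a\<in>carrier A'. \<forall>b\<in>carrier B'. s (\<beta> a b) <= p a * q b"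
  using bdd_bilD(2)[OF \<beta>] by meson
 then show "\<exists>p\<in>CS A. \<exists>q\<in>CS B. \<forall>a\<in>carrier A. \<forall>b\<in>carrier B. s (\<beta> (f a) (g b)) <= p a * q b"
  using clin_bound[OF f pq(1)] clin_bound[OF g pq(2)] clinD(2)[OF f] clinD(2)[OF g]
  by (intro bexI[of _ "%x. p (f x)"] bexI[of _ "%x. q (g x)"]) auto
qed

lemma bdd_bil_add:
 assumes V: "LCA V" and \<beta>: "bdd_bil_on A B V \<beta>" and \<gamma>: "bdd_bil_on A B V \<gamma>"
 shows "bdd_bil_on A B V (%a b. \<beta> a b \<oplus>\<^sub>V \<gamma> a b)"
proof -
 interpret V: locally_convex_algebra V by fact
 note b = bilD[OF bdd_bilD(1)[OF \<beta>]] and c = bilD[OF bdd_bilD(1)[OF \<gamma>]]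
 have "\<exists>p\<in>CS A. \<exists>q\<in>CS B. \<forall>a\<in>carrier A. \<forall>x\<in>carrier B. s (\<beta> a x \<oplus>\<^sub>V \<gamma> a x) <= p a * q x"
  if s: "s : CS V" for s
 proof -
  obtain p q p' q' where pq: "p : CS A" "q : CS B"
   "\<forall>a\<in>carrier A. \<forall>x\<in>carrier B. s (\<beta> a x) <= p a * q x"
   and pq': "p' : CS A" "q' : CS B"
   "\<forall>a\<in>carrier A. \<forall>x\<in>carrier B. s (\<gamma> a x) <= p' a * q' x"
   using bdd_bilD(2)[OF \<beta> s] bdd_bilD(2)[OF \<gamma> s] by metis
  have "s (\<beta> a x \<oplus>\<^sub>V \<gamma> a x) <= (p a + p' a) * (q x + q' x)" if ab: "a : carrier A" "x : carrier B" for a x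
  proof -
   have "s (\<beta> a x \<oplus>\<^sub>V \<gamma> a x) <= p a * q x + p' a * q' x"
    using csD(4)[OF s b(1)[OF ab] c(1)[OF ab]] pq(3) pq'(3) ab by force
   also have "... <= (p a + p' a) * (q x + q' x)"
    using csD(3)[OF pq(1) ab(1)] csD(3)[OF pq(2) ab(2)] csD(3)[OF pq'(1) ab(1)] csD(3)[OF pq'(2) ab(2)]
    by (simp add: algebra_simps)
   finally show ?thesis .
  qed
  then show ?thesis
   using cs_add[OF pq(1) pq'(1)] cs_add[OF pq(2) pq'(2)] by (intro bexI[of _ "%a. p a + p' a"] bexI[of _ "%a. q a + q' a"]) auto
 qed
 moreover have "bilinear_on A B V (%a b. \<beta> a b \<oplus>\<^sub>V \<gamma> a b)"
  unfolding bilinear_on_def by (auto simp: b c V.sm_add_right V.M.a_ac)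
 ultimately show ?thesis unfolding bdd_bil_on_def by blast
qed

lemma cmod_cs: "\<phi> : clin A CL ==> (%a. cmod (\<phi> a)) : CS A"
 using clinD[of \<phi> A CL] unfolding cont_seminorms_def seminorm_def
 by (auto simp: complex_lca_def norm_triangle_ineq norm_mult intro!: continuous_map_norm)

lemma bdd_bil_scalar:
 assumes A: "LCA A" and V: "LCA V" and \<phi>: "\<phi> : clin A CL" and g: "g : clin B V"
 shows "bdd_bil_on A B V (%a b. \<phi> a \<odot>\<^sub>V g b)"
proof -
 interpret V: locally_convex_algebra V by fact
 have l: "\<phi> (x \<oplus>\<^sub>A y) = \<phi> x + \<phi> y" "\<phi> (c \<odot>\<^sub>A x) = c * \<phi> x" if "x : carrier A" "y : carrier A" for x y c
  using clinD(3,4)[OF \<phi>] that by (simp_all add: complex_lca_def)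
 have "\<exists>p\<in>CS A. \<exists>q\<in>CS B. \<forall>a\<in>carrier A. \<forall>b\<in>carrier B. s (\<phi> a \<odot>\<^sub>V g b) <= p a * q b"
  if s: "s : CS V" for s using cmod_cs[OF \<phi>] clin_bound[OF g s] clinD(2)[OF g]
  by (intro bexI[of _ "%a. cmod (\<phi> a)"] bexI[of _ "%b. s (g b)"]) (auto simp: csD(5)[OF s])
 then show ?thesis unfolding bdd_bil_on_def bilinear_on_def
  using clinD(2,3,4)[OF g] by (auto simp: l V.sm_closed V.sm_add_left V.sm_add_right V.sm_assoc[symmetric] mult.commute)
qed

context tpair
begin

text \<open>\<open>span_bound\<close> carried from the span to \<open>T\<close> by density, with the
  same uniformity in \<open>F\<close> and \<open>K\<close>.\<close>

lemma dominate:
 assumes p: "p : CS A" and q: "q : CS B" shows "\<exists>s\<in>CS T. \<forall>F\<in>CS T. \<forall>K\<ge>0.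
  (\<forall>a\<in>carrier A. \<forall>b\<in>carrier B. F (t a b) <= K * (p a * q b)) \<longrightarrow> (\<forall>w\<in>carrier T. F w <= K * s w)"
proof -
 obtain s where s: "s : CS T"
  "\<forall>F K. 0 <= K & (\<forall>w\<in>tspan. \<forall>c. F (c \<odot>\<^sub>T w) = cmod c * F w) &
   (\<forall>n a b w. (n, a, b) : reps w \<longrightarrow> F w <= K * (\<Sum>i<n. p (a i) * q (b i))) \<longrightarrow> (\<forall>w\<in>tspan. F w <= K * s w)"
  using span_bound[OF p q] by (elim bexE) (rule that)
 show ?thesis
 proof (intro bexI[OF _ s(1)] ballI allI impI)
  fix F K w assume F: "F : CS T" and K: "(0::real) <= K"
   and le: "\<forall>a\<in>carrier A. \<forall>b\<in>carrier B. F (t a b) <= K * (p a * q b)" and w: "w : carrier T"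
  have "F v <= K * (\<Sum>i<n. p (a i) * q (b i))" if n: "(n, a, b) : reps v" for n a b v
  proof -
   note ab = repsD[OF n]
   have "F v <= (\<Sum>i<n. F (t (a i) (b i)))"
    unfolding ab(3) using ab by (intro T.cs_finsum_le[OF F]) (auto simp: t_closed)
   also have "... <= (\<Sum>i<n. K * (p (a i) * q (b i)))" using ab le by (intro sum_mono) auto
   finally show ?thesis by (simp add: sum_distrib_left)
  qed
  then have sp: "F v <= K * s v" if "v : tspan" for v
   using s(2)[THEN spec, of F, THEN spec, of K] K that span_carrier csD(5)[OF F] by blast
  show "F w <= K * s w"
  proof (rule field_le_epsilon)
   fix e :: real assume e: "0 < e"
   have r: "(%x. F x + K * s x) : CS T" by (intro cs_add F cs_scale s K)
   obtain v where v: "v : tspan" "v : carrier T" "F (w \<ominus>\<^sub>T v) + K * s (w \<ominus>\<^sub>T v) < e"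
    using T.dense_approx[OF span_dense w r e] .
   have "F w <= F (w \<ominus>\<^sub>T v) + F v"
    using csD(4)[OF F, of "w \<ominus>\<^sub>T v" v] w v by (simp add: T.add_diff_cancel)
   moreover have "s v <= s (v \<ominus>\<^sub>T w) + s w"
    using csD(4)[OF s(1), of "v \<ominus>\<^sub>T w" w] w v by (simp add: T.add_diff_cancel)
   then have "K * s v <= K * s (w \<ominus>\<^sub>T v) + K * s w"
    using K w v by (simp add: T.cs_minus_commute[OF s(1), of v w] mult_left_mono flip: distrib_left)
   ultimately show "F w <= K * s w + e" using sp[OF v(1)] v(3) by simp
  qed
 qed
qed

lemma t_clin_left: "b : carrier B ==> (%a. t a b) : clin A T"
proof (rule clinI[OF A.lca_axioms T.lca_axioms])
 fix s assume b: "b : carrier B" and s: "s : CS T"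
 obtain p q where pq: "p : CS A" "q : CS B" "\<forall>a\<in>carrier A. \<forall>b\<in>carrier B. s (t a b) <= p a * q b"
  using bdd_bilD(2)[OF t_bounded s] by blast
 then show "\<exists>p\<in>CS A. \<forall>x\<in>carrier A. s (t x b) <= p x"
  using b csD(3)[OF pq(2) b] by (intro bexI[OF _ cs_scale[of p A "q b"]]) (auto simp: mult.commute)
qed (use bilD[OF t_bilinear] in \<open>auto simp: hom_def\<close>)

lemma t_clin_right: "a : carrier A ==> (%b. t a b) : clin B T"
proof (rule clinI[OF B.lca_axioms T.lca_axioms])
 fix s assume b: "a : carrier A" and s: "s : CS T"
 obtain p q where pq: "p : CS A" "q : CS B" "\<forall>a\<in>carrier A. \<forall>b\<in>carrier B. s (t a b) <= p a * q b"
  using bdd_bilD(2)[OF t_bounded s] by blast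
 then show "\<exists>q\<in>CS B. \<forall>x\<in>carrier B. s (t a x) <= q x"
  using b csD(3)[OF pq(1) b] by (intro bexI[OF _ cs_scale[of q B "p a"]]) auto
qed (use bilD[OF t_bilinear] in \<open>auto simp: hom_def\<close>)

lemma lift_hom_exists:
 assumes V: "LCA V" and \<beta>: "bdd_bil_on A B V \<beta>"
  and mult: "!!a b a' b'. [|a : carrier A; b : carrier B; a' : carrier A; b' : carrier B|] ==>
   \<beta> (a \<otimes>\<^sub>A a') (b \<otimes>\<^sub>B b') = \<beta> a b \<otimes>\<^sub>V \<beta> a' b'"
 shows "\<exists>h\<in>lca_hom T V. \<forall>a\<in>carrier A. \<forall>b\<in>carrier B. h (t a b) = \<beta> a b"
proof -
 obtain h where h: "h : clin T V" "\<forall>a\<in>carrier A. \<forall>b\<in>carrier B. h (t a b) = \<beta> a b"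
  using lift_exists[OF V \<beta>] by blast
 have "h : lca_hom T V" by (rule lift_multiplicative[OF V h(1)]) (simp add: h(2) A.m_closed B.m_closed mult)
 with h(2) show ?thesis by blast
qed

lemma tensor_lift:
 assumes V: "LCA V" and \<beta>: "bdd_bil_on A B V \<beta>"
  and mult: "!!a b a' b'. [|a : carrier A; b : carrier B; a' : carrier A; b' : carrier B|] ==>
   \<beta> (a \<otimes>\<^sub>A a') (b \<otimes>\<^sub>B b') = \<beta> a b \<otimes>\<^sub>V \<beta> a' b'"
 shows "tensor_lift A B T t V \<beta> : lca_hom T V"
  "[|a : carrier A; b : carrier B|] ==> tensor_lift A B T t V \<beta> (t a b) = \<beta> a b"
proof -
 have "\<exists>h. h : lca_hom T V & (\<forall>a\<in>carrier A. \<forall>b\<in>carrier B. h (t a b) = \<beta> a b)"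
  using lift_hom_exists[OF assms] by blast
 note * = someI_ex[OF this, folded tensor_lift_def]
 show "tensor_lift A B T t V \<beta> : lca_hom T V"
  "[|a : carrier A; b : carrier B|] ==> tensor_lift A B T t V \<beta> (t a b) = \<beta> a b"
  using * by blast+
qed

text \<open>For each \<open>c\<close> the universal property gives a map on \<open>T\<close>. The
  difficulty is that these maps be jointly bounded in \<open>w\<close> and \<open>c\<close>; for
  this the estimate on \<open>T\<close> must use a seminorm independent of \<open>c\<close>.\<close>

lemma trilinear_lift:
 assumes C: "LCA C" and V: "LCA V"
  and bil: "!!c. c : carrier C ==> bilinear_on A B V (%a b. \<tau> a b c)"
  and lin: "!!a b c c' z. [|a : carrier A; b : carrier B; c : carrier C; c' : carrier C|] ==>
   \<tau> a b (c \<oplus>\<^sub>C c') = \<tau> a b c \<oplus>\<^sub>V \<tau> a b c' & \<tau> a b (z \<odot>\<^sub>C c) = z \<odot>\<^sub>V \<tau> a b c"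
  and bd: "!!s. s : CS V ==> \<exists>p\<in>CS A. \<exists>q\<in>CS B. \<exists>r\<in>CS C.
   \<forall>a\<in>carrier A. \<forall>b\<in>carrier B. \<forall>c\<in>carrier C. s (\<tau> a b c) <= r c * (p a * q b)"
 shows "\<exists>\<Gamma>. bdd_bil_on T C V \<Gamma> &
  (\<forall>a\<in>carrier A. \<forall>b\<in>carrier B. \<forall>c\<in>carrier C. \<Gamma> (t a b) c = \<tau> a b c)"
proof -
 interpret C: locally_convex_algebra C by fact
 interpret V: locally_convex_algebra V by fact
 have "\<exists>h\<in>clin T V. \<forall>a\<in>carrier A. \<forall>b\<in>carrier B. h (t a b) = \<tau> a b c" if c: "c : carrier C" for c
 proof (rule lift_exists[OF V], unfold bdd_bil_on_def, intro conjI bil c ballI)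
  fix s assume "s : CS V"
  then obtain p q r where pqr: "p : CS A" "q : CS B" "r : CS C"
   "\<forall>a\<in>carrier A. \<forall>b\<in>carrier B. \<forall>c\<in>carrier C. s (\<tau> a b c) <= r c * (p a * q b)" using bd by metis
  then show "\<exists>p\<in>CS A. \<exists>q\<in>CS B. \<forall>a\<in>carrier A. \<forall>b\<in>carrier B. s (\<tau> a b c) <= p a * q b"
   using c csD(3)[OF pqr(3) c] by (intro bexI[OF _ cs_scale[of p A "r c"]] bexI[OF _ pqr(2)]) (auto simp: mult.assoc)
 qed
 then obtain h where h: "!!c. c : carrier C ==> h c : clin T V"
  "!!a b c. [|a : carrier A; b : carrier B; c : carrier C|] ==> h c (t a b) = \<tau> a b c" by metis
 note hD = clinD[OF h(1)]
 have add: "h (c \<oplus>\<^sub>C c') w = h c w \<oplus>\<^sub>V h c' w" if c: "c : carrier C" "c' : carrier C" and w: "w : carrier T" for c c' w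
 proof (rule clin_unique[OF V h(1) _ _ w])
  show "(%w. h c w \<oplus>\<^sub>V h c' w) : clin T V"
  proof (rule clinI[OF T.lca_axioms V])
   fix s assume s: "s : CS V"
   show "\<exists>p\<in>CS T. \<forall>x\<in>carrier T. s (h c x \<oplus>\<^sub>V h c' x) <= p x"
    using cs_add[OF clin_bound[OF h(1)[OF c(1)] s] clin_bound[OF h(1)[OF c(2)] s]] csD(4)[OF s] hD(2) c
    by (intro bexI[of _ "%x. s (h c x) + s (h c' x)"]) auto
  qed (use c hD in \<open>auto simp: hom_def V.sm_add_right V.sm_closed V.M.a_ac\<close>)
 qed (use c h(2) lin in auto)
 have sm: "h (z \<odot>\<^sub>C c) w = z \<odot>\<^sub>V h c w" if c: "c : carrier C" and w: "w : carrier T" for c z w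
 proof (rule clin_unique[OF V h(1) _ _ w])
  show "(%w. z \<odot>\<^sub>V h c w) : clin T V"
  proof (rule clinI[OF T.lca_axioms V])
   fix s assume s: "s : CS V"
   show "\<exists>p\<in>CS T. \<forall>x\<in>carrier T. s (z \<odot>\<^sub>V h c x) <= p x"
    using cs_scale[OF clin_bound[OF h(1)[OF c] s], of "cmod z"] hD(2)[OF c]
    by (intro bexI[of _ "%x. cmod z * s (h c x)"]) (auto simp: csD(5)[OF s])
  qed (use c hD in \<open>auto simp: hom_def V.sm_closed V.sm_add_right V.sm_assoc[symmetric] mult.commute\<close>)
 qed (use c h(2) lin in \<open>auto simp: C.sm_closed\<close>)
 have "bdd_bil_on T C V (%w c. h c w)" unfolding bdd_bil_on_def
 proof (intro conjI ballI)
  show "bilinear_on T C V (%w c. h c w)" unfolding bilinear_on_def using hD add sm by auto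
  fix s assume s: "s : CS V"
  then obtain p q r where pqr: "p : CS A" "q : CS B" "r : CS C"
   "\<forall>a\<in>carrier A. \<forall>b\<in>carrier B. \<forall>c\<in>carrier C. s (\<tau> a b c) <= r c * (p a * q b)" using bd by metis
  obtain s' where s': "s' : CS T" "\<forall>F\<in>CS T. \<forall>K\<ge>0.
   (\<forall>a\<in>carrier A. \<forall>b\<in>carrier B. F (t a b) <= K * (p a * q b)) \<longrightarrow> (\<forall>w\<in>carrier T. F w <= K * s' w)"
   using dominate[OF pqr(1,2)] by blast
  \<comment> \<open>\<open>dominate\<close> with \<open>F\<close> the seminorm of \<open>h c\<close>
    and \<open>K = r c\<close>; its seminorm \<open>s'\<close> does not depend on
    \<open>c\<close>.\<close>
  have "s (h c w) <= s' w * r c" if "w : carrier T" "c : carrier C" for w c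
   using s'(2)[THEN bspec, OF clin_bound[OF h(1)[OF that(2)] s], THEN spec, of "r c"] csD(3)[OF pqr(3) that(2)]
    pqr(4) that h(2) by (simp add: mult.commute)
  then show "\<exists>p\<in>CS T. \<exists>q\<in>CS C. \<forall>a\<in>carrier T. \<forall>b\<in>carrier C. s (h b a) <= p a * q b"
   using s'(1) pqr(3) by blast
 qed
 then show ?thesis using h(2) by (intro exI[of _ "%w c. h c w"]) auto
qed

end

section \<open>Associativity of the tensor product\<close>

locale tensor_triple = AB: tpair A B AB t1 + X: tpair AB C X t2 + BC: tpair B C BC t3 + Y: tpair A BC Y t4
 for A :: "'a lca" and B :: "'b lca" and AB :: "'d lca" and t1 and C :: "'c lca" and X :: "'e lca" and t2
  and BC :: "'f lca" and t3 and Y :: "'g lca" and t4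
begin

lemma unique_left:
 assumes V: "LCA V" and f: "f : clin X V" and g: "g : clin X V"
  and eq: "!!a b c. [|a : carrier A; b : carrier B; c : carrier C|] ==> f (t2 (t1 a b) c) = g (t2 (t1 a b) c)"
  and x: "x : carrier X" shows "f x = g x"
proof (rule X.clin_unique[OF V f g _ x])
 fix w c assume w: "w : carrier AB" and c: "c : carrier C"
 show "f (t2 w c) = g (t2 w c)"
  using AB.clin_unique[OF V clin_comp[OF X.t_clin_left[OF c] f] clin_comp[OF X.t_clin_left[OF c] g] _ w] eq c by simp
qed

lemma unique_right:
 assumes V: "LCA V" and f: "f : clin Y V" and g: "g : clin Y V"
  and eq: "!!a b c. [|a : carrier A; b : carrier B; c : carrier C|] ==> f (t4 a (t3 b c)) = g (t4 a (t3 b c))"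
  and x: "x : carrier Y" shows "f x = g x"
proof (rule Y.clin_unique[OF V f g _ x])
 fix a w assume w: "w : carrier BC" and a: "a : carrier A"
 show "f (t4 a w) = g (t4 a w)"
  using BC.clin_unique[OF V clin_comp[OF Y.t_clin_right[OF a] f] clin_comp[OF Y.t_clin_right[OF a] g] _ w] eq a by simp
qed

lemma assoc_right:
 shows "\<exists>h\<in>clin X Y. \<forall>a\<in>carrier A. \<forall>b\<in>carrier B. \<forall>c\<in>carrier C. h (t2 (t1 a b) c) = t4 a (t3 b c)"
proof -
 note b3 = bilD[OF BC.t_bilinear] and b4 = bilD[OF Y.t_bilinear]
 have "\<exists>\<Gamma>. bdd_bil_on AB C Y \<Gamma> &
  (\<forall>a\<in>carrier A. \<forall>b\<in>carrier B. \<forall>c\<in>carrier C. \<Gamma> (t1 a b) c = t4 a (t3 b c))"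
 proof (rule AB.trilinear_lift[OF X.B.lca_axioms Y.T.lca_axioms])
  fix s assume "s : CS Y"
  then obtain p q where pq: "p : CS A" "q : CS BC" "\<forall>a\<in>carrier A. \<forall>b\<in>carrier BC. s (t4 a b) <= p a * q b"
   using bdd_bilD(2)[OF Y.t_bounded] by meson
  obtain p' q' where pq': "p' : CS B" "q' : CS C" "\<forall>a\<in>carrier B. \<forall>b\<in>carrier C. q (t3 a b) <= p' a * q' b"
   using bdd_bilD(2)[OF BC.t_bounded pq(2)] by meson
  have "s (t4 a (t3 b c)) <= q' c * (p a * p' b)" if abc: "a : carrier A" "b : carrier B" "c : carrier C" for a b c
  proof -
   have "s (t4 a (t3 b c)) <= p a * q (t3 b c)" using pq abc b3 by auto
   also have "... <= p a * (p' b * q' c)" using pq' abc csD(3)[OF pq(1) abc(1)] by (intro mult_left_mono) auto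
   finally show ?thesis by (simp add: mult_ac)
  qed
  then show "\<exists>p\<in>CS A. \<exists>q\<in>CS B. \<exists>r\<in>CS C.
   \<forall>a\<in>carrier A. \<forall>b\<in>carrier B. \<forall>c\<in>carrier C. s (t4 a (t3 b c)) <= r c * (p a * q b)"
   using pq(1) pq'(1,2) by blast
 qed (use b3 b4 in \<open>auto simp: bilinear_on_def\<close>)
 then obtain \<Gamma> where \<Gamma>: "bdd_bil_on AB C Y \<Gamma>"
  "\<forall>a\<in>carrier A. \<forall>b\<in>carrier B. \<forall>c\<in>carrier C. \<Gamma> (t1 a b) c = t4 a (t3 b c)" by blast
 obtain h where "h : clin X Y" "\<forall>w\<in>carrier AB. \<forall>c\<in>carrier C. h (t2 w c) = \<Gamma> w c"
  using X.lift_exists[OF Y.T.lca_axioms \<Gamma>(1)] by blast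
 then show ?thesis using \<Gamma>(2) AB.t_closed by (intro bexI[of _ h]) auto
qed

text \<open>Here \<open>BC\<close> is the tensor product being mapped and \<open>A\<close> the
  additional variable, so the bilinear map arises with its arguments exchanged.\<close>

lemma assoc_left:
 shows "\<exists>h\<in>clin Y X. \<forall>a\<in>carrier A. \<forall>b\<in>carrier B. \<forall>c\<in>carrier C. h (t4 a (t3 b c)) = t2 (t1 a b) c"
proof -
 note b1 = bilD[OF AB.t_bilinear] and b2 = bilD[OF X.t_bilinear]
 have "\<exists>\<Gamma>. bdd_bil_on BC A X \<Gamma> &
  (\<forall>b\<in>carrier B. \<forall>c\<in>carrier C. \<forall>a\<in>carrier A. \<Gamma> (t3 b c) a = t2 (t1 a b) c)"
 proof (rule BC.trilinear_lift[OF AB.A.lca_axioms X.T.lca_axioms])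
  fix s assume "s : CS X"
  then obtain p q where pq: "p : CS AB" "q : CS C" "\<forall>a\<in>carrier AB. \<forall>b\<in>carrier C. s (t2 a b) <= p a * q b"
   using bdd_bilD(2)[OF X.t_bounded] by meson
  obtain p' q' where pq': "p' : CS A" "q' : CS B" "\<forall>a\<in>carrier A. \<forall>b\<in>carrier B. p (t1 a b) <= p' a * q' b"
   using bdd_bilD(2)[OF AB.t_bounded pq(1)] by meson
  have "s (t2 (t1 a b) c) <= p' a * (q' b * q c)" if abc: "a : carrier A" "b : carrier B" "c : carrier C" for a b c
  proof -
   have "s (t2 (t1 a b) c) <= p (t1 a b) * q c" using pq abc b1 by auto
   also have "... <= (p' a * q' b) * q c" using pq' abc csD(3)[OF pq(2) abc(3)] by (intro mult_right_mono) auto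
   finally show ?thesis by (simp add: mult_ac)
  qed
  then show "\<exists>p\<in>CS B. \<exists>q\<in>CS C. \<exists>r\<in>CS A.
   \<forall>b\<in>carrier B. \<forall>c\<in>carrier C. \<forall>a\<in>carrier A. s (t2 (t1 a b) c) <= r a * (p b * q c)"
   using pq(2) pq'(1,2) by blast
 qed (use b1 b2 in \<open>auto simp: bilinear_on_def\<close>)
 then obtain \<Gamma> where \<Gamma>: "bdd_bil_on BC A X \<Gamma>"
  "\<forall>b\<in>carrier B. \<forall>c\<in>carrier C. \<forall>a\<in>carrier A. \<Gamma> (t3 b c) a = t2 (t1 a b) c" by blast
 obtain h where "h : clin Y X" "\<forall>a\<in>carrier A. \<forall>w\<in>carrier BC. h (t4 a w) = \<Gamma> w a"
  using Y.lift_exists[OF X.T.lca_axioms bdd_bil_flip[OF \<Gamma>(1)]] by blast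
 then show ?thesis using \<Gamma>(2) BC.t_closed by (intro bexI[of _ h]) auto
qed

lemma assoc_iso:
 shows "\<exists>h\<in>lca_iso X Y. \<forall>a\<in>carrier A. \<forall>b\<in>carrier B. \<forall>c\<in>carrier C. h (t2 (t1 a b) c) = t4 a (t3 b c)"
proof -
 obtain h where h: "h : clin X Y" "!!a b c. [|a : carrier A; b : carrier B; c : carrier C|] ==> h (t2 (t1 a b) c) = t4 a (t3 b c)"
  using assoc_right by auto
 obtain k where k: "k : clin Y X" "!!a b c. [|a : carrier A; b : carrier B; c : carrier C|] ==> k (t4 a (t3 b c)) = t2 (t1 a b) c"
  using assoc_left by auto
 note LX = X.T.lca_axioms and LY = Y.T.lca_axioms
 have kh: "k (h x) = x" if "x : carrier X" for x
  using unique_left[OF LX clin_comp[OF h(1) k(1)] clin_ident _ that] h k by simp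
 have hk: "h (k y) = y" if "y : carrier Y" for y
  using unique_right[OF LY clin_comp[OF k(1) h(1)] clin_ident _ that] h k by simp
 have "h : lca_hom X Y"
 proof (rule X.lift_multiplicative[OF LY h(1)])
  note hc = clinD(2)[OF h(1)]
  \<comment> \<open>Multiplicativity is extended in stages: from elementary tensors in
    \<open>AB\<close> to an arbitrary left factor \<open>w\<close>, then to an arbitrary right
    factor \<open>w'\<close>.\<close>
  have 0: "h (t2 (t1 a b \<otimes>\<^sub>AB t1 a' b') (c \<otimes>\<^sub>C c')) = h (t2 (t1 a b) c) \<otimes>\<^sub>Y h (t2 (t1 a' b') c')"
   if "a : carrier A" "b : carrier B" "c : carrier C" "a' : carrier A" "b' : carrier B" "c' : carrier C" for a b c a' b' c'
   using that by (simp add: AB.t_mult h(2) AB.A.m_closed AB.B.m_closed X.B.m_closed Y.t_mult BC.t_mult[symmetric] BC.t_closed)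
  have 1: "h (t2 (w \<otimes>\<^sub>AB t1 a' b') (c \<otimes>\<^sub>C c')) = h (t2 w c) \<otimes>\<^sub>Y h (t2 (t1 a' b') c')"
   if "w : carrier AB" "c : carrier C" "a' : carrier A" "b' : carrier B" "c' : carrier C" for w c a' b' c'
   using AB.clin_unique[OF LY clin_comp[OF clin_comp[OF AB.T.mult_clin_right X.t_clin_left] h(1)]
     clin_comp[OF clin_comp[OF X.t_clin_left h(1)] Y.T.mult_clin_right], of "t1 a' b'" "c \<otimes>\<^sub>C c'" c "h (t2 (t1 a' b') c')" w]
    that by (simp add: 0 hc X.t_closed AB.t_closed X.B.m_closed)
  fix w c w' c' assume as: "w : carrier AB" "c : carrier C" "w' : carrier AB" "c' : carrier C"
  show "h (t2 (w \<otimes>\<^sub>AB w') (c \<otimes>\<^sub>C c')) = h (t2 w c) \<otimes>\<^sub>Y h (t2 w' c')"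
   using AB.clin_unique[OF LY clin_comp[OF clin_comp[OF AB.T.mult_clin_left X.t_clin_left] h(1)]
     clin_comp[OF clin_comp[OF X.t_clin_left h(1)] Y.T.mult_clin_left], of w "c \<otimes>\<^sub>C c'" c' "h (t2 w c)" w']
    as by (simp add: 1 hc X.t_closed X.B.m_closed)
 qed
 moreover have "homeomorphic_map (topo X) (topo Y) h" unfolding homeomorphic_map_maps homeomorphic_maps_def
  using clinD(5)[OF h(1)] clinD(5)[OF k(1)] kh hk by (intro exI[of _ k]) (auto simp: X.T.topspace Y.T.topspace)
 ultimately show ?thesis using h(2) by (intro bexI[of _ h]) (auto simp: lca_iso_def)
qed

end

section \<open>Isomorphisms and unitisations\<close>

text \<open>What inverting an isomorphism requires of its source. It can be checked for a
  unitisation directly from the formulas, whereas completeness is known for the copy in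
  \<open>Obj\<close>.\<close>

definition lca_like :: "'a lca => bool" where
 "lca_like X \<longleftrightarrow> abelian_group X & (\<forall>c. \<forall>x\<in>carrier X. c \<odot>\<^sub>X x : carrier X) &
  (\<forall>x\<in>carrier X. \<forall>y\<in>carrier X. x \<otimes>\<^sub>X y : carrier X) & topspace (topo X) = carrier X"

lemma (in locally_convex_algebra) lca_like: "lca_like A"
 unfolding lca_like_def by (auto simp: topspace m_closed sm_closed intro: M.abelian_group_axioms)

lemma iso_hom: "f : lca_iso X Y ==> f : lca_hom X Y" by (simp add: lca_iso_def)

lemma lca_iso_inv_into:
 assumes X: "lca_like X" and Y: "topspace (topo Y) = carrier Y" and f: "f : lca_iso X Y"
 defines "g \<equiv> inv_into (carrier X) f"
 shows "g : lca_iso Y X" "!!x. x : carrier X ==> g (f x) = x" "!!y. y : carrier Y ==> f (g y) = y"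
proof -
 have tX: "topspace (topo X) = carrier X" using X by (simp add: lca_like_def)
 have fh: "f : lca_hom X Y" and hm: "homeomorphic_map (topo X) (topo Y) f" using f by (auto simp: lca_iso_def)
 note fD = homD[OF fh]
 obtain g' where g': "homeomorphic_maps (topo X) (topo Y) f g'" using hm homeomorphic_map_maps by blast
 then have g'D: "!!x. x : carrier X ==> g' (f x) = x" "!!y. y : carrier Y ==> f (g' y) = y & g' y : carrier X"
  by (auto simp: homeomorphic_maps_def tX Y continuous_map_def)
 have bij: "bij_betw f (carrier X) (carrier Y)" by (rule bij_betw_byWitness[of _ g']) (use g'D fD(3) in auto)
 show gf: "!!x. x : carrier X ==> g (f x) = x" and fg: "!!y. y : carrier Y ==> f (g y) = y"
  using bij by (auto simp: g_def bij_betw_def f_inv_into_f)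
 have gc: "g y : carrier X" if "y : carrier Y" for y
  using bij that by (auto simp: g_def bij_betw_def inv_into_into)
 have gg': "g y = g' y" if "y : carrier Y" for y using gf[of "g' y"] g'D(2)[OF that] by simp
 have "continuous_map (topo Y) (topo X) g"
  by (rule continuous_map_eq[of _ _ g']) (use g' gg' in \<open>auto simp: homeomorphic_maps_def Y\<close>)
 then have "homeomorphic_maps (topo Y) (topo X) g f"
  using homD(6)[OF fh] gf fg by (auto simp: homeomorphic_maps_def tX Y)
 then have hg: "homeomorphic_map (topo Y) (topo X) g" "continuous_map (topo Y) (topo X) g"
  using homeomorphic_map_maps by (auto simp: homeomorphic_maps_def)
 interpret ab: abelian_group X using X by (simp add: lca_like_def)
 have "g (y \<oplus>\<^sub>Y y') = g y \<oplus>\<^sub>X g y'" "g (y \<otimes>\<^sub>Y y') = g y \<otimes>\<^sub>X g y'" "g (c \<odot>\<^sub>Y y) = c \<odot>\<^sub>X g y"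
  if y: "y : carrier Y" "y' : carrier Y" for y y' c
 proof -
  have cl: "g y \<otimes>\<^sub>X g y' : carrier X" "c \<odot>\<^sub>X g y : carrier X"
   using X gc y by (auto simp: lca_like_def)
  show "g (y \<oplus>\<^sub>Y y') = g y \<oplus>\<^sub>X g y'"
   using gf[of "g y \<oplus>\<^sub>X g y'"] fD(4)[of "g y" "g y'"] gc y fg by simp
  show "g (y \<otimes>\<^sub>Y y') = g y \<otimes>\<^sub>X g y'"
   using gf[OF cl(1)] fD(7)[of "g y" "g y'"] gc y fg by simp
  show "g (c \<odot>\<^sub>Y y) = c \<odot>\<^sub>X g y" using gf[OF cl(2)] fD(5)[of "g y" c] gc y fg by simp
 qed
 then show "g : lca_iso Y X" using hg gc by (auto simp: lca_iso_def lca_hom_def hom_def)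
qed

text \<open>\<open>KG_cup\<close> refers to tensor products of the unitisations themselves, whereas
  the universe supplies tensor products of their copies. This lemma passes between the two.\<close>

lemma proj_tensor_iso:
 assumes X: "lca_like X1" "lca_like X2" and U: "lca_like U1" "lca_like U2"
  and f: "f : lca_iso X1 U1" and g: "g : lca_iso X2 U2" and P: "proj_tensor U1 U2 R r"
 shows "proj_tensor X1 X2 R (%a b. r (f a) (g b))"
proof -
 let ?\<rho> = "%a b. r (f a) (g b)"
 have tU: "topspace (topo U1) = carrier U1" "topspace (topo U2) = carrier U2" using U by (auto simp: lca_like_def)
 note fi = lca_iso_inv_into[OF X(1) tU(1) f] and gi = lca_iso_inv_into[OF X(2) tU(2) g]
 define f' where "f' = inv_into (carrier X1) f"
 define g' where "g' = inv_into (carrier X2) g"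
 note fi = fi[folded f'_def] and gi = gi[folded g'_def]
 note fD = homD[OF iso_hom[OF f]] and gD = homD[OF iso_hom[OF g]]
 note f'D = homD[OF iso_hom[OF fi(1)]] and g'D = homD[OF iso_hom[OF gi(1)]]
 interpret R: locally_convex_algebra R using P by (simp add: proj_tensor_def)
 have rb: "bilinear_on U1 U2 R r" using P by (simp add: proj_tensor_def)
 have reps1: "(n, %i. f (a i), %i. g (b i)) : tensor_reps U1 U2 R r w" if "(n, a, b) : tensor_reps X1 X2 R ?\<rho> w" for n a b w
  using that fD(3) gD(3) by (auto simp: tensor_reps_def)
 have reps2: "(n, %i. f' (a i), %i. g' (b i)) : tensor_reps X1 X2 R ?\<rho> w" if "(n, a, b) : tensor_reps U1 U2 R r w" for n a b w
  using that f'D(3) g'D(3) by (auto simp: tensor_reps_def fi(3) gi(3) Pi_iff intro!: finsum_congr)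
 have sp: "tensor_span X1 X2 R ?\<rho> = tensor_span U1 U2 R r" using reps1 reps2 by (force simp: tensor_span_def)
 have ps: "proj_seminorm X1 X2 R ?\<rho> (%x. p (f x)) (%x. q (g x)) w = proj_seminorm U1 U2 R r p q w" for p q w
 proof -
  have "(%(n, a, b). \<Sum>i<n. p (f (a i)) * q (g (b i))) ` tensor_reps X1 X2 R ?\<rho> w =
   (%(n, a, b). \<Sum>i<n. p (a i) * q (b i)) ` tensor_reps U1 U2 R r w"
  proof (intro equalityI subsetI)
   fix x assume "x : (%(n, a, b). \<Sum>i<n. p (f (a i)) * q (g (b i))) ` tensor_reps X1 X2 R ?\<rho> w"
   then obtain n a b where "(n, a, b) : tensor_reps X1 X2 R ?\<rho> w" "x = (\<Sum>i<n. p (f (a i)) * q (g (b i)))" by auto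
   then show "x : (%(n, a, b). \<Sum>i<n. p (a i) * q (b i)) ` tensor_reps U1 U2 R r w"
    using reps1 by (intro image_eqI[of _ _ "(n, %i. f (a i), %i. g (b i))"]) auto
  next
   fix x assume "x : (%(n, a, b). \<Sum>i<n. p (a i) * q (b i)) ` tensor_reps U1 U2 R r w"
   then obtain n a b where n: "(n, a, b) : tensor_reps U1 U2 R r w" "x = (\<Sum>i<n. p (a i) * q (b i))" by auto
   then have "a i : carrier U1" "b i : carrier U2" if "i < n" for i using that by (auto simp: tensor_reps_def)
   then show "x : (%(n, a, b). \<Sum>i<n. p (f (a i)) * q (g (b i))) ` tensor_reps X1 X2 R ?\<rho> w"
    using reps2[OF n(1)] n(2)
    by (intro image_eqI[of _ _ "(n, %i. f' (a i), %i. g' (b i))"]) (auto simp: fi(3) gi(3))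
  qed
  then show ?thesis by (simp add: proj_seminorm_def)
 qed
 have cs_eq: "proj_seminorm X1 X2 R ?\<rho> p q w = proj_seminorm U1 U2 R r (%x. p (f' x)) (%x. q (g' x)) w" for p q w
 proof -
  have "proj_seminorm X1 X2 R ?\<rho> (%x. p (f' (f x))) (%x. q (g' (g x))) w = proj_seminorm X1 X2 R ?\<rho> p q w"
   unfolding proj_seminorm_def
  proof (rule INF_cong[OF refl])
   fix x assume "x : tensor_reps X1 X2 R ?\<rho> w"
   then obtain n a b where x: "x = (n, a, b)" "(n, a, b) : tensor_reps X1 X2 R ?\<rho> w" by (cases x) auto
   then have "a i : carrier X1" "b i : carrier X2" if "i < n" for i using that by (auto simp: tensor_reps_def)
   then show "(case x of (n, a, b) => \<Sum>i<n. p (f' (f (a i))) * q (g' (g (b i)))) = (case x of (n, a, b) => \<Sum>i<n. p (a i) * q (b i))"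
    by (simp add: x fi(2) gi(2))
  qed
  then show ?thesis using ps[of "%x. p (f' x)" "%x. q (g' x)"] by simp
 qed
 have inj: "tensor_injective X1 X2 R ?\<rho>" unfolding tensor_injective_def
 proof (intro allI ballI impI)
  fix n a b i assume a: "a : {..<n} \<rightarrow> carrier X1" and b: "b : {..<n} \<rightarrow> carrier X2" and i: "i < n"
   and li: "lin_indep_family X1 n a & (\<Oplus>\<^sub>R i\<in>{..<n}. r (f (a i)) (g (b i))) = \<zero>\<^sub>R"
  have aX: "abelian_group X1" "abelian_group U1" "abelian_group X2" "abelian_group U2" using X U by (auto simp: lca_like_def)
  have "lin_indep_family U1 n (%i. f (a i))" unfolding lin_indep_family_def
  proof (intro allI impI)
   fix c k assume c: "(\<Oplus>\<^sub>U1 i\<in>{..<n}. c i \<odot>\<^sub>U1 f (a i)) = \<zero>\<^sub>U1" and k: "k < n"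
   have fa: "f (a i) : carrier U1" "a i : carrier X1" if "i < n" for i using a fD(3) that by auto
   have "(\<Oplus>\<^sub>X1 i\<in>{..<n}. c i \<odot>\<^sub>X1 a i) = (\<Oplus>\<^sub>X1 i\<in>{..<n}. f' (c i \<odot>\<^sub>U1 f (a i)))"
    using fa by (intro finsum_congr) (auto simp: f'D(5) fi(2))
   also have "... = f' (\<Oplus>\<^sub>U1 i\<in>{..<n}. c i \<odot>\<^sub>U1 f (a i))"
    using fa U(1) by (intro add_hom_finsum[OF aX(2,1) f'D(2), symmetric]) (auto simp: lca_like_def)
   also have "... = \<zero>\<^sub>X1" unfolding c by (rule add_hom_zero[OF aX(2,1) f'D(2)])
   finally show "c k = 0" using li k by (auto simp: lin_indep_family_def)
  qed
  note liU = this
  have fa: "(%i. f (a i)) : {..<n} \<rightarrow> carrier U1" and gb: "(%i. g (b i)) : {..<n} \<rightarrow> carrier U2"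
   using a b fD(3) gD(3) by auto
  have "tensor_injective U1 U2 R r" using P by (simp add: proj_tensor_def)
  from this[unfolded tensor_injective_def, THEN spec[of _ n], THEN bspec, OF fa, THEN bspec, OF gb,
    THEN mp, OF conjI[OF liU conjunct2[OF li]]]
  have "\<forall>i<n. g (b i) = \<zero>\<^sub>U2" .
  then have "g' (g (b i)) = \<zero>\<^sub>X2" using i add_hom_zero[OF aX(4,3) g'D(2)] by simp
  moreover have "b i : carrier X2" using b i by auto
  ultimately show "b i = \<zero>\<^sub>X2" by (simp add: gi(2))
 qed
 have openiff: "openin (subtopology (topo R) (tensor_span U1 U2 R r)) W \<longleftrightarrow>
    W \<subseteq> tensor_span U1 U2 R r &
    (\<forall>w\<in>W. \<exists>p\<in>CS U1. \<exists>q\<in>CS U2. \<exists>\<epsilon>>0.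
     {v : tensor_span U1 U2 R r. proj_seminorm U1 U2 R r p q (v \<ominus>\<^sub>R w) < \<epsilon>} \<subseteq> W)" for W
  using P unfolding proj_tensor_def by (elim conjE) (erule spec)
 \<comment> \<open>Continuous seminorms can be pulled back along \<open>f\<close> and
   \<open>g\<close> and along their inverses, so the two families of projective seminorms
   coincide.\<close>
 have quant: "(\<exists>p\<in>CS X1. \<exists>q\<in>CS X2. \<exists>\<epsilon>>0.
     {v : tensor_span U1 U2 R r. proj_seminorm X1 X2 R ?\<rho> p q (v \<ominus>\<^sub>R w) < \<epsilon>} \<subseteq> W) \<longleftrightarrow>
   (\<exists>p\<in>CS U1. \<exists>q\<in>CS U2. \<exists>\<epsilon>>0.
     {v : tensor_span U1 U2 R r. proj_seminorm U1 U2 R r p q (v \<ominus>\<^sub>R w) < \<epsilon>} \<subseteq> W)" (is "?A \<longleftrightarrow> ?B") for w W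
 proof
  assume ?A
  then obtain p q where "p : CS X1" "q : CS X2" "\<exists>\<epsilon>>0.
     {v : tensor_span U1 U2 R r. proj_seminorm U1 U2 R r (%x. p (f' x)) (%x. q (g' x)) (v \<ominus>\<^sub>R w) < \<epsilon>} \<subseteq> W"
   unfolding cs_eq by blast
  then show ?B using clin_bound[OF f'D(1)] clin_bound[OF g'D(1)]
   by (intro bexI[of _ "%x. p (f' x)"] bexI[of _ "%x. q (g' x)"])
 next
  assume ?B
  then obtain p q where "p : CS U1" "q : CS U2" "\<exists>\<epsilon>>0.
     {v : tensor_span U1 U2 R r. proj_seminorm X1 X2 R ?\<rho> (%x. p (f x)) (%x. q (g x)) (v \<ominus>\<^sub>R w) < \<epsilon>} \<subseteq> W"
   unfolding ps by blast
  then show ?A using clin_bound[OF fD(1)] clin_bound[OF gD(1)]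
   by (intro bexI[of _ "%x. p (f x)"] bexI[of _ "%x. q (g x)"])
 qed
 have bil: "bilinear_on X1 X2 R ?\<rho>" using bilD[OF rb] fD(3,4,5) gD(3,4,5) by (auto simp: bilinear_on_def)
 have mul: "\<forall>a\<in>carrier X1. \<forall>a'\<in>carrier X1. \<forall>b\<in>carrier X2. \<forall>b'\<in>carrier X2.
   ?\<rho> a b \<otimes>\<^sub>R ?\<rho> a' b' = ?\<rho> (a \<otimes>\<^sub>X1 a') (b \<otimes>\<^sub>X2 b')"
  using P fD(3,7) gD(3,7) by (auto simp: proj_tensor_def)
 have dense: "topo R closure_of tensor_span U1 U2 R r = carrier R" using P by (simp add: proj_tensor_def)
 show ?thesis unfolding proj_tensor_def sp using R.lca_axioms bil mul inj dense openiff quant by simp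
qed

section \<open>The complex numbers and the unitisation\<close>

lemma cplx_simps: "carrier CL = UNIV" "x \<oplus>\<^bsub>CL\<^esub> y = x + y" "x \<otimes>\<^bsub>CL\<^esub> y = x * y"
 "\<zero>\<^bsub>CL\<^esub> = 0" "\<one>\<^bsub>CL\<^esub> = 1" "c \<odot>\<^bsub>CL\<^esub> x = c * x" "topo CL = euclidean"
 by (simp_all add: complex_lca_def)

lemma cplx_nring: "nring CL"
proof (intro nring.intro nring_axioms.intro abelian_groupI)
 fix x :: complex
 show "\<exists>y\<in>carrier CL. y \<oplus>\<^bsub>CL\<^esub> x = \<zero>\<^bsub>CL\<^esub>"
  by (rule bexI[of _ "- x"]) (auto simp: cplx_simps)
qed (auto simp: cplx_simps algebra_simps)

lemma complex_unit: "is_unit CL 1" by (simp add: is_unit_def cplx_simps)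

lemma unit_simps:
 "carrier (unz A) = UNIV \<times> carrier A"
 "(c, a) \<oplus>\<^bsub>unz A\<^esub> (d, b) = (c + d, a \<oplus>\<^sub>A b)"
 "(c, a) \<otimes>\<^bsub>unz A\<^esub> (d, b) = (c * d, (c \<odot>\<^sub>A b \<oplus>\<^sub>A d \<odot>\<^sub>A a) \<oplus>\<^sub>A a \<otimes>\<^sub>A b)"
 "\<zero>\<^bsub>unz A\<^esub> = (0, \<zero>\<^sub>A)" "\<one>\<^bsub>unz A\<^esub> = (1, \<zero>\<^sub>A)"
 "z \<odot>\<^bsub>unz A\<^esub> (c, a) = (z * c, z \<odot>\<^sub>A a)"
 "topo (unz A) = prod_topology euclidean (topo A)" by (simp_all add: unitization_def)

context locally_convex_algebra
begin

lemma unit_nring: "nring (unz A)"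
proof (intro nring.intro nring_axioms.intro abelian_groupI)
 fix x assume "x : carrier (unz A)"
 then show "\<exists>y\<in>carrier (unz A). y \<oplus>\<^bsub>unz A\<^esub> x = \<zero>\<^bsub>unz A\<^esub>"
  by (intro bexI[of _ "(- fst x, \<ominus> snd x)"]) (auto simp: unit_simps M.l_neg)
next
 fix x y z assume "x : carrier (unz A)" "y : carrier (unz A)" "z : carrier (unz A)"
 then obtain c a d b e f where xyz: "x = (c, a)" "y = (d, b)" "z = (e, f)"
  and [simp]: "a : carrier A" "b : carrier A" "f : carrier A" by (auto simp: unit_simps)
 note [simp] = sm_closed m_closed
 show "(x \<otimes>\<^bsub>unz A\<^esub> y) \<otimes>\<^bsub>unz A\<^esub> z = x \<otimes>\<^bsub>unz A\<^esub> (y \<otimes>\<^bsub>unz A\<^esub> z)"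
  by (simp add: xyz unit_simps sm_add_right l_distr r_distr smult_m_left smult_m_right m_assoc
    sm_assoc[symmetric] M.a_ac mult.commute mult.left_commute)
 show "(x \<oplus>\<^bsub>unz A\<^esub> y) \<otimes>\<^bsub>unz A\<^esub> z = x \<otimes>\<^bsub>unz A\<^esub> z \<oplus>\<^bsub>unz A\<^esub> y \<otimes>\<^bsub>unz A\<^esub> z"
  by (simp add: xyz unit_simps sm_add_right sm_add_left l_distr M.a_ac distrib_right)
 show "z \<otimes>\<^bsub>unz A\<^esub> (x \<oplus>\<^bsub>unz A\<^esub> y) = z \<otimes>\<^bsub>unz A\<^esub> x \<oplus>\<^bsub>unz A\<^esub> z \<otimes>\<^bsub>unz A\<^esub> y"
  by (simp add: xyz unit_simps sm_add_right sm_add_left r_distr M.a_ac distrib_left)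
qed (auto simp: unit_simps M.a_ac m_closed sm_closed)

lemma unitization_unit: "is_unit (unz A) (1, \<zero>)"
 by (auto simp: is_unit_def unit_simps sm_one sm_zero_right N.l_null N.r_null)

lemma unitization_lca_like: "lca_like (unz A)" using unit_nring nring.m_closed[OF unit_nring]
 by (auto simp: lca_like_def nring_def unit_simps sm_closed topspace)

lemma fst_hom: "fst : lca_hom (unz A) CL"
 by (auto simp: lca_hom_def hom_def unit_simps cplx_simps continuous_map_fst)

lemma snd_clin: "snd : clin (unz A) A" by (auto simp: clin_def hom_def unit_simps continuous_map_snd)

lemma incl_hom: "(%a. (0, a)) : lca_hom A (unz A)"
 by (auto simp: lca_hom_def hom_def unit_simps sm_zero_left m_closed continuous_map_pairwise o_def)

lemma scalar_hom: "(%c. (c, \<zero>)) : lca_hom CL (unz A)"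
 by (auto simp: lca_hom_def hom_def unit_simps cplx_simps sm_zero_right N.l_null continuous_map_pairwise o_def topspace)

end

lemma unitization_map_hom:
 assumes "LCA A" "LCA B" "f : lca_hom A B"
 shows "(%(c, a). (c, f a)) : lca_hom (unz A) (unz B)"
proof -
 interpret A: locally_convex_algebra A by fact
 interpret B: locally_convex_algebra B by fact
 note f = homD[OF assms(3)]
 have "continuous_map (prod_topology euclidean (topo A)) (prod_topology euclidean (topo B)) (\<lambda>(c::complex, a). (c, f a))"
  using continuous_map_compose[OF continuous_map_snd f(6)]
  by (auto simp: continuous_map_pairwise o_def case_prod_unfold continuous_map_fst)
 then show ?thesis using f by (auto simp: lca_hom_def hom_def unit_simps A.sm_closed A.m_closed)
qed

section \<open>Split extensions and tensor products\<close>

text \<open>A split extension together with a continuous linear retraction \<open>P\<close> of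
  \<open>i\<close> and the decomposition of every \<open>x\<close> as
  \<open>s (q x) + i (P x)\<close>. These are identities between continuous linear maps, so they
  persist after tensoring; exactness is then recovered from them.\<close>

definition sdata :: "'a lca => 'b lca => 'c lca => ('a => 'b) => ('b => 'c) => ('c => 'b) => ('b => 'a) => bool" where
 "sdata I E Q i q s P \<longleftrightarrow> i : lca_hom I E & q : lca_hom E Q & s : lca_hom Q E & P : clin E I &
  (\<forall>x\<in>carrier I. P (i x) = x) & (\<forall>x\<in>carrier I. q (i x) = \<zero>\<^sub>Q) & (\<forall>x\<in>carrier Q. q (s x) = x) &
  (\<forall>x\<in>carrier E. s (q x) \<oplus>\<^sub>E i (P x) = x)"

lemma sdata_extension:
 assumes I: "LCA I" and E: "LCA E" and Q: "LCA Q"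
  and sd: "sdata I E Q i q s P" shows "split_extension I E Q i q s"
proof -
 interpret I: locally_convex_algebra I by fact
 interpret E: locally_convex_algebra E by fact
 interpret Q: locally_convex_algebra Q by fact
 have h: "i : lca_hom I E" "q : lca_hom E Q" "s : lca_hom Q E" "P : clin E I"
  and Pi: "!!x. x : carrier I ==> P (i x) = x" and qi: "!!x. x : carrier I ==> q (i x) = \<zero>\<^sub>Q"
  and qs: "!!x. x : carrier Q ==> q (s x) = x" and dec: "!!x. x : carrier E ==> s (q x) \<oplus>\<^sub>E i (P x) = x"
  using sd by (auto simp: sdata_def)
 have "embedding_map (topo I) (topo E) i" unfolding embedding_map_def homeomorphic_map_maps homeomorphic_maps_def
  using homD(6)[OF h(1)] clinD(5)[OF h(4)] Pi homD(3)[OF h(1)]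
  by (intro exI[of _ P]) (auto simp: I.topspace E.topspace continuous_map_in_subtopology continuous_map_from_subtopology)
 moreover have "x : i ` carrier I" if "x : carrier E" "q x = \<zero>\<^sub>Q" for x
 proof -
  have "x = i (P x)"
   using dec[OF that(1)] that clin_zero[OF Q E homD(1)[OF h(3)]] homD(3)[OF h(1)] clinD(2)[OF h(4)] by simp
  then show ?thesis using clinD(2)[OF h(4) that(1)] by blast
 qed
 ultimately show ?thesis using h qi qs homD(3)[OF h(1)] by (auto simp: split_extension_def)
qed

section \<open>Tensor products of maps and copies of unitisations in the universe\<close>

context lca_universe
begin

lemma pair: "[|A : Obj; B : Obj|] ==> tpair A B (tens A B) (tm A B)"
 by (intro tpair.intro tpair_axioms.intro obj_lca obj_tens proj_tensor_tens)

text \<open>Defined for continuous linear maps, because the retractions in \<open>sdata\<close> have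
  to be tensored too. On morphisms it is the morphism of \<open>tensor_lift\<close>, by
  \<open>tensor_lift_tmap\<close>.\<close>

definition tmap :: "'u lca => 'u lca => 'u lca => 'u lca => ('u => 'u) => ('u => 'u) => 'u => 'u" where
 "tmap A1 B1 A2 B2 f g = (SOME h. h : clin (tens A1 B1) (tens A2 B2) &
  (\<forall>a\<in>carrier A1. \<forall>b\<in>carrier B1. h (tm A1 B1 a b) = tm A2 B2 (f a) (g b)))"

lemma tmap:
 assumes "A1 : Obj" "B1 : Obj" "A2 : Obj" "B2 : Obj" and f: "f : clin A1 A2" and g: "g : clin B1 B2"
 shows "tmap A1 B1 A2 B2 f g : clin (tens A1 B1) (tens A2 B2)"
  "[|a : carrier A1; b : carrier B1|] ==> tmap A1 B1 A2 B2 f g (tm A1 B1 a b) = tm A2 B2 (f a) (g b)"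
proof -
 interpret P1: tpair A1 B1 "tens A1 B1" "tm A1 B1" by (rule pair) fact+
 interpret P2: tpair A2 B2 "tens A2 B2" "tm A2 B2" by (rule pair) fact+
 have "\<exists>h. h : clin (tens A1 B1) (tens A2 B2) &
  (\<forall>a\<in>carrier A1. \<forall>b\<in>carrier B1. h (tm A1 B1 a b) = tm A2 B2 (f a) (g b))"
  using P1.lift_exists[OF P2.T.lca_axioms bdd_bil_comp[OF P2.t_bounded f g]] by blast
 note * = someI_ex[OF this, folded tmap_def]
 show "tmap A1 B1 A2 B2 f g : clin (tens A1 B1) (tens A2 B2)"
  "[|a : carrier A1; b : carrier B1|] ==> tmap A1 B1 A2 B2 f g (tm A1 B1 a b) = tm A2 B2 (f a) (g b)"
  using * by blast+
qed

lemma tmap_hom: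
 assumes "A1 : Obj" "B1 : Obj" "A2 : Obj" "B2 : Obj" and f: "f : lca_hom A1 A2" and g: "g : lca_hom B1 B2"
 shows "tmap A1 B1 A2 B2 f g : lca_hom (tens A1 B1) (tens A2 B2)"
proof -
 interpret P1: tpair A1 B1 "tens A1 B1" "tm A1 B1" by (rule pair) fact+
 interpret P2: tpair A2 B2 "tens A2 B2" "tm A2 B2" by (rule pair) fact+
 note t = tmap[OF assms(1-4) homD(1)[OF f] homD(1)[OF g]]
 show ?thesis by (rule P1.lift_multiplicative[OF P2.T.lca_axioms t(1)])
   (simp add: t(2) P1.A.m_closed P1.B.m_closed homD(3,7)[OF f] homD(3,7)[OF g] P2.t_mult)
qed

lemma tensor_lift_tmap:
 assumes A: "A1 : Obj" "B1 : Obj" "A2 : Obj" "B2 : Obj" and f: "f : lca_hom A1 A2" and g: "g : lca_hom B1 B2"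
 shows "tensor_lift A1 B1 (tens A1 B1) (tm A1 B1) (tens A2 B2) (%a b. tm A2 B2 (f a) (g b)) : lca_hom (tens A1 B1) (tens A2 B2)"
  "w : carrier (tens A1 B1) ==>
   tensor_lift A1 B1 (tens A1 B1) (tm A1 B1) (tens A2 B2) (%a b. tm A2 B2 (f a) (g b)) w = tmap A1 B1 A2 B2 f g w"
proof -
 interpret P1: tpair A1 B1 "tens A1 B1" "tm A1 B1" by (rule pair) fact+
 interpret P2: tpair A2 B2 "tens A2 B2" "tm A2 B2" by (rule pair) fact+
 note fD = homD[OF f] and gD = homD[OF g]
 have mult: "tm A2 B2 (f (a \<otimes>\<^sub>A1 a')) (g (b \<otimes>\<^sub>B1 b')) = tm A2 B2 (f a) (g b) \<otimes>\<^bsub>tens A2 B2\<^esub> tm A2 B2 (f a') (g b')"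
  if "a : carrier A1" "b : carrier B1" "a' : carrier A1" "b' : carrier B1" for a b a' b'
  using that by (simp add: fD gD P2.t_mult)
 note tl = P1.tensor_lift[OF P2.T.lca_axioms bdd_bil_comp[OF P2.t_bounded fD(1) gD(1)]]
 let ?l = "tensor_lift A1 B1 (tens A1 B1) (tm A1 B1) (tens A2 B2) (%a b. tm A2 B2 (f a) (g b))"
 show h: "?l : lca_hom (tens A1 B1) (tens A2 B2)" by (rule tl(1)) (rule mult)
 have v: "?l (tm A1 B1 a b) = tm A2 B2 (f a) (g b)" if "a : carrier A1" "b : carrier B1" for a b
  by (rule tl(2)[OF _ that]) (rule mult)
 show "?l w = tmap A1 B1 A2 B2 f g w" if "w : carrier (tens A1 B1)"
  by (rule P1.clin_unique[OF P2.T.lca_axioms homD(1)[OF h] tmap(1)[OF A fD(1) gD(1)] _ that])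
   (simp add: v tmap(2)[OF A fD(1) gD(1)])
qed

text \<open>The decomposition \<open>dec\<close> is not automatic for a tensor product of two
  extensions. It holds when one of them is replaced by an algebra with identity maps in all places,
  which are the two cases below.\<close>

lemma sdata_tmap:
 assumes O: "I : Obj" "E : Obj" "Q : Obj" "I' : Obj" "E' : Obj" "Q' : Obj"
  and i: "i : lca_hom I E" "i' : lca_hom I' E'" and q: "q : lca_hom E Q" "q' : lca_hom E' Q'"
  and s: "s : lca_hom Q E" "s' : lca_hom Q' E'" and P: "P : clin E I" "P' : clin E' I'"
  and Pi: "\<forall>x\<in>carrier I. P (i x) = x" "\<forall>x\<in>carrier I'. P' (i' x) = x"
  and qs: "\<forall>x\<in>carrier Q. q (s x) = x" "\<forall>x\<in>carrier Q'. q' (s' x) = x"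
  and qi: "!!x y. [|x : carrier I; y : carrier I'|] ==> tm Q Q' (q (i x)) (q' (i' y)) = \<zero>\<^bsub>tens Q Q'\<^esub>"
  and dec: "!!x y. [|x : carrier E; y : carrier E'|] ==>
   tm E E' (s (q x)) (s' (q' y)) \<oplus>\<^bsub>tens E E'\<^esub> tm E E' (i (P x)) (i' (P' y)) = tm E E' x y"
 shows "sdata (tens I I') (tens E E') (tens Q Q') (tmap I I' E E' i i') (tmap E E' Q Q' q q')
  (tmap Q Q' E E' s s') (tmap E E' I I' P P')"
proof -
 interpret I: tpair I I' "tens I I'" "tm I I'" by (rule pair) fact+
 interpret E: tpair E E' "tens E E'" "tm E E'" by (rule pair) fact+
 interpret Q: tpair Q Q' "tens Q Q'" "tm Q Q'" by (rule pair) fact+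
 note LI = I.T.lca_axioms and LE = E.T.lca_axioms and LQ = Q.T.lca_axioms
 note ic = homD(1)[OF i(1)] homD(1)[OF i(2)] and qc = homD(1)[OF q(1)] homD(1)[OF q(2)]
  and sc = homD(1)[OF s(1)] homD(1)[OF s(2)]
 note ti = tmap[OF O(1,4,2,5) ic] and tq = tmap[OF O(2,5,3,6) qc] and ts = tmap[OF O(3,6,2,5) sc] and tP = tmap[OF O(2,5,1,4) P]
 note c = clinD(2)[OF ic(1)] clinD(2)[OF ic(2)] clinD(2)[OF qc(1)] clinD(2)[OF qc(2)] clinD(2)[OF sc(1)] clinD(2)[OF sc(2)]
  clinD(2)[OF P(1)] clinD(2)[OF P(2)]
 have 1: "tmap E E' I I' P P' (tmap I I' E E' i i' x) = x" if "x : carrier (tens I I')" for x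
  using I.clin_unique[OF LI clin_comp[OF ti(1) tP(1)] clin_ident _ that] by (simp add: ti(2) tP(2) Pi c)
 have 2: "tmap E E' Q Q' q q' (tmap I I' E E' i i' x) = \<zero>\<^bsub>tens Q Q'\<^esub>" if "x : carrier (tens I I')" for x
  using I.clin_unique[OF LQ clin_comp[OF ti(1) tq(1)] zero_clin[OF LI LQ] _ that] by (simp add: ti(2) tq(2) qi c)
 have 3: "tmap E E' Q Q' q q' (tmap Q Q' E E' s s' x) = x" if "x : carrier (tens Q Q')" for x
  using Q.clin_unique[OF LQ clin_comp[OF ts(1) tq(1)] clin_ident _ that] by (simp add: ts(2) tq(2) qs c)
 have 4: "tmap Q Q' E E' s s' (tmap E E' Q Q' q q' x) \<oplus>\<^bsub>tens E E'\<^esub> tmap I I' E E' i i' (tmap E E' I I' P P' x) = x"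
  if "x : carrier (tens E E')" for x
  using E.clin_unique[OF LE clin_add[OF LE LE clin_comp[OF tq(1) ts(1)] clin_comp[OF tP(1) ti(1)]] clin_ident _ that]
  by (simp add: ts(2) tq(2) ti(2) tP(2) dec c)
 show ?thesis
  unfolding sdata_def using tmap_hom[OF O(1,4,2,5) i] tmap_hom[OF O(2,5,3,6) q] tmap_hom[OF O(3,6,2,5) s] tP(1) 1 2 3 4 by blast
qed

lemma sdata_tmap_left:
 assumes A: "A : Obj" "I : Obj" "E : Obj" "Q : Obj" and sd: "sdata I E Q i q s P"
 shows "sdata (tens A I) (tens A E) (tens A Q) (tmap A I A E (%x. x) i) (tmap A E A Q (%x. x) q)
  (tmap A Q A E (%x. x) s) (tmap A E A I (%x. x) P)"
proof -
 interpret E: tpair A E "tens A E" "tm A E" by (rule pair) fact+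
 interpret Q: tpair A Q "tens A Q" "tm A Q" by (rule pair) fact+
 note sd = sd[unfolded sdata_def]
 then have c: "s (q x) : carrier E & i (P x) : carrier E" if "x : carrier E" for x
  using that by (meson homD(3) clinD(2))
 show ?thesis by (rule sdata_tmap[OF A(1,1,1) A(2-4)])
   (use sd c in \<open>simp_all add: hom_ident clin_ident Q.tb.null_right bilD(3)[OF E.t_bilinear, symmetric]\<close>)
qed

lemma sdata_tmap_right:
 assumes A: "A : Obj" "I : Obj" "E : Obj" "Q : Obj" and sd: "sdata I E Q i q s P"
 shows "sdata (tens I A) (tens E A) (tens Q A) (tmap I A E A i (%x. x)) (tmap E A Q A q (%x. x))
  (tmap Q A E A s (%x. x)) (tmap E A I A P (%x. x))"
proof -
 interpret E: tpair E A "tens E A" "tm E A" by (rule pair) fact+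
 interpret Q: tpair Q A "tens Q A" "tm Q A" by (rule pair) fact+
 interpret mpairing Q A "tens Q A" "tm Q A" by (rule Q.mpairing)
 note sd = sd[unfolded sdata_def]
 then have c: "s (q x) : carrier E & i (P x) : carrier E" if "x : carrier E" for x
  using that by (meson homD(3) clinD(2))
 show ?thesis by (rule sdata_tmap[OF A(2-4) A(1,1,1)])
   (use sd c in \<open>simp_all add: hom_ident clin_ident t_zero_left bilD(2)[OF E.t_bilinear, symmetric]\<close>)
qed

text \<open>The complex numbers and the unitisations live on types of their own, so copies
  \<open>CC\<close> and \<open>UU A\<close> in \<open>Obj\<close> are fixed, with isomorphisms
  \<open>cc\<close> and \<open>uu A\<close> and inverses \<open>cc'\<close> and
  \<open>uu' A\<close>.\<close>

definition CC :: "'u lca" where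
 "CC = (SOME C. C : Obj & lca_iso C CL ~= {})"

definition cc :: "'u => complex" where
 "cc = (SOME f. f : lca_iso CC CL)"

definition cc' :: "complex => 'u" where
 "cc' = inv_into (carrier CC) cc"

definition UU :: "'u lca => 'u lca" where
 "UU A = (SOME U. U : Obj & lca_iso U (unz A) ~= {})"

definition uu :: "'u lca => 'u => complex \<times> 'u" where
 "uu A = (SOME f. f : lca_iso (UU A) (unz A))"

definition uu' :: "'u lca => complex \<times> 'u => 'u" where
 "uu' A = inv_into (carrier (UU A)) (uu A)"

lemma CC: "CC : Obj" "cc : lca_iso CC CL" "cc' : lca_iso CL CC"
 "x : carrier CC ==> cc' (cc x) = x" "cc (cc' z) = z"
proof -
 have "\<exists>C. C : Obj & lca_iso C CL ~= {}" using obj_complex by blast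
 note * = someI_ex[OF this, folded CC_def]
 then show C: "CC : Obj" by simp
 show c: "cc : lca_iso CC CL" unfolding cc_def using * by (simp add: some_in_eq)
 interpret C: locally_convex_algebra CC by (rule obj_lca[OF C])
 note i = lca_iso_inv_into[OF C.lca_like _ c, folded cc'_def]
 show "cc' : lca_iso CL CC" "x : carrier CC ==> cc' (cc x) = x" "cc (cc' z) = z"
  using i by (auto simp: cplx_simps)
qed

lemma UU:
 assumes A: "A : Obj"
 shows "UU A : Obj" "uu A : lca_iso (UU A) (unz A)" "uu' A : lca_iso (unz A) (UU A)"
  "x : carrier (UU A) ==> uu' A (uu A x) = x" "y : carrier (unz A) ==> uu A (uu' A y) = y"
proof -
 have "\<exists>U. U : Obj & lca_iso U (unz A) ~= {}" using obj_unitization[OF A] by blast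
 note * = someI_ex[OF this, folded UU_def]
 then show U: "UU A : Obj" by simp
 show u: "uu A : lca_iso (UU A) (unz A)" unfolding uu_def using * by (simp add: some_in_eq)
 interpret A: locally_convex_algebra A by (rule obj_lca[OF A])
 interpret U: locally_convex_algebra "UU A" by (rule obj_lca[OF U])
 note i = lca_iso_inv_into[OF U.lca_like _ u, folded uu'_def]
 show "uu' A : lca_iso (unz A) (UU A)" "x : carrier (UU A) ==> uu' A (uu A x) = x"
  "y : carrier (unz A) ==> uu A (uu' A y) = y"
  using i A.unitization_lca_like by (auto simp: lca_like_def)
qed

text \<open>\<open>ui\<close>, \<open>uq\<close> and \<open>us\<close> are the inclusion, the
  character and the scalar splitting of the unitisation, transported to the copies.\<close>

abbreviation "ui A \<equiv> uu' A \<circ> (%a. (0, a))"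
abbreviation "uq A \<equiv> cc' \<circ> (fst \<circ> uu A)"
abbreviation "us A \<equiv> uu' A \<circ> ((%c. (c, \<zero>\<^sub>A)) \<circ> cc)"

lemma split_unit:
 assumes A: "A : Obj" shows "sdata A (UU A) CC (ui A) (uq A) (us A) (snd \<circ> uu A)"
proof -
 interpret A: locally_convex_algebra A by (rule obj_lca[OF A])
 interpret C: locally_convex_algebra CC by (rule obj_lca[OF CC(1)])
 note u = UU[OF A]
 note uD = homD[OF iso_hom[OF u(2)]] and u'D = homD[OF iso_hom[OF u(3)]]
 note cD = homD[OF iso_hom[OF CC(2)]] and c'D = homD[OF iso_hom[OF CC(3)]]
 interpret U: locally_convex_algebra "UU A" by (rule obj_lca[OF u(1)])
 have "us A (uq A x) \<oplus>\<^bsub>UU A\<^esub> ui A ((snd \<circ> uu A) x) = x" if x: "x : carrier (UU A)" for x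
 proof -
  obtain c a where ca: "uu A x = (c, a)" "a : carrier A" using uD(3)[OF x] by (auto simp: unit_simps)
  have "us A (uq A x) \<oplus>\<^bsub>UU A\<^esub> ui A ((snd \<circ> uu A) x) = uu' A ((c, \<zero>\<^sub>A) \<oplus>\<^bsub>unz A\<^esub> (0, a))"
   using ca by (subst u'D(4)) (auto simp: unit_simps CC(5))
  then show ?thesis using ca u(4)[OF x] by (simp add: unit_simps)
 qed
 moreover have "cc' 0 = \<zero>\<^sub>CC"
  using add_hom_zero[OF nring.axioms(1)[OF cplx_nring] C.M.abelian_group_axioms c'D(2)] by (simp add: cplx_simps)
 ultimately show ?thesis unfolding sdata_def
  using hom_comp[OF A.incl_hom iso_hom[OF u(3)]] hom_comp[OF hom_comp[OF iso_hom[OF u(2)] A.fst_hom] iso_hom[OF CC(3)]]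
   hom_comp[OF hom_comp[OF iso_hom[OF CC(2)] A.scalar_hom] iso_hom[OF u(3)]]
   clin_comp[OF uD(1) A.snd_clin] by (auto simp: u(5) unit_simps CC(4))
qed

end

section \<open>Morphisms into matrix algebras\<close>

lemma mlca_simps:
 "carrier (mat_lca n D) = mats D n n"
 "x \<otimes>\<^bsub>mat_lca n D\<^esub> y = mx D n n n x y"
 "\<zero>\<^bsub>mat_lca n D\<^esub> = (\<lambda>_\<in>{..<n} \<times> {..<n}. \<zero>\<^sub>D)"
 "x \<oplus>\<^bsub>mat_lca n D\<^esub> y = (\<lambda>ij\<in>{..<n} \<times> {..<n}. x ij \<oplus>\<^sub>D y ij)"
 "c \<odot>\<^bsub>mat_lca n D\<^esub> x = (\<lambda>ij\<in>{..<n} \<times> {..<n}. c \<odot>\<^sub>D x ij)"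
 "topo (mat_lca n D) = product_topology (%_. topo D) ({..<n} \<times> {..<n})" by (simp_all add: mat_lca_def)

lemma (in locally_convex_algebra) topspace_mat: "topspace (topo (mat_lca n A)) = carrier (mat_lca n A)"
 by (simp add: mlca_simps mats_def topspace)

lemma mat_homI:
 assumes B: "LCA B" and D: "LCA D"
  and \<sigma>: "!!b. b : carrier B ==> \<sigma> b : mats D n n"
  and entry: "!!i j. [|i < n; j < n|] ==> (%b. \<sigma> b (i, j)) : clin B D"
  and mult: "!!b b' i k. [|b : carrier B; b' : carrier B; i < n; k < n|] ==>
   \<sigma> (b \<otimes>\<^sub>B b') (i, k) = (\<Oplus>\<^sub>D j\<in>{..<n}. \<sigma> b (i, j) \<otimes>\<^sub>D \<sigma> b' (j, k))"
 shows "\<sigma> : lca_hom B (mat_lca n D)"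
proof -
 interpret B: locally_convex_algebra B by fact
 interpret D: locally_convex_algebra D by fact
 note e = clinD[OF entry]
 have "continuous_map (topo B) (topo (mat_lca n D)) \<sigma>" unfolding mlca_simps continuous_map_componentwise
  using \<sigma> e(5) by (auto simp: B.topspace mats_def PiE_def)
 moreover have "\<sigma> (b \<otimes>\<^sub>B b') = mx D n n n (\<sigma> b) (\<sigma> b')" if "b : carrier B" "b' : carrier B" for b b'
  by (rule mats_eqI[of _ D n n _ D]) (use that \<sigma> in \<open>auto simp: mm_app mult intro!: B.m_closed D.N.mm_mats\<close>)
 moreover have "\<sigma> (b \<oplus>\<^sub>B b') = (\<lambda>ij\<in>{..<n} \<times> {..<n}. \<sigma> b ij \<oplus>\<^sub>D \<sigma> b' ij)" if "b : carrier B" "b' : carrier B" for b b'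
  by (rule mats_eqI[of _ D n n _ D]) (use that \<sigma> e(3) in \<open>auto intro!: matsI dest: matsD\<close>)
 moreover have "\<sigma> (c \<odot>\<^sub>B b) = (\<lambda>ij\<in>{..<n} \<times> {..<n}. c \<odot>\<^sub>D \<sigma> b ij)" if "b : carrier B" for b c
  by (rule mats_eqI[of _ D n n _ D]) (use that \<sigma> e(4) in \<open>auto intro!: matsI D.sm_closed B.sm_closed dest: matsD\<close>)
 ultimately show ?thesis using \<sigma> by (auto simp: lca_hom_def hom_def mlca_simps)
qed

lemma mat_homD:
 assumes \<sigma>: "\<sigma> : lca_hom B (mat_lca n D)" shows "b : carrier B ==> \<sigma> b : mats D n n"
  "[|i < n; j < n|] ==> (%b. \<sigma> b (i, j)) : clin B D"
  "[|b : carrier B; b' : carrier B|] ==> \<sigma> (b \<otimes>\<^sub>B b') = mx D n n n (\<sigma> b) (\<sigma> b')"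
proof -
 note s = homD[OF \<sigma>]
 show 1: "b : carrier B ==> \<sigma> b : mats D n n" for b using s(3) by (simp add: mlca_simps)
 show "[|b : carrier B; b' : carrier B|] ==> \<sigma> (b \<otimes>\<^sub>B b') = mx D n n n (\<sigma> b) (\<sigma> b')"
  using s(7) by (simp add: mlca_simps)
 show "(%b. \<sigma> b (i, j)) : clin B D" if ij: "i < n" "j < n"
 proof -
  have "continuous_map (topo B) (topo D) (%b. \<sigma> b (i, j))"
   using s(6) ij unfolding mlca_simps continuous_map_componentwise by auto
  then show ?thesis using ij s(4,5) matsD[OF 1 ij] by (auto simp: clin_def hom_def mlca_simps)
 qed
qed

text \<open>Arbitrary positions are needed besides the upper left corner: \<open>flat\<close> turns
  a corner into a scattered block, and independence of the position is proved by comparing different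
  injections.\<close>

definition emb :: "'a lca => (nat => nat) => nat => nat => (nat \<times> nat => 'a) => (nat \<times> nat => 'a)" where
 "emb D \<rho> n N X = (\<lambda>(i, j)\<in>{..<N} \<times> {..<N}. if i : \<rho> ` {..<n} & j : \<rho> ` {..<n}
  then X (inv_into {..<n} \<rho> i, inv_into {..<n} \<rho> j) else \<zero>\<^sub>D)"

definition iinj :: "(nat => nat) => nat => nat => bool" where
 "iinj \<rho> n N \<longleftrightarrow> inj_on \<rho> {..<n} & \<rho> ` {..<n} \<subseteq> {..<N}"

lemma iinj_less: "[|iinj \<rho> n N; i < n|] ==> \<rho> i < N" by (auto simp: iinj_def)

lemma iinj_comp: "[|iinj \<rho> n N; iinj \<rho>' N K|] ==> iinj (\<rho>' \<circ> \<rho>) n K"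
 by (auto simp: iinj_def inj_on_def image_subset_iff)

lemma iinj_ident: "n <= N ==> iinj (%i. i) n N" by (auto simp: iinj_def)

lemma emb_image: "[|iinj \<rho> n N; i < n; j < n|] ==> emb D \<rho> n N X (\<rho> i, \<rho> j) = X (i, j)"
 by (auto simp: emb_def iinj_def)

lemma emb_outside: "[|i < N; j < N; i \<notin> \<rho> ` {..<n} \<or> j \<notin> \<rho> ` {..<n}|] ==> emb D \<rho> n N X (i, j) = \<zero>\<^sub>D"
 by (auto simp: emb_def)

lemma (in locally_convex_algebra) emb_mats:
 assumes "iinj \<rho> n N" "X : mats A n n" shows "emb A \<rho> n N X : mats A N N"
 unfolding emb_def using assms by (intro matsI) (auto simp: iinj_def intro: matsD)

lemma (in locally_convex_algebra) emb_emb: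
 assumes \<rho>: "iinj \<rho> n N" and \<rho>': "iinj \<rho>' N K" and X: "X : mats A n n"
 shows "emb A \<rho>' N K (emb A \<rho> n N X) = emb A (\<rho>' \<circ> \<rho>) n K X"
proof (rule mats_eqI[of _ A K K _ A])
 note c = iinj_comp[OF \<rho> \<rho>']
 fix i j assume ij: "i < K" "j < K"
 show "emb A \<rho>' N K (emb A \<rho> n N X) (i, j) = emb A (\<rho>' \<circ> \<rho>) n K X (i, j)"
 proof (cases "i : (\<rho>' \<circ> \<rho>) ` {..<n} & j : (\<rho>' \<circ> \<rho>) ` {..<n}")
  case True
  then obtain a b where ab: "a < n" "b < n" "i = \<rho>' (\<rho> a)" "j = \<rho>' (\<rho> b)" by auto
  show ?thesis using emb_image[OF c ab(1,2), of A X] emb_image[OF \<rho> ab(1,2), of A X]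
    emb_image[OF \<rho>' iinj_less[OF \<rho> ab(1)] iinj_less[OF \<rho> ab(2)], of A "emb A \<rho> n N X"]
   by (simp add: ab)
 next
  case False
  then have R: "emb A (\<rho>' \<circ> \<rho>) n K X (i, j) = \<zero>" using ij by (intro emb_outside) auto
  show ?thesis
  proof (cases "i : \<rho>' ` {..<N} & j : \<rho>' ` {..<N}")
   case True
   then obtain a b where ab: "a < N" "b < N" "i = \<rho>' a" "j = \<rho>' b" by auto
   then have "a \<notin> \<rho> ` {..<n} \<or> b \<notin> \<rho> ` {..<n}" using False by auto
   then show ?thesis using R ab by (simp add: emb_image[OF \<rho>'] emb_outside)
  next
   case False
   then show ?thesis using R ij by (simp add: emb_outside)
  qed
 qed
qed (use assms in \<open>auto intro!: emb_mats iinj_comp[OF \<rho> \<rho>']\<close>)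

lemma (in locally_convex_algebra) emb_mult:
 assumes \<rho>: "iinj \<rho> n N" and X: "X : mats A n n" and Y: "Y : mats A n n"
 shows "mx A N N N (emb A \<rho> n N X) (emb A \<rho> n N Y) = emb A \<rho> n N (mx A n n n X Y)"
proof (rule mats_eqI[of _ A N N _ A])
 have em: "emb A \<rho> n N X : mats A N N" "emb A \<rho> n N Y : mats A N N"
  using X Y by (auto intro!: emb_mats \<rho>)
 then show "mx A N N N (emb A \<rho> n N X) (emb A \<rho> n N Y) : mats A N N" by (intro N.mm_mats)
 show "emb A \<rho> n N (mx A n n n X Y) : mats A N N" using X Y by (intro emb_mats \<rho> N.mm_mats)
 fix i k assume ik: "i < N" "k < N"
 show "mx A N N N (emb A \<rho> n N X) (emb A \<rho> n N Y) (i, k) = emb A \<rho> n N (mx A n n n X Y) (i, k)"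
 proof (cases "i : \<rho> ` {..<n} & k : \<rho> ` {..<n}")
  case True
  then obtain a c where ac: "a < n" "c < n" "i = \<rho> a" "k = \<rho> c" by auto
  have "(\<Oplus>j\<in>{..<N}. emb A \<rho> n N X (i, j) \<otimes> emb A \<rho> n N Y (j, k)) =
    (\<Oplus>j\<in>{..<n}. emb A \<rho> n N X (i, \<rho> j) \<otimes> emb A \<rho> n N Y (\<rho> j, k))"
   using \<rho> ik by (intro M.finsum_inj_support[symmetric])
    (auto simp: iinj_def emb_outside N.l_null matsD[OF em(2)] intro!: m_closed matsD[OF em(1)] matsD[OF em(2)])
  then show ?thesis using ac ik by (simp add: emb_image[OF \<rho>] mm_app cong: fsum_congr)
 next
  case False
  have "(\<Oplus>j\<in>{..<N}. emb A \<rho> n N X (i, j) \<otimes> emb A \<rho> n N Y (j, k)) = \<zero>"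
   using False ik by (intro M.add.finprod_one_eqI)
    (auto simp: emb_outside N.l_null N.r_null matsD[OF em(1)] matsD[OF em(2)])
  then show ?thesis using False ik by (simp add: emb_outside mm_app)
 qed
qed

lemma emb_hom:
 assumes B: "LCA B" and D: "LCA D"
  and \<rho>: "iinj \<rho> n N" and \<sigma>: "\<sigma> : lca_hom B (mat_lca n D)"
 shows "(%b. emb D \<rho> n N (\<sigma> b)) : lca_hom B (mat_lca N D)"
proof (rule mat_homI[OF B D])
 interpret B: locally_convex_algebra B by fact
 interpret D: locally_convex_algebra D by fact
 note s = mat_homD[OF \<sigma>]
 show "b : carrier B ==> emb D \<rho> n N (\<sigma> b) : mats D N N" for b
  using s(1) by (intro D.emb_mats \<rho>)
 have zero_clin: "(%b. \<zero>\<^sub>D) : clin B D"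
  by (rule clinI[OF B D]) (auto simp: hom_def D.sm_zero_right D.cs_null intro: cs_zero)
 show "(%b. emb D \<rho> n N (\<sigma> b) (i, j)) : clin B D" if ij: "i < N" "j < N" for i j
 proof (cases "i : \<rho> ` {..<n} & j : \<rho> ` {..<n}")
  case True
  then obtain a b where "a < n" "b < n" "i = \<rho> a" "j = \<rho> b" by auto
  then show ?thesis using s(2) by (simp add: emb_image[OF \<rho>])
 next
  case False
  then show ?thesis using zero_clin ij by (simp add: emb_outside)
 qed
 fix b b' i k assume b: "b : carrier B" "b' : carrier B" and ik: "i < N" "k < N"
 show "emb D \<rho> n N (\<sigma> (b \<otimes>\<^sub>B b')) (i, k) =
  (\<Oplus>\<^sub>D j\<in>{..<N}. emb D \<rho> n N (\<sigma> b) (i, j) \<otimes>\<^sub>D emb D \<rho> n N (\<sigma> b') (j, k))"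
  using b ik s(1) by (simp add: s(3) D.emb_mult[OF \<rho>, symmetric] mm_app)
qed

definition mat1 :: "'a => (nat \<times> nat => 'a)" where
 "mat1 a = (\<lambda>_\<in>{..<1} \<times> {..<1}. a)"

lemma mat1_hom:
 assumes B: "LCA B" and D: "LCA D" and f: "f : lca_hom B D"
 shows "(%a. mat1 (f a)) : lca_hom B (mat_lca 1 D)"
proof (rule mat_homI[OF B D])
 interpret D: locally_convex_algebra D by fact
 note f = homD[OF f]
 show "mat1 (f b) : mats D 1 1" if "b : carrier B" for b
  unfolding mat1_def using that f(3) by (intro matsI) auto
 show "(%b. mat1 (f b) (i, j)) : clin B D" if "i < 1" "j < 1" for i j using that f(1) by (simp add: mat1_def)
 show "mat1 (f (b \<otimes>\<^sub>B b')) (i, k) = (\<Oplus>\<^sub>D j\<in>{..<1}. mat1 (f b) (i, j) \<otimes>\<^sub>D mat1 (f b') (j, k))"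
  if "b : carrier B" "b' : carrier B" "i < 1" "k < 1" for b b' i k
  using that f(3,7) by (simp add: mat1_def lessThan_Suc D.m_closed)
qed

lemma corner_emb: "0 < N ==> corner N D a = emb D (%i. i) 1 N (mat1 a)"
 unfolding corner_def emb_def mat1_def by (rule restrict_ext) auto

lemma mat_hom_iso:
 assumes D: "LCA D" and M: "LCA M" and \<phi>: "\<phi> : lca_iso M (mat_lca n D)"
 defines "\<phi>' \<equiv> inv_into (carrier M) \<phi>"
 shows "\<phi>' : lca_hom (mat_lca n D) M" "!!x. x : carrier M ==> \<phi>' (\<phi> x) = x"
  "!!y. y : mats D n n ==> \<phi> (\<phi>' y) = y" "!!x. x : carrier M ==> \<phi> x : mats D n n"
  "!!y. y : mats D n n ==> \<phi>' y : carrier M"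
 using lca_iso_inv_into[OF locally_convex_algebra.lca_like[OF M] locally_convex_algebra.topspace_mat[OF D] \<phi>]
  homD(3)[OF iso_hom[OF \<phi>]] homD(3)[OF iso_hom, of \<phi>' "mat_lca n D" M]
 by (auto simp: \<phi>'_def mlca_simps dest: iso_hom)

text \<open>A matrix over \<open>D\<close> whose entries are turned into matrices over
  \<open>E\<close> by \<open>\<tau>\<close>, with brackets removed. The position inside
  \<open>X\<close> is the inner index, in agreement with the Kronecker numbering of
  \<open>mat_tensor\<close>.\<close>

definition flat :: "nat => nat => ('a => nat \<times> nat => 'b) => (nat \<times> nat => 'a) => (nat \<times> nat => 'b)" where
 "flat m n \<tau> X = (\<lambda>(i, j)\<in>{..<m * n} \<times> {..<m * n}. \<tau> (X (i mod n, j mod n)) (i div n, j div n))"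

lemma flat_app: "[|i < m * n; j < m * n|] ==> flat m n \<tau> X (i, j) = \<tau> (X (i mod n, j mod n)) (i div n, j div n)"
 by (simp add: flat_def)

lemma flat_hom:
 assumes B: "LCA B" and D: "LCA D" and E: "LCA E"
  and \<sigma>: "\<sigma> : lca_hom B (mat_lca n D)" and \<tau>: "\<tau> : lca_hom D (mat_lca m E)"
 shows "(%b. flat m n \<tau> (\<sigma> b)) : lca_hom B (mat_lca (m * n) E)"
proof (rule mat_homI[OF B E])
 interpret B: locally_convex_algebra B by fact
 interpret D: locally_convex_algebra D by fact
 interpret E: locally_convex_algebra E by fact
 note s = mat_homD[OF \<sigma>] and t = mat_homD[OF \<tau>]
 have tc: "\<tau> d (i, j) : carrier E" if "d : carrier D" "i < m" "j < m" for d i j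
  using t(1)[OF that(1)] that(2,3) by (rule matsD)
 show "flat m n \<tau> (\<sigma> b) : mats E (m * n) (m * n)" if b: "b : carrier B" for b
  unfolding flat_def using matsD[OF s(1)[OF b]] by (intro matsI) (auto intro!: tc dest: divmod_less)
 show "(%b. flat m n \<tau> (\<sigma> b) (i, j)) : clin B E" if "i < m * n" "j < m * n" for i j
  using clin_comp[OF s(2) t(2), of "i mod n" "j mod n" "i div n" "j div n"] that divmod_less
  by (simp add: flat_app o_def)
 fix b b' i k assume b: "b : carrier B" "b' : carrier B" and ik: "i < m * n" "k < m * n"
 note lt = divmod_less[OF ik(1)] divmod_less[OF ik(2)]
 let ?X = "\<sigma> b" and ?Y = "\<sigma> b'"
 note X = matsD[OF s(1)[OF b(1)]] and Y = matsD[OF s(1)[OF b(2)]]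
 have "flat m n \<tau> (\<sigma> (b \<otimes>\<^sub>B b')) (i, k) = \<tau> (\<Oplus>\<^sub>D j\<in>{..<n}. ?X (i mod n, j) \<otimes>\<^sub>D ?Y (j, k mod n)) (i div n, k div n)"
  using b ik lt by (simp add: flat_app s(3) mm_app)
 also have "... = (\<Oplus>\<^sub>E j\<in>{..<n}. \<tau> (?X (i mod n, j) \<otimes>\<^sub>D ?Y (j, k mod n)) (i div n, k div n))"
  using lt X Y by (intro add_hom_finsum[OF D.M.abelian_group_axioms E.M.abelian_group_axioms clinD(1)[OF t(2)]])
   (auto intro: D.m_closed)
 also have "... = (\<Oplus>\<^sub>E j\<in>{..<n}. \<Oplus>\<^sub>E l\<in>{..<m}. \<tau> (?X (i mod n, j)) (i div n, l) \<otimes>\<^sub>E \<tau> (?Y (j, k mod n)) (l, k div n))"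
  using lt X Y by (intro finsum_congr refl) (simp add: t(3) mm_app)
 also have "... = (\<Oplus>\<^sub>E l\<in>{..<m}. \<Oplus>\<^sub>E j\<in>{..<n}. \<tau> (?X (i mod n, j)) (i div n, l) \<otimes>\<^sub>E \<tau> (?Y (j, k mod n)) (l, k div n))"
  using lt X Y by (intro E.M.finsum_swap) (auto intro!: E.m_closed tc)
 also have "... = (\<Oplus>\<^sub>E j\<in>{..<m * n}. \<tau> (?X (i mod n, j mod n)) (i div n, j div n) \<otimes>\<^sub>E \<tau> (?Y (j mod n, k mod n)) (j div n, k div n))"
  using lt X Y
  by (intro E.M.finsum_lessThan_times[of m n "%l j. \<tau> (?X (i mod n, j)) (i div n, l) \<otimes>\<^sub>E \<tau> (?Y (j, k mod n)) (l, k div n)", symmetric])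
   (auto intro!: E.m_closed tc)
 also have "... = (\<Oplus>\<^sub>E j\<in>{..<m * n}. flat m n \<tau> ?X (i, j) \<otimes>\<^sub>E flat m n \<tau> ?Y (j, k))"
  using ik by (intro finsum_congr refl) (simp add: flat_app)
 finally show "flat m n \<tau> (\<sigma> (b \<otimes>\<^sub>B b')) (i, k) = (\<Oplus>\<^sub>E j\<in>{..<m * n}. flat m n \<tau> ?X (i, j) \<otimes>\<^sub>E flat m n \<tau> ?Y (j, k))" .
qed

section \<open>Split exact and stable functors\<close>

locale lca_setting = lca_universe Obj tens tm + lca_functor Obj H Hmap
 for Obj :: "'u lca set" and tens tm and H :: "'u lca => 'h monoid" and Hmap +
 assumes split: "split_exact Obj H Hmap" and stable: "M2_stable Obj H Hmap"
begin

lemma H_closed: "[|A : Obj; B : Obj; f : lca_hom A B; x : carrier (H A)|] ==> Hmap A B f x : carrier (H B)"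
 using map_hom hom_in_carrier by metis

lemma H_one: "[|A : Obj; B : Obj; f : lca_hom A B|] ==> Hmap A B f \<one>\<^bsub>H A\<^esub> = \<one>\<^bsub>H B\<^esub>"
 using map_hom obj_group hom_one comm_group.axioms(2) by metis

lemma H_mult: "[|A : Obj; B : Obj; f : lca_hom A B; x : carrier (H A); y : carrier (H A)|] ==>
  Hmap A B f (x \<otimes>\<^bsub>H A\<^esub> y) = Hmap A B f x \<otimes>\<^bsub>H B\<^esub> Hmap A B f y"
 using map_hom hom_mult by metis

lemma H_comp: "[|A : Obj; B : Obj; C : Obj; f : lca_hom A B; g : lca_hom B C; h : lca_hom A C;
  !!a. a : carrier A ==> g (f a) = h a; x : carrier (H A)|] ==> Hmap B C g (Hmap A B f x) = Hmap A C h x"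
 using map_comp[of A B C f g x] map_cong[of A C "g \<circ> f" h x] hom_comp[of f A B g C] by simp

lemma H_ident: "[|A : Obj; f : lca_hom A A; !!a. a : carrier A ==> f a = a; x : carrier (H A)|] ==> Hmap A A f x = x"
 using map_cong[of A A f "%x. x" x] map_id[of A x] hom_ident[of A] by simp

lemma H_inverse: "[|A : Obj; B : Obj; f : lca_hom A B; g : lca_hom B A; !!a. a : carrier A ==> g (f a) = a;
  x : carrier (H A)|] ==> Hmap B A g (Hmap A B f x) = x"
 using H_comp[of A B A f g "%x. x" x] map_id[of A x] hom_ident[of A] by simp

lemma H_split:
 assumes Obj: "I : Obj" "E : Obj" "Q : Obj" and sd: "sdata I E Q i q s P"
 shows "inj_on (Hmap I E i) (carrier (H I))"
  "!!x. [|x : carrier (H E); Hmap E Q q x = \<one>\<^bsub>H Q\<^esub>|] ==> \<exists>y\<in>carrier (H I). Hmap I E i y = x"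
  "!!y. y : carrier (H I) ==> Hmap E Q q (Hmap I E i y) = \<one>\<^bsub>H Q\<^esub>"
proof -
 have "split_extension I E Q i q s" by (rule sdata_extension[OF obj_lca obj_lca obj_lca sd]) fact+
 then have "short_exact_sequence (H Q) (H E) (H I) (Hmap E Q q) (Hmap I E i)"
  using split Obj unfolding split_exact_def by blast
 then have "exact_seq ([H Q, H E, H I], [Hmap E Q q, Hmap I E i])" and m: "Hmap I E i : mon (H I) (H E)"
  by (auto dest: short_exact_sequenceD)
 then have ker: "kernel (H E) (H Q) (Hmap E Q q) = Hmap I E i ` carrier (H I)" by simp
 show "inj_on (Hmap I E i) (carrier (H I))" using m by (simp add: mon_def)
 show "\<exists>y\<in>carrier (H I). Hmap I E i y = x" if "x : carrier (H E)" "Hmap E Q q x = \<one>\<^bsub>H Q\<^esub>" for x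
 proof -
  have "x : Hmap I E i ` carrier (H I)" using ker that by (auto simp: kernel_def)
  then show ?thesis by blast
 qed
 show "!!y. y : carrier (H I) ==> Hmap E Q q (Hmap I E i y) = \<one>\<^bsub>H Q\<^esub>"
  using ker by (auto simp: kernel_def set_eq_iff)
qed

lemma zero_hom: "[|A : Obj; B : Obj|] ==> (%_. \<zero>\<^sub>B) : lca_hom A B"
proof -
 assume A: "A : Obj" "B : Obj"
 interpret A: locally_convex_algebra A by (rule obj_lca[OF A(1)])
 interpret B: locally_convex_algebra B by (rule obj_lca[OF A(2)])
 show ?thesis by (auto simp: lca_hom_def hom_def B.sm_zero_right B.N.l_null B.topspace)
qed

text \<open>No additivity is assumed of the functor. The zero morphism to \<open>CC\<close> is the
  composite of inclusion and quotient of a split extension, so exactness makes its effect trivial,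
  and every zero morphism factors through this one.\<close>

lemma H_zero:
 assumes A: "A : Obj" "B : Obj" and x: "x : carrier (H A)"
 shows "Hmap A B (%_. \<zero>\<^sub>B) x = \<one>\<^bsub>H B\<^esub>"
proof -
 note sd = split_unit[OF A(1)]
 have h: "ui A : lca_hom A (UU A)" "uq A : lca_hom (UU A) CC"
  and qi: "!!a. a : carrier A ==> uq A (ui A a) = \<zero>\<^sub>CC" using sd by (auto simp: sdata_def)
 have "Hmap A CC (%_. \<zero>\<^sub>CC) x = Hmap (UU A) CC (uq A) (Hmap A (UU A) (ui A) x)"
  by (rule H_comp[OF A(1) UU(1)[OF A(1)] CC(1) h zero_hom[OF A(1) CC(1)] qi x, symmetric])
 also have "... = \<one>\<^bsub>H CC\<^esub>" using H_split(3)[OF A(1) UU(1)[OF A(1)] CC(1) sd x] .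
 finally have 1: "Hmap A CC (%_. \<zero>\<^sub>CC) x = \<one>\<^bsub>H CC\<^esub>" .
 have "Hmap A B (%_. \<zero>\<^sub>B) x = Hmap CC B (%_. \<zero>\<^sub>B) (Hmap A CC (%_. \<zero>\<^sub>CC) x)"
  by (rule H_comp[OF A(1) CC(1) A(2) zero_hom[OF A(1) CC(1)] zero_hom[OF CC(1) A(2)] zero_hom[OF A] refl x, symmetric])
 then show ?thesis using 1 A CC(1) zero_hom by (simp add: H_one)
qed

end

lemma emb_cong:
 assumes \<rho>: "iinj \<rho> n N" and eq: "!!i. i < n ==> \<rho> i = \<rho>' i"
 shows "emb D \<rho> n N X = emb D \<rho>' n N X"
proof -
 have \<rho>': "iinj \<rho>' n N" using \<rho> eq by (auto simp: iinj_def inj_on_def)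
 have im: "\<rho> ` {..<n} = \<rho>' ` {..<n}" using eq by auto
 have "emb D \<rho> n N X (i, j) = emb D \<rho>' n N X (i, j)" if ij: "i < N" "j < N" for i j
 proof (cases "i : \<rho> ` {..<n} & j : \<rho> ` {..<n}")
  case True
  then obtain a b where "a < n" "b < n" "i = \<rho> a" "j = \<rho> b" by auto
  then show ?thesis using emb_image[OF \<rho>] emb_image[OF \<rho>'] eq by metis
 next
  case False
  then have "i \<notin> \<rho>' ` {..<n} \<or> j \<notin> \<rho>' ` {..<n}" using im by simp
  then show ?thesis using False ij by (simp add: emb_outside)
 qed
 moreover have "emb D \<rho> n N X x = emb D \<rho>' n N X x" if "x \<notin> {..<N} \<times> {..<N}" for x
  using that by (simp add: emb_def)
 ultimately show ?thesis by (intro ext) (metis SigmaE SigmaI lessThan_iff)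
qed

lemma (in locally_convex_algebra) emb_ident:
 assumes "X : mats A N N" shows "emb A (%i. i) N N X = X"
proof (rule mats_eqI[of _ A N N _ A])
 show "emb A (%i. i) N N X (i, j) = X (i, j)" if "i < N" "j < N" for i j
  using emb_image[OF iinj_ident[OF order_refl] that, of A X] by simp
qed (auto intro: emb_mats iinj_ident assms)

text \<open>The complements of the two images have the same size, and any bijection between them
  completes the permutation.\<close>

lemma extend_injection:
 assumes \<rho>: "iinj \<rho> n N" "iinj \<rho>' n N"
 shows "\<exists>\<pi>. iinj \<pi> N N & (\<forall>i<n. \<pi> (\<rho> i) = \<rho>' i)"
proof -
 define R where "R = {..<N} - \<rho> ` {..<n}"
 define R' where "R' = {..<N} - \<rho>' ` {..<n}"
 have "card R = card R'" using \<rho> by (simp add: R_def R'_def iinj_def card_Diff_subset card_image)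
 then obtain g where g: "bij_betw g R R'" using finite_same_card_bij[of R R'] by (auto simp: R_def R'_def)
 define \<pi> where "\<pi> x = (if x : \<rho> ` {..<n} then \<rho>' (inv_into {..<n} \<rho> x) else g x)" for x
 have 1: "\<pi> (\<rho> i) = \<rho>' i" if "i < n" for i using that \<rho> by (simp add: \<pi>_def iinj_def)
 have b1: "bij_betw \<pi> (\<rho> ` {..<n}) (\<rho>' ` {..<n})" unfolding bij_betw_def
 proof
  show "inj_on \<pi> (\<rho> ` {..<n})" using \<rho> 1 by (auto simp: inj_on_def iinj_def)
  show "\<pi> ` \<rho> ` {..<n} = \<rho>' ` {..<n}" using 1 by (force simp: image_image)
 qed
 have b2: "bij_betw \<pi> R R'" using g by (subst bij_betw_cong[of R \<pi> g]) (auto simp: \<pi>_def R_def)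
 have "bij_betw \<pi> (\<rho> ` {..<n} \<union> R) (\<rho>' ` {..<n} \<union> R')"
  using b1 b2 by (rule bij_betw_combine) (auto simp: R'_def)
 moreover have "\<rho> ` {..<n} \<union> R = {..<N}" "\<rho>' ` {..<n} \<union> R' = {..<N}"
  using \<rho> by (auto simp: R_def R'_def iinj_def)
 ultimately show ?thesis using 1 by (intro exI[of _ \<pi>]) (auto simp: iinj_def bij_betw_def)
qed

section \<open>Matrix algebras of size \<open>2 ^ k\<close> and maps induced by morphisms into
  matrices\<close>

context lca_setting
begin

text \<open>Only matrices of size two are guaranteed in the universe, so copies of larger matrix
  algebras are obtained by iteration and have size a power of two. Bijectivity of the corner
  embedding is carried along the iteration.\<close>

definition matobj :: "'u lca => nat => 'u lca => ('u => nat \<times> nat => 'u) => bool" where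
 "matobj D k M \<phi> \<longleftrightarrow> M : Obj & \<phi> : lca_iso M (mat_lca (2 ^ k) D) &
  bij_betw (Hmap D M (inv_into (carrier M) \<phi> \<circ> corner (2 ^ k) D)) (carrier (H D)) (carrier (H M))"

lemma corner_hom:
 assumes D: "LCA D" and "0 < N" shows "corner N D : lca_hom D (mat_lca N D)"
proof -
 have "(%a. emb D (%i. i) 1 N (mat1 a)) : lca_hom D (mat_lca N D)"
  using assms by (intro emb_hom[OF D D] iinj_ident mat1_hom[OF D D hom_ident]) simp
 moreover have "corner N D = (%a. emb D (%i. i) 1 N (mat1 a))" by (rule ext) (rule corner_emb[OF assms(2)])
 ultimately show ?thesis by (simp only:)
qed

lemma matobj_0: "D : Obj ==> matobj D 0 D mat1"
proof -
 assume D: "D : Obj"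
 interpret D: locally_convex_algebra D by (rule obj_lca[OF D])
 have h: "mat1 : lca_hom D (mat_lca 1 D)" using mat1_hom[OF D.lca_axioms D.lca_axioms hom_ident] by simp
 have inv: "mat1 (x (0, 0)) = x" if "x : mats D 1 1" for x
  by (rule mats_eqI[of _ D 1 1 _ D]) (use that matsD[OF that] in \<open>auto simp: mat1_def intro!: matsI\<close>)
 have "homeomorphic_maps (topo D) (topo (mat_lca 1 D)) mat1 (%x. x (0, 0))"
  unfolding homeomorphic_maps_def D.topspace D.topspace_mat using homD(6)[OF h] inv
  by (auto simp: mlca_simps mat1_def intro!: continuous_map_product_projection)
 then have i: "mat1 : lca_iso D (mat_lca 1 D)" using h homeomorphic_map_maps by (auto simp: lca_iso_def)
 note i' = mat_hom_iso[OF D.lca_axioms D.lca_axioms i]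
 have c: "corner 1 D a = mat1 a" for a by (auto simp: corner_def mat1_def)
 have "Hmap D D (inv_into (carrier D) mat1 \<circ> corner 1 D) x = x" if "x : carrier (H D)" for x
  by (rule H_ident[OF D hom_comp[OF corner_hom i'(1)] _ that])
   (auto simp: c[simplified] i'(2) D.lca_axioms)
 then show ?thesis unfolding matobj_def using D i by (auto simp: bij_betw_def inj_on_def)
qed

text \<open>Two by two matrices over a copy of the matrices of size \<open>N\<close> are a copy of
  those of size \<open>N * 2\<close>, by \<open>flat\<close>; the corner embedding factors into the
  two smaller ones.\<close>

lemma matobj_Suc:
 assumes D: "D : Obj" and M: "matobj D k M \<phi>" shows "\<exists>M' \<phi>'. matobj D (Suc k) M' \<phi>'"
proof -
 define N :: nat where "N = 2 ^ k"
 have N0: "0 < N" by (simp add: N_def)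
 have MO: "M : Obj" and \<phi>: "\<phi> : lca_iso M (mat_lca N D)"
  and bij: "bij_betw (Hmap D M (inv_into (carrier M) \<phi> \<circ> corner N D)) (carrier (H D)) (carrier (H M))"
  using M by (auto simp: matobj_def N_def)
 obtain M' \<psi> where M': "M' : Obj" and \<psi>: "\<psi> : lca_iso M' (mat_lca 2 M)"
  using obj_mat[OF MO] by blast
 note LD = obj_lca[OF D] and LM = obj_lca[OF MO] and LM' = obj_lca[OF M']
 interpret D: locally_convex_algebra D by (rule LD)
 interpret M: locally_convex_algebra M by (rule LM)
 interpret M': locally_convex_algebra M' by (rule LM')
 define \<phi>' where "\<phi>' = inv_into (carrier M) \<phi>"
 define \<psi>' where "\<psi>' = inv_into (carrier M') \<psi>"
 note p = mat_hom_iso[OF LD LM \<phi>, folded \<phi>'_def] and q = mat_hom_iso[OF LM LM' \<psi>, folded \<psi>'_def]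
 define \<Phi> where "\<Phi> x = flat N 2 \<phi> (\<psi> x)" for x
 \<comment> \<open>The inverse of \<open>\<Phi>\<close>: the entry \<open>(a, b)\<close> of the
   outer matrix collects the positions congruent to \<open>a\<close> and \<open>b\<close> modulo
   two.\<close>
 define G where "G Y = \<psi>' (\<lambda>(a, b)\<in>{..<2} \<times> {..<2}. \<phi>' (\<lambda>(i, j)\<in>{..<N} \<times> {..<N}. Y (i * 2 + a, j * 2 + b)))" for Y
 have \<Phi>h: "\<Phi> : lca_hom M' (mat_lca (N * 2) D)"
  unfolding \<Phi>_def by (rule flat_hom[OF LM' LM LD iso_hom[OF \<psi>] iso_hom[OF \<phi>]])
 have lt: "i * 2 + a < N * 2" if "i < N" "a < 2" for i a :: nat using that by simp
 have inner: "(\<lambda>(i, j)\<in>{..<N} \<times> {..<N}. Y (i * 2 + a, j * 2 + b)) : mats D N N" if "Y : mats D (N * 2) (N * 2)" "a < 2" "b < 2" for Y a b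
  using that by (intro matsI) (auto intro!: matsD[OF that(1)])
 have outer: "(\<lambda>(a, b)\<in>{..<2} \<times> {..<2}. \<phi>' (\<lambda>(i, j)\<in>{..<N} \<times> {..<N}. Y (i * 2 + a, j * 2 + b))) : mats M 2 2"
  if "Y : mats D (N * 2) (N * 2)" for Y using inner[OF that] by (intro matsI) (auto intro!: p(5))
 have \<Phi>m: "\<Phi> x : mats D (N * 2) (N * 2)" if "x : carrier M'" for x
  using homD(3)[OF \<Phi>h that] by (simp add: mlca_simps)
 have G\<Phi>: "G (\<Phi> x) = x" if x: "x : carrier M'" for x
 proof -
  have "\<phi>' (\<lambda>(i, j)\<in>{..<N} \<times> {..<N}. \<Phi> x (i * 2 + a, j * 2 + b)) = \<psi> x (a, b)" if ab: "a < 2" "b < 2" for a b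
  proof -
   have c: "\<psi> x (a, b) : carrier M" using q(4)[OF x] ab by (rule matsD)
   have "(\<lambda>(i, j)\<in>{..<N} \<times> {..<N}. \<Phi> x (i * 2 + a, j * 2 + b)) = \<phi> (\<psi> x (a, b))"
    by (rule mats_eqI[of _ D N N _ D]) (use ab p(4)[OF c] inner[OF \<Phi>m[OF x] ab] lt in \<open>auto simp: \<Phi>_def flat_app\<close>)
   then show ?thesis using p(2)[OF c] by simp
  qed
  then have "(\<lambda>(a, b)\<in>{..<2} \<times> {..<2}. \<phi>' (\<lambda>(i, j)\<in>{..<N} \<times> {..<N}. \<Phi> x (i * 2 + a, j * 2 + b))) = \<psi> x"
   by (intro mats_eqI[of _ M 2 2 _ M] outer \<Phi>m x q(4)) simp
  then show ?thesis using q(2)[OF x] by (simp add: G_def)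
 qed
 have Gc: "G Y : carrier M'" if "Y : mats D (N * 2) (N * 2)" for Y
  unfolding G_def by (rule q(5)[OF outer[OF that]])
 have \<Phi>G: "\<Phi> (G Y) = Y" if Y: "Y : mats D (N * 2) (N * 2)" for Y
 proof (rule mats_eqI[OF \<Phi>m[OF Gc[OF Y]] Y])
  fix i j assume ij: "i < N * 2" "j < N * 2"
  have d: "i div 2 < N" "j div 2 < N" "i mod 2 < 2" "j mod 2 < 2" using ij by auto
  show "\<Phi> (G Y) (i, j) = Y (i, j)"
   using ij d inner[OF Y d(3,4)] by (simp add: \<Phi>_def flat_app G_def q(3)[OF outer[OF Y]] p(3))
 qed
 have Gcont: "continuous_map (topo (mat_lca (N * 2) D)) (topo M') G"
 proof -
  have i: "continuous_map (topo (mat_lca (N * 2) D)) (topo (mat_lca N D)) (%Y. \<lambda>(i, j)\<in>{..<N} \<times> {..<N}. Y (i * 2 + a, j * 2 + b))" if "a < 2" "b < 2" for a b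
   unfolding mlca_simps continuous_map_componentwise
   using that lt by (auto intro!: continuous_map_product_projection)
  have "continuous_map (topo (mat_lca (N * 2) D)) (topo (mat_lca 2 M))
    (%Y. \<lambda>(a, b)\<in>{..<2} \<times> {..<2}. \<phi>' (\<lambda>(i, j)\<in>{..<N} \<times> {..<N}. Y (i * 2 + a, j * 2 + b)))"
   unfolding mlca_simps(6)[of 2] continuous_map_componentwise
   using continuous_map_compose[OF i homD(6)[OF p(1)]] by (auto simp: o_def)
  from continuous_map_compose[OF this homD(6)[OF q(1)]] show ?thesis by (simp add: o_def G_def[abs_def])
 qed
 have "homeomorphic_maps (topo M') (topo (mat_lca (N * 2) D)) \<Phi> G"
  unfolding homeomorphic_maps_def M'.topspace D.topspace_mat
  using homD(6)[OF \<Phi>h] Gcont G\<Phi> \<Phi>G by (simp add: mlca_simps)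
 then have \<Phi>i: "\<Phi> : lca_iso M' (mat_lca (N * 2) D)"
  using \<Phi>h homeomorphic_map_maps by (auto simp: lca_iso_def)
 note r = mat_hom_iso[OF LD LM' \<Phi>i]
 define c where "c = \<phi>' \<circ> corner N D"
 define e where "e = \<psi>' \<circ> corner 2 M"
 have c: "c : lca_hom D M" and e: "e : lca_hom M M'"
  unfolding c_def e_def using hom_comp[OF corner_hom[OF LD N0] p(1)] hom_comp[OF corner_hom[OF LM] q(1)] by auto
 have cm: "corner N D a : mats D N N" if "a : carrier D" for a
  using homD(3)[OF corner_hom[OF LD N0] that] by (simp add: mlca_simps)
 have em: "corner 2 M m : mats M 2 2" if "m : carrier M" for m
  using homD(3)[OF corner_hom[OF LM] that, of 2] by (simp add: mlca_simps)
 \<comment> \<open>Row zero has quotient and remainder zero, so the corner of size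
   \<open>N * 2\<close> is the corner of size two applied to the corner of size
   \<open>N\<close>.\<close>
 have ec: "inv_into (carrier M') \<Phi> (corner (N * 2) D a) = e (c a)" if a: "a : carrier D" for a
 proof -
  have ca: "c a : carrier M" and eca: "e (c a) : carrier M'" using homD(3)[OF c a] homD(3)[OF e] by auto
  have "\<Phi> (e (c a)) = corner (N * 2) D a"
  proof (rule mats_eqI[OF \<Phi>m[OF eca]])
   show "corner (N * 2) D a : mats D (N * 2) (N * 2)"
    using homD(3)[OF corner_hom[OF LD] a, of "N * 2"] N0 by (simp add: mlca_simps)
   fix i j assume ij: "i < N * 2" "j < N * 2"
   have d: "i div 2 < N" "j div 2 < N" using ij by auto
   have z: "\<phi> \<zero>\<^sub>M (i', j') = \<zero>\<^sub>D" if "i' < N" "j' < N" for i' j'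
    using clin_zero[OF LM LD mat_homD(2)[OF iso_hom[OF \<phi>] that]] .
   have z2: "i = 0" if "i mod 2 = 0" "i div 2 = 0" for i :: nat using that by presburger
   have "\<Phi> (e (c a)) (i, j) = \<phi> (corner 2 M (c a) (i mod 2, j mod 2)) (i div 2, j div 2)"
    using ij by (simp add: \<Phi>_def flat_app e_def q(3)[OF em[OF ca]])
   also have "... = (if i mod 2 = 0 & j mod 2 = 0 then corner N D a (i div 2, j div 2) else \<zero>\<^sub>D)"
    using d p(3)[OF cm[OF a]] by (simp add: corner_def z) (simp add: c_def corner_def)
   also have "... = corner (N * 2) D a (i, j)" using d ij z2[of i] z2[of j] by (auto simp: corner_def)
   finally show "\<Phi> (e (c a)) (i, j) = corner (N * 2) D a (i, j)" .
  qed
  then show ?thesis using r(2)[OF eca] by simp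
 qed
 have eiso: "bij_betw (Hmap M M' e) (carrier (H M)) (carrier (H M'))"
  using stable[unfolded M2_stable_def, THEN bspec, OF MO, THEN bspec, OF M', THEN bspec, OF \<psi>, THEN bspec, OF e]
   q(3) em by (auto simp: iso_def e_def)
 have "inv_into (carrier M') \<Phi> \<circ> corner (N * 2) D : lca_hom D M'"
  using hom_comp[OF corner_hom[OF LD] r(1)] N0 by simp
 then have "Hmap D M' (inv_into (carrier M') \<Phi> \<circ> corner (N * 2) D) x = Hmap M M' e (Hmap D M c x)" if "x : carrier (H D)" for x
  by (intro H_comp[OF D MO M' c e _ _ that, symmetric]) (auto simp: ec)
 then have "bij_betw (Hmap D M' (inv_into (carrier M') \<Phi> \<circ> corner (N * 2) D)) (carrier (H D)) (carrier (H M'))"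
  using bij_betw_trans[OF bij[folded \<phi>'_def, folded c_def] eiso]
  by (subst bij_betw_cong[where g = "Hmap M M' e \<circ> Hmap D M c"]) auto
 then have "matobj D (Suc k) M' \<Phi>" using M' \<Phi>i by (simp add: matobj_def N_def mult.commute)
 then show ?thesis by blast
qed

lemma matobj_ex: "D : Obj ==> \<exists>M \<phi>. matobj D k M \<phi>"
proof (induction k)
 case 0
 then show ?case using matobj_0 by blast
next
 case (Suc k)
 then show ?case using matobj_Suc by blast
qed

definition MO :: "'u lca => nat => 'u lca" where
 "MO D k = (SOME M. \<exists>\<phi>. matobj D k M \<phi>)"

definition mo :: "'u lca => nat => 'u => nat \<times> nat => 'u" where
 "mo D k = (SOME \<phi>. matobj D k (MO D k) \<phi>)"

definition mo' :: "'u lca => nat => (nat \<times> nat => 'u) => 'u" where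
 "mo' D k = inv_into (carrier (MO D k)) (mo D k)"

lemma MO:
 assumes D: "D : Obj" shows "MO D k : Obj" "mo D k : lca_iso (MO D k) (mat_lca (2 ^ k) D)"
  "bij_betw (Hmap D (MO D k) (mo' D k \<circ> corner (2 ^ k) D)) (carrier (H D)) (carrier (H (MO D k)))"
  "mo' D k : lca_hom (mat_lca (2 ^ k) D) (MO D k)" "!!x. x : carrier (MO D k) ==> mo' D k (mo D k x) = x"
  "!!y. y : mats D (2 ^ k) (2 ^ k) ==> mo D k (mo' D k y) = y"
  "!!x. x : carrier (MO D k) ==> mo D k x : mats D (2 ^ k) (2 ^ k)"
  "mo D k : lca_hom (MO D k) (mat_lca (2 ^ k) D)"
proof -
 have "\<exists>\<phi>. matobj D k (MO D k) \<phi>" unfolding MO_def by (rule someI_ex[OF matobj_ex[OF D]])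
 then have m: "matobj D k (MO D k) (mo D k)" unfolding mo_def by (rule someI_ex)
 then show 1: "MO D k : Obj" "mo D k : lca_iso (MO D k) (mat_lca (2 ^ k) D)"
  "bij_betw (Hmap D (MO D k) (mo' D k \<circ> corner (2 ^ k) D)) (carrier (H D)) (carrier (H (MO D k)))"
  by (auto simp: matobj_def mo'_def)
 show "mo D k : lca_hom (MO D k) (mat_lca (2 ^ k) D)" using 1(2) by (rule iso_hom)
 show "mo' D k : lca_hom (mat_lca (2 ^ k) D) (MO D k)" "!!x. x : carrier (MO D k) ==> mo' D k (mo D k x) = x"
  "!!y. y : mats D (2 ^ k) (2 ^ k) ==> mo D k (mo' D k y) = y"
  "!!x. x : carrier (MO D k) ==> mo D k x : mats D (2 ^ k) (2 ^ k)"
  using mat_hom_iso[OF obj_lca[OF D] obj_lca[OF 1(1)] 1(2)] by (auto simp: mo'_def)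
qed

abbreviation "cor D k \<equiv> mo' D k \<circ> corner (2 ^ k) D"

text \<open>A morphism \<open>\<sigma>\<close> into matrices of size \<open>n\<close>, placed at the
  positions \<open>\<rho>\<close> in the copy of the matrices of size \<open>2 ^ k\<close>.\<close>

abbreviation "JJ D k \<rho> n \<sigma> \<equiv> (%b. mo' D k (emb D \<rho> n (2 ^ k) (\<sigma> b)))"

lemma cor_hom: "D : Obj ==> cor D k : lca_hom D (MO D k)" using hom_comp[OF corner_hom MO(4)] obj_lca by simp

lemma JJ_hom:
 assumes "B : Obj" "D : Obj" "iinj \<rho> n (2 ^ k)" "\<sigma> : lca_hom B (mat_lca n D)"
 shows "JJ D k \<rho> n \<sigma> : lca_hom B (MO D k)"
 using hom_comp[OF emb_hom[OF obj_lca obj_lca assms(3,4)] MO(4)] assms by (simp add: o_def)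

lemma cor_JJ: "cor D k = JJ D k (%i. i) 1 mat1" by (rule ext) (simp add: corner_emb)

lemma mat1_hom': "D : Obj ==> mat1 : lca_hom D (mat_lca 1 D)"
 using mat1_hom[OF obj_lca obj_lca hom_ident] by simp

lemma cor_surj: "[|D : Obj; y : carrier (H (MO D k))|] ==> \<exists>d\<in>carrier (H D). Hmap D (MO D k) (cor D k) d = y"
 using MO(3)[of D k] unfolding bij_betw_def image_iff[symmetric] by (metis imageE)

text \<open>A permutation with a fixed point \<open>l\<close> leaves the embedding of
  \<open>D\<close> at the diagonal position \<open>l\<close> unchanged. This embedding is the corner
  embedding followed by an involution, so it too is surjective on \<open>H\<close>, and the
  permutation acts trivially.\<close>

lemma H_perm:
 assumes D: "D : Obj" and \<pi>: "iinj \<pi> (2 ^ k) (2 ^ k)" and l: "l < 2 ^ k" "\<pi> l = l"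
  and x: "x : carrier (H (MO D k))" shows "Hmap (MO D k) (MO D k) (JJ D k \<pi> (2 ^ k) (mo D k)) x = x"
proof -
 interpret D: locally_convex_algebra D by (rule obj_lca[OF D])
 note M = MO[OF D, where k = k]
 let ?N = "2 ^ k :: nat" and ?M = "MO D k"
 define \<tau> where "\<tau> = Transposition.transpose 0 l"
 have \<tau>: "iinj \<tau> ?N ?N" using l by (auto simp: iinj_def \<tau>_def Transposition.transpose_def inj_on_def)
 define T where "T = JJ D k \<tau> ?N (mo D k)"
 have Th: "T : lca_hom ?M ?M" and Ph: "JJ D k \<pi> ?N (mo D k) : lca_hom ?M ?M"
  unfolding T_def by (rule JJ_hom[OF M(1) D _ M(8)]; fact)+
 have TT: "T (T y) = y" if y: "y : carrier ?M" for y
 proof -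
  have "\<tau> \<circ> \<tau> = (%i. i)" by (rule ext) (simp add: \<tau>_def)
  then show ?thesis
   using y M(7)[OF y] by (simp add: T_def M(6) D.emb_mats \<tau> D.emb_emb[OF \<tau> \<tau>] D.emb_ident M(5))
 qed
 have m1: "mat1 a : mats D 1 1" if "a : carrier D" for a
  using homD(3)[OF mat1_hom'[OF D] that] by (simp add: mlca_simps)
 have i1: "iinj (%i. i) 1 ?N" by (rule iinj_ident) simp
 define jl where "jl = T \<circ> cor D k"
 have jl: "jl : lca_hom D ?M" unfolding jl_def by (rule hom_comp[OF cor_hom[OF D] Th])
 have jla: "jl a = mo' D k (emb D \<tau> 1 ?N (mat1 a))" if a: "a : carrier D" for a
 proof -
  have "cor D k a = mo' D k (emb D (%i. i) 1 ?N (mat1 a))" by (rule fun_cong[OF cor_JJ])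
  then have "jl a = T (mo' D k (emb D (%i. i) 1 ?N (mat1 a)))" unfolding jl_def comp_apply[of T] by (rule arg_cong)
  also have "... = mo' D k (emb D \<tau> ?N ?N (emb D (%i. i) 1 ?N (mat1 a)))"
   unfolding T_def M(6)[OF D.emb_mats[OF i1 m1[OF a]]] ..
  also have "... = mo' D k (emb D \<tau> 1 ?N (mat1 a))" unfolding D.emb_emb[OF i1 \<tau> m1[OF a]] o_def ..
  finally show ?thesis .
 qed
 have t1: "iinj \<tau> 1 ?N" using iinj_comp[OF i1 \<tau>] by (simp add: o_def)
 have Pj: "JJ D k \<pi> ?N (mo D k) (jl a) = jl a" if a: "a : carrier D" for a
 proof -
  have "emb D (\<pi> \<circ> \<tau>) 1 ?N (mat1 a) = emb D \<tau> 1 ?N (mat1 a)"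
   by (rule emb_cong[OF iinj_comp[OF t1 \<pi>]]) (simp add: \<tau>_def l)
  then show ?thesis
   unfolding jla[OF a] M(6)[OF D.emb_mats[OF t1 m1[OF a]]] D.emb_emb[OF t1 \<pi> m1[OF a]] by (rule arg_cong)
 qed
 define y where "y = Hmap ?M ?M T x"
 have y: "y : carrier (H ?M)" unfolding y_def by (rule H_closed[OF M(1) M(1) Th x])
 have Ty: "Hmap ?M ?M T y = x" unfolding y_def by (rule H_inverse[OF M(1) M(1) Th Th TT x])
 obtain d where d: "d : carrier (H D)" "Hmap D ?M (cor D k) d = y" using cor_surj[OF D y] by blast
 have jd: "Hmap D ?M jl d = x" using H_comp[OF D M(1) M(1) cor_hom[OF D] Th jl _ d(1)] d(2) Ty by (simp add: jl_def)
 have "Hmap ?M ?M (JJ D k \<pi> ?N (mo D k)) (Hmap D ?M jl d) = Hmap D ?M jl d"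
  by (rule H_comp[OF D M(1) M(1) jl Ph jl Pj d(1)])
 then show ?thesis by (simp add: jd)
qed

text \<open>The map on \<open>H\<close> induced by a morphism into matrices, with stability used to
  return to \<open>H D\<close>. The size \<open>2 ^ n\<close> is merely a convenient power of two
  that is at least \<open>n\<close>; by \<open>Hm_char\<close> neither it nor the position
  matters.\<close>

definition Hm :: "'u lca => 'u lca => nat => ('u => nat \<times> nat => 'u) => 'h => 'h" where
 "Hm B D n \<sigma> b = inv_into (carrier (H D)) (Hmap D (MO D n) (cor D n)) (Hmap B (MO D n) (JJ D n (%i. i) n \<sigma>) b)"

lemma iinj_pow: "iinj (%i. i) n (2 ^ n)" by (rule iinj_ident) (simp add: less_imp_le)

lemma Hm_basic:
 assumes "B : Obj" "D : Obj" "\<sigma> : lca_hom B (mat_lca n D)" "b : carrier (H B)"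
 shows "Hm B D n \<sigma> b : carrier (H D)"
  "Hmap D (MO D n) (cor D n) (Hm B D n \<sigma> b) = Hmap B (MO D n) (JJ D n (%i. i) n \<sigma>) b"
proof -
 have "Hmap B (MO D n) (JJ D n (%i. i) n \<sigma>) b : carrier (H (MO D n))"
  by (rule H_closed[OF assms(1) MO(1)[OF assms(2)] JJ_hom[OF assms(1,2) iinj_pow assms(3)] assms(4)])
 then have "Hmap B (MO D n) (JJ D n (%i. i) n \<sigma>) b : Hmap D (MO D n) (cor D n) ` carrier (H D)"
  using MO(3)[OF assms(2), of n] by (simp add: bij_betw_def)
 then show "Hm B D n \<sigma> b : carrier (H D)"
  "Hmap D (MO D n) (cor D n) (Hm B D n \<sigma> b) = Hmap B (MO D n) (JJ D n (%i. i) n \<sigma>) b"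
  by (simp_all add: Hm_def inv_into_into f_inv_into_f)
qed

lemma cor_inj: "[|D : Obj; x : carrier (H D); y : carrier (H D);
  Hmap D (MO D k) (cor D k) x = Hmap D (MO D k) (cor D k) y|] ==> x = y"
 using MO(3)[of D k] by (auto simp: bij_betw_def dest: inj_onD)

text \<open>Any two placements become conjugate by a permutation in a larger matrix algebra. The
  enlargement also leaves an unoccupied position, which supplies the fixed point required by
  \<open>H_perm\<close>.\<close>

lemma Hm_char:
 assumes B: "B : Obj" and D: "D : Obj" and \<sigma>: "\<sigma> : lca_hom B (mat_lca n D)" and b: "b : carrier (H B)"
  and \<rho>: "iinj \<rho> n (2 ^ k)"
 shows "Hmap B (MO D k) (JJ D k \<rho> n \<sigma>) b = Hmap D (MO D k) (cor D k) (Hm B D n \<sigma> b)"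
proof -
 interpret D: locally_convex_algebra D by (rule obj_lca[OF D])
 \<comment> \<open>Large enough for both \<open>2 ^ k\<close> and \<open>2 ^ n\<close> to lie
   strictly below \<open>2 ^ K\<close>.\<close>
 define K where "K = n + k + 1"
 have kK: "(2::nat) ^ k < 2 ^ K" "(2::nat) ^ n < 2 ^ K" by (rule power_strict_increasing; simp add: K_def)+
 have nK: "n < 2 ^ K" by (rule less_trans[OF less_exp kK(2)])
 note M = MO[OF D]
 define \<psi> where "\<psi> r = JJ D K (%i. i) (2 ^ r) (mo D r)" for r
 have ir: "iinj (%i. i) (2 ^ r) (2 ^ K)" if "r = k \<or> r = n" for r using that kK by (intro iinj_ident) auto
 have \<psi>h: "\<psi> r : lca_hom (MO D r) (MO D K)" if "r = k \<or> r = n" for r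
  unfolding \<psi>_def by (rule JJ_hom[OF M(1) D ir[OF that] M(8)])
 have \<psi>J: "\<psi> r (JJ D r \<rho>' m f a) = JJ D K \<rho>' m f a" if "r = k \<or> r = n" "iinj \<rho>' m (2 ^ r)" "f a : mats D m m"
  for r \<rho>' m and f :: "'u => nat \<times> nat => 'u" and a
  using D.emb_mats[OF that(2,3)] D.emb_emb[OF that(2) ir[OF that(1)] that(3)] by (simp add: \<psi>_def M(6) o_def)
 have m1: "mat1 a : mats D 1 1" if "a : carrier D" for a
  using homD(3)[OF mat1_hom'[OF D] that] by (simp add: mlca_simps)
 have \<psi>c: "Hmap (MO D r) (MO D K) (\<psi> r) (Hmap D (MO D r) (cor D r) d) = Hmap D (MO D K) (cor D K) d"
  if r: "r = k \<or> r = n" and d: "d : carrier (H D)" for r d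
 proof (rule H_comp[OF D M(1) M(1) cor_hom[OF D] \<psi>h[OF r] cor_hom[OF D] _ d])
  fix a assume a: "a : carrier D"
  show "\<psi> r (cor D r a) = cor D K a"
   unfolding cor_JJ using r m1[OF a] by (intro \<psi>J) (auto intro: iinj_ident)
 qed
 have \<psi>\<sigma>: "Hmap (MO D r) (MO D K) (\<psi> r) (Hmap B (MO D r) (JJ D r \<rho>' n \<sigma>) b) = Hmap B (MO D K) (JJ D K \<rho>' n \<sigma>) b"
  if r: "r = k \<or> r = n" and \<rho>': "iinj \<rho>' n (2 ^ r)" for r \<rho>'
 proof (rule H_comp[OF B M(1) M(1) JJ_hom[OF B D \<rho>' \<sigma>] \<psi>h[OF r] JJ_hom[OF B D _ \<sigma>] _ b])
  show "iinj \<rho>' n (2 ^ K)" using iinj_comp[OF \<rho>' ir[OF r]] by (simp add: o_def)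
  fix a assume a: "a : carrier B"
  then show "\<psi> r (JJ D r \<rho>' n \<sigma> a) = JJ D K \<rho>' n \<sigma> a"
   using r \<rho>' mat_homD(1)[OF \<sigma>] by (intro \<psi>J) auto
 qed
 \<comment> \<open>The last index, outside both placements. The permutation is built on the smaller
   indices and fixes \<open>L\<close>.\<close>
 define L where "L = (2::nat) ^ K - 1"
 have "\<rho> i < L" if "i < n" for i using iinj_less[OF \<rho> that] kK(1) unfolding L_def by linarith
 then have r1: "iinj \<rho> n L" using \<rho> by (auto simp: iinj_def)
 have r2: "iinj (%i. i) n L" using nK by (auto simp: iinj_def L_def)
 obtain \<pi>0 where \<pi>0: "iinj \<pi>0 L L" "\<forall>i<n. \<pi>0 (\<rho> i) = i"
  using extend_injection[OF r1 r2] by auto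
 define \<pi> where "\<pi> i = (if i < L then \<pi>0 i else i)" for i
 have \<pi>: "iinj \<pi> (2 ^ K) (2 ^ K)"
 proof -
  have "{..<2 ^ K} = insert L {..<L}" by (auto simp: L_def)
  moreover have "inj_on \<pi> {..<L}" "\<pi> ` {..<L} \<subseteq> {..<L}" "\<pi> L = L"
   using \<pi>0(1) by (auto simp: iinj_def \<pi>_def inj_on_def)
  ultimately show ?thesis by (auto simp: iinj_def)
 qed
 have \<rho>K: "iinj \<rho> n (2 ^ K)" using r1 by (auto simp: iinj_def L_def)
 have perm: "Hmap (MO D K) (MO D K) (JJ D K \<pi> (2 ^ K) (mo D K)) (Hmap B (MO D K) (JJ D K \<rho> n \<sigma>) b) =
   Hmap B (MO D K) (JJ D K (%i. i) n \<sigma>) b"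
 proof (rule H_comp[OF B M(1) M(1) JJ_hom[OF B D \<rho>K \<sigma>] JJ_hom[OF M(1) D \<pi> M(8)] JJ_hom[OF B D iinj_ident \<sigma>] _ b])
  fix a assume a: "a : carrier B"
  have "emb D (\<pi> \<circ> \<rho>) n (2 ^ K) (\<sigma> a) = emb D (%i. i) n (2 ^ K) (\<sigma> a)"
   using \<pi>0(2) iinj_less[OF r1] by (intro emb_cong[OF iinj_comp[OF \<rho>K \<pi>]]) (simp add: \<pi>_def)
  then show "JJ D K \<pi> (2 ^ K) (mo D K) (JJ D K \<rho> n \<sigma> a) = JJ D K (%i. i) n \<sigma> a"
   using mat_homD(1)[OF \<sigma> a] by (simp add: M(6) D.emb_mats[OF \<rho>K] D.emb_emb[OF \<rho>K \<pi>])
 qed (use nK in simp)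
 have eqK: "Hmap B (MO D K) (JJ D K \<rho> n \<sigma>) b = Hmap B (MO D K) (JJ D K (%i. i) n \<sigma>) b"
  unfolding perm[symmetric] by (rule H_perm[OF D \<pi>, of L, symmetric])
   (auto simp: \<pi>_def L_def intro: H_closed[OF B M(1) JJ_hom[OF B D \<rho>K \<sigma>] b])
 note hb = Hm_basic[OF B D \<sigma> b]
 have "Hmap B (MO D k) (JJ D k \<rho> n \<sigma>) b : carrier (H (MO D k))"
  by (rule H_closed[OF B M(1) JJ_hom[OF B D \<rho> \<sigma>] b])
 then obtain d where d: "d : carrier (H D)" "Hmap D (MO D k) (cor D k) d = Hmap B (MO D k) (JJ D k \<rho> n \<sigma>) b"
  using cor_surj[OF D] by blast
 have "Hmap D (MO D K) (cor D K) d = Hmap B (MO D K) (JJ D K \<rho> n \<sigma>) b"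
  using \<psi>c[of k d] \<psi>\<sigma>[of k \<rho>] d \<rho> by simp
 also have "... = Hmap D (MO D K) (cor D K) (Hm B D n \<sigma> b)"
  using \<psi>c[of n "Hm B D n \<sigma> b"] \<psi>\<sigma>[of n "%i. i"] hb eqK iinj_pow by simp
 finally have "d = Hm B D n \<sigma> b" by (rule cor_inj[OF D d(1) hb(1)])
 then show ?thesis using d(2) by simp
qed

end

text \<open>The extension of \<open>\<phi>\<close> to a character that takes the unit to one. For
  the complex numbers and their identity, this and \<open>fst\<close> identify the unitisation with
  two copies of the complex numbers.\<close>

lemma (in locally_convex_algebra) second_character:
 assumes \<phi>: "\<phi> : lca_hom A CL"
 shows "(%x. fst x + \<phi> (snd x)) : lca_hom (unz A) CL"
proof -
 have "continuous_map (topo (unz A)) euclidean (%x. fst x + \<phi> (snd x))" unfolding unit_simps cplx_simps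
  using continuous_map_compose[OF continuous_map_snd homD(6)[OF \<phi>]]
  by (intro continuous_map_add) (auto simp: o_def cplx_simps intro: continuous_map_fst)
 then show ?thesis using homD(4,5,7)[OF \<phi>]
  by (auto simp: lca_hom_def hom_def unit_simps cplx_simps sm_closed m_closed algebra_simps)
qed

text \<open>\<open>c\<close> and \<open>c + d\<close> are the values of the two characters at
  \<open>(c, d)\<close>; if both are zero or one, \<open>(c, d)\<close> is idempotent in the
  unitisation.\<close>

lemma complex_01: "(c = 0 \<or> c = 1) & (c + d = 0 \<or> c + d = 1) ==> c * c = c & c * d + c * d + d * d = (d::complex)"
proof -
 assume cd: "(c = 0 \<or> c = 1) & (c + d = 0 \<or> c + d = 1)"
 have "(c + d) * (c + d) = c + d" "c * c = c" using cd by auto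
 then show ?thesis by (auto simp: algebra_simps)
qed

context lca_setting
begin

lemma H_inv: "[|A : Obj; B : Obj; f : lca_hom A B; x : carrier (H A)|] ==>
  Hmap A B f (inv\<^bsub>H A\<^esub> x) = inv\<^bsub>H B\<^esub> Hmap A B f x"
 by (rule group_hom.hom_inv[OF group_hom.intro[OF _ _ group_hom_axioms.intro]])
  (simp_all add: comm_group.axioms(2)[OF obj_group] map_hom)

text \<open>Tensoring with \<open>e\<close> is multiplicative because \<open>e\<close> is
  idempotent.\<close>

lemma tm_idem_hom:
 assumes "U : Obj" "B : Obj" "e : carrier U" "e \<otimes>\<^sub>U e = e"
 shows "tm U B e : lca_hom B (tens U B)"
proof -
 interpret T: tpair U B "tens U B" "tm U B" by (rule pair) fact+
 show ?thesis using T.t_clin_right[OF assms(3)] T.t_mult[OF assms(3,3)] assms(4) by (simp add: lca_hom_iff)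
qed

text \<open>In the unitisation \<open>U\<close> of the complex numbers the unit is the sum of two
  orthogonal idempotents, and \<open>\<sigma>\<close>, \<open>\<tau>\<close> define a morphism from
  the tensor product of \<open>U\<close> and \<open>B\<close> that carries these three elements to
  \<open>\<tau>\<close>, \<open>\<sigma>\<close> and their sum. So additivity is needed only for the
  unit of \<open>U\<close>, where the split extension of \<open>U\<close> provides it.\<close>

lemma H_add:
 assumes B: "B : Obj" and X: "X : Obj" and \<sigma>: "\<sigma> : lca_hom B X" and \<tau>: "\<tau> : lca_hom B X" and h: "h : lca_hom B X"
  and orth: "!!b b'. [|b : carrier B; b' : carrier B|] ==> \<sigma> b \<otimes>\<^sub>X \<tau> b' = \<zero>\<^sub>X"
   "!!b b'. [|b : carrier B; b' : carrier B|] ==> \<tau> b \<otimes>\<^sub>X \<sigma> b' = \<zero>\<^sub>X"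
  and sum: "!!b. b : carrier B ==> h b = \<sigma> b \<oplus>\<^sub>X \<tau> b"
  and x: "x : carrier (H B)"
 shows "Hmap B X h x = Hmap B X \<sigma> x \<otimes>\<^bsub>H X\<^esub> Hmap B X \<tau> x"
proof -
 define U where "U = UU CC"
 note C = CC(1)
 note uU = UU[OF C, folded U_def]
 have U: "U : Obj" by (rule uU(1))
 have UB: "tens U B : Obj" and CB: "tens CC B : Obj" by (rule obj_tens, fact+)+
 interpret B: locally_convex_algebra B by (rule obj_lca[OF B])
 interpret C: locally_convex_algebra CC by (rule obj_lca[OF C])
 interpret X: locally_convex_algebra X by (rule obj_lca[OF X])
 interpret U: tpair U B "tens U B" "tm U B" by (rule pair[OF U B])
 interpret T: tpair CC B "tens CC B" "tm CC B" by (rule pair[OF C B])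
 have uh: "uu CC : lca_hom U (unz CC)" and u'h: "uu' CC : lca_hom (unz CC) U"
  and ch: "cc : lca_hom CC CL" and c'h: "cc' : lca_hom CL CC"
  using uU(2,3) CC(2,3) by (auto dest: iso_hom)
 note uh = uh u'h and ch = ch c'h
 note c' = homD[OF ch(2), unfolded cplx_simps] and cD = homD[OF ch(1), unfolded cplx_simps]
 have c'c: "cc' d : carrier CC" for d using c'(3) by simp
 \<comment> \<open>The element of \<open>U\<close> with scalar part \<open>c\<close> and remaining
   part \<open>d\<close>; the two characters take the values \<open>c\<close> and
   \<open>c + d\<close> on it.\<close>
 define w where "w c d = uu' CC (c, cc' d)" for c d
 have wc: "w c d : carrier U" for c d unfolding w_def by (rule homD(3)[OF uh(2)]) (simp add: unit_simps c'c)
 have uw: "uu CC (w c d) = (c, cc' d)" for c d unfolding w_def by (rule uU(5)) (simp add: unit_simps c'c)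
 have ww: "w c d \<otimes>\<^sub>U w a b = w (c * a) (c * b + a * d + d * b)" for a b c d
 proof -
  have "w c d \<otimes>\<^sub>U w a b = uu' CC ((c, cc' d) \<otimes>\<^bsub>unz CC\<^esub> (a, cc' b))"
   unfolding w_def by (rule homD(7)[OF uh(2), symmetric]) (simp_all add: unit_simps c'c)
  also have "(c, cc' d) \<otimes>\<^bsub>unz CC\<^esub> (a, cc' b) = (c * a, cc' (c * b + a * d + d * b))"
   using c'(4)[of "c * b" "a * d"] c'(4)[of "c * b + a * d" "d * b"] c'(5) c'(7) by (simp add: unit_simps)
  finally show ?thesis by (simp add: w_def)
 qed
 define J where "J c d b = tm U B (w c d) b" for c d b
 have Jh: "J c d : lca_hom B (tens U B)" if "(c = 0 \<or> c = 1) & (c + d = 0 \<or> c + d = 1)" for c d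
 proof -
  have e: "c * c = c" "c * d + c * d + d * d = d" using complex_01[OF that] by simp_all
  then show ?thesis unfolding J_def by (intro tm_idem_hom[OF U B wc]) (simp only: ww e)
 qed
 \<comment> \<open>The idempotents with character values \<open>(1, 1)\<close>,
   \<open>(1, 0)\<close> and \<open>(0, 1)\<close>: the unit and its two orthogonal parts.\<close>
 have J1: "J 1 0 : lca_hom B (tens U B)" "J 1 (- 1) : lca_hom B (tens U B)" "J 0 1 : lca_hom B (tens U B)"
  by (rule Jh; simp)+
 define k1 where "k1 u = fst (uu CC u)" for u
 define k2 where "k2 u = fst (uu CC u) + cc (snd (uu CC u))" for u
 have k1: "k1 : lca_hom U CL" using hom_comp[OF uh(1) C.fst_hom] by (simp add: k1_def[abs_def] o_def)
 have k2: "k2 : lca_hom U CL"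
  using hom_comp[OF uh(1) C.second_character[OF ch(1)]] by (simp add: k2_def[abs_def] o_def)
 have kw: "k1 (w c d) = c" "k2 (w c d) = c + d" for c d by (simp_all add: k1_def k2_def uw CC(5))
 \<comment> \<open>The mixed terms of a product vanish because \<open>s\<close> and \<open>t\<close>
   have orthogonal ranges; this makes the bilinear map multiplicative.\<close>
 have Psi: "\<exists>\<Psi>\<in>lca_hom (tens U B) Y. \<forall>u\<in>carrier U. \<forall>b\<in>carrier B. \<Psi> (tm U B u b) = k1 u \<odot>\<^sub>Y s b \<oplus>\<^sub>Y k2 u \<odot>\<^sub>Y t b"
  if Y: "LCA Y" and s: "s : lca_hom B Y" and t: "t : lca_hom B Y"
   and o: "\<forall>b\<in>carrier B. \<forall>b'\<in>carrier B. s b \<otimes>\<^sub>Y t b' = \<zero>\<^sub>Y & t b \<otimes>\<^sub>Y s b' = \<zero>\<^sub>Y" for Y :: "'u lca" and s t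
 proof (rule U.lift_hom_exists[OF Y])
  interpret Y: locally_convex_algebra Y by fact
  show "bdd_bil_on U B Y (%u b. k1 u \<odot>\<^sub>Y s b \<oplus>\<^sub>Y k2 u \<odot>\<^sub>Y t b)"
   by (intro bdd_bil_add[OF Y] bdd_bil_scalar[OF obj_lca[OF U] Y] homD(1) k1 k2 s t)
  fix u b u' b' assume "u : carrier U" "b : carrier B" "u' : carrier U" "b' : carrier B"
  then show "k1 (u \<otimes>\<^sub>U u') \<odot>\<^sub>Y s (b \<otimes>\<^sub>B b') \<oplus>\<^sub>Y k2 (u \<otimes>\<^sub>U u') \<odot>\<^sub>Y t (b \<otimes>\<^sub>B b') =
   (k1 u \<odot>\<^sub>Y s b \<oplus>\<^sub>Y k2 u \<odot>\<^sub>Y t b) \<otimes>\<^sub>Y (k1 u' \<odot>\<^sub>Y s b' \<oplus>\<^sub>Y k2 u' \<odot>\<^sub>Y t b')"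
   using homD(7)[OF k1, of u u'] homD(7)[OF k2, of u u'] homD(3,7)[OF s] homD(3,7)[OF t] o
   by (simp add: cplx_simps Y.l_distr Y.r_distr Y.smult_m_left Y.smult_m_right Y.sm_closed Y.m_closed
     Y.sm_zero_right Y.sm_assoc mult.commute)
 qed
 define l where "l = tm CC B (cc' 1)"
 have l: "l : lca_hom B (tens CC B)" unfolding l_def using c'(7)[of 1 1] by (intro tm_idem_hom[OF C B c'c]) simp
 note LT = T.T.lca_axioms
 define i where "i = tmap CC B U B (ui CC) (%x. x)"
 define q where "q = tmap U B CC B (uq CC) (%x. x)"
 define r where "r = tmap CC B U B (us CC) (%x. x)"
 define P where "P = tmap U B CC B (snd \<circ> uu CC) (%x. x)"
 have sd0: "sdata CC U CC (ui CC) (uq CC) (us CC) (snd \<circ> uu CC)" unfolding U_def by (rule split_unit[OF C])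
 have sd: "sdata (tens CC B) (tens U B) (tens CC B) i q r P"
  unfolding i_def q_def r_def P_def by (rule sdata_tmap_right[OF B C U C sd0])
 have iq: "i : lca_hom (tens CC B) (tens U B)" "q : lca_hom (tens U B) (tens CC B)"
  using sd by (auto simp: sdata_def)
 have i_app: "i (tm CC B z b) = tm U B (ui CC z) b" if "z : carrier CC" "b : carrier B" for z b
  unfolding i_def using sd0 that by (intro tmap(2)[OF C B U B _ clin_ident] homD(1)) (auto simp: sdata_def)
 have q_app: "q (tm U B z b) = tm CC B (uq CC z) b" if "z : carrier U" "b : carrier B" for z b
  unfolding q_def using sd0 that by (intro tmap(2)[OF U B C B _ clin_ident] homD(1)) (auto simp: sdata_def)
 have qJ: "q (J 1 d b) = l b" if "b : carrier B" for b d using that wc by (simp add: J_def q_app uw l_def)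
 have il: "i (l b) = J 0 1 b" if "b : carrier B" for b using that c'c by (simp add: J_def i_app w_def l_def)
 let ?TB = "tens CC B"
 \<comment> \<open>The second character yields a left inverse of \<open>i\<close>, by which elements
   of the kernel are identified.\<close>
 obtain \<Psi>0 where \<Psi>0: "\<Psi>0 : lca_hom (tens U B) ?TB"
  "\<forall>u\<in>carrier U. \<forall>b\<in>carrier B. \<Psi>0 (tm U B u b) = k1 u \<odot>\<^sub>?TB \<zero>\<^sub>?TB \<oplus>\<^sub>?TB k2 u \<odot>\<^sub>?TB l b"
  using Psi[OF LT zero_hom[OF B CB] l] homD(3)[OF l] by (auto simp: T.T.N.l_null T.T.N.r_null)
 have \<Psi>0J: "\<Psi>0 (J c d b) = (c + d) \<odot>\<^sub>?TB l b" if "b : carrier B" for c d b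
  using that wc \<Psi>0(2) homD(3)[OF l that] by (simp add: J_def kw T.T.sm_zero_right T.T.sm_closed)
 have \<Psi>0i: "\<Psi>0 (i y) = y" if y: "y : carrier ?TB" for y
 proof -
  have "(\<Psi>0 \<circ> i) y = y"
  proof (rule T.clin_unique[OF LT clin_comp[OF homD(1)[OF iq(1)] homD(1)[OF \<Psi>0(1)]] clin_ident _ y])
   fix z b assume zb: "z : carrier CC" "b : carrier B"
   have z: "z = cc z \<odot>\<^sub>CC cc' 1" using c'(5)[of 1 "cc z"] CC(4)[OF zb(1)] by simp
   have uz: "ui CC z = w 0 (cc z)" using zb by (simp add: w_def CC(4))
   have "(\<Psi>0 \<circ> i) (tm CC B z b) = \<Psi>0 (J 0 (cc z) b)" using zb by (simp add: i_app uz[simplified] J_def)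
   also have "... = cc z \<odot>\<^sub>?TB l b" using zb by (simp add: \<Psi>0J)
   also have "... = tm CC B (cc z \<odot>\<^sub>CC cc' 1) b" using zb c'c by (simp add: l_def bilD(4)[OF T.t_bilinear])
   finally show "(\<Psi>0 \<circ> i) (tm CC B z b) = tm CC B z b" using z by simp
  qed
  then show ?thesis by simp
 qed
 interpret HU: comm_group "H (tens U B)" by (rule obj_group[OF UB])
 interpret HT: comm_group "H ?TB" by (rule obj_group[OF CB])
 define s1 where "s1 = Hmap B (tens U B) (J 1 0) x"
 define s2 where "s2 = Hmap B (tens U B) (J 1 (- 1)) x"
 have s12: "s1 : carrier (H (tens U B))" "s2 : carrier (H (tens U B))"
  unfolding s1_def s2_def by (rule H_closed[OF B UB]; fact J1 x)+
 \<comment> \<open>The unit and the idempotent \<open>(1, 0)\<close> have the same first character,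
   so the difference of their maps dies under \<open>q\<close> and comes from the kernel. The left
   inverse \<open>\<Psi>0\<close> shows that it comes from \<open>l\<close>, since the second
   character is one on the first and zero on the other.\<close>
 define z where "z = s1 \<otimes>\<^bsub>H (tens U B)\<^esub> inv\<^bsub>H (tens U B)\<^esub> s2"
 have z: "z : carrier (H (tens U B))" unfolding z_def using s12 by simp
 have lx: "Hmap B ?TB l x : carrier (H ?TB)" by (rule H_closed[OF B CB l x])
 have "Hmap (tens U B) ?TB q s1 = Hmap B ?TB l x" "Hmap (tens U B) ?TB q s2 = Hmap B ?TB l x" unfolding s1_def s2_def
  by (rule H_comp[OF B UB CB J1(1) iq(2) l _ x], simp add: qJ, rule H_comp[OF B UB CB J1(2) iq(2) l _ x], simp add: qJ)
 then have "Hmap (tens U B) ?TB q z = \<one>\<^bsub>H ?TB\<^esub>"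
  unfolding z_def using s12 lx by (simp add: H_mult[OF UB CB iq(2)] H_inv[OF UB CB iq(2)])
 then obtain y where y: "y : carrier (H ?TB)" "Hmap ?TB (tens U B) i y = z"
  using H_split(2)[OF CB UB CB sd z] by blast
 have "y = Hmap (tens U B) ?TB \<Psi>0 z"
  unfolding y(2)[symmetric] by (rule H_inverse[OF CB UB iq(1) \<Psi>0(1) \<Psi>0i y(1), symmetric])
 also have "Hmap (tens U B) ?TB \<Psi>0 z = Hmap (tens U B) ?TB \<Psi>0 s1 \<otimes>\<^bsub>H ?TB\<^esub> inv\<^bsub>H ?TB\<^esub> Hmap (tens U B) ?TB \<Psi>0 s2"
  unfolding z_def using s12 by (simp add: H_mult[OF UB CB \<Psi>0(1)] H_inv[OF UB CB \<Psi>0(1)])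
 also have "Hmap (tens U B) ?TB \<Psi>0 s1 = Hmap B ?TB l x"
  unfolding s1_def using homD(3)[OF l] by (intro H_comp[OF B UB CB J1(1) \<Psi>0(1) l _ x]) (simp add: \<Psi>0J T.T.sm_one)
 also have "Hmap (tens U B) ?TB \<Psi>0 s2 = Hmap B ?TB (%_. \<zero>\<^sub>?TB) x"
  unfolding s2_def using homD(3)[OF l] by (intro H_comp[OF B UB CB J1(2) \<Psi>0(1) zero_hom[OF B CB] _ x]) (simp add: \<Psi>0J T.T.sm_zero_left)
 finally have "y = Hmap B ?TB l x" using lx by (simp add: H_zero[OF B CB x])
 then have zx: "z = Hmap B (tens U B) (J 0 1) x" using y(2) H_comp[OF B CB UB l iq(1) J1(3) il x] by simp
 have "s1 = z \<otimes>\<^bsub>H (tens U B)\<^esub> s2" using s12 by (simp add: z_def HU.m_assoc)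
 then have S: "s1 = Hmap B (tens U B) (J 0 1) x \<otimes>\<^bsub>H (tens U B)\<^esub> s2" unfolding zx .
 have j3: "Hmap B (tens U B) (J 0 1) x : carrier (H (tens U B))" by (rule H_closed[OF B UB J1(3) x])
 \<comment> \<open>Carries the universal identity to \<open>X\<close>: the unit goes to
   \<open>h\<close>, the idempotents \<open>(1, 0)\<close> and \<open>(0, 1)\<close> to
   \<open>\<sigma>\<close> and \<open>\<tau>\<close>.\<close>
 obtain \<Psi> where \<Psi>: "\<Psi> : lca_hom (tens U B) X"
  "\<forall>u\<in>carrier U. \<forall>b\<in>carrier B. \<Psi> (tm U B u b) = k1 u \<odot>\<^sub>X \<sigma> b \<oplus>\<^sub>X k2 u \<odot>\<^sub>X \<tau> b"
  using Psi[OF obj_lca[OF X] \<sigma> \<tau>] orth by auto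
 have \<Psi>J: "\<Psi> (J c d b) = c \<odot>\<^sub>X \<sigma> b \<oplus>\<^sub>X (c + d) \<odot>\<^sub>X \<tau> b" if "b : carrier B" for c d b
  using that wc \<Psi>(2) by (simp add: J_def kw)
 note st = homD(3)[OF \<sigma>] homD(3)[OF \<tau>]
 have "Hmap (tens U B) X \<Psi> s1 = Hmap B X h x"
  unfolding s1_def using st by (intro H_comp[OF B UB X J1(1) \<Psi>(1) h _ x]) (simp add: \<Psi>J X.sm_one sum)
 moreover have "Hmap (tens U B) X \<Psi> s2 = Hmap B X \<sigma> x"
  unfolding s2_def using st by (intro H_comp[OF B UB X J1(2) \<Psi>(1) \<sigma> _ x]) (simp add: \<Psi>J X.sm_one X.sm_zero_left)
 moreover have "Hmap (tens U B) X \<Psi> (Hmap B (tens U B) (J 0 1) x) = Hmap B X \<tau> x"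
  using st by (intro H_comp[OF B UB X J1(3) \<Psi>(1) \<tau> _ x]) (simp add: \<Psi>J X.sm_one X.sm_zero_left)
 moreover have "Hmap (tens U B) X \<Psi> s1 = Hmap (tens U B) X \<Psi> (Hmap B (tens U B) (J 0 1) x) \<otimes>\<^bsub>H X\<^esub> Hmap (tens U B) X \<Psi> s2"
  by (subst S) (rule H_mult[OF UB X \<Psi>(1) j3 s12(2)])
 ultimately show ?thesis
  using comm_group.axioms(1)[OF obj_group[OF X]] H_closed[OF B X \<sigma> x] H_closed[OF B X \<tau> x]
  by (simp add: comm_monoid.m_comm)
qed

end

text \<open>Placing before flattening moves only the inner index, so after flattening the block
  number \<open>k div n\<close> is kept and the position inside each block is moved by
  \<open>\<rho>\<close>.\<close>

lemma flat_emb: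
 assumes D: "LCA D" and E: "LCA E" and \<tau>: "\<tau> : lca_hom D (mat_lca m E)"
  and \<rho>: "iinj \<rho> n N" shows "iinj (%k. k div n * N + \<rho> (k mod n)) (m * n) (m * N)"
  "flat m N \<tau> (emb D \<rho> n N X) = emb E (%k. k div n * N + \<rho> (k mod n)) (m * n) (m * N) (flat m n \<tau> X)"
proof -
 define r where "r k = k div n * N + \<rho> (k mod n)" for k
 have rdm: "r k div N = k div n" "r k mod N = \<rho> (k mod n)" if "k < m * n" for k
  using iinj_less[OF \<rho>, of "k mod n"] divmod_less[OF that] by (auto simp: r_def)
 have rlt: "r k < m * N" if k: "k < m * n" for k
 proof -
  have "\<rho> (k mod n) < N" using iinj_less[OF \<rho>] divmod_less[OF k] by auto
  then have "r k < Suc (k div n) * N" by (simp add: r_def)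
  also have "... <= m * N" using divmod_less[OF k] by (intro mult_right_mono) auto
  finally show ?thesis .
 qed
 have inj: "inj_on r {..<m * n}"
 proof (rule inj_onI)
  fix k l assume kl: "k : {..<m * n}" "l : {..<m * n}" "r k = r l"
  then have "k div n = l div n" "\<rho> (k mod n) = \<rho> (l mod n)" using rdm[of k] rdm[of l] by auto
  moreover have "k mod n = l mod n" using calculation(2) \<rho> divmod_less[of k m n] divmod_less[of l m n] kl
   by (auto simp: iinj_def dest: inj_onD)
  ultimately show "k = l" by (metis div_mod_decomp)
 qed
 have r: "iinj r (m * n) (m * N)" using inj rlt by (auto simp: iinj_def)
 then show "iinj (%k. k div n * N + \<rho> (k mod n)) (m * n) (m * N)" by (simp add: r_def[abs_def])
 have z: "\<tau> \<zero>\<^sub>D (i, j) = \<zero>\<^sub>E" if "i < m" "j < m" for i j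
  using clin_zero[OF D E mat_homD(2)[OF \<tau> that]] .
 have im: "i mod N : \<rho> ` {..<n} \<longleftrightarrow> i : r ` {..<m * n}" if i: "i < m * N" for i
 proof
  assume "i : r ` {..<m * n}"
  then show "i mod N : \<rho> ` {..<n}" using rdm divmod_less[of _ m n] by auto
 next
  assume "i mod N : \<rho> ` {..<n}"
  then obtain a where a: "a < n" "i mod N = \<rho> a" by auto
  have "i div N * n + a < Suc (i div N) * n" using a by simp
  also have "... <= m * n" using divmod_less[OF i] by (intro mult_right_mono) auto
  finally have lt: "i div N * n + a < m * n" .
  have "r (i div N * n + a) = i" using a by (simp add: r_def flip: a(2))
  then show "i : r ` {..<m * n}" using lt by (metis image_eqI lessThan_iff)
 qed
 have "flat m N \<tau> (emb D \<rho> n N X) (i, j) = emb E r (m * n) (m * N) (flat m n \<tau> X) (i, j)" if ij: "i < m * N" "j < m * N" for i j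
 proof (cases "i mod N : \<rho> ` {..<n} & j mod N : \<rho> ` {..<n}")
  case True
  then obtain a b where ab: "a < m * n" "b < m * n" "i = r a" "j = r b" using im ij by auto
  have "flat m N \<tau> (emb D \<rho> n N X) (i, j) = \<tau> (emb D \<rho> n N X (\<rho> (a mod n), \<rho> (b mod n))) (a div n, b div n)"
   using ij ab by (simp add: flat_app rdm)
  also have "... = \<tau> (X (a mod n, b mod n)) (a div n, b div n)"
   using divmod_less[OF ab(1)] divmod_less[OF ab(2)] by (simp add: emb_image[OF \<rho>])
  finally show ?thesis using ab by (simp add: emb_image[OF r] flat_app)
 next
  case False
  then have "emb D \<rho> n N X (i mod N, j mod N) = \<zero>\<^sub>D"
   using divmod_less[OF ij(1)] divmod_less[OF ij(2)] by (intro emb_outside) auto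
  then show ?thesis using False im[OF ij(1)] im[OF ij(2)] ij divmod_less[OF ij(1)] divmod_less[OF ij(2)]
   by (simp add: flat_app z emb_outside)
 qed
 then show "flat m N \<tau> (emb D \<rho> n N X) = emb E (%k. k div n * N + \<rho> (k mod n)) (m * n) (m * N) (flat m n \<tau> X)"
  unfolding r_def[symmetric, abs_def] by (intro ext) (auto simp: flat_def emb_def)
qed

context lca_setting
begin

lemma Hm_eqI:
 assumes "B : Obj" "D : Obj" "\<sigma> : lca_hom B (mat_lca n D)" "b : carrier (H B)" "iinj \<rho> n (2 ^ k)" "d : carrier (H D)"
  and "Hmap D (MO D k) (cor D k) d = Hmap B (MO D k) (JJ D k \<rho> n \<sigma>) b" shows "Hm B D n \<sigma> b = d"
 by (rule cor_inj[OF assms(2) Hm_basic(1)[OF assms(1-4)] assms(6), of k]) (simp add: assms(7) Hm_char[OF assms(1-5)])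

lemma Hm_cong:
 assumes B: "B : Obj" and D: "D : Obj" and \<sigma>: "\<sigma> : lca_hom B (mat_lca n D)" and \<sigma>': "\<sigma>' : lca_hom B (mat_lca n D)"
  and eq: "!!b. b : carrier B ==> \<sigma> b = \<sigma>' b" and x: "x : carrier (H B)"
 shows "Hm B D n \<sigma> x = Hm B D n \<sigma>' x" unfolding Hm_def
 by (intro arg_cong[where f = "inv_into _ _"] map_cong[OF B MO(1)[OF D] JJ_hom[OF B D iinj_pow] JJ_hom[OF B D iinj_pow]])
  (simp_all add: assms)

lemma Hm_hom:
 assumes B: "B : Obj" and D: "D : Obj" and \<sigma>: "\<sigma> : lca_hom B (mat_lca n D)"
 shows "Hm B D n \<sigma> : hom (H B) (H D)"
proof (rule homI)
 note b = Hm_basic[OF B D \<sigma>]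
 interpret HB: comm_group "H B" by (rule obj_group[OF B])
 interpret HD: comm_group "H D" by (rule obj_group[OF D])
 note h = JJ_hom[OF B D iinj_pow \<sigma>]
 show "x : carrier (H B) ==> Hm B D n \<sigma> x : carrier (H D)" for x by (rule b(1))
 show "Hm B D n \<sigma> (x \<otimes>\<^bsub>H B\<^esub> y) = Hm B D n \<sigma> x \<otimes>\<^bsub>H D\<^esub> Hm B D n \<sigma> y" if "x : carrier (H B)" "y : carrier (H B)" for x y
  using that b(1) by (intro Hm_eqI[OF B D \<sigma> _ iinj_pow])
   (simp_all add: H_mult[OF D MO(1)[OF D] cor_hom[OF D]] H_mult[OF B MO(1)[OF D] h] b(2))
qed

lemma Hm_pre:
 assumes A: "A : Obj" and B: "B : Obj" and D: "D : Obj" and \<sigma>: "\<sigma> : lca_hom B (mat_lca n D)" and g: "g : lca_hom A B"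
  and x: "x : carrier (H A)" shows "Hm B D n \<sigma> (Hmap A B g x) = Hm A D n (%a. \<sigma> (g a)) x"
proof -
 have \<sigma>g: "(%a. \<sigma> (g a)) : lca_hom A (mat_lca n D)" using hom_comp[OF g \<sigma>] by (simp add: o_def)
 show ?thesis by (rule Hm_eqI[OF B D \<sigma> H_closed[OF A B g x] iinj_pow Hm_basic(1)[OF A D \<sigma>g x]])
   (simp add: Hm_basic(2)[OF A D \<sigma>g x]
    H_comp[OF A B MO(1)[OF D] g JJ_hom[OF B D iinj_pow \<sigma>] JJ_hom[OF A D iinj_pow \<sigma>g] refl x])
qed

lemma Hm_emb:
 assumes B: "B : Obj" and D: "D : Obj" and \<sigma>: "\<sigma> : lca_hom B (mat_lca n D)" and \<rho>: "iinj \<rho> n N"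
  and x: "x : carrier (H B)" shows "Hm B D N (%b. emb D \<rho> n N (\<sigma> b)) x = Hm B D n \<sigma> x"
proof (rule Hm_eqI[OF B D emb_hom[OF obj_lca obj_lca \<rho> \<sigma>] x iinj_pow Hm_basic(1)[OF B D \<sigma> x]])
 interpret D: locally_convex_algebra D by (rule obj_lca[OF D])
 have \<rho>': "iinj \<rho> n (2 ^ N)" using iinj_comp[OF \<rho> iinj_pow] by (simp add: o_def)
 have "Hmap B (MO D N) (JJ D N (%i. i) N (%b. emb D \<rho> n N (\<sigma> b))) x = Hmap B (MO D N) (JJ D N \<rho> n \<sigma>) x"
  using mat_homD(1)[OF \<sigma>]
  by (intro map_cong[OF B MO(1)[OF D] JJ_hom[OF B D iinj_pow emb_hom[OF obj_lca obj_lca \<rho> \<sigma>]] JJ_hom[OF B D \<rho>' \<sigma>] _ x])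
   (simp_all add: B D D.emb_emb[OF \<rho> iinj_pow] o_def)
 then show "Hmap D (MO D N) (cor D N) (Hm B D n \<sigma> x) = Hmap B (MO D N) (JJ D N (%i. i) N (%b. emb D \<rho> n N (\<sigma> b))) x"
  by (simp add: Hm_char[OF B D \<sigma> x \<rho>'])
qed (use B D in auto)

lemma Hm_mat1:
 assumes B: "B : Obj" and D: "D : Obj" and g: "g : lca_hom B D" and x: "x : carrier (H B)"
 shows "Hm B D 1 (%b. mat1 (g b)) x = Hmap B D g x"
proof (rule Hm_eqI[OF B D mat1_hom[OF obj_lca obj_lca g] x iinj_pow H_closed[OF B D g x]])
 have eq: "cor D 1 (g b) = mo' D 1 (emb D (%i. i) 1 (2 ^ 1) (mat1 (g b)))" for b by (rule fun_cong[OF cor_JJ])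
 show "Hmap D (MO D 1) (cor D 1) (Hmap B D g x) = Hmap B (MO D 1) (JJ D 1 (%i. i) 1 (%b. mat1 (g b))) x"
  by (rule H_comp[OF B D MO(1)[OF D] g cor_hom[OF D] JJ_hom[OF B D iinj_pow mat1_hom[OF obj_lca obj_lca g]] eq x])
   (use B D in auto)
qed (use B D in auto)

text \<open>Functoriality of \<open>Hm\<close>. Applying \<open>\<tau>\<close> entrywise to the
  whole copy of the matrices over \<open>D\<close> produces scattered placements of
  \<open>\<tau>\<close> and of the flattened morphism; \<open>Hm_char\<close> makes their positions
  irrelevant.\<close>

lemma Hm_flat:
 assumes B: "B : Obj" and D: "D : Obj" and E: "E : Obj" and \<sigma>: "\<sigma> : lca_hom B (mat_lca n D)"
  and \<tau>: "\<tau> : lca_hom D (mat_lca m E)" and x: "x : carrier (H B)"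
 shows "Hm D E m \<tau> (Hm B D n \<sigma> x) = Hm B E (m * n) (%b. flat m n \<tau> (\<sigma> b)) x"
proof -
 interpret D: locally_convex_algebra D by (rule obj_lca[OF D])
 interpret E: locally_convex_algebra E by (rule obj_lca[OF E])
 note LB = obj_lca[OF B] and LD = obj_lca[OF D] and LE = obj_lca[OF E]
 define N :: nat where "N = 2 ^ n"
 define y where "y = Hm B D n \<sigma> x"
 have y: "y : carrier (H D)" unfolding y_def by (rule Hm_basic(1)[OF B D \<sigma> x])
 have ty: "Hm D E m \<tau> y : carrier (H E)" by (rule Hm_basic(1)[OF D E \<tau> y])
 let ?k = "m + n" and ?M = "MO D n"
 have le: "m * N <= 2 ^ ?k" by (simp add: N_def power_add less_imp_le)
 note i0 = iinj_ident[OF le]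
 note MD = MO[OF D, where k = n, folded N_def] and ME = MO[OF E, where k = ?k]
 \<comment> \<open>Entrywise application of \<open>\<tau>\<close>; the size \<open>m * 2 ^ n\<close>
   fits into \<open>2 ^ (m + n)\<close>.\<close>
 define T where "T = JJ E ?k (%i. i) (m * N) (%z. flat m N \<tau> (mo D n z))"
 have Th: "T : lca_hom ?M (MO E ?k)"
  unfolding T_def by (rule JJ_hom[OF MD(1) E i0 flat_hom[OF obj_lca[OF MD(1)] LD LE MD(8) \<tau>]])
 have T_emb: "T (mo' D n (emb D \<rho> l N X)) = mo' E ?k (emb E (%k. k div l * N + \<rho> (k mod l)) (m * l) (2 ^ ?k) (flat m l \<tau> X))"
  and T_inj: "iinj (%k. k div l * N + \<rho> (k mod l)) (m * l) (2 ^ ?k)"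
  if \<rho>: "iinj \<rho> l N" and X: "X : mats D l l" and fX: "flat m l \<tau> X : mats E (m * l) (m * l)" for \<rho> l X
 proof -
  note fe = flat_emb[OF LD LE \<tau> \<rho>]
  show "iinj (%k. k div l * N + \<rho> (k mod l)) (m * l) (2 ^ ?k)"
   using iinj_comp[OF fe(1) i0] by (simp add: o_def)
  show "T (mo' D n (emb D \<rho> l N X)) = mo' E ?k (emb E (%k. k div l * N + \<rho> (k mod l)) (m * l) (2 ^ ?k) (flat m l \<tau> X))"
   using X by (simp add: T_def MD(6) D.emb_mats[OF \<rho>] fe(2) E.emb_emb[OF fe(1) i0 fX] o_def)
 qed
 have fh: "(%b. flat m n \<tau> (\<sigma> b)) : lca_hom B (mat_lca (m * n) E)" by (rule flat_hom[OF LB LD LE \<sigma> \<tau>])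
 have fh1: "(%a. flat m 1 \<tau> (mat1 a)) : lca_hom D (mat_lca (m * 1) E)" by (rule flat_hom[OF LD LD LE mat1_hom'[OF D] \<tau>])
 have f1: "flat m 1 \<tau> (mat1 a) = \<tau> a" if a: "a : carrier D" for a
 proof (rule mats_eqI)
  show "flat m 1 \<tau> (mat1 a) : mats E m m" using mat_homD(1)[OF fh1 a] by simp
  show "\<tau> a : mats E m m" by (rule mat_homD(1)[OF \<tau> a])
 qed (simp add: flat_def mat1_def)
 have i1: "iinj (%i. i) 1 N" "iinj (%i. i) n N" by (auto simp: iinj_def N_def)
 \<comment> \<open>The positions reached through \<open>T\<close> from a corner of size one, and
   \<open>\<rho>2\<close> those reached from a corner of size \<open>n\<close>.\<close>
 define \<rho>1 where "\<rho>1 = (%k. k div 1 * N + k mod (1::nat))"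
 define \<rho>2 where "\<rho>2 = (%k. k div n * N + k mod n)"
 have m1: "mat1 a : mats D 1 1" if "a : carrier D" for a using mat_homD(1)[OF mat1_hom'[OF D] that] .
 have r1: "iinj \<rho>1 m (2 ^ ?k)"
  using T_inj[OF i1(1) m1[OF D.M.zero_closed] mat_homD(1)[OF fh1 D.M.zero_closed]] by (simp only: \<rho>1_def mult_1_right)
 have "iinj \<rho>2 (m * n) (m * N)" unfolding \<rho>2_def using flat_emb(1)[OF LD LE \<tau> i1(2)] by simp
 then have r2: "iinj \<rho>2 (m * n) (2 ^ ?k)" using iinj_comp[OF _ i0] by (simp add: o_def)
 have "Hmap ?M (MO E ?k) T (Hmap D ?M (cor D n) y) = Hmap D (MO E ?k) (JJ E ?k \<rho>1 m \<tau>) y"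
 proof (rule H_comp[OF D MD(1) ME(1) cor_hom[OF D] Th JJ_hom[OF D E r1 \<tau>] _ y])
  fix a assume a: "a : carrier D"
  have "cor D n a = mo' D n (emb D (%i. i) 1 N (mat1 a))" unfolding N_def by (rule fun_cong[OF cor_JJ])
  then have "T (cor D n a) = T (mo' D n (emb D (%i. i) 1 N (mat1 a)))" by (rule arg_cong)
  also have "... = mo' E ?k (emb E \<rho>1 m (2 ^ ?k) (\<tau> a))"
   unfolding T_emb[OF i1(1) m1[OF a] mat_homD(1)[OF fh1 a]] f1[OF a] \<rho>1_def mult_1_right ..
  finally show "T (cor D n a) = JJ E ?k \<rho>1 m \<tau> a" .
 qed
 also have "... = Hmap E (MO E ?k) (cor E ?k) (Hm D E m \<tau> y)" by (rule Hm_char[OF D E \<tau> y r1])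
 finally have 1: "Hmap ?M (MO E ?k) T (Hmap D ?M (cor D n) y) = Hmap E (MO E ?k) (cor E ?k) (Hm D E m \<tau> y)" .
 have "Hmap ?M (MO E ?k) T (Hmap B ?M (JJ D n (%i. i) n \<sigma>) x) = Hmap B (MO E ?k) (JJ E ?k \<rho>2 (m * n) (%b. flat m n \<tau> (\<sigma> b))) x"
 proof (rule H_comp[OF B MD(1) ME(1) JJ_hom[OF B D iinj_pow \<sigma>] Th JJ_hom[OF B E r2 fh] _ x])
  fix a assume a: "a : carrier B"
  show "T (JJ D n (%i. i) n \<sigma> a) = JJ E ?k \<rho>2 (m * n) (%b. flat m n \<tau> (\<sigma> b)) a"
   using T_emb[OF i1(2) mat_homD(1)[OF \<sigma> a] mat_homD(1)[OF fh a]] by (simp add: \<rho>2_def N_def)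
 qed
 then have "Hmap E (MO E ?k) (cor E ?k) (Hm D E m \<tau> y) = Hmap B (MO E ?k) (JJ E ?k \<rho>2 (m * n) (%b. flat m n \<tau> (\<sigma> b))) x"
  using 1 Hm_basic(2)[OF B D \<sigma> x] by (simp add: y_def)
 then show ?thesis unfolding y_def[symmetric] by (rule Hm_eqI[OF B E fh x r2 ty, symmetric])
qed

text \<open>A morphism into \<open>E\<close> is a morphism into matrices of size one, so this is
  \<open>Hm_flat\<close> with \<open>m = 1\<close>.\<close>

lemma Hm_post:
 assumes B: "B : Obj" and D: "D : Obj" and E: "E : Obj" and \<sigma>: "\<sigma> : lca_hom B (mat_lca n D)"
  and f: "f : lca_hom D E" and x: "x : carrier (H B)"
 shows "(%b. rmap f n n (\<sigma> b)) : lca_hom B (mat_lca n E)"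
  "Hmap D E f (Hm B D n \<sigma> x) = Hm B E n (%b. rmap f n n (\<sigma> b)) x"
proof -
 have eq: "flat 1 n (%a. mat1 (f a)) X = rmap f n n X" for X by (rule ext) (auto simp: flat_def rmap_def mat1_def)
 note t = mat1_hom[OF obj_lca[OF D] obj_lca[OF E] f]
 have "Hmap D E f (Hm B D n \<sigma> x) = Hm D E 1 (%a. mat1 (f a)) (Hm B D n \<sigma> x)"
  by (rule Hm_mat1[OF D E f Hm_basic(1)[OF B D \<sigma> x], symmetric])
 also have "... = Hm B E (1 * n) (%b. flat 1 n (%a. mat1 (f a)) (\<sigma> b)) x" by (rule Hm_flat[OF B D E \<sigma> t x])
 finally show "Hmap D E f (Hm B D n \<sigma> x) = Hm B E n (%b. rmap f n n (\<sigma> b)) x" unfolding eq mult_1_left .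
 show "(%b. rmap f n n (\<sigma> b)) : lca_hom B (mat_lca n E)"
  using flat_hom[OF obj_lca[OF B] obj_lca[OF D] obj_lca[OF E] \<sigma> t] unfolding eq mult_1_left .
qed

lemma Hm_add:
 assumes B: "B : Obj" and D: "D : Obj" and \<sigma>: "\<sigma> : lca_hom B (mat_lca n D)" and \<tau>: "\<tau> : lca_hom B (mat_lca n D)"
  and h: "h : lca_hom B (mat_lca n D)"
  and orth: "!!b b'. [|b : carrier B; b' : carrier B|] ==> mx D n n n (\<sigma> b) (\<tau> b') = \<zero>\<^bsub>mat_lca n D\<^esub>"
   "!!b b'. [|b : carrier B; b' : carrier B|] ==> mx D n n n (\<tau> b) (\<sigma> b') = \<zero>\<^bsub>mat_lca n D\<^esub>"
  and sum: "!!b. b : carrier B ==> h b = \<sigma> b \<oplus>\<^bsub>mat_lca n D\<^esub> \<tau> b"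
  and x: "x : carrier (H B)"
 shows "Hm B D n h x = Hm B D n \<sigma> x \<otimes>\<^bsub>H D\<^esub> Hm B D n \<tau> x"
proof -
 interpret D: locally_convex_algebra D by (rule obj_lca[OF D])
 note M = MO[OF D, where k = n]
 interpret M: locally_convex_algebra "MO D n" by (rule obj_lca[OF M(1)])
 interpret HD: comm_group "H D" by (rule obj_group[OF D])
 note i = iinj_pow[of n]
 note sm = mat_homD(1)[OF \<sigma>] mat_homD(1)[OF \<tau>] mat_homD(1)[OF h]
 note J = JJ_hom[OF B D i \<sigma>] JJ_hom[OF B D i \<tau>] JJ_hom[OF B D i h]
 have e0: "emb D (%i. i) n (2 ^ n) \<zero>\<^bsub>mat_lca n D\<^esub> = \<zero>\<^bsub>mat_lca (2 ^ n) D\<^esub>"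
  unfolding emb_def mlca_simps by (rule ext) (auto simp: inv_into_f_eq restrict_def)
 have eadd: "emb D (%i. i) n (2 ^ n) (X \<oplus>\<^bsub>mat_lca n D\<^esub> Y) = emb D (%i. i) n (2 ^ n) X \<oplus>\<^bsub>mat_lca (2 ^ n) D\<^esub> emb D (%i. i) n (2 ^ n) Y"
  for X Y unfolding emb_def mlca_simps by (rule ext) (auto simp: inv_into_f_eq restrict_def)
 note mo' = homD[OF M(4), unfolded mlca_simps(1,2)]
 have z: "\<zero>\<^bsub>mat_lca (2 ^ n) D\<^esub> : mats D (2 ^ n) (2 ^ n)" unfolding mlca_simps by (intro matsI) auto
 have "\<zero>\<^bsub>mat_lca (2 ^ n) D\<^esub> \<oplus>\<^bsub>mat_lca (2 ^ n) D\<^esub> \<zero>\<^bsub>mat_lca (2 ^ n) D\<^esub> = \<zero>\<^bsub>mat_lca (2 ^ n) D\<^esub>"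
  unfolding mlca_simps by (rule ext) (auto simp: restrict_def)
 then have z': "mo' D n \<zero>\<^bsub>mat_lca (2 ^ n) D\<^esub> = \<zero>\<^bsub>MO D n\<^esub>"
  using mo'(4)[OF z z] mo'(3)[OF z] by (metis M.M.add.l_cancel_one')
 have o: "mo' D n (emb D (%i. i) n (2 ^ n) X) \<otimes>\<^bsub>MO D n\<^esub> mo' D n (emb D (%i. i) n (2 ^ n) Y) = \<zero>\<^bsub>MO D n\<^esub>"
  if "X : mats D n n" "Y : mats D n n" "mx D n n n X Y = \<zero>\<^bsub>mat_lca n D\<^esub>" for X Y
  using that mo'(7)[OF D.emb_mats[OF i that(1)] D.emb_mats[OF i that(2)]] by (simp add: D.emb_mult[OF i] e0 z')
 have "Hmap B (MO D n) (JJ D n (%i. i) n h) x =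
   Hmap B (MO D n) (JJ D n (%i. i) n \<sigma>) x \<otimes>\<^bsub>H (MO D n)\<^esub> Hmap B (MO D n) (JJ D n (%i. i) n \<tau>) x"
  by (rule H_add[OF B M(1) J _ _ _ x]) (use sm in \<open>simp_all add: o orth sum eadd mo'(4) D.emb_mats[OF i]\<close>)
 then show ?thesis by (intro Hm_eqI[OF B D h x i])
   (simp_all add: H_mult[OF D M(1) cor_hom[OF D]] Hm_basic[OF B D \<sigma> x] Hm_basic[OF B D \<tau> x])
qed

text \<open>The two diagonal embeddings of \<open>B\<close> into the two by two matrices induce the
  same map by \<open>Hm_char\<close>; hence so do their composites with any
  \<open>\<Theta>\<close>.\<close>

lemma Hm_corner:
 assumes B: "B : Obj" and D: "D : Obj" and \<Theta>: "\<Theta> : lca_hom (MO B 1) (mat_lca n D)" and x: "x : carrier (H B)"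
  and \<rho>: "\<rho> 0 < (2::nat)" "\<rho>' 0 < (2::nat)"
 shows "(%b. \<Theta> (JJ B 1 \<rho> 1 mat1 b)) : lca_hom B (mat_lca n D)"
  "Hm B D n (%b. \<Theta> (JJ B 1 \<rho> 1 mat1 b)) x = Hm B D n (%b. \<Theta> (JJ B 1 \<rho>' 1 mat1 b)) x"
proof -
 have i: "iinj \<rho> 1 (2 ^ 1)" "iinj \<rho>' 1 (2 ^ 1)" using \<rho> by (auto simp: iinj_def inj_on_def)
 note h = JJ_hom[OF B B i(1) mat1_hom'[OF B]] JJ_hom[OF B B i(2) mat1_hom'[OF B]]
 note M = MO(1)[OF B, of 1]
 show "(%b. \<Theta> (JJ B 1 \<rho> 1 mat1 b)) : lca_hom B (mat_lca n D)"
  using hom_comp[OF h(1) \<Theta>] unfolding o_def .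
 show "Hm B D n (%b. \<Theta> (JJ B 1 \<rho> 1 mat1 b)) x = Hm B D n (%b. \<Theta> (JJ B 1 \<rho>' 1 mat1 b)) x"
  unfolding Hm_pre[OF B M D \<Theta> h(1) x, symmetric] Hm_pre[OF B M D \<Theta> h(2) x, symmetric]
   Hm_char[OF B B mat1_hom'[OF B] x i(1)] Hm_char[OF B B mat1_hom'[OF B] x i(2)] ..
qed

end

section \<open>The pairing with idempotents\<close>

lemma emb_const: "[|d < N; i < N; j < N|] ==> emb D (%_. d) 1 N (mat1 b) (i, j) = (if i = d & j = d then b else \<zero>\<^sub>D)"
 using emb_image[of "%_. d" 1 N 0 0 D "mat1 b"] emb_outside[of i N j "%_. d" 1 D "mat1 b"]
 by (auto simp: iinj_def mat1_def inj_on_def)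

context lca_setting
begin

definition tmat :: "'u lca => 'u lca => nat => (nat \<times> nat => 'u) => 'u => (nat \<times> nat => 'u)" where
 "tmat A B n e b = (\<lambda>ij\<in>{..<n} \<times> {..<n}. tm A B (e ij) b)"

definition Phi :: "'u lca => 'u lca => 'u idem => 'h => 'h" where
 "Phi A B p = Hm B (tens A B) (fst p) (tmat A B (fst p) (snd p))"

lemma tmat_app: "[|i < n; j < n|] ==> tmat A B n e b (i, j) = tm A B (e (i, j)) b" by (simp add: tmat_def)

lemma tmat_mats:
 assumes A: "A : Obj" and B: "B : Obj" and e: "e : mats A n n" and b: "b : carrier B"
 shows "tmat A B n e b : mats (tens A B) n n"
proof -
 interpret T: tpair A B "tens A B" "tm A B" by (rule pair[OF A B])
 show ?thesis unfolding tmat_def using matsD[OF e] b by (intro matsI T.t_closed) auto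
qed

lemma tmat_hom:
 assumes A: "A : Obj" and B: "B : Obj" and p: "(n, e) : idems A"
 shows "tmat A B n e : lca_hom B (mat_lca n (tens A B))"
proof (rule mat_homI[OF obj_lca[OF B] obj_lca[OF obj_tens[OF A B]] tmat_mats[OF A B idemsD(1)[OF p]]])
 interpret T: tpair A B "tens A B" "tm A B" by (rule pair[OF A B])
 interpret P: mpairing A B "tens A B" "tm A B" by (rule T.mpairing)
 note e = matsD[OF idemsD(1)[OF p]]
 show "(%b. tmat A B n e b (i, j)) : clin B (tens A B)" if "i < n" "j < n" for i j
  using T.t_clin_right[OF e[OF that]] that by (simp add: tmat_app)
 fix b b' i k assume b: "b : carrier B" "b' : carrier B" and ik: "i < n" "k < n"
 have ee: "(\<Oplus>\<^sub>A j\<in>{..<n}. e (i, j) \<otimes>\<^sub>A e (j, k)) = e (i, k)"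
  using fun_cong[OF idemsD(2)[OF p], of "(i, k)"] ik by (simp add: mm_app)
 have "(\<Oplus>\<^bsub>tens A B\<^esub>j\<in>{..<n}. tmat A B n e b (i, j) \<otimes>\<^bsub>tens A B\<^esub> tmat A B n e b' (j, k)) =
   (\<Oplus>\<^bsub>tens A B\<^esub>j\<in>{..<n}. tm A B (e (i, j) \<otimes>\<^sub>A e (j, k)) (b \<otimes>\<^sub>B b'))"
  using ik b e by (intro finsum_congr) (auto simp: tmat_app T.t_mult)
 also have "... = tm A B (e (i, k)) (b \<otimes>\<^sub>B b')"
  using ik b e by (subst P.t_finsum_left[symmetric]) (auto simp: ee T.A.m_closed T.B.m_closed)
 finally show "tmat A B n e (b \<otimes>\<^sub>B b') (i, k) =
   (\<Oplus>\<^bsub>tens A B\<^esub>j\<in>{..<n}. tmat A B n e b (i, j) \<otimes>\<^bsub>tens A B\<^esub> tmat A B n e b' (j, k))"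
  using ik by (simp add: tmat_app)
qed

lemma Phi_hom: "[|A : Obj; B : Obj; p : idems A|] ==> Phi A B p : hom (H B) (H (tens A B))"
 unfolding Phi_def by (rule Hm_hom) (auto simp: obj_tens tmat_hom)

lemma Phi_closed: "[|A : Obj; B : Obj; p : idems A; b : carrier (H B)|] ==> Phi A B p b : carrier (H (tens A B))"
 using Phi_hom hom_in_carrier by metis

text \<open>The idempotents and the matrices of the equivalence form a block matrix \<open>W\<close>
  with rows \<open>(e a)\<close> and \<open>(c f)\<close>. A two by two matrix over \<open>B\<close>
  is tensored into the blocks of \<open>W\<close>, one entry for each block. This is a morphism, and
  its restrictions to the two diagonal positions are the morphisms of \<open>e\<close> and
  \<open>f\<close>.\<close>

lemma Phi_equiv:
 assumes A: "A : Obj" and B: "B : Obj" and pq: "(p, q) : idem_equiv A" and x: "x : carrier (H B)"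
 shows "Phi A B p x = Phi A B q x"
proof -
 interpret T: tpair A B "tens A B" "tm A B" by (rule pair[OF A B])
 interpret P: mpairing A B "tens A B" "tm A B" by (rule T.mpairing)
 obtain m e n f where pq_eq: "p = (m, e)" "q = (n, f)" by (cases p; cases q)
 obtain a c where ef: "(m, e) : idems A" "(n, f) : idems A" and ac: "a : mats A m n" "c : mats A n m"
  "mx A m n m a c = e" "mx A n m n c a = f"
  "mx A m m n e a = a" "mx A n n m f c = c"
  "mx A m n n a f = a" "mx A n m m c e = c" using pq unfolding pq_eq by (rule T.A.N.idem_equivE)
 note em = idemsD(1)[OF ef(1)] and fm = idemsD(1)[OF ef(2)]
 define W where "W = blk m n m n e a c f"
 have Wm: "W : mats A (m + n) (m + n)" unfolding W_def by (rule blk_mats) (fact em ac fm)+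
 note Wc = matsD[OF Wm]
 \<comment> \<open>The number of the block to which an index belongs.\<close>
 define d where "d i = (if i < m then 0 else 1 :: nat)" for i
 have d2: "d i < 2" "d (m + i) = 1" "i < m ==> d i = 0" for i by (auto simp: d_def)
 \<comment> \<open>Whether the inner index runs through the first or the second block alone, the
   product of \<open>W\<close> with itself is again \<open>W\<close>; this combines all eight
   relations between \<open>e\<close>, \<open>a\<close>, \<open>c\<close> and
   \<open>f\<close>.\<close>
 have sum0: "(\<Oplus>\<^sub>A j\<in>{..<m}. W (i, j) \<otimes>\<^sub>A W (j, k)) = W (i, k)"
  and sum1: "(\<Oplus>\<^sub>A j\<in>{..<n}. W (i, m + j) \<otimes>\<^sub>A W (m + j, k)) = W (i, k)" if ik: "i < m + n" "k < m + n" for i k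
 proof -
  have E: "(\<Oplus>\<^sub>A j\<in>{..<l}. u (i, j) \<otimes>\<^sub>A v (j, k)) = w (i, k)"
   if "mx A r l s u v = w" "i < r" "k < s" for r l s u v w i k
   using mm_app[OF that(2,3), of A l u v] that(1) by simp
  note EE = E[OF idemsD(2)[OF ef(1)]] E[OF idemsD(2)[OF ef(2)]] E[OF ac(3)] E[OF ac(4)] E[OF ac(5)] E[OF ac(6)] E[OF ac(7)] E[OF ac(8)]
  show "(\<Oplus>\<^sub>A j\<in>{..<m}. W (i, j) \<otimes>\<^sub>A W (j, k)) = W (i, k)"
   by (rule less_add_cases[OF ik(1)]; rule less_add_cases[OF ik(2)])
    (simp_all add: W_def blk_app EE cong: fsum_congr)
  show "(\<Oplus>\<^sub>A j\<in>{..<n}. W (i, m + j) \<otimes>\<^sub>A W (m + j, k)) = W (i, k)"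
   by (rule less_add_cases[OF ik(1)]; rule less_add_cases[OF ik(2)])
    (simp_all add: W_def blk_app EE cong: fsum_congr)
 qed
 define M where "M = MO B 1"
 define mu where "mu = mo B 1"
 note MB = MO[OF B, where k = 1, folded M_def mu_def, unfolded power_one_right]
 note muD = mat_homD[OF MB(8)]
 define \<Theta> where "\<Theta> z = (\<lambda>(i, j)\<in>{..<m + n} \<times> {..<m + n}. tm A B (W (i, j)) (mu z (d i, d j)))" for z
 have \<Theta>_app: "\<Theta> z (i, j) = tm A B (W (i, j)) (mu z (d i, d j))" if "i < m + n" "j < m + n" for z i j
  using that by (simp add: \<Theta>_def)
 have muc: "mu z (i, j) : carrier B" if "z : carrier M" "i < 2" "j < 2" for z i j
  using muD(1)[OF that(1)] that(2,3) by (rule matsD)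
 have \<Theta>h: "\<Theta> : lca_hom M (mat_lca (m + n) (tens A B))"
 proof (rule mat_homI[OF obj_lca[OF MB(1)] T.T.lca_axioms])
  show "\<Theta> z : mats (tens A B) (m + n) (m + n)" if "z : carrier M" for z
   unfolding \<Theta>_def using Wc muc[OF that] d2(1) by (intro matsI) (auto intro!: T.t_closed)
  show "(%z. \<Theta> z (i, j)) : clin M (tens A B)" if ij: "i < m + n" "j < m + n" for i j
   using clin_comp[OF muD(2)[OF d2(1) d2(1)] T.t_clin_right[OF Wc[OF ij]]] ij by (simp add: \<Theta>_app o_def)
  fix z z' i k assume z: "z : carrier M" "z' : carrier M" and ik: "i < m + n" "k < m + n"
  define X where "X = mu z" define Y where "Y = mu z'"
  have Xc: "X (i, j) : carrier B" "Y (i, j) : carrier B" if "i < 2" "j < 2" for i j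
   using that z muc by (auto simp: X_def Y_def)
  have two: "{..<2} = {0, 1::nat}" by auto
  have "mu (z \<otimes>\<^sub>M z') (d i, d k) = X (d i, 0) \<otimes>\<^sub>B Y (0, d k) \<oplus>\<^sub>B X (d i, 1) \<otimes>\<^sub>B Y (1, d k)"
   using Xc d2(1) by (simp add: muD(3)[OF z] mm_app two X_def[symmetric] Y_def[symmetric] T.B.m_closed)
  then have "\<Theta> (z \<otimes>\<^sub>M z') (i, k) = tm A B (W (i, k)) (X (d i, 0) \<otimes>\<^sub>B Y (0, d k)) \<oplus>\<^bsub>tens A B\<^esub>
    tm A B (W (i, k)) (X (d i, 1) \<otimes>\<^sub>B Y (1, d k))"
   using Xc d2(1) Wc[OF ik] by (simp add: \<Theta>_app[OF ik] P.t_add_right T.B.m_closed)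
  \<comment> \<open>The term of the product over \<open>B\<close> with middle index zero is expanded
    through the first block of \<open>W\<close>; the term with middle index one is expanded below
    through the second.\<close>
  also have "tm A B (W (i, k)) (X (d i, 0) \<otimes>\<^sub>B Y (0, d k)) =
    (\<Oplus>\<^bsub>tens A B\<^esub>j\<in>{..<m}. tm A B (W (i, j) \<otimes>\<^sub>A W (j, k)) (X (d i, 0) \<otimes>\<^sub>B Y (0, d k)))"
   using Xc d2(1) Wc ik by (subst sum0[OF ik, symmetric], intro P.t_finsum_left) (auto simp: T.A.m_closed T.B.m_closed)
  also have "... = (\<Oplus>\<^bsub>tens A B\<^esub>j\<in>{..<m}. \<Theta> z (i, j) \<otimes>\<^bsub>tens A B\<^esub> \<Theta> z' (j, k))"
   using Xc d2 Wc ik by (intro finsum_congr refl) (auto simp: \<Theta>_app T.t_mult X_def Y_def)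
  also have "tm A B (W (i, k)) (X (d i, 1) \<otimes>\<^sub>B Y (1, d k)) =
    (\<Oplus>\<^bsub>tens A B\<^esub>j\<in>{..<n}. tm A B (W (i, m + j) \<otimes>\<^sub>A W (m + j, k)) (X (d i, 1) \<otimes>\<^sub>B Y (1, d k)))"
   using Xc d2(1) Wc ik by (subst sum1[OF ik, symmetric], intro P.t_finsum_left) (auto simp: T.A.m_closed T.B.m_closed)
  also have "... = (\<Oplus>\<^bsub>tens A B\<^esub>j\<in>{..<n}. \<Theta> z (i, m + j) \<otimes>\<^bsub>tens A B\<^esub> \<Theta> z' (m + j, k))"
   using Xc d2 Wc ik by (intro finsum_congr refl) (auto simp: \<Theta>_app T.t_mult X_def Y_def)
  also have "(\<Oplus>\<^bsub>tens A B\<^esub>j\<in>{..<m}. \<Theta> z (i, j) \<otimes>\<^bsub>tens A B\<^esub> \<Theta> z' (j, k)) \<oplus>\<^bsub>tens A B\<^esub>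
    (\<Oplus>\<^bsub>tens A B\<^esub>j\<in>{..<n}. \<Theta> z (i, m + j) \<otimes>\<^bsub>tens A B\<^esub> \<Theta> z' (m + j, k)) =
   (\<Oplus>\<^bsub>tens A B\<^esub>j\<in>{..<m + n}. \<Theta> z (i, j) \<otimes>\<^bsub>tens A B\<^esub> \<Theta> z' (j, k))"
   using muc z d2(1) Wc ik
   by (intro T.T.M.finsum_lessThan_add[symmetric]) (auto simp: \<Theta>_app intro!: T.T.m_closed T.t_closed)
  finally show "\<Theta> (z \<otimes>\<^sub>M z') (i, k) = (\<Oplus>\<^bsub>tens A B\<^esub>j\<in>{..<m + n}. \<Theta> z (i, j) \<otimes>\<^bsub>tens A B\<^esub> \<Theta> z' (j, k))" .
 qed
 define J where "J \<delta> b = mo' B 1 (emb B (%_. \<delta>) 1 (2 ^ 1) (mat1 b))" for \<delta> b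
 have J: "mu (J \<delta> b) (i, j) = (if i = \<delta> & j = \<delta> then b else \<zero>\<^sub>B)"
  if b: "b : carrier B" and \<delta>: "\<delta> < 2" "i < 2" "j < 2" for b \<delta> i j
 proof -
  have i: "iinj (%_. \<delta>) 1 2" using \<delta> by (auto simp: iinj_def inj_on_def)
  have "mu (J \<delta> b) = emb B (%_. \<delta>) 1 2 (mat1 b)" unfolding J_def mu_def power_one_right
   by (rule MB(6)[unfolded mu_def]) (rule T.B.emb_mats[OF i mat_homD(1)[OF mat1_hom'[OF B] b]])
  then show ?thesis using emb_const[OF \<delta>, of B b] by (simp only:)
 qed
 have i1: "iinj (%i. i) m (m + n)" and i2: "iinj (%i. m + i) n (m + n)" by (auto simp: iinj_def)
 note te = tmat_hom[OF A B ef(1)] and tf = tmat_hom[OF A B ef(2)]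
 note LB = obj_lca[OF B] and LT = T.T.lca_axioms and OT = obj_tens[OF A B]
 have \<rho>: "0 < (2::nat)" "1 < (2::nat)" by simp_all
 note hc = Hm_corner[OF B OT \<Theta>h[unfolded M_def] x]
 note \<Theta>J = hc[where \<rho> = "%_. 0" and \<rho>' = "%_. 1", OF \<rho>, folded J_def]
  and \<Theta>J' = hc(1)[where \<rho> = "%_. 1" and \<rho>' = "%_. 0", OF \<rho>(2,1), folded J_def]
 have e1: "\<Theta> (J 0 b) = emb (tens A B) (%i. i) m (m + n) (tmat A B m e b)" if b: "b : carrier B" for b
 proof (rule block_eqI)
  show "\<Theta> (J 0 b) : mats (tens A B) (m + n) (m + n)" by (rule mat_homD(1)[OF \<Theta>J(1) b])
  show "emb (tens A B) (%i. i) m (m + n) (tmat A B m e b) : mats (tens A B) (m + n) (m + n)"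
   by (rule T.T.emb_mats[OF i1 mat_homD(1)[OF te b]])
 qed (use b matsD[OF em] matsD[OF fm] matsD[OF ac(1)] matsD[OF ac(2)] emb_image[OF i1, of _ _ "tens A B" "tmat A B m e b"] in
   \<open>simp_all add: \<Theta>_app J d2 W_def blk_app tmat_app emb_outside P.t_zero_right\<close>)
 have fo: "emb (tens A B) (%i. m + i) n (m + n) X (i, j) = \<zero>\<^bsub>tens A B\<^esub>" if "i < m + n" "j < m + n" "i < m \<or> j < m" for X i j
  using that by (intro emb_outside) auto
 have e2: "\<Theta> (J 1 b) = emb (tens A B) (%i. m + i) n (m + n) (tmat A B n f b)" if b: "b : carrier B" for b
 proof (rule block_eqI)
  show "\<Theta> (J 1 b) : mats (tens A B) (m + n) (m + n)" by (rule mat_homD(1)[OF \<Theta>J' b])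
  show "emb (tens A B) (%i. m + i) n (m + n) (tmat A B n f b) : mats (tens A B) (m + n) (m + n)"
   by (rule T.T.emb_mats[OF i2 mat_homD(1)[OF tf b]])
 qed (use b matsD[OF em] matsD[OF fm] matsD[OF ac(1)] matsD[OF ac(2)] emb_image[OF i2, of _ _ "tens A B" "tmat A B n f b"] in
   \<open>simp_all add: \<Theta>_app J[simplified] d2[simplified] W_def blk_app tmat_app fo P.t_zero_right\<close>)
 have "Hm B (tens A B) m (tmat A B m e) x = Hm B (tens A B) (m + n) (%b. \<Theta> (J 0 b)) x"
  unfolding Hm_emb[OF B OT te i1 x, symmetric]
  by (rule Hm_cong[OF B OT emb_hom[OF LB LT i1 te] \<Theta>J(1) e1[symmetric] x])
 also have "... = Hm B (tens A B) (m + n) (%b. \<Theta> (J 1 b)) x" by (rule \<Theta>J(2))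
 also have "... = Hm B (tens A B) n (tmat A B n f) x" unfolding Hm_emb[OF B OT tf i2 x, symmetric]
  by (rule Hm_cong[OF B OT \<Theta>J' emb_hom[OF LB LT i2 tf] e2 x])
 finally show ?thesis by (simp add: Phi_def pq_eq)
qed

text \<open>The morphism of a block sum is the orthogonal sum of the two morphisms placed in
  complementary blocks, and \<open>Hm_emb\<close> discards the placement.\<close>

lemma Phi_bsum:
 assumes A: "A : Obj" and B: "B : Obj" and p: "p : idems A" and q: "q : idems A" and x: "x : carrier (H B)"
 shows "Phi A B (bsum A p q) x = Phi A B p x \<otimes>\<^bsub>H (tens A B)\<^esub> Phi A B q x"
proof -
 interpret T: tpair A B "tens A B" "tm A B" by (rule pair[OF A B])
 interpret P: mpairing A B "tens A B" "tm A B" by (rule T.mpairing)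
 obtain m e n f where pq: "p = (m, e)" "q = (n, f)" by (cases p; cases q)
 have s: "(m + n, block_diag A m n e f) : idems A" using T.A.N.bsum_idems[OF p q] by (simp add: pq bsum_def)
 have i1: "iinj (%i. i) m (m + n)" and i2: "iinj (%i. m + i) n (m + n)" by (auto simp: iinj_def)
 note te = tmat_hom[OF A B p[unfolded pq]] and tf = tmat_hom[OF A B q[unfolded pq]] and ts = tmat_hom[OF A B s]
 note LB = obj_lca[OF B] and LT = T.T.lca_axioms and OT = obj_tens[OF A B]
 let ?e = "%b. emb (tens A B) (%i. i) m (m + n) (tmat A B m e b)"
  and ?f = "%b. emb (tens A B) (%i. m + i) n (m + n) (tmat A B n f b)"
 have em: "?e b : mats (tens A B) (m + n) (m + n)" "?f b : mats (tens A B) (m + n) (m + n)" if "b : carrier B" for b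
  using T.T.emb_mats[OF i1 mat_homD(1)[OF te that]] T.T.emb_mats[OF i2 mat_homD(1)[OF tf that]] .
 have zm: "\<zero>\<^bsub>mat_lca (m + n) (tens A B)\<^esub> : mats (tens A B) (m + n) (m + n)" unfolding mlca_simps by (intro matsI) auto
 have orth: "mx (tens A B) (m + n) (m + n) (m + n) X Y = \<zero>\<^bsub>mat_lca (m + n) (tens A B)\<^esub>"
  if XY: "X : mats (tens A B) (m + n) (m + n)" "Y : mats (tens A B) (m + n) (m + n)"
   and z: "\<forall>i<m + n. \<forall>j<m + n. \<forall>k<m + n. X (i, j) = \<zero>\<^bsub>tens A B\<^esub> \<or> Y (j, k) = \<zero>\<^bsub>tens A B\<^esub>" for X Y
 proof (rule mats_eqI[OF T.T.N.mm_mats[OF XY] zm])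
  fix i k assume ik: "i < m + n" "k < m + n"
  have "(\<Oplus>\<^bsub>tens A B\<^esub>j\<in>{..<m + n}. X (i, j) \<otimes>\<^bsub>tens A B\<^esub> Y (j, k)) = \<zero>\<^bsub>tens A B\<^esub>"
  proof (rule T.T.M.add.finprod_one_eqI)
   fix j assume j: "j : {..<m + n}"
   then have "X (i, j) = \<zero>\<^bsub>tens A B\<^esub> \<or> Y (j, k) = \<zero>\<^bsub>tens A B\<^esub>" using z ik by blast
   then show "X (i, j) \<otimes>\<^bsub>tens A B\<^esub> Y (j, k) = \<zero>\<^bsub>tens A B\<^esub>"
    using j ik matsD[OF XY(1), of i j] matsD[OF XY(2), of j k] by (auto simp: T.T.N.l_null T.T.N.r_null)
  qed
  then show "mx (tens A B) (m + n) (m + n) (m + n) X Y (i, k) = \<zero>\<^bsub>mat_lca (m + n) (tens A B)\<^esub> (i, k)"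
   using ik by (simp add: mm_app mlca_simps)
 qed
 have eo: "?e b (i, j) = \<zero>\<^bsub>tens A B\<^esub>" if "i < m + n" "j < m + n" "i \<ge> m \<or> j \<ge> m" for b i j
  using that by (intro emb_outside) auto
 have fo: "?f b (i, j) = \<zero>\<^bsub>tens A B\<^esub>" if "i < m + n" "j < m + n" "i < m \<or> j < m" for b i j
  using that by (intro emb_outside) auto
 have "Hm B (tens A B) (m + n) (tmat A B (m + n) (block_diag A m n e f)) x =
   Hm B (tens A B) (m + n) ?e x \<otimes>\<^bsub>H (tens A B)\<^esub> Hm B (tens A B) (m + n) ?f x"
 proof (rule Hm_add[OF B OT emb_hom[OF LB LT i1 te] emb_hom[OF LB LT i2 tf] ts _ _ _ x])
  fix b b' assume b: "b : carrier B" "b' : carrier B"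
  have lm: "j < m \<or> m <= j" for j by linarith
  show "mx (tens A B) (m + n) (m + n) (m + n) (?e b) (?f b') = \<zero>\<^bsub>mat_lca (m + n) (tens A B)\<^esub>"
   by (rule orth[OF em(1)[OF b(1)] em(2)[OF b(2)]]) (use lm eo fo in blast)
  show "mx (tens A B) (m + n) (m + n) (m + n) (?f b) (?e b') = \<zero>\<^bsub>mat_lca (m + n) (tens A B)\<^esub>"
   by (rule orth[OF em(2)[OF b(1)] em(1)[OF b(2)]]) (use lm eo fo in blast)
 next
  fix b assume b: "b : carrier B"
  show "tmat A B (m + n) (block_diag A m n e f) b = ?e b \<oplus>\<^bsub>mat_lca (m + n) (tens A B)\<^esub> ?f b"
  proof (rule block_eqI)
   show "tmat A B (m + n) (block_diag A m n e f) b : mats (tens A B) (m + n) (m + n)" by (rule mat_homD(1)[OF ts b])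
   show "?e b \<oplus>\<^bsub>mat_lca (m + n) (tens A B)\<^esub> ?f b : mats (tens A B) (m + n) (m + n)"
    unfolding mlca_simps using em[OF b, THEN matsD] by (intro matsI) auto
  qed (use b matsD[OF idemsD(1)[OF p[unfolded pq]]] matsD[OF idemsD(1)[OF q[unfolded pq]]]
    emb_image[OF i1, of _ _ "tens A B" "tmat A B m e b"] emb_image[OF i2, of _ _ "tens A B" "tmat A B n f b"] in
    \<open>simp_all add: mlca_simps tmat_app block_diag_def eo fo P.t_zero_left P.t_closed\<close>)
 qed
 then show ?thesis by (simp add: Phi_def pq bsum_def Hm_emb[OF B OT te i1 x] Hm_emb[OF B OT tf i2 x])
qed

lemma Phi_natural:
 assumes Obj: "A : Obj" "B : Obj" "A' : Obj" "B' : Obj" and f: "f : lca_hom A A'" and g: "g : lca_hom B B'"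
  and p: "p : idems A" and x: "x : carrier (H B)"
 shows "Hmap (tens A B) (tens A' B') (tmap A B A' B' f g) (Phi A B p x) = Phi A' B' (imap f p) (Hmap B B' g x)"
proof -
 note A = obj_lca[OF Obj(1)] and A' = obj_lca[OF Obj(3)]
 obtain n e where pe: "p = (n, e)" by (cases p)
 have p': "(n, rmap f n n e) : idems A'"
  using imap_idems[OF locally_convex_algebra.nring[OF A] locally_convex_algebra.nring[OF A'] nring_hom_of[OF f] p]
  by (simp add: pe imap_def)
 note t = tmat_hom[OF Obj(1,2) p[unfolded pe]] and t' = tmat_hom[OF Obj(3,4) p']
 note O1 = obj_tens[OF Obj(1,2)] and O2 = obj_tens[OF Obj(3,4)]
 note fg = tmap_hom[OF Obj f g]
 have "Hmap (tens A B) (tens A' B') (tmap A B A' B' f g) (Hm B (tens A B) n (tmat A B n e) x) =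
   Hm B (tens A' B') n (%b. rmap (tmap A B A' B' f g) n n (tmat A B n e b)) x"
  by (rule Hm_post(2)[OF Obj(2) O1 O2 t fg x])
 also have "... = Hm B (tens A' B') n (%b. tmat A' B' n (rmap f n n e) (g b)) x"
 proof (rule Hm_cong[OF Obj(2) O2 Hm_post(1)[OF Obj(2) O1 O2 t fg x] hom_comp[OF g t', unfolded o_def] _ x])
  fix b assume b: "b : carrier B"
  show "rmap (tmap A B A' B' f g) n n (tmat A B n e b) = tmat A' B' n (rmap f n n e) (g b)"
   by (rule ext) (use b tmap(2)[OF Obj homD(1)[OF f] homD(1)[OF g]] matsD[OF idemsD(1)[OF p[unfolded pe]]] in
    \<open>auto simp: rmap_def tmat_def\<close>)
 qed
 also have "... = Hm B' (tens A' B') n (tmat A' B' n (rmap f n n e)) (Hmap B B' g x)"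
  by (rule Hm_pre[OF Obj(2,4) O2 t' g x, symmetric])
 finally show ?thesis by (simp add: Phi_def pe imap_def)
qed

text \<open>Both sides come from morphisms into matrices of size \<open>m * n\<close>. The Kronecker
  product and \<open>flat\<close> number their indices alike, so \<open>h\<close> matches the two
  entry by entry.\<close>

lemma Phi_assoc:
 assumes Obj: "A : Obj" "B : Obj" "C : Obj"
  and h: "h : lca_hom (tens (tens A B) C) (tens A (tens B C))"
  and happ: "!!a b c. [|a : carrier A; b : carrier B; c : carrier C|] ==>
   h (tm (tens A B) C (tm A B a b) c) = tm A (tens B C) a (tm B C b c)"
  and p: "p : idems A" and q: "q : idems B" and x: "x : carrier (H C)"
 shows "Hmap (tens (tens A B) C) (tens A (tens B C)) h (Phi (tens A B) C (itens (tm A B) p q) x) =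
  Phi A (tens B C) p (Phi B C q x)"
proof -
 interpret T: tpair A B "tens A B" "tm A B" by (rule pair[OF Obj(1,2)])
 interpret P: mpairing A B "tens A B" "tm A B" by (rule T.mpairing)
 note OAB = obj_tens[OF Obj(1,2)] and OBC = obj_tens[OF Obj(2,3)]
 note O1 = obj_tens[OF OAB Obj(3)] and O2 = obj_tens[OF Obj(1) OBC]
 obtain m e n f where pq: "p = (m, e)" "q = (n, f)" by (cases p; cases q)
 have r: "(m * n, kron (tm A B) m m n n e f) : idems (tens A B)"
  using P.itens_idems[OF p q] by (simp add: pq itens_def)
 note tr = tmat_hom[OF OAB Obj(3) r] and tp = tmat_hom[OF Obj(1) OBC p[unfolded pq]] and tq = tmat_hom[OF Obj(2,3) q[unfolded pq]]
 note fl = flat_hom[OF obj_lca[OF Obj(3)] obj_lca[OF OBC] obj_lca[OF O2] tq tp]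
 have "Hmap (tens (tens A B) C) (tens A (tens B C)) h (Hm C (tens (tens A B) C) (m * n) (tmat (tens A B) C (m * n) (kron (tm A B) m m n n e f)) x) =
   Hm C (tens A (tens B C)) (m * n) (%c. rmap h (m * n) (m * n) (tmat (tens A B) C (m * n) (kron (tm A B) m m n n e f) c)) x"
  by (rule Hm_post(2)[OF Obj(3) O1 O2 tr h x])
 also have "... = Hm C (tens A (tens B C)) (m * n) (%c. flat m n (tmat A (tens B C) m e) (tmat B C n f c)) x"
 proof (rule Hm_cong[OF Obj(3) O2 Hm_post(1)[OF Obj(3) O1 O2 tr h x] fl _ x])
  fix c assume c: "c : carrier C"
  show "rmap h (m * n) (m * n) (tmat (tens A B) C (m * n) (kron (tm A B) m m n n e f) c) =
    flat m n (tmat A (tens B C) m e) (tmat B C n f c)"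
  proof (rule ext)
   fix ij
   show "rmap h (m * n) (m * n) (tmat (tens A B) C (m * n) (kron (tm A B) m m n n e f) c) ij =
    flat m n (tmat A (tens B C) m e) (tmat B C n f c) ij"
    using c matsD[OF idemsD(1)[OF p[unfolded pq]]] matsD[OF idemsD(1)[OF q[unfolded pq]]] divmod_less[of _ m n]
    by (cases ij) (auto simp: rmap_def tmat_def flat_def kron_def happ)
  qed
 qed
 also have "... = Hm (tens B C) (tens A (tens B C)) m (tmat A (tens B C) m e) (Hm C (tens B C) n (tmat B C n f) x)"
  by (rule Hm_flat[OF Obj(3) OBC O2 tq tp x, symmetric])
 finally show ?thesis by (simp add: Phi_def pq itens_def)
qed

end

lemma (in comm_group) diff_mult_diff:
 assumes [simp]: "a : carrier G" "b : carrier G" "c : carrier G" "d : carrier G"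
 shows "(a \<otimes> inv b) \<otimes> (c \<otimes> inv d) = (a \<otimes> c) \<otimes> inv (b \<otimes> d)"
 by (simp add: inv_mult m_ac)

lemma idem_monoid_one: "\<one>\<^bsub>idem_monoid R\<^esub> = idem_class R (0, %_. undefined)"
 by (simp add: idem_monoid_def)

lemma (in nring) mat1_idems:
 assumes e: "e : carrier R" "e \<otimes> e = e" shows "(1, mat1 e) : idems R"
proof -
 have "mat1 e : mats R 1 1" unfolding mat1_def using e(1) by (intro matsI) auto
 moreover have "mx R 1 1 1 (mat1 e) (mat1 e) = mat1 e"
  unfolding mat_mult_def mat1_def using e by (intro restrict_ext) (auto simp: lessThan_Suc)
 ultimately show ?thesis by (simp add: idems_def)
qed

text \<open>\<open>KG_one\<close> lies over the unitisation of \<open>complex_lca\<close> itself,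
  which need not belong to \<open>Obj\<close>.\<close>

lemma unitization_cplx_nring: "nring (unz CL)"
proof (intro nring.intro nring_axioms.intro abelian_groupI)
 fix x assume "x : carrier (unz CL)"
 show "\<exists>y\<in>carrier (unz CL). y \<oplus>\<^bsub>unz CL\<^esub> x = \<zero>\<^bsub>unz CL\<^esub>"
  by (rule bexI[of _ "- x"]) (cases x, auto simp: unit_simps cplx_simps)
qed (auto simp: unit_simps cplx_simps algebra_simps)

section \<open>The pairing of \<open>K0\<close> with the functor\<close>

context lca_setting
begin

lemma nr: "A : Obj ==> nring A" by (rule locally_convex_algebra.nring[OF obj_lca])

lemma unitization_nr: "A : Obj ==> nring (unz A)" by (rule locally_convex_algebra.unit_nring[OF obj_lca])

definition Phi_class :: "'u lca => 'u lca => 'h => 'u idem set => 'h" where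
 "Phi_class A B b P = Phi A B (SOME p. p : P) b"

text \<open>The pairing with idempotents over \<open>A\<close> itself. For the product it is used
  with copies of unitisations and their tensor products in place of \<open>A\<close>.\<close>

definition Kp :: "'u lca => 'u lca => 'u k0 => 'h => 'h" where
 "Kp A B X b = groth_lift (idem_monoid A) (H (tens A B)) (Phi_class A B b) X"

lemma Phi_class:
 assumes A: "A : Obj" and B: "B : Obj" and p: "p : idems A" and b: "b : carrier (H B)"
 shows "Phi_class A B b (idem_class A p) = Phi A B p b"
proof -
 have "(SOME q. q : idem_class A p) : idem_class A p"
  by (rule someI_ex) (use nring.idem_class_self[OF nr[OF A] p] in blast)
 then show ?thesis unfolding Phi_class_def using Phi_equiv[OF A B _ b] nring.idem_class_mem[OF nr[OF A]] by metis
qed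

lemma Phi_class_hom:
 assumes A: "A : Obj" and B: "B : Obj" and b: "b : carrier (H B)"
 shows "Phi_class A B b : hom (idem_monoid A) (H (tens A B))"
proof (rule homI)
 interpret A: nring A by (rule nr[OF A])
 fix P Q assume "P : carrier (idem_monoid A)" "Q : carrier (idem_monoid A)"
 then obtain p q where pq: "P = idem_class A p" "p : idems A" "Q = idem_class A q" "q : idems A"
  unfolding A.idem_carrier by blast
 then show "Phi_class A B b (P \<otimes>\<^bsub>idem_monoid A\<^esub> Q) = Phi_class A B b P \<otimes>\<^bsub>H (tens A B)\<^esub> Phi_class A B b Q"
  by (simp add: A.cls_bsum Phi_class[OF A B _ b] A.bsum_idems Phi_bsum[OF A B _ _ b])
next
 interpret A: nring A by (rule nr[OF A])
 fix P assume "P : carrier (idem_monoid A)"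
 then obtain p where "P = idem_class A p" "p : idems A" unfolding A.idem_carrier by blast
 then show "Phi_class A B b P : carrier (H (tens A B))"
  by (simp add: Phi_class[OF A B _ b] Phi_closed[OF A B _ b])
qed

lemma Kp_kcls:
 assumes A: "A : Obj" and B: "B : Obj" and b: "b : carrier (H B)" and p: "p : idems A" and q: "q : idems A"
 shows "Kp A B (kcls A p q) b = Phi A B p b \<otimes>\<^bsub>H (tens A B)\<^esub> inv\<^bsub>H (tens A B)\<^esub> Phi A B q b"
 unfolding Kp_def kcls_def
 using groth_lift_class[OF nring.idem_comm_monoid[OF nr[OF A]] obj_group[OF obj_tens[OF A B]] Phi_class_hom[OF A B b]
   nring.cls_carrier[OF nr[OF A] p] nring.cls_carrier[OF nr[OF A] q]] by (simp add: Phi_class[OF A B _ b] p q)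

lemma Kp_hom_left:
 assumes A: "A : Obj" and B: "B : Obj" and b: "b : carrier (H B)"
 shows "(%X. Kp A B X b) : hom (K0 A) (H (tens A B))"
 using groth_lift_hom[OF nring.idem_comm_monoid[OF nr[OF A]] obj_group[OF obj_tens[OF A B]] Phi_class_hom[OF A B b]]
 unfolding Kp_def[abs_def] K0_def by simp

lemma Kp_closed: "[|A : Obj; B : Obj; X : carrier (K0 A); b : carrier (H B)|] ==> Kp A B X b : carrier (H (tens A B))"
 using hom_in_carrier[OF Kp_hom_left] by blast

lemma Kp_one: "[|A : Obj; B : Obj; b : carrier (H B)|] ==> Kp A B \<one>\<^bsub>K0 A\<^esub> b = \<one>\<^bsub>H (tens A B)\<^esub>"
 by (rule hom_one[OF Kp_hom_left]) (simp_all add: comm_group.axioms(2) nring.K0_comm_group[OF nr] obj_group[OF obj_tens])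

lemma Kp_hom_right:
 assumes A: "A : Obj" and B: "B : Obj" and X: "X : carrier (K0 A)"
 shows "Kp A B X : hom (H B) (H (tens A B))"
proof (rule homI)
 interpret HB: comm_group "H B" by (rule obj_group[OF B])
 interpret HT: comm_group "H (tens A B)" by (rule obj_group[OF obj_tens[OF A B]])
 show "Kp A B X b : carrier (H (tens A B))" if "b : carrier (H B)" for b using Kp_closed[OF A B X that] .
 fix b c assume b: "b : carrier (H B)" "c : carrier (H B)"
 obtain p q where pq: "p : idems A" "q : idems A" and Xe: "X = kcls A p q" using X by (rule nring.K0_cases[OF nr[OF A]])
 note pc = Phi_closed[OF A B pq(1)] Phi_closed[OF A B pq(2)]
 show "Kp A B X (b \<otimes>\<^bsub>H B\<^esub> c) = Kp A B X b \<otimes>\<^bsub>H (tens A B)\<^esub> Kp A B X c"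
  using b pc hom_mult[OF Phi_hom[OF A B pq(1)] b] hom_mult[OF Phi_hom[OF A B pq(2)] b]
  by (simp add: Xe Kp_kcls[OF A B _ pq] HT.diff_mult_diff)
qed

lemma Kp_natural:
 assumes Obj: "A : Obj" "B : Obj" "A' : Obj" "B' : Obj" and f: "f : lca_hom A A'" and g: "g : lca_hom B B'"
  and X: "X : carrier (K0 A)" and b: "b : carrier (H B)"
 shows "Hmap (tens A B) (tens A' B') (tmap A B A' B' f g) (Kp A B X b) = Kp A' B' (K0_map A' f X) (Hmap B B' g b)"
proof -
 obtain p q where pq: "p : idems A" "q : idems A" and Xe: "X = kcls A p q" using X by (rule nring.K0_cases[OF nr[OF Obj(1)]])
 note O1 = obj_tens[OF Obj(1,2)] and O2 = obj_tens[OF Obj(3,4)] and t = tmap_hom[OF Obj f g]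
 note fh = nr[OF Obj(1)] nr[OF Obj(3)] nring_hom_of[OF f]
 interpret H1: comm_group "H (tens A B)" by (rule obj_group[OF O1])
 have b': "Hmap B B' g b : carrier (H B')" by (rule H_closed[OF Obj(2,4) g b])
 show ?thesis unfolding Xe Kp_kcls[OF Obj(1,2) b pq] K0_map_kcls[OF fh pq]
   Kp_kcls[OF Obj(3,4) b' imap_idems[OF fh pq(1)] imap_idems[OF fh pq(2)]]
  using Phi_closed[OF Obj(1,2) pq(1) b] Phi_closed[OF Obj(1,2) pq(2) b]
  by (simp add: H_mult[OF O1 O2 t] H_inv[OF O1 O2 t] Phi_natural[OF Obj f g _ b] pq)
qed

lemma Kp_assoc:
 assumes Obj: "A : Obj" "B : Obj" "C : Obj"
  and h: "h : lca_hom (tens (tens A B) C) (tens A (tens B C))"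
  and happ: "!!a b c. [|a : carrier A; b : carrier B; c : carrier C|] ==>
   h (tm (tens A B) C (tm A B a b) c) = tm A (tens B C) a (tm B C b c)"
  and X: "X : carrier (K0 A)" and Y: "Y : carrier (K0 B)" and c: "c : carrier (H C)"
 shows "Hmap (tens (tens A B) C) (tens A (tens B C)) h (Kp (tens A B) C (K0_cup (tens A B) (tm A B) X Y) c) =
  Kp A (tens B C) X (Kp B C Y c)"
proof -
 interpret T: tpair A B "tens A B" "tm A B" by (rule pair[OF Obj(1,2)])
 interpret P: mpairing A B "tens A B" "tm A B" by (rule T.mpairing)
 note OAB = obj_tens[OF Obj(1,2)] and OBC = obj_tens[OF Obj(2,3)]
 note O1 = obj_tens[OF OAB Obj(3)] and O2 = obj_tens[OF Obj(1) OBC]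
 interpret H1: comm_group "H (tens (tens A B) C)" by (rule obj_group[OF O1])
 interpret H2: comm_group "H (tens A (tens B C))" by (rule obj_group[OF O2])
 interpret H3: comm_group "H (tens B C)" by (rule obj_group[OF OBC])
 obtain p p' where p: "p : idems A" "p' : idems A" and Xe: "X = kcls A p p'" using X by (rule nring.K0_cases[OF nr[OF Obj(1)]])
 obtain q q' where q: "q : idems B" "q' : idems B" and Ye: "Y = kcls B q q'" using Y by (rule nring.K0_cases[OF nr[OF Obj(2)]])
 let ?i = "itens (tm A B)" and ?h = "Hmap (tens (tens A B) C) (tens A (tens B C)) h"
 have it: "?i r s : idems (tens A B)" if "r : idems A" "s : idems B" for r s by (rule P.itens_idems[OF that])
 define F where "F r s = Phi A (tens B C) r (Phi B C s c)" for r s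
 have qc: "Phi B C s c : carrier (H (tens B C))" if "s : idems B" for s by (rule Phi_closed[OF Obj(2,3) that c])
 have Fc: "F r s : carrier (H (tens A (tens B C)))" if "r : idems A" "s : idems B" for r s
  unfolding F_def by (rule Phi_closed[OF Obj(1) OBC that(1) qc[OF that(2)]])
 have hF: "?h (Phi (tens A B) C (?i r s) c) = F r s" if "r : idems A" "s : idems B" for r s
  unfolding F_def by (rule Phi_assoc[OF Obj h happ that c])
 have sum: "?h (Phi (tens A B) C (bsum (tens A B) (?i r s) (?i r' s')) c) = F r s \<otimes>\<^bsub>H (tens A (tens B C))\<^esub> F r' s'"
  if "r : idems A" "s : idems B" "r' : idems A" "s' : idems B" for r s r' s'
  using that by (simp add: Phi_bsum[OF OAB Obj(3) _ _ c] it H_mult[OF O1 O2 h] Phi_closed[OF OAB Obj(3) _ c] hF)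
 have bs: "bsum (tens A B) (?i r s) (?i r' s') : idems (tens A B)"
  if "r : idems A" "s : idems B" "r' : idems A" "s' : idems B" for r s r' s'
  by (rule nring.bsum_idems[OF nr[OF OAB] it[OF that(1,2)] it[OF that(3,4)]])
 note c1 = Phi_closed[OF OAB Obj(3) bs[OF p(1) q(1) p(2) q(2)] c] and c2 = Phi_closed[OF OAB Obj(3) bs[OF p(1) q(2) p(2) q(1)] c]
 have "?h (Kp (tens A B) C (K0_cup (tens A B) (tm A B) X Y) c) =
   (F p q \<otimes>\<^bsub>H (tens A (tens B C))\<^esub> F p' q') \<otimes>\<^bsub>H (tens A (tens B C))\<^esub>
    inv\<^bsub>H (tens A (tens B C))\<^esub> (F p q' \<otimes>\<^bsub>H (tens A (tens B C))\<^esub> F p' q)"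
  unfolding Xe Ye P.K0_cup_kcls[OF p q] Kp_kcls[OF OAB Obj(3) c bs[OF p(1) q(1) p(2) q(2)] bs[OF p(1) q(2) p(2) q(1)]]
  using c1 c2 p q by (simp add: H_mult[OF O1 O2 h] H_inv[OF O1 O2 h] sum)
 \<comment> \<open>Regroups the four terms of \<open>(p - p') (q - q')\<close> by the first factor,
   as in the iterated pairing.\<close>
 also have "... = (F p q \<otimes>\<^bsub>H (tens A (tens B C))\<^esub> inv\<^bsub>H (tens A (tens B C))\<^esub> F p q') \<otimes>\<^bsub>H (tens A (tens B C))\<^esub>
   inv\<^bsub>H (tens A (tens B C))\<^esub> (F p' q \<otimes>\<^bsub>H (tens A (tens B C))\<^esub> inv\<^bsub>H (tens A (tens B C))\<^esub> F p' q')"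
  using Fc p q by (simp add: H2.inv_mult H2.m_ac)
 also have "... = Kp A (tens B C) X (Kp B C Y c)"
 proof -
  have "Phi A (tens B C) r (Kp B C Y c) = F r q \<otimes>\<^bsub>H (tens A (tens B C))\<^esub> inv\<^bsub>H (tens A (tens B C))\<^esub> F r q'"
   if r: "r : idems A" for r
  proof -
   interpret g: group_hom "H (tens B C)" "H (tens A (tens B C))" "Phi A (tens B C) r"
    using Phi_hom[OF Obj(1) OBC r] by unfold_locales
   show ?thesis using qc[OF q(1)] qc[OF q(2)] by (simp add: Ye Kp_kcls[OF Obj(2,3) c q] F_def)
  qed
  moreover have "Kp B C Y c : carrier (H (tens B C))" by (rule Kp_closed[OF Obj(2,3) Y c])
  ultimately show ?thesis using p by (simp add: Xe Kp_kcls[OF Obj(1) OBC _ p])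
 qed
 finally show ?thesis .
qed

lemma Kp_rank_one:
 assumes A: "A : Obj" and B: "B : Obj" and e: "e : carrier A" "e \<otimes>\<^sub>A e = e" and b: "b : carrier (H B)"
 shows "(1, mat1 e) : idems A"
  "Kp A B (kcls A (1, mat1 e) (0, %_. undefined)) b = Hmap B (tens A B) (tm A B e) b"
proof -
 interpret A: nring A by (rule nr[OF A])
 interpret HT: comm_group "H (tens A B)" by (rule obj_group[OF obj_tens[OF A B]])
 show i: "(1, mat1 e) : idems A" by (rule A.mat1_idems[OF e])
 note z = A.idem_zero_idems
 \<comment> \<open>The empty idempotent is its own double, so the map it induces is trivial.\<close>
 have "bsum A (0, %_. undefined) (0, %_. undefined) = (0, %_. undefined)" by (auto simp: bsum_def block_diag_def)
 then have "Phi A B (0, %_. undefined) b = Phi A B (0, %_. undefined) b \<otimes>\<^bsub>H (tens A B)\<^esub> Phi A B (0, %_. undefined) b"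
  using Phi_bsum[OF A B z z b] by simp
 then have 0: "Phi A B (0, %_. undefined) b = \<one>\<^bsub>H (tens A B)\<^esub>"
  using Phi_closed[OF A B z b] by (metis HT.l_cancel_one')
 have eq: "tmat A B 1 (mat1 e) = (%x. mat1 (tm A B e x))" by (rule ext) (auto simp: tmat_def mat1_def)
 have "Phi A B (1, mat1 e) b = Hmap B (tens A B) (tm A B e) b"
  unfolding Phi_def fst_conv snd_conv eq by (rule Hm_mat1[OF B obj_tens[OF A B] tm_idem_hom[OF A B e] b])
 then show "Kp A B (kcls A (1, mat1 e) (0, %_. undefined)) b = Hmap B (tens A B) (tm A B e) b"
  unfolding Kp_kcls[OF A B b i z] 0 using Phi_closed[OF A B i b] by simp
qed

section \<open>The product\<close>

lemma tmap_comp: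
 assumes Obj: "A : Obj" "B : Obj" "A' : Obj" "B' : Obj" "A'' : Obj" "B'' : Obj"
  and f: "f : clin A A'" "g : clin B B'" and f': "f' : clin A' A''" "g' : clin B' B''"
  and f'': "f'' : clin A A''" "g'' : clin B B''"
  and eq: "!!a. a : carrier A ==> f' (f a) = f'' a" "!!b. b : carrier B ==> g' (g b) = g'' b"
  and w: "w : carrier (tens A B)"
 shows "tmap A' B' A'' B'' f' g' (tmap A B A' B' f g w) = tmap A B A'' B'' f'' g'' w"
proof -
 interpret T: tpair A B "tens A B" "tm A B" by (rule pair[OF Obj(1,2)])
 note t = tmap[OF Obj(1-4) f] and t' = tmap[OF Obj(3-6) f'] and t'' = tmap[OF Obj(1,2,5,6) f'']
 have "(tmap A' B' A'' B'' f' g' \<circ> tmap A B A' B' f g) w = tmap A B A'' B'' f'' g'' w"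
  by (rule T.clin_unique[OF obj_lca[OF obj_tens[OF Obj(5,6)]] clin_comp[OF t(1) t'(1)] t''(1) _ w])
   (simp add: t(2) t'(2) t''(2) clinD(2)[OF f(1)] clinD(2)[OF f(2)] eq)
 then show ?thesis by simp
qed

abbreviation "kx A x \<equiv> K0_map (UU A) (uu' A) x"
abbreviation "um A B \<equiv> tmap A B (UU A) B (ui A) (%b. b)"

text \<open>The pairing with the image of \<open>x\<close> over the unitisation restricts to zero on
  the quotient \<open>CC\<close>, because \<open>x\<close> has trivial image over the complex
  numbers; by split exactness it then comes from exactly one element over \<open>A\<close>.\<close>

definition prd :: "'u lca => 'u lca => (complex \<times> 'u) k0 => 'h => 'h" where
 "prd A B x b = (THE y. y : carrier (H (tens A B)) &
  Hmap (tens A B) (tens (UU A) B) (um A B) y = Kp (UU A) B (kx A x) b)"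

lemma ui_hom: "A : Obj ==> ui A : lca_hom A (UU A)" using split_unit by (auto simp: sdata_def)

lemma uu'_nring_hom: "A : Obj ==> uu' A : nring_hom (unz A) (UU A)"
 by (rule nring_hom_of[OF iso_hom[OF UU(3)]])

lemma um_split:
 assumes A: "A : Obj" and B: "B : Obj"
 shows "sdata (tens A B) (tens (UU A) B) (tens CC B) (um A B) (tmap (UU A) B CC B (uq A) (%b. b))
  (tmap CC B (UU A) B (us A) (%b. b)) (tmap (UU A) B A B (snd \<circ> uu A) (%b. b))"
 by (rule sdata_tmap_right[OF B A UU(1)[OF A] CC(1) split_unit[OF A]])

lemma um_hom: "[|A : Obj; B : Obj|] ==> um A B : lca_hom (tens A B) (tens (UU A) B)"
 using um_split by (auto simp: sdata_def)

lemma um_inj: "[|A : Obj; B : Obj|] ==> inj_on (Hmap (tens A B) (tens (UU A) B) (um A B)) (carrier (H (tens A B)))"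
 by (rule H_split(1)[OF obj_tens obj_tens obj_tens um_split]) (auto intro: UU(1) CC(1))

lemma KG_simps:
 assumes A: "A : Obj"
 shows "x : carrier (KG A) \<longleftrightarrow> x : carrier (K0 (unz A)) & K0_map CL fst x = \<one>\<^bsub>K0 CL\<^esub>"
  "x \<otimes>\<^bsub>KG A\<^esub> y = x \<otimes>\<^bsub>K0 (unz A)\<^esub> y"
 by (auto simp: KG_def kernel_def)

lemma kx_hom: "A : Obj ==> K0_map (UU A) (uu' A) : hom (K0 (unz A)) (K0 (UU A))"
 by (rule K0_map_hom[OF unitization_nr nr[OF UU(1)] uu'_nring_hom])

lemma kx_closed: "[|A : Obj; x : carrier (K0 (unz A))|] ==> kx A x : carrier (K0 (UU A))"
 using hom_in_carrier[OF kx_hom] .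

lemma prd_eqI:
 assumes A: "A : Obj" and B: "B : Obj" and y: "y : carrier (H (tens A B))"
  and eq: "Hmap (tens A B) (tens (UU A) B) (um A B) y = Kp (UU A) B (kx A x) b" shows "prd A B x b = y"
 unfolding prd_def using y eq inj_onD[OF um_inj[OF A B]] by (intro the_equality) auto

lemma prd:
 assumes A: "A : Obj" and B: "B : Obj" and x: "x : carrier (KG A)" and b: "b : carrier (H B)"
 shows "prd A B x b : carrier (H (tens A B))"
  "Hmap (tens A B) (tens (UU A) B) (um A B) (prd A B x b) = Kp (UU A) B (kx A x) b"
proof -
 note U = UU(1)[OF A]
 note x = x[unfolded KG_simps[OF A]]
 note O = obj_tens[OF A B] obj_tens[OF U B] obj_tens[OF CC(1) B]
 have uq: "uq A : lca_hom (UU A) CC" using split_unit[OF A] by (auto simp: sdata_def)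
 have c': "cc' : nring_hom CL CC" by (rule nring_hom_of[OF iso_hom[OF CC(3)]])
 have fst: "fst : nring_hom (unz A) CL"
  by (rule nring_hom_of[OF locally_convex_algebra.fst_hom[OF obj_lca[OF A]]])
 note nU = unitization_nr[OF A] and nC = nr[OF CC(1)]
 \<comment> \<open>On the copies, the quotient map corresponds to \<open>fst\<close>, under which
   \<open>x\<close> becomes trivial by definition of \<open>KG A\<close>.\<close>
 have "K0_map CC (uq A) (kx A x) = K0_map CC (uq A \<circ> uu' A) x"
  by (rule K0_map_comp[OF nU nr[OF U] nC uu'_nring_hom[OF A] nring_hom_of[OF uq]]) (use x in simp)
 also have "... = K0_map CC (cc' \<circ> fst) x"
  by (rule K0_map_cong[OF nU nC nring_hom_comp[OF uu'_nring_hom[OF A] nring_hom_of[OF uq]] nring_hom_comp[OF fst c']])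
   (use x UU(5)[OF A] in auto)
 also have "... = K0_map CC cc' (K0_map CL fst x)"
  by (rule K0_map_comp[OF nU cplx_nring nC fst c', symmetric]) (use x in simp)
 also have "... = \<one>\<^bsub>K0 CC\<^esub>"
  using x hom_one[OF K0_map_hom[OF cplx_nring nC c']] nring.K0_comm_group[OF cplx_nring] nring.K0_comm_group[OF nC]
  by (simp add: comm_group.axioms(2))
 finally have q1: "K0_map CC (uq A) (kx A x) = \<one>\<^bsub>K0 CC\<^esub>" .
 have kx: "kx A x : carrier (K0 (UU A))" using kx_closed[OF A] x by simp
 have "Hmap (tens (UU A) B) (tens CC B) (tmap (UU A) B CC B (uq A) (%b. b)) (Kp (UU A) B (kx A x) b) =
   Kp CC B (K0_map CC (uq A) (kx A x)) (Hmap B B (%b. b) b)" by (rule Kp_natural[OF U B CC(1) B uq hom_ident kx b])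
 also have "... = \<one>\<^bsub>H (tens CC B)\<^esub>"
  unfolding q1 by (rule Kp_one[OF CC(1) B H_closed[OF B B hom_ident b]])
 finally obtain y where y: "y : carrier (H (tens A B))" "Hmap (tens A B) (tens (UU A) B) (um A B) y = Kp (UU A) B (kx A x) b"
  using H_split(2)[OF O um_split[OF A B] Kp_closed[OF U B kx b]] by blast
 then have "prd A B x b = y" by (intro prd_eqI[OF A B])
 with y show "prd A B x b : carrier (H (tens A B))"
  "Hmap (tens A B) (tens (UU A) B) (um A B) (prd A B x b) = Kp (UU A) B (kx A x) b" by auto
qed

lemma prd_biadditive:
 assumes A: "A : Obj" and B: "B : Obj" shows "biadditive (KG A) (H B) (H (tens A B)) (prd A B)"
proof -
 note U = UU(1)[OF A]
 note O = obj_tens[OF A B] obj_tens[OF U B]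
 interpret H1: comm_group "H (tens A B)" by (rule obj_group[OF O(1)])
 interpret HB: comm_group "H B" by (rule obj_group[OF B])
 interpret KA: comm_group "K0 (unz A)" by (rule nring.K0_comm_group[OF unitization_nr[OF A]])
 interpret KC: comm_group "K0 CL" by (rule nring.K0_comm_group[OF cplx_nring])
 note pr = prd[OF A B] and hm = H_mult[OF O um_hom[OF A B]]
 have "prd A B x : hom (H B) (H (tens A B))" if x: "x : carrier (KG A)" for x
 proof (rule homI)
  fix b c assume bc: "b : carrier (H B)" "c : carrier (H B)"
  have kx: "kx A x : carrier (K0 (UU A))" using kx_closed[OF A] x by (simp add: KG_simps[OF A])
  show "prd A B x (b \<otimes>\<^bsub>H B\<^esub> c) = prd A B x b \<otimes>\<^bsub>H (tens A B)\<^esub> prd A B x c"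
   using hom_mult[OF Kp_hom_right[OF U B kx] bc] bc pr x by (intro prd_eqI[OF A B]) (simp_all add: hm)
 qed (rule pr(1)[OF x])
 moreover have "(%x. prd A B x b) : hom (KG A) (H (tens A B))" if b: "b : carrier (H B)" for b
 proof (rule homI)
  fix x y assume xy: "x : carrier (KG A)" "y : carrier (KG A)"
  then have x: "x : carrier (K0 (unz A))" and y: "y : carrier (K0 (unz A))" by (auto simp: KG_simps[OF A])
  show "prd A B (x \<otimes>\<^bsub>KG A\<^esub> y) b = prd A B x b \<otimes>\<^bsub>H (tens A B)\<^esub> prd A B y b"
   using hom_mult[OF kx_hom[OF A] x y] hom_mult[OF Kp_hom_left[OF U B b] kx_closed[OF A x] kx_closed[OF A y]] pr xy b
   by (intro prd_eqI[OF A B]) (simp_all add: hm KG_simps[OF A])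
 qed (rule pr(1)[OF _ b])
 ultimately show ?thesis by (simp add: biadditive_def)
qed

lemma prd_natural:
 assumes Obj: "A1 : Obj" "A2 : Obj" "B1 : Obj" "B2 : Obj" and f: "f : lca_hom A1 A2" and g: "g : lca_hom B1 B2"
  and x: "x : carrier (KG A1)" and b: "b : carrier (H B1)"
 shows "prd A2 B2 (KG_map A2 f x) (Hmap B1 B2 g b) =
  Hmap (tens A1 B1) (tens A2 B2) (tmap A1 B1 A2 B2 f g) (prd A1 B1 x b)"
proof (rule prd_eqI[OF Obj(2,4)])
 note U1 = UU(1)[OF Obj(1)] and U2 = UU(1)[OF Obj(2)]
 note t = tmap_hom[OF Obj(1,3,2,4) f g]
 note O = obj_tens[OF Obj(1,3)] obj_tens[OF Obj(2,4)] obj_tens[OF U2 Obj(4)] obj_tens[OF U1 Obj(3)]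
 note pr = prd[OF Obj(1,3) x b]
 have xc: "x : carrier (K0 (unz A1))" using x by (simp add: KG_simps[OF Obj(1)])
 show "Hmap (tens A1 B1) (tens A2 B2) (tmap A1 B1 A2 B2 f g) (prd A1 B1 x b) : carrier (H (tens A2 B2))"
  by (rule H_closed[OF O(1,2) t pr(1)])
 let ?f = "%(c, a). (c, f a)"
 have fh: "?f : lca_hom (unz A1) (unz A2)"
  by (rule unitization_map_hom[OF obj_lca[OF Obj(1)] obj_lca[OF Obj(2)] f])
 \<comment> \<open>The unit preserving extension of \<open>f\<close>, transported to the copies of
   the unitisations.\<close>
 define F where "F = uu' A2 \<circ> (?f \<circ> uu A1)"
 have F: "F : lca_hom (UU A1) (UU A2)"
  unfolding F_def by (intro hom_comp[of _ _ "unz A2"] hom_comp[of _ _ "unz A1"] iso_hom UU fh Obj)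
 have Fu: "F (uu' A1 z) = uu' A2 (?f z)" if "z : carrier (unz A1)" for z
  using that by (simp add: F_def UU(5)[OF Obj(1)])
 have Fui: "F (ui A1 a) = ui A2 (f a)" if "a : carrier A1" for a using that by (simp add: Fu unit_simps)
 let ?G = "tmap A1 B1 (UU A2) B2 (ui A2 \<circ> f) g"
 note uf = hom_comp[OF f ui_hom[OF Obj(2)]]
 have G: "?G : lca_hom (tens A1 B1) (tens (UU A2) B2)" by (rule tmap_hom[OF Obj(1,3) U2 Obj(4) uf g])
 have "Hmap (tens A2 B2) (tens (UU A2) B2) (um A2 B2) (Hmap (tens A1 B1) (tens A2 B2) (tmap A1 B1 A2 B2 f g) (prd A1 B1 x b)) =
   Hmap (tens A1 B1) (tens (UU A2) B2) ?G (prd A1 B1 x b)"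
  by (rule H_comp[OF O(1-3) t um_hom[OF Obj(2,4)] G _ pr(1)],
    rule tmap_comp[OF Obj(1,3,2,4) U2 Obj(4) homD(1)[OF f] homD(1)[OF g] homD(1)[OF ui_hom[OF Obj(2)]] clin_ident
     homD(1)[OF uf] homD(1)[OF g]]) simp_all
 also have "... = Hmap (tens (UU A1) B1) (tens (UU A2) B2) (tmap (UU A1) B1 (UU A2) B2 F g)
   (Hmap (tens A1 B1) (tens (UU A1) B1) (um A1 B1) (prd A1 B1 x b))"
  by (rule H_comp[OF O(1,4,3) um_hom[OF Obj(1,3)] tmap_hom[OF U1 Obj(3) U2 Obj(4) F g] G _ pr(1), symmetric],
    rule tmap_comp[OF Obj(1,3) U1 Obj(3) U2 Obj(4) homD(1)[OF ui_hom[OF Obj(1)]] clin_ident homD(1)[OF F] homD(1)[OF g]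
     homD(1)[OF uf] homD(1)[OF g]]) (use Fui in simp_all)
 also have "... = Kp (UU A2) B2 (K0_map (UU A2) F (kx A1 x)) (Hmap B1 B2 g b)"
  unfolding pr(2) by (rule Kp_natural[OF U1 Obj(3) U2 Obj(4) F g kx_closed[OF Obj(1) xc] b])
 also have "K0_map (UU A2) F (kx A1 x) = K0_map (UU A2) (F \<circ> uu' A1) x"
  by (rule K0_map_comp[OF unitization_nr[OF Obj(1)] nr[OF U1] nr[OF U2] uu'_nring_hom[OF Obj(1)] nring_hom_of[OF F] xc])
 also have "... = K0_map (UU A2) (uu' A2 \<circ> ?f) x"
  by (rule K0_map_cong[OF unitization_nr[OF Obj(1)] nr[OF U2] nring_hom_comp[OF uu'_nring_hom[OF Obj(1)] nring_hom_of[OF F]]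
     nring_hom_comp[OF nring_hom_of[OF fh] uu'_nring_hom[OF Obj(2)]] _ xc]) (simp add: Fu)
 also have "... = kx A2 (KG_map A2 f x)" unfolding KG_map_def
  by (rule K0_map_comp[OF unitization_nr[OF Obj(1)] unitization_nr[OF Obj(2)] nr[OF U2] nring_hom_of[OF fh] uu'_nring_hom[OF Obj(2)] xc, symmetric])
 finally show "Hmap (tens A2 B2) (tens (UU A2) B2) (um A2 B2)
   (Hmap (tens A1 B1) (tens A2 B2) (tmap A1 B1 A2 B2 f g) (prd A1 B1 x b)) =
  Kp (UU A2) B2 (kx A2 (KG_map A2 f x)) (Hmap B1 B2 g b)" .
qed

text \<open>The class \<open>KG_one\<close> becomes the rank one idempotent \<open>ui C e\<close>,
  where \<open>e\<close> is the unit of the copy \<open>C\<close>. By \<open>Kp_rank_one\<close> its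
  product is induced by tensoring with \<open>e\<close>, and the identification with
  \<open>B\<close> undoes this since \<open>\<phi> e = 1\<close>.\<close>

lemma prd_one:
 assumes C: "C : Obj" and \<phi>: "\<phi> : lca_iso C CL" and B: "B : Obj" and b: "b : carrier (H B)"
 shows "Hmap (tens C B) B (tensor_lift C B (tens C B) (tm C B) B (%z b. \<phi> z \<odot>\<^sub>B b))
  (prd C B (KG_map C (inv_into (carrier C) \<phi>) KG_one) b) = b"
proof -
 note U = UU(1)[OF C]
 interpret C: locally_convex_algebra C by (rule obj_lca[OF C])
 interpret B: locally_convex_algebra B by (rule obj_lca[OF B])
 interpret T: tpair C B "tens C B" "tm C B" by (rule pair[OF C B])
 define \<psi> where "\<psi> = inv_into (carrier C) \<phi>"
 have ti: "topspace (topo CL) = carrier CL" by (simp add: cplx_simps)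
 note ii = lca_iso_inv_into[OF C.lca_like ti \<phi>, folded \<psi>_def]
 have \<psi>: "\<psi> : lca_hom CL C" by (rule iso_hom[OF ii(1)])
 have \<phi>h: "\<phi> : lca_hom C CL" by (rule iso_hom[OF \<phi>])
 note pD = homD[OF \<psi>, unfolded cplx_simps] and fD = homD[OF \<phi>h, unfolded cplx_simps]
 define e where "e = \<psi> 1"
 have e: "e : carrier C" "e \<otimes>\<^sub>C e = e" using pD(3) pD(7)[of 1 1] by (auto simp: e_def)
 have \<phi>e: "\<phi> e = 1" using ii(3)[of 1] by (simp add: e_def cplx_simps)
 have ue: "ui C e : carrier (UU C)" "ui C e \<otimes>\<^bsub>UU C\<^esub> ui C e = ui C e"
  using homD(3)[OF ui_hom[OF C] e(1)] homD(7)[OF ui_hom[OF C] e(1) e(1)] by (simp_all only: e(2))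
 have m1: "(\<lambda>_\<in>{..<1} \<times> {..<1}. a) = mat1 a" for a :: "'x" unfolding mat1_def ..
 have ich: "(%a. (0, a)) : nring_hom CL (unz CL)"
  by (auto simp: nring_hom_def hom_def unit_simps cplx_simps)
 note nuc = unitization_cplx_nring
 have i1: "(1, mat1 (1::complex)) : idems CL"
  by (rule nring.mat1_idems[OF cplx_nring]) (simp_all add: cplx_simps)
 let ?z = "(0, %_. undefined)"
 have one: "KG_one = kcls (unz CL) (imap (%a. (0, a)) (1, mat1 1)) ?z"
  unfolding KG_one_def KG_class_def kcls_def m1 idem_monoid_one idem_map_class[OF cplx_nring nuc ich i1] ..
 let ?f = "%(c, a). (c, \<psi> a)"
 have fh: "?f : nring_hom (unz CL) (unz C)"
  using pD by (auto simp: nring_hom_def hom_def unit_simps cplx_simps)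
 have r1: "rmap h 1 1 (mat1 a) = mat1 (h a)" for h :: "'x => 'y" and a by (auto simp: rmap_def mat1_def)
 have iz: "imap h ?z = ?z" for h :: "'x => 'y" by (auto simp: imap_def rmap_def)
 note ii1 = imap_idems[OF cplx_nring nuc ich i1] and z = nring.idem_zero_idems
 have "kx C (KG_map C \<psi> KG_one) = kcls (UU C) (imap (uu' C) (imap ?f (imap (%a. (0, a)) (1, mat1 1)))) ?z"
  unfolding KG_map_def one K0_map_kcls[OF nuc unitization_nr[OF C] fh ii1 z[OF nuc]]
   K0_map_kcls[OF unitization_nr[OF C] nr[OF U] uu'_nring_hom[OF C] imap_idems[OF nuc unitization_nr[OF C] fh ii1] z[OF unitization_nr[OF C]]] iz ..
 also have "imap (uu' C) (imap ?f (imap (%a. (0, a)) (1, mat1 1))) = (1, mat1 (ui C e))"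
  by (simp add: imap_def r1[simplified] e_def)
 finally have X: "kx C (KG_map C \<psi> KG_one) = kcls (UU C) (1, mat1 (ui C e)) ?z" .
 note tmh = tm_idem_hom[OF C B e] and tmh' = tm_idem_hom[OF U B ue]
 note O = obj_tens[OF C B] obj_tens[OF U B]
 have p: "prd C B (KG_map C \<psi> KG_one) b = Hmap B (tens C B) (tm C B e) b"
 proof (rule prd_eqI[OF C B H_closed[OF B O(1) tmh b]])
  show "Hmap (tens C B) (tens (UU C) B) (um C B) (Hmap B (tens C B) (tm C B e) b) = Kp (UU C) B (kx C (KG_map C \<psi> KG_one)) b"
   unfolding X Kp_rank_one(2)[OF U B ue b] by (rule H_comp[OF B O tmh um_hom[OF C B] tmh' _ b],
     rule tmap(2)[OF C B U B homD(1)[OF ui_hom[OF C]] clin_ident e(1)])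
 qed
 have bb: "bdd_bil_on C B B (%z b. \<phi> z \<odot>\<^sub>B b)"
  by (rule bdd_bil_scalar[OF C.lca_axioms B.lca_axioms homD(1)[OF \<phi>h] clin_ident])
 have mult: "\<phi> (a \<otimes>\<^sub>C a') \<odot>\<^sub>B (x \<otimes>\<^sub>B x') = (\<phi> a \<odot>\<^sub>B x) \<otimes>\<^sub>B (\<phi> a' \<odot>\<^sub>B x')"
  if "a : carrier C" "x : carrier B" "a' : carrier C" "x' : carrier B" for a x a' x'
  using that by (simp add: fD(7) B.smult_m_left B.smult_m_right B.sm_closed B.m_closed B.sm_assoc[symmetric] mult.commute)
 note tl = T.tensor_lift[OF B.lca_axioms bb mult]
 have "Hmap (tens C B) B (tensor_lift C B (tens C B) (tm C B) B (%z b. \<phi> z \<odot>\<^sub>B b)) (Hmap B (tens C B) (tm C B e) b) =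
   Hmap B B (%b. b) b"
  by (rule H_comp[OF B O(1) B tmh tl(1) hom_ident _ b]) (simp_all add: tl(2) e \<phi>e B.sm_one)
 then show ?thesis using p map_id[OF B b] by (simp add: \<psi>_def)
qed

end

section \<open>The outer product of non-unital algebras\<close>

lemma clin_scalar:
 assumes A: "LCA A" and V: "LCA V" and \<phi>: "\<phi> : clin A CL" and v: "v : carrier V"
 shows "(%x. \<phi> x \<odot>\<^sub>V v) : clin A V"
proof (rule clinI[OF A V])
 interpret V: locally_convex_algebra V by fact
 note p = clinD[OF \<phi>, unfolded cplx_simps]
 show "(%x. \<phi> x \<odot>\<^sub>V v) : hom (add_monoid A) (add_monoid V)"
  using p(3) v by (auto simp: hom_def V.sm_closed V.sm_add_left)
 show "\<phi> (c \<odot>\<^sub>A x) \<odot>\<^sub>V v = c \<odot>\<^sub>V (\<phi> x \<odot>\<^sub>V v)" if "x : carrier A" for c x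
  using that p(4) v by (simp add: V.sm_assoc)
 fix s assume s: "s : CS V"
 show "\<exists>p\<in>CS A. \<forall>x\<in>carrier A. s (\<phi> x \<odot>\<^sub>V v) <= p x"
  using cs_scale[OF cmod_cs[OF \<phi>] csD(3)[OF s v]] v
  by (intro bexI[of _ "%x. s v * cmod (\<phi> x)"]) (auto simp: csD(5)[OF s] mult.commute)
qed

text \<open>\<open>R\<close> is the tensor product of the unitised algebras, and \<open>T\<close>
  sits in it as the common kernel of the two maps that apply the character to one factor. Its group
  \<open>K\<close> is reached by two successive excisions, one for each factor.\<close>

locale unital_pair = lca_universe Obj tens tm for Obj :: "'u lca set" and tens tm +
 fixes A B :: "'u lca"
 assumes A_obj: "A : Obj" and B_obj: "B : Obj"
begin

abbreviation "U \<equiv> UU A"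
abbreviation "V \<equiv> UU B"
abbreviation "T \<equiv> tens A B"
abbreviation "R \<equiv> tens U V"

lemmas U_obj = UU(1)[OF A_obj] and V_obj = UU(1)[OF B_obj]
lemmas T_obj = obj_tens[OF A_obj B_obj] and R_obj = obj_tens[OF U_obj V_obj]

sublocale AB: tpair A B T "tm A B" by (rule pair[OF A_obj B_obj])
sublocale UV: tpair U V R "tm U V" by (rule pair[OF U_obj V_obj])
sublocale UVm: mpairing U V R "tm U V" by (rule UV.mpairing)

definition eU :: 'u where "eU = uu' A (1, \<zero>\<^sub>A)"
definition eV :: 'u where "eV = uu' B (1, \<zero>\<^sub>B)"
definition eR :: 'u where "eR = tm U V eU eV"
definition chU :: "'u => complex" where "chU u = fst (uu A u)"
definition chV :: "'u => complex" where "chV v = fst (uu B v)"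

lemma uu_unit:
 assumes D: "D : Obj"
 shows "is_unit (UU D) (uu' D (1, \<zero>\<^sub>D))" "(%u. fst (uu D u)) : lca_hom (UU D) CL"
  "fst (uu D (uu' D (1, \<zero>\<^sub>D))) = 1"
proof -
 interpret D: locally_convex_algebra D by (rule obj_lca[OF D])
 note u = iso_hom[OF UU(2)[OF D]] and u' = iso_hom[OF UU(3)[OF D]]
 have one: "(1, \<zero>\<^sub>D) : carrier (unz D)" by (simp add: unit_simps)
 have "uu' D (1, \<zero>\<^sub>D) \<otimes>\<^bsub>UU D\<^esub> x = x & x \<otimes>\<^bsub>UU D\<^esub> uu' D (1, \<zero>\<^sub>D) = x" if x: "x : carrier (UU D)" for x
  using homD(7)[OF u' one homD(3)[OF u x]] homD(7)[OF u' homD(3)[OF u x] one] D.unitization_unit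
   homD(3)[OF u x] by (simp add: UU(4)[OF D x] is_unit_def)
 then show "is_unit (UU D) (uu' D (1, \<zero>\<^sub>D))" using homD(3)[OF u' one] by (simp add: is_unit_def)
 show "(%u. fst (uu D u)) : lca_hom (UU D) CL" using hom_comp[OF u D.fst_hom] by (simp add: o_def)
 show "fst (uu D (uu' D (1, \<zero>\<^sub>D))) = 1" by (simp add: UU(5)[OF D one])
qed

lemma eU: "eU : carrier U" "u : carrier U ==> eU \<otimes>\<^sub>U u = u" "u : carrier U ==> u \<otimes>\<^sub>U eU = u" "chU eU = 1"
 and eV: "eV : carrier V" "v : carrier V ==> eV \<otimes>\<^sub>V v = v" "v : carrier V ==> v \<otimes>\<^sub>V eV = v" "chV eV = 1"
 and units: "is_unit U eU" "is_unit V eV"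
 using uu_unit[OF A_obj] uu_unit[OF B_obj] by (auto simp: is_unit_def eU_def eV_def chU_def chV_def)

lemma chU: "chU : lca_hom U CL" and chV: "chV : lca_hom V CL"
 using uu_unit(2)[OF A_obj] uu_unit(2)[OF B_obj] by (simp_all add: chU_def[abs_def] chV_def[abs_def])

lemmas chU_simps = homD[OF chU, unfolded cplx_simps]
lemmas chV_simps = homD[OF chV, unfolded cplx_simps]

lemma eR_closed: "eR : carrier R" unfolding eR_def by (rule UV.t_closed[OF eU(1) eV(1)])

lemma eR_unit: "is_unit R eR"
proof -
 note LR = UV.T.lca_axioms
 have "eR \<otimes>\<^sub>R w = w" if w: "w : carrier R" for w
  by (rule UV.clin_unique[OF LR UV.T.mult_clin_left[OF eR_closed] clin_ident _ w]) (simp add: eR_def UV.t_mult eU eV)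
 moreover have "w \<otimes>\<^sub>R eR = w" if w: "w : carrier R" for w
  by (rule UV.clin_unique[OF LR UV.T.mult_clin_right[OF eR_closed] clin_ident _ w]) (simp add: eR_def UV.t_mult eU eV)
 ultimately show ?thesis using eR_closed by (simp add: is_unit_def)
qed

lemma smul_hom: "is_unit D e ==> locally_convex_algebra D ==> (%c. c \<odot>\<^sub>D e) : nring_hom CL D"
proof -
 assume e: "is_unit D e" and D: "LCA D"
 interpret D: locally_convex_algebra D by (rule D)
 have e: "e : carrier D" "e \<otimes>\<^sub>D e = e" using e by (auto simp: is_unit_def)
 show ?thesis
  using e by (auto simp: nring_hom_def hom_def cplx_simps D.sm_closed D.sm_add_left D.smult_m_left D.smult_m_right D.sm_assoc[symmetric] mult.commute)
qed

lemma projections: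
 "\<exists>h\<in>lca_hom R U. \<forall>u\<in>carrier U. \<forall>v\<in>carrier V. h (tm U V u v) = chV v \<odot>\<^sub>U u"
 "\<exists>h\<in>lca_hom R V. \<forall>u\<in>carrier U. \<forall>v\<in>carrier V. h (tm U V u v) = chU u \<odot>\<^sub>V v"
proof -
 note LU = UV.A.lca_axioms and LV = UV.B.lca_axioms
 show "\<exists>h\<in>lca_hom R U. \<forall>u\<in>carrier U. \<forall>v\<in>carrier V. h (tm U V u v) = chV v \<odot>\<^sub>U u"
  by (rule UV.lift_hom_exists[OF LU bdd_bil_flip[OF bdd_bil_scalar[OF LV LU homD(1)[OF chV] clin_ident]]])
   (simp add: chV_simps(7) UV.A.smult_m_left UV.A.smult_m_right UV.A.sm_closed UV.A.m_closed UV.A.sm_assoc[symmetric] mult.commute)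
 show "\<exists>h\<in>lca_hom R V. \<forall>u\<in>carrier U. \<forall>v\<in>carrier V. h (tm U V u v) = chU u \<odot>\<^sub>V v"
  by (rule UV.lift_hom_exists[OF LV bdd_bil_scalar[OF LU LV homD(1)[OF chU] clin_ident]])
   (simp add: chU_simps(7) UV.B.smult_m_left UV.B.smult_m_right UV.B.sm_closed UV.B.m_closed UV.B.sm_assoc[symmetric] mult.commute)
qed

definition p1 :: "'u => 'u" where
 "p1 = (SOME h. h : lca_hom R U & (\<forall>u\<in>carrier U. \<forall>v\<in>carrier V. h (tm U V u v) = chV v \<odot>\<^sub>U u))"

definition p2 :: "'u => 'u" where
 "p2 = (SOME h. h : lca_hom R V & (\<forall>u\<in>carrier U. \<forall>v\<in>carrier V. h (tm U V u v) = chU u \<odot>\<^sub>V v))"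

lemma p1: "p1 : lca_hom R U" "[|u : carrier U; v : carrier V|] ==> p1 (tm U V u v) = chV v \<odot>\<^sub>U u"
 and p2: "p2 : lca_hom R V" "[|u : carrier U; v : carrier V|] ==> p2 (tm U V u v) = chU u \<odot>\<^sub>V v"
 using someI_ex[OF projections(1)[unfolded Bex_def], folded p1_def]
  someI_ex[OF projections(2)[unfolded Bex_def], folded p2_def] by auto

definition chR :: "'u => complex" where "chR w = chU (p1 w)"

lemma chR: "chR : lca_hom R CL" using hom_comp[OF p1(1) chU] by (simp add: chR_def[abs_def] o_def)

lemmas chR_simps = homD[OF chR, unfolded cplx_simps]

lemma chR_tm: "[|u : carrier U; v : carrier V|] ==> chR (tm U V u v) = chU u * chV v"
 by (simp add: chR_def p1(2) chU_simps(5) mult.commute)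

lemma chR_p2: "w : carrier R ==> chV (p2 w) = chR w"
proof -
 assume w: "w : carrier R"
 note c' = iso_hom[OF CC(3)]
 \<comment> \<open>Uniqueness on tensor products is stated for targets that are locally convex
   algebras; the copy \<open>CC\<close> is known to be one.\<close>
 have "(cc' \<circ> (chV \<circ> p2)) w = (cc' \<circ> chR) w"
  by (rule UV.clin_unique[OF obj_lca[OF CC(1)] homD(1)[OF hom_comp[OF hom_comp[OF p2(1) chV] c']]
     homD(1)[OF hom_comp[OF chR c']] _ w])
   (simp add: p2(2) chR_tm chV_simps(5))
 then have "cc (cc' (chV (p2 w))) = cc (cc' (chR w))" by simp
 then show ?thesis by (simp add: CC(5))
qed

definition s1 :: "'u => 'u" where "s1 u = tm U V u eV"
definition s2 :: "'u => 'u" where "s2 v = tm U V eU v"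

lemma s1: "s1 : lca_hom U R" and s2: "s2 : lca_hom V R"
 using UV.t_clin_left[OF eV(1)] UV.t_clin_right[OF eU(1)]
 by (auto simp: lca_hom_iff s1_def[abs_def] s2_def[abs_def] UV.t_mult eU eV)

lemma p1_s1: "u : carrier U ==> p1 (s1 u) = u"
 and p2_s2: "v : carrier V ==> p2 (s2 v) = v"
 and p1_s2: "v : carrier V ==> p1 (s2 v) = chV v \<odot>\<^sub>U eU"
 and p1_eR: "p1 eR = eU" and p2_eR: "p2 eR = eV" and chR_eR: "chR eR = 1"
 by (simp_all add: s1_def s2_def eR_def p1(2) p2(2) chR_tm eU eV UV.A.sm_one UV.B.sm_one)

definition inc :: "'u => 'u" where "inc = tmap A B U V (ui A) (ui B)"
definition ret :: "'u => 'u" where "ret = tmap U V A B (snd \<circ> uu A) (snd \<circ> uu B)"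

lemma ui:
 assumes D: "D : Obj"
 shows "ui D : lca_hom D (UU D)" "(snd \<circ> uu D) : clin (UU D) D" "!!d. d : carrier D ==> fst (uu D (ui D d)) = 0"
  "!!d. d : carrier D ==> snd (uu D (ui D d)) = d" "snd (uu D (uu' D (1, \<zero>\<^sub>D))) = \<zero>\<^sub>D"
proof -
 interpret D: locally_convex_algebra D by (rule obj_lca[OF D])
 show "ui D : lca_hom D (UU D)" "(snd \<circ> uu D) : clin (UU D) D"
  using split_unit[OF D] by (auto simp: sdata_def)
 show "fst (uu D (ui D d)) = 0" "snd (uu D (ui D d)) = d" if "d : carrier D" for d
  using that by (simp_all add: UU(5)[OF D] unit_simps)
 show "snd (uu D (uu' D (1, \<zero>\<^sub>D))) = \<zero>\<^sub>D" by (simp add: UU(5)[OF D] unit_simps)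
qed

lemma uu_decompose:
 assumes D: "D : Obj" and u: "u : carrier (UU D)"
 shows "u = fst (uu D u) \<odot>\<^bsub>UU D\<^esub> uu' D (1, \<zero>\<^sub>D) \<oplus>\<^bsub>UU D\<^esub> ui D (snd (uu D u))"
proof -
 interpret D: locally_convex_algebra D by (rule obj_lca[OF D])
 note u' = homD[OF iso_hom[OF UU(3)[OF D]]]
 have "us D (uq D u) = uu' D (fst (uu D u) \<odot>\<^bsub>unz D\<^esub> (1, \<zero>\<^sub>D))"
  by (simp add: CC(5) unit_simps D.sm_zero_right)
 also have "... = fst (uu D u) \<odot>\<^bsub>UU D\<^esub> uu' D (1, \<zero>\<^sub>D)"
  by (rule u'(5)) (simp add: unit_simps)
 finally have 1: "us D (uq D u) = fst (uu D u) \<odot>\<^bsub>UU D\<^esub> uu' D (1, \<zero>\<^sub>D)" .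
 have "us D (uq D u) \<oplus>\<^bsub>UU D\<^esub> ui D ((snd \<circ> uu D) u) = u"
  using split_unit[OF D] u unfolding sdata_def by blast
 then show ?thesis unfolding 1 comp_apply[of snd] by (rule sym)
qed

lemma inc: "inc : lca_hom T R" "[|a : carrier A; b : carrier B|] ==> inc (tm A B a b) = tm U V (ui A a) (ui B b)"
 unfolding inc_def using tmap_hom[OF A_obj B_obj U_obj V_obj ui(1)[OF A_obj] ui(1)[OF B_obj]]
  tmap(2)[OF A_obj B_obj U_obj V_obj homD(1)[OF ui(1)[OF A_obj]] homD(1)[OF ui(1)[OF B_obj]]] by simp_all

lemma ret: "ret : clin R T" "[|u : carrier U; v : carrier V|] ==> ret (tm U V u v) = tm A B (snd (uu A u)) (snd (uu B v))"
 unfolding ret_def using tmap[OF U_obj V_obj A_obj B_obj ui(2)[OF A_obj] ui(2)[OF B_obj]] by simp_all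

lemma ui_closed: "a : carrier A ==> ui A a : carrier U" "b : carrier B ==> ui B b : carrier V"
 using homD(3)[OF ui(1)[OF A_obj]] homD(3)[OF ui(1)[OF B_obj]] by auto

lemma snd_uu: "u : carrier U ==> snd (uu A u) : carrier A" "v : carrier V ==> snd (uu B v) : carrier B"
 using clinD(2)[OF ui(2)[OF A_obj]] clinD(2)[OF ui(2)[OF B_obj]] by auto

lemma p_inc:
 assumes w: "w : carrier T"
 shows "p1 (inc w) = \<zero>\<^sub>U" "p2 (inc w) = \<zero>\<^sub>V" "chR (inc w) = 0" "ret (inc w) = w"
proof -
 note LU = UV.A.lca_axioms and LV = UV.B.lca_axioms and LT = AB.T.lca_axioms
 have z: "chU (ui A a) = 0" "chV (ui B b) = 0" if "a : carrier A" "b : carrier B" for a b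
  using that ui(3)[OF A_obj] ui(3)[OF B_obj] by (auto simp: chU_def chV_def)
 have "(p1 \<circ> inc) w = \<zero>\<^sub>U"
  by (rule AB.clin_unique[OF LU homD(1)[OF hom_comp[OF inc(1) p1(1)]] zero_clin[OF LT LU] _ w])
   (use ui_closed z in \<open>simp add: inc(2) p1(2) UV.A.sm_zero_left del: comp_apply add: comp_apply[of p1]\<close>)
 then show 1: "p1 (inc w) = \<zero>\<^sub>U" by simp
 have "(p2 \<circ> inc) w = \<zero>\<^sub>V"
  by (rule AB.clin_unique[OF LV homD(1)[OF hom_comp[OF inc(1) p2(1)]] zero_clin[OF LT LV] _ w])
   (use ui_closed z in \<open>simp add: inc(2) p2(2) UV.B.sm_zero_left del: comp_apply add: comp_apply[of p2]\<close>)
 then show "p2 (inc w) = \<zero>\<^sub>V" by simp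
 show "chR (inc w) = 0" using clinD(4)[OF homD(1)[OF chU] UV.A.M.zero_closed, of 0]
  by (simp add: chR_def 1 UV.A.sm_zero_left cplx_simps)
 have "(ret \<circ> inc) w = w"
  by (rule AB.clin_unique[OF LT clin_comp[OF homD(1)[OF inc(1)] ret(1)] clin_ident _ w])
   (use ui_closed ui(4)[OF A_obj] ui(4)[OF B_obj] in \<open>simp add: inc(2) ret(2) del: comp_apply add: comp_apply[of ret]\<close>)
 then show "ret (inc w) = w" by simp
qed

lemma ret_eR: "ret eR = \<zero>\<^sub>T" using ui(5)[OF A_obj] ui(5)[OF B_obj] AB.tb.null_right[OF AB.A.M.zero_closed]
 by (simp add: eR_def ret(2) eU(1) eV(1)) (simp add: eU_def eV_def)

text \<open>For \<open>u = \<alpha> 1 + a\<close> and \<open>v = \<beta> 1 + b\<close> the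
  elementary tensor of \<open>u\<close> and \<open>v\<close> has four terms; the two projections
  recover three of them and count the scalar term twice, while \<open>ret\<close> recovers the
  tensor of \<open>a\<close> and \<open>b\<close>. Density does the rest.\<close>

lemma decompose:
 assumes w: "w : carrier R"
 shows "w \<oplus>\<^sub>R chR w \<odot>\<^sub>R eR = (s1 (p1 w) \<oplus>\<^sub>R s2 (p2 w)) \<oplus>\<^sub>R inc (ret w)"
proof (rule UV.clin_unique[OF UV.T.lca_axioms _ _ _ w])
 note LR = UV.T.lca_axioms
 show "(%w. w \<oplus>\<^sub>R chR w \<odot>\<^sub>R eR) : clin R R"
  by (intro clin_add LR clin_ident clin_scalar homD(1)[OF chR] eR_closed)
 show "(%w. (s1 (p1 w) \<oplus>\<^sub>R s2 (p2 w)) \<oplus>\<^sub>R inc (ret w)) : clin R R"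
  using clin_comp[OF homD(1)[OF p1(1)] homD(1)[OF s1]] clin_comp[OF homD(1)[OF p2(1)] homD(1)[OF s2]]
   clin_comp[OF ret(1) homD(1)[OF inc(1)]] by (intro clin_add LR) (simp_all add: o_def)
 fix u v assume uv: "u : carrier U" "v : carrier V"
 define a where "a = ui A (snd (uu A u))"
 define b where "b = ui B (snd (uu B v))"
 have ab: "a : carrier U" "b : carrier V" using ui_closed snd_uu uv by (auto simp: a_def b_def)
 have u: "u = chU u \<odot>\<^sub>U eU \<oplus>\<^sub>U a" and v: "v = chV v \<odot>\<^sub>V eV \<oplus>\<^sub>V b"
  using uu_decompose[OF A_obj uv(1)] uu_decompose[OF B_obj uv(2)] by (simp_all add: a_def b_def eU_def eV_def chU_def chV_def)
 define \<alpha> where "\<alpha> = chU u" define \<beta> where "\<beta> = chV v"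
 note bl = bilD[OF UV.t_bilinear]
 note [simp] = ab eU(1) eV(1) uv UV.A.sm_closed UV.B.sm_closed UV.T.sm_closed UV.t_closed
 have 1: "tm U V u v = (\<alpha> * \<beta>) \<odot>\<^sub>R eR \<oplus>\<^sub>R (\<alpha> \<odot>\<^sub>R tm U V eU b \<oplus>\<^sub>R (\<beta> \<odot>\<^sub>R tm U V a eV \<oplus>\<^sub>R tm U V a b))"
  by (subst u, subst v)
   (simp add: bl(2,3,4,5) UV.T.sm_add_right UV.T.sm_assoc[symmetric] mult.commute UV.T.M.a_ac eR_def flip: \<alpha>_def \<beta>_def)
 have 2: "s1 (p1 (tm U V u v)) = (\<alpha> * \<beta>) \<odot>\<^sub>R eR \<oplus>\<^sub>R \<beta> \<odot>\<^sub>R tm U V a eV"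
  by (simp add: p1(2) s1_def bl(4), subst u)
   (simp add: bl(2,4) UV.T.sm_add_right UV.T.sm_assoc[symmetric] eR_def mult.commute flip: \<alpha>_def \<beta>_def)
 have 3: "s2 (p2 (tm U V u v)) = (\<alpha> * \<beta>) \<odot>\<^sub>R eR \<oplus>\<^sub>R \<alpha> \<odot>\<^sub>R tm U V eU b"
  by (simp add: p2(2) s2_def bl(5), subst v)
   (simp add: bl(3,5) UV.T.sm_add_right UV.T.sm_assoc eR_def flip: \<alpha>_def \<beta>_def)
 have 4: "inc (ret (tm U V u v)) = tm U V a b" using snd_uu uv by (simp add: ret(2) inc(2) a_def b_def)
 show "tm U V u v \<oplus>\<^sub>R chR (tm U V u v) \<odot>\<^sub>R eR =
   (s1 (p1 (tm U V u v)) \<oplus>\<^sub>R s2 (p2 (tm U V u v))) \<oplus>\<^sub>R inc (ret (tm U V u v))"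
  unfolding 2 3 4 chR_tm[OF uv] \<alpha>_def[symmetric] \<beta>_def[symmetric]
  by (subst 1) (simp add: UV.T.M.a_ac eR_closed)
qed

end

section \<open>The two excision steps and the outer product\<close>

context unital_pair
begin

text \<open>The kernel of \<open>p1\<close> together with the scalars, the ring between the two
  excision steps. If \<open>p1 w\<close> is a multiple of the unit, the factor can only be
  \<open>chR w\<close>, which explains the form of the condition.\<close>

definition S1 :: "'u lca" where
 "S1 = R\<lparr>carrier := {w : carrier R. p1 w = chR w \<odot>\<^sub>U eU}\<rparr>"

lemma S1_simps: "w : carrier S1 \<longleftrightarrow> w : carrier R & p1 w = chR w \<odot>\<^sub>U eU"
 "x \<oplus>\<^sub>S1 y = x \<oplus>\<^sub>R y" "x \<otimes>\<^sub>S1 y = x \<otimes>\<^sub>R y" "\<zero>\<^sub>S1 = \<zero>\<^sub>R"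
 by (simp_all add: S1_def)

lemma S1_iff: "w : carrier R ==> p1 w = c \<odot>\<^sub>U eU ==> w : carrier S1"
 by (simp add: S1_simps chR_def chU_simps(5) eU)

lemma p1_S1: "w : carrier S1 ==> p1 w = chR w \<odot>\<^sub>U eU" by (simp add: S1_simps)

lemmas p1_simps = homD(3-5,7)[OF p1(1)]

lemma S1_add: "[|x : carrier S1; y : carrier S1|] ==> x \<oplus>\<^sub>R y : carrier S1"
 by (rule S1_iff[of _ "chR x + chR y"]) (simp_all add: S1_simps p1_simps UV.A.sm_add_left eU)

lemma S1_scale: "x : carrier S1 ==> c \<odot>\<^sub>R x : carrier S1"
 by (rule S1_iff[of _ "c * chR x"]) (simp_all add: S1_simps p1_simps UV.A.sm_assoc eU UV.T.sm_closed)

lemma S1_mult: "[|x : carrier S1; y : carrier S1|] ==> x \<otimes>\<^sub>R y : carrier S1"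
 by (rule S1_iff[of _ "chR x * chR y"])
  (simp_all add: S1_simps p1_simps UV.A.sm_assoc[symmetric] mult.commute eU UV.T.m_closed UV.A.smult_m_left UV.A.smult_m_right UV.A.sm_closed)

lemma S1_eR: "eR : carrier S1" by (rule S1_iff[of _ 1]) (simp_all add: p1_eR UV.A.sm_one eU eR_closed)

lemma S1_zero: "\<zero>\<^sub>R : carrier S1"
 using S1_scale[OF S1_eR, of 0] by (simp add: UV.T.sm_zero_left eR_closed)

lemma S1_nring: "nring S1"
proof (intro nring.intro nring_axioms.intro abelian_groupI)
 fix x assume x: "x : carrier S1"
 then have "(- 1) \<odot>\<^sub>R x \<oplus>\<^sub>R x = \<zero>\<^sub>R"
  by (simp add: S1_simps UV.T.sm_minus_one UV.T.M.l_neg)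
 then show "\<exists>y\<in>carrier S1. y \<oplus>\<^sub>S1 x = \<zero>\<^sub>S1"
  using S1_scale[OF x] by (auto simp: S1_simps(2,4))
next
 fix x y assume "x : carrier S1" "y : carrier S1"
 then show "x \<oplus>\<^sub>S1 y : carrier S1" "x \<otimes>\<^sub>S1 y : carrier S1" unfolding S1_simps(2,3) by (rule S1_add S1_mult)+
next
 show "\<zero>\<^sub>S1 : carrier S1" unfolding S1_simps(4) by (rule S1_zero)
qed (auto simp: S1_simps UV.T.M.a_ac UV.T.m_assoc UV.T.l_distr UV.T.r_distr)

lemma S1_unit: "is_unit S1 eR" using eR_unit S1_eR by (auto simp: is_unit_def S1_simps)

lemma sub_nring_hom: "f : nring_hom R D ==> f : nring_hom S1 D" by (auto simp: nring_hom_def hom_def S1_simps)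

lemma nring_hom_S1: "[|f : nring_hom D R; !!x. x : carrier D ==> f x : carrier S1|] ==> f : nring_hom D S1"
 by (simp add: nring_hom_def hom_def Pi_iff S1_simps(2,3))

text \<open>The map called \<open>j\<close> in \<open>KG_cup\<close>, for the tensor product
  \<open>R\<close>. It is routed through the copy \<open>UU T\<close>, a locally convex algebra,
  from which its continuity is obtained; \<open>jU\<close> is the same map on that copy.\<close>

definition j0 :: "complex \<times> 'u => 'u" where
 "j0 z = fst (uu T (uu' T z)) \<odot>\<^sub>R eR \<oplus>\<^sub>R inc (snd (uu T (uu' T z)))"

lemma j0_app: "w : carrier T ==> j0 (c, w) = c \<odot>\<^sub>R eR \<oplus>\<^sub>R inc w"
 by (simp add: j0_def UU(5)[OF T_obj] unit_simps)

definition jU :: "'u => 'u" where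
 "jU u = fst (uu T u) \<odot>\<^sub>R eR \<oplus>\<^sub>R inc (snd (uu T u))"

lemma jU_hom: "jU : lca_hom (UU T) R"
proof -
 note LR = UV.T.lca_axioms and LU = obj_lca[OF UU(1)[OF T_obj]]
 note ch = uu_unit(2)[OF T_obj] and sn = ui(2)[OF T_obj] and uh = iso_hom[OF UU(2)[OF T_obj]]
 have "jU : clin (UU T) R" unfolding jU_def[abs_def] using clin_comp[OF sn homD(1)[OF inc(1)]]
  by (intro clin_add LR LU clin_scalar homD(1)[OF ch] eR_closed) (simp_all add: o_def)
 moreover have "jU (x \<otimes>\<^bsub>UU T\<^esub> y) = jU x \<otimes>\<^sub>R jU y" if xy: "x : carrier (UU T)" "y : carrier (UU T)" for x y
 proof -
  obtain c a d b where cd: "uu T x = (c, a)" "uu T y = (d, b)" by (cases "uu T x"; cases "uu T y")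
  have ab: "a : carrier T" "b : carrier T"
   using homD(3)[OF uh xy(1)] homD(3)[OF uh xy(2)] cd by (auto simp: unit_simps)
  have m: "uu T (x \<otimes>\<^bsub>UU T\<^esub> y) = (c * d, (c \<odot>\<^sub>T b \<oplus>\<^sub>T d \<odot>\<^sub>T a) \<oplus>\<^sub>T a \<otimes>\<^sub>T b)"
   using homD(7)[OF uh xy] by (simp add: cd unit_simps)
  note i = homD(3-5,7)[OF inc(1)]
  note e = eR_unit[unfolded is_unit_def, THEN conjunct2, rule_format]
  note [simp] = UV.T.sm_closed UV.T.m_closed AB.T.sm_closed AB.T.m_closed
  show ?thesis using ab eR_closed i(1) e
   by (simp add: jU_def m cd i UV.T.l_distr UV.T.r_distr UV.T.smult_m_left UV.T.smult_m_right UV.T.sm_add_right UV.T.sm_assoc[symmetric]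
     mult.commute UV.T.M.a_ac)
 qed
 ultimately show ?thesis by (simp add: lca_hom_iff)
qed

lemma j0_hom: "j0 : lca_hom (unz T) R"
 using hom_comp[OF iso_hom[OF UU(3)[OF T_obj]] jU_hom] by (simp add: j0_def[abs_def] jU_def[abs_def] o_def)

lemma p_j0:
 assumes "z : carrier (unz T)"
 shows "p1 (j0 z) = fst z \<odot>\<^sub>U eU" "p2 (j0 z) = fst z \<odot>\<^sub>V eV" "chR (j0 z) = fst z" "ret (j0 z) = snd z" "j0 z : carrier S1"
proof -
 obtain c w where z: "z = (c, w)" "w : carrier T" using assms by (auto simp: unit_simps)
 have iw: "inc w : carrier R" by (rule homD(3)[OF inc(1) z(2)])
 note [simp] = UV.T.sm_closed AB.T.sm_closed eR_closed iw z(2)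
 note pi = p_inc[OF z(2)]
 show p1: "p1 (j0 z) = fst z \<odot>\<^sub>U eU" by (simp add: z(1) j0_app p1_simps p1_eR pi UV.A.sm_closed eU)
 show "p2 (j0 z) = fst z \<odot>\<^sub>V eV" by (simp add: z(1) j0_app homD(3-5)[OF p2(1)] p2_eR pi UV.B.sm_closed eV)
 show "chR (j0 z) = fst z" by (simp add: z(1) j0_app chR_simps chR_eR pi)
 show "ret (j0 z) = snd z" by (simp add: z(1) j0_app clinD(2-4)[OF ret(1)] ret_eR pi AB.T.sm_zero_right)
 show "j0 z : carrier S1" by (rule S1_iff[OF homD(3)[OF j0_hom assms] p1])
qed

lemma smul_inj:
 assumes "LCA D" "\<phi> : lca_hom D CL" "e : carrier D" "\<phi> e = 1"
 shows "inj_on (%c. c \<odot>\<^sub>D e) (carrier CL)"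
proof (rule inj_onI)
 fix c d assume "c \<odot>\<^sub>D e = d \<odot>\<^sub>D e"
 then have "\<phi> (c \<odot>\<^sub>D e) = \<phi> (d \<odot>\<^sub>D e)" by simp
 then show "c = d" using assms(4) homD(5)[OF assms(2,3)] by (simp add: cplx_simps)
qed

lemma s_units: "s1 eU = eR" "s2 eV = eR" by (simp_all add: s1_def s2_def eR_def)

text \<open>First excision step, along \<open>p1\<close>; the splitting \<open>s1\<close> tensors
  with the unit of \<open>V\<close>.\<close>

lemma square1: "split_square S1 eR R eR U eU CL 1 (%w. w) p1 s1 chR (%c. c \<odot>\<^sub>U eU)"
proof (intro split_square.intro uring.intro uring_axioms.intro split_square_axioms.intro)
 note LU = UV.A.lca_axioms
 show "(%w. w) : nring_hom S1 R" by (auto simp: nring_hom_def hom_def S1_simps)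
 show "chR : nring_hom S1 CL" by (rule sub_nring_hom[OF nring_hom_of[OF chR]])
 show "inj_on (%c. c \<odot>\<^sub>U eU) (carrier CL)" by (rule smul_inj[OF LU chU]) (simp_all add: eU)
 show "(%c. c \<odot>\<^sub>U eU) : nring_hom CL U" by (rule smul_hom[OF units(1) LU])
 show "x : (%w. w) ` carrier S1" if "x : carrier R" "p1 x = c \<odot>\<^sub>U eU" for x c
  using S1_iff[OF that] by simp
qed (auto simp: S1_nring UV.T.nring UV.A.nring cplx_nring S1_unit eR_unit units complex_unit p1_eR chR_eR UV.A.sm_one eU
  nring_hom_of p1(1) s1 p1_s1 p1_S1 s_units)

text \<open>Second excision step, inside \<open>S1\<close> and along \<open>p2\<close>. What remains
  is the unitisation of \<open>T\<close>, by \<open>decompose\<close>.\<close>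

lemma square2: "split_square (unz T) (1, \<zero>\<^sub>T) S1 eR V eV CL 1 j0 p2 s2 fst (%c. c \<odot>\<^sub>V eV)"
proof (intro split_square.intro uring.intro uring_axioms.intro split_square_axioms.intro)
 note LV = UV.B.lca_axioms
 show "j0 : nring_hom (unz T) S1" by (rule nring_hom_S1[OF nring_hom_of[OF j0_hom] p_j0(5)])
 show "p2 : nring_hom S1 V" by (rule sub_nring_hom[OF nring_hom_of[OF p2(1)]])
 show "s2 : nring_hom V S1" by (rule nring_hom_S1[OF nring_hom_of[OF s2]]) (rule S1_iff[OF homD(3)[OF s2] p1_s2])
 show "fst : nring_hom (unz T) CL" by (rule nring_hom_of[OF AB.T.fst_hom])
 show "inj_on (%c. c \<odot>\<^sub>V eV) (carrier CL)" by (rule smul_inj[OF LV chV]) (simp_all add: eV)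
 show "(%c. c \<odot>\<^sub>V eV) : nring_hom CL V" by (rule smul_hom[OF units(2) LV])
 show "inj_on j0 (carrier (unz T))" by (rule inj_onI) (metis p_j0(3,4) prod.expand)
 show "j0 (1, \<zero>\<^sub>T) = eR"
  using homD(3)[OF inc(1) AB.T.M.zero_closed] clin_zero[OF AB.T.lca_axioms UV.T.lca_axioms homD(1)[OF inc(1)]]
  by (simp add: j0_app UV.T.sm_one eR_closed)
 show "w : j0 ` carrier (unz T)" if w: "w : carrier S1" "c : carrier CL" "p2 w = c \<odot>\<^sub>V eV" for w c
 proof -
  have wR: "w : carrier R" using w(1) by (simp add: S1_simps)
  have c: "chR w = c" using chR_p2[OF wR] w(3) by (simp add: chV_simps(5) eV)
  have rw: "ret w : carrier T" by (rule clinD(2)[OF ret(1) wR])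
  have s12: "s1 (p1 w) = c \<odot>\<^sub>R eR" "s2 (p2 w) = c \<odot>\<^sub>R eR"
   using homD(5)[OF s1 eU(1)] homD(5)[OF s2 eV(1)]
   by (simp_all add: p1_S1[OF w(1)] c w(3)) (simp_all add: s1_def s2_def eR_def)
  \<comment> \<open>Both projections of \<open>w\<close> are the scalar \<open>c\<close>, so in
    \<open>decompose\<close> two scalar terms on the right face one on the left.\<close>
  have "w \<oplus>\<^sub>R c \<odot>\<^sub>R eR = (c \<odot>\<^sub>R eR \<oplus>\<^sub>R inc (ret w)) \<oplus>\<^sub>R c \<odot>\<^sub>R eR"
   using decompose[OF wR] homD(3)[OF inc(1) rw] by (simp add: s12 c UV.T.M.a_ac UV.T.sm_closed eR_closed)
  then have "w = j0 (c, ret w)" using wR homD(3)[OF inc(1) rw] by (simp add: j0_app[OF rw] UV.T.sm_closed eR_closed)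
  then show ?thesis using rw by (intro image_eqI[of _ _ "(c, ret w)"]) (simp_all add: unit_simps)
 qed
qed (auto simp: AB.T.unit_nring AB.T.unitization_unit S1_nring UV.B.nring cplx_nring S1_unit units complex_unit
  p2_eR UV.B.sm_one eV p2_s2 p_j0 s_units)

text \<open>A class trivial in \<open>K0 R\<close> and over the complex numbers is trivial in
  \<open>K0 S1\<close> by the first excision and then in \<open>K0\<close> of the unitisation of
  \<open>T\<close> by the second; applied to the difference of \<open>z\<close> and
  \<open>z'\<close>.\<close>

lemma K0_j0_inj:
 assumes z: "z : carrier (KG T)" "z' : carrier (KG T)" and eq: "K0_map R j0 z = K0_map R j0 z'"
 shows "z = z'"
proof -
 interpret sq1: split_square S1 eR R eR U eU CL 1 "%w. w" p1 s1 chR "%c. c \<odot>\<^sub>U eU" by (rule square1)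
 interpret sq2: split_square "unz T" "(1, \<zero>\<^sub>T)" S1 eR V eV CL 1 j0 p2 s2 fst "%c. c \<odot>\<^sub>V eV" by (rule square2)
 note nT = AB.T.unit_nring and nR = UV.T.nring
 interpret KT: comm_group "K0 (unz T)" by (rule nring.K0_comm_group[OF nT])
 interpret KR: comm_group "K0 R" by (rule nring.K0_comm_group[OF nR])
 interpret KC: comm_group "K0 CL" by (rule nring.K0_comm_group[OF cplx_nring])
 have jh: "j0 : nring_hom (unz T) R" by (rule nring_hom_of[OF j0_hom])
 have fh: "fst : nring_hom (unz T) CL" by (rule sq2.ch)
 interpret j: group_hom "K0 (unz T)" "K0 R" "K0_map R j0" using K0_map_hom[OF nT nR jh] by unfold_locales
 interpret f: group_hom "K0 (unz T)" "K0 CL" "K0_map CL fst"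
  using K0_map_hom[OF nT cplx_nring fh] by unfold_locales
 have zc: "z : carrier (K0 (unz T))" "z' : carrier (K0 (unz T))"
  and zf: "K0_map CL fst z = \<one>\<^bsub>K0 CL\<^esub>" "K0_map CL fst z' = \<one>\<^bsub>K0 CL\<^esub>"
  using z by (auto simp: KG_def kernel_def)
 define d where "d = z \<otimes>\<^bsub>K0 (unz T)\<^esub> inv\<^bsub>K0 (unz T)\<^esub> z'"
 have d: "d : carrier (K0 (unz T))" unfolding d_def using zc by simp
 have jd: "K0_map R j0 d = \<one>\<^bsub>K0 R\<^esub>" and fd: "K0_map CL fst d = \<one>\<^bsub>K0 CL\<^esub>"
  unfolding d_def using zc zf eq by simp_all
 define d1 where "d1 = K0_map S1 j0 d"
 have d1: "d1 : carrier (K0 S1)" unfolding d1_def by (rule hom_in_carrier[OF K0_map_hom[OF sq2.hj] d])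
 have "K0_map R (%w. w) d1 = K0_map R j0 d"
  unfolding d1_def using K0_map_comp[OF nT S1_nring nR sq2.j sq1.j d] by (simp add: o_def)
 moreover have "K0_map CL chR d1 = K0_map CL fst d"
  unfolding d1_def K0_map_comp[OF nT S1_nring cplx_nring sq2.j sq1.ch d]
  by (rule K0_map_cong[OF nT cplx_nring nring_hom_comp[OF sq2.j sq1.ch] fh _ d]) (simp add: p_j0(3))
 ultimately have "d1 = \<one>\<^bsub>K0 S1\<^esub>" using sq1.K0_split_injective[OF d1] jd fd by simp
 then have "d = \<one>\<^bsub>K0 (unz T)\<^esub>" using sq2.K0_split_injective[OF d fd] by (simp add: d1_def)
 then show ?thesis using zc by (metis d_def KT.inv_equality KT.inv_inv KT.inv_closed)
qed

text \<open>The tensor map on the unitisations themselves, as \<open>KG_cup\<close> requires, with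
  values in the tensor product of the copies.\<close>

definition r0 :: "complex \<times> 'u => complex \<times> 'u => 'u" where
 "r0 u v = tm U V (uu' A u) (uu' B v)"

lemma r0_proj: "proj_tensor (unz A) (unz B) R r0" unfolding r0_def[abs_def]
 by (rule proj_tensor_iso[OF AB.A.unitization_lca_like AB.B.unitization_lca_like UV.A.lca_like UV.B.lca_like
    UU(3)[OF A_obj] UU(3)[OF B_obj] UV.proj])

lemma r0_pairing: "mpairing (unz A) (unz B) R r0"
proof -
 note a = nring_homD[OF nring_hom_of[OF iso_hom[OF UU(3)[OF A_obj]]]]
  and b = nring_homD[OF nring_hom_of[OF iso_hom[OF UU(3)[OF B_obj]]]]
 show ?thesis by (intro mpairing.intro mpairing_axioms.intro AB.A.unit_nring AB.B.unit_nring UV.T.nring)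
   (simp_all add: r0_def UV.t_closed UVm.t_add_left UVm.t_add_right UV.t_mult a b)
qed

lemma cup_r0:
 assumes x: "x : carrier (K0 (unz A))" and y: "y : carrier (K0 (unz B))"
 shows "K0_cup R r0 x y = K0_cup R (tm U V) (K0_map U (uu' A) x) (K0_map V (uu' B) y)"
proof -
 note a = nring_hom_of[OF iso_hom[OF UU(3)[OF A_obj]]] and b = nring_hom_of[OF iso_hom[OF UU(3)[OF B_obj]]]
 have i: "(%w. w) : nring_hom R R" by (simp add: nring_hom_def hom_def)
 have "K0_map R (%w. w) (K0_cup R r0 x y) = K0_cup R r0 x y"
  by (rule K0_map_ident[OF UV.T.nring i refl mpairing.K0_cup_carrier[OF r0_pairing x y]])
 moreover have "K0_map R (%w. w) (K0_cup R r0 x y) = K0_cup R (tm U V) (K0_map U (uu' A) x) (K0_map V (uu' B) y)"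
  by (rule K0_cup_natural[OF r0_pairing UV.mpairing i a b _ x y]) (simp add: r0_def)
 ultimately show ?thesis by simp
qed

text \<open>Applying the character to one factor turns the cup product into a product with the image
  of \<open>y\<close>, or of \<open>x\<close>, over the complex numbers, and these images are
  trivial. So the cup product dies under \<open>p1\<close>, its lift to \<open>S1\<close> dies under
  \<open>p2\<close>, and each excision step lifts it further.\<close>

lemma cup_lift:
 assumes x: "x : carrier (KG A)" and y: "y : carrier (KG B)"
 shows "\<exists>z\<in>carrier (KG T). K0_map R j0 z = K0_cup R r0 x y"
proof -
 interpret sq1: split_square S1 eR R eR U eU CL 1 "%w. w" p1 s1 chR "%c. c \<odot>\<^sub>U eU" by (rule square1)
 interpret sq2: split_square "unz T" "(1, \<zero>\<^sub>T)" S1 eR V eV CL 1 j0 p2 s2 fst "%c. c \<odot>\<^sub>V eV" by (rule square2)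
 note nT = AB.T.unit_nring and nR = UV.T.nring
 have xc: "x : carrier (K0 (unz A))" "K0_map CL fst x = \<one>\<^bsub>K0 CL\<^esub>"
  and yc: "y : carrier (K0 (unz B))" "K0_map CL fst y = \<one>\<^bsub>K0 CL\<^esub>"
  using x y by (auto simp: KG_def kernel_def)
 define w where "w = K0_cup R r0 x y"
 have w: "w : carrier (K0 R)" unfolding w_def by (rule mpairing.K0_cup_carrier[OF r0_pairing xc(1) yc(1)])
 note a = nring_hom_of[OF iso_hom[OF UU(3)[OF A_obj]]] and b = nring_hom_of[OF iso_hom[OF UU(3)[OF B_obj]]]
 note aD = nring_homD[OF a] and bD = nring_homD[OF b]
 \<comment> \<open>The pairing to which the tensor pairing degenerates when the character is applied
   to the second factor; \<open>pr2\<close> is the same for the first.\<close>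
 have pr1: "mpairing U CL U (%u c. c \<odot>\<^sub>U u)"
  by (intro mpairing.intro mpairing_axioms.intro UV.A.nring cplx_nring)
   (simp_all add: cplx_simps UV.A.sm_closed UV.A.sm_add_left UV.A.sm_add_right UV.A.smult_m_left UV.A.smult_m_right
    UV.A.sm_assoc[symmetric] UV.A.m_closed mult.commute)
 have pr2: "mpairing CL V V (%c v. c \<odot>\<^sub>V v)"
  by (intro mpairing.intro mpairing_axioms.intro UV.B.nring cplx_nring)
   (simp_all add: cplx_simps UV.B.sm_closed UV.B.sm_add_left UV.B.sm_add_right UV.B.smult_m_left UV.B.smult_m_right
    UV.B.sm_assoc[symmetric] UV.B.m_closed mult.commute)
 have "K0_map U p1 w = K0_cup U (%u c. c \<odot>\<^sub>U u) (K0_map U (uu' A) x) (K0_map CL fst y)"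
  unfolding w_def
  by (rule K0_cup_natural[OF r0_pairing pr1 sq1.\<pi> a nring_hom_of[OF AB.B.fst_hom] _ xc(1) yc(1)])
   (simp add: r0_def p1(2) aD bD chV_def UU(5)[OF B_obj])
 also have "... = \<one>\<^bsub>K0 U\<^esub>"
  unfolding yc(2) by (rule mpairing.K0_cup_one_right[OF pr1 hom_in_carrier[OF K0_map_hom[OF AB.A.unit_nring UV.A.nring a] xc(1)]])
 finally obtain Y where Y: "Y : carrier (K0 S1)" "K0_map CL chR Y = \<one>\<^bsub>K0 CL\<^esub>" "K0_map R (%w. w) Y = w"
  using sq1.K0_split_surjective[OF w] by blast
 have "K0_map V p2 Y = K0_map V p2 (K0_map R (%w. w) Y)"
  using K0_map_comp[OF S1_nring nR UV.B.nring sq1.j nring_hom_of[OF p2(1)] Y(1)] by (simp add: o_def)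
 also have "... = K0_cup V (%c v. c \<odot>\<^sub>V v) (K0_map CL fst x) (K0_map V (uu' B) y)"
  unfolding Y(3) w_def
  by (rule K0_cup_natural[OF r0_pairing pr2 nring_hom_of[OF p2(1)] nring_hom_of[OF AB.A.fst_hom] b _ xc(1) yc(1)])
   (simp add: r0_def p2(2) aD bD chU_def UU(5)[OF A_obj])
 also have "... = \<one>\<^bsub>K0 V\<^esub>"
  unfolding xc(2) by (rule mpairing.K0_cup_one_left[OF pr2 hom_in_carrier[OF K0_map_hom[OF AB.B.unit_nring UV.B.nring b] yc(1)]])
 finally obtain z where z: "z : carrier (K0 (unz T))" "K0_map CL fst z = \<one>\<^bsub>K0 CL\<^esub>" "K0_map S1 j0 z = Y"
  using sq2.K0_split_surjective[OF Y(1)] by blast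
 have "K0_map R j0 z = K0_map R (%w. w) (K0_map S1 j0 z)"
  using K0_map_comp[OF nT S1_nring nR sq2.j sq1.j z(1)] by (simp add: o_def)
 then show ?thesis using z Y(3) by (auto simp: KG_def kernel_def w_def)
qed

text \<open>\<open>KG_cup\<close> admits any tensor product of the unitisations. Its universal
  property compares it with \<open>R\<close> by a morphism \<open>\<theta>\<close> that carries
  \<open>j\<close> to \<open>j0\<close>, so every candidate for the outer product is a candidate
  with respect to \<open>R\<close>.\<close>

lemma j_transport:
 assumes P: "proj_tensor (unz A) (unz B) (R' :: 'u lca) r" and j: "j : lca_hom (unz T) R'"
  and jt: "\<forall>c. \<forall>a\<in>carrier A. \<forall>b\<in>carrier B.
   j (c, tm A B a b) = c \<odot>\<^sub>R' r \<one>\<^bsub>unz A\<^esub> \<one>\<^bsub>unz B\<^esub> \<oplus>\<^sub>R' r (0, a) (0, b)"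
  and x: "x : carrier (K0 (unz A))" and y: "y : carrier (K0 (unz B))"
  and z: "z : carrier (K0 (unz T))" "K0_map R' j z = K0_cup R' r x y"
 shows "K0_map R j0 z = K0_cup R r0 x y"
proof -
 define r' where "r' u v = r (uu A u) (uu B v)" for u v
 have LR': "LCA R'" using P by (simp add: proj_tensor_def)
 have P': "proj_tensor U V R' r'" unfolding r'_def[abs_def]
  by (rule proj_tensor_iso[OF UV.A.lca_like UV.B.lca_like AB.A.unitization_lca_like AB.B.unitization_lca_like UU(2)[OF A_obj] UU(2)[OF B_obj] P])
 interpret Q: tpair U V R' r' by (intro tpair.intro tpair_axioms.intro UV.A.lca_axioms UV.B.lca_axioms LR' P')
 obtain \<theta> where \<theta>: "\<theta> : lca_hom R' R" "\<forall>u\<in>carrier U. \<forall>v\<in>carrier V. \<theta> (r' u v) = tm U V u v"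
  using Q.lift_hom_exists[OF UV.T.lca_axioms UV.t_bounded] UV.t_mult by auto
 have rr': "r u v = r' (uu' A u) (uu' B v)" if "u : carrier (unz A)" "v : carrier (unz B)" for u v
  using that by (simp add: r'_def UU(5)[OF A_obj] UU(5)[OF B_obj])
 note aD = homD[OF iso_hom[OF UU(3)[OF A_obj]]] and bD = homD[OF iso_hom[OF UU(3)[OF B_obj]]]
 have \<theta>r: "\<theta> (r u v) = r0 u v" if "u : carrier (unz A)" "v : carrier (unz B)" for u v
  using that \<theta>(2) aD(3) bD(3) by (simp add: rr' r0_def)
 have rc: "r u v : carrier R'" if "u : carrier (unz A)" "v : carrier (unz B)" for u v
  using that Q.t_closed aD(3) bD(3) by (simp add: rr')
 have oA: "(1, \<zero>\<^sub>A) : carrier (unz A)" and oB: "(1, \<zero>\<^sub>B) : carrier (unz B)"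
  by (simp_all add: unit_simps)
 have one: "\<theta> (r (1, \<zero>\<^sub>A) (1, \<zero>\<^sub>B)) = eR"
  using \<theta>r[OF oA oB] by (simp add: r0_def eR_def eU_def eV_def)
 have \<theta>j_gen: "\<theta> (j (c, tm A B a b)) = c \<odot>\<^sub>R eR \<oplus>\<^sub>R inc (tm A B a b)" if "a : carrier A" "b : carrier B" for c a b
 proof -
  have ab: "(0, a) : carrier (unz A)" "(0, b) : carrier (unz B)" using that by (simp_all add: unit_simps)
  show ?thesis using jt that rc[OF oA oB] rc[OF ab]
   by (simp add: unit_simps(5) homD(4,5)[OF \<theta>(1)] Q.T.sm_closed one \<theta>r[OF ab] inc(2))
    (simp add: r0_def)
 qed
 have jh: "(%w. \<theta> (j (0, w))) : clin T R"
  using clin_comp[OF clin_comp[OF homD(1)[OF AB.T.incl_hom] homD(1)[OF j]] homD(1)[OF \<theta>(1)]] by (simp add: o_def)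
 have incR: "inc w : carrier R" if "w : carrier T" for w by (rule homD(3)[OF inc(1) that])
 have \<theta>j0: "\<theta> (j (0, w)) = inc w" if w: "w : carrier T" for w
  by (rule AB.clin_unique[OF UV.T.lca_axioms jh homD(1)[OF inc(1)] _ w])
   (simp add: \<theta>j_gen UV.T.sm_zero_left eR_closed incR AB.t_closed)
 \<comment> \<open>The condition on \<open>j\<close> concerns pairs of a scalar and an elementary
   tensor. The scalar part is read off at the zero tensor, the rest follows by density.\<close>
 have \<theta>j: "(\<theta> \<circ> j) z = j0 z" if z: "z : carrier (unz T)" for z
 proof -
  obtain c w where cw: "z = (c, w)" "w : carrier T" using z by (auto simp: unit_simps)
  have t0: "tm A B \<zero>\<^sub>A \<zero>\<^sub>B = \<zero>\<^sub>T" by (rule AB.tb.null_right[OF AB.A.M.zero_closed])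
  have i0: "inc \<zero>\<^sub>T = \<zero>\<^sub>R"
   by (rule clin_zero[OF AB.T.lca_axioms UV.T.lca_axioms homD(1)[OF inc(1)]])
  have c0: "\<theta> (j (c, \<zero>\<^sub>T)) = c \<odot>\<^sub>R eR"
   using \<theta>j_gen[OF AB.A.M.zero_closed AB.B.M.zero_closed, of c] by (simp add: t0 i0 UV.T.sm_closed eR_closed)
  have m: "(c, \<zero>\<^sub>T) : carrier (unz T)" "(0, w) : carrier (unz T)" using cw by (simp_all add: unit_simps)
  have "z = (c, \<zero>\<^sub>T) \<oplus>\<^bsub>unz T\<^esub> (0, w)" using cw by (simp add: unit_simps)
  then have "\<theta> (j z) = \<theta> (j (c, \<zero>\<^sub>T)) \<oplus>\<^sub>R \<theta> (j (0, w))"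
   using m homD(3,4)[OF j] by (simp add: homD(4)[OF \<theta>(1)])
  then show ?thesis using cw by (simp add: c0 \<theta>j0 j0_app)
 qed
 have mp: "mpairing (unz A) (unz B) R' r" using bilD[of "unz A" "unz B" R' r] P
  by (intro mpairing.intro mpairing_axioms.intro AB.A.unit_nring AB.B.unit_nring Q.T.nring)
   (simp_all add: proj_tensor_def)
 note nj = nring_hom_of[OF j] and n\<theta> = nring_hom_of[OF \<theta>(1)] and nj0 = nring_hom_of[OF j0_hom]
 have iA: "(%w. w) : nring_hom (unz A) (unz A)" "(%w. w) : nring_hom (unz B) (unz B)"
  by (simp_all add: nring_hom_def hom_def)
 have "K0_map R j0 z = K0_map R (\<theta> \<circ> j) z"
  by (rule K0_map_cong[OF AB.T.unit_nring UV.T.nring nj0 nring_hom_comp[OF nj n\<theta>] \<theta>j[symmetric] z(1)])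
 also have "... = K0_map R \<theta> (K0_map R' j z)"
  by (rule K0_map_comp[OF AB.T.unit_nring Q.T.nring UV.T.nring nj n\<theta> z(1), symmetric])
 also have "... = K0_cup R r0 (K0_map (unz A) (%w. w) x) (K0_map (unz B) (%w. w) y)"
  unfolding z(2) by (rule K0_cup_natural[OF mp r0_pairing n\<theta> iA _ x y]) (rule \<theta>r)
 finally show ?thesis
  by (simp add: K0_map_ident[OF AB.A.unit_nring iA(1) _ x] K0_map_ident[OF AB.B.unit_nring iA(2) _ y])
qed

text \<open>Existence is \<open>cup_lift\<close>; for uniqueness \<open>j_transport\<close> moves
  every candidate to \<open>R\<close>, where \<open>K0_j0_inj\<close> applies.\<close>

lemma KG_cup:
 assumes x: "x : carrier (KG A)" and y: "y : carrier (KG B)"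
 shows "KG_cup A B T (tm A B) x y : carrier (KG T)"
  "K0_map R j0 (KG_cup A B T (tm A B) x y) = K0_cup R (tm U V) (K0_map U (uu' A) x) (K0_map V (uu' B) y)"
proof -
 have xc: "x : carrier (K0 (unz A))" and yc: "y : carrier (K0 (unz B))" using x y by (auto simp: KG_def kernel_def)
 obtain z where z: "z : carrier (KG T)" "K0_map R j0 z = K0_cup R r0 x y" using cup_lift[OF x y] by blast
 have j0t: "\<forall>c. \<forall>a\<in>carrier A. \<forall>b\<in>carrier B.
   j0 (c, tm A B a b) = c \<odot>\<^sub>R r0 \<one>\<^bsub>unz A\<^esub> \<one>\<^bsub>unz B\<^esub> \<oplus>\<^sub>R r0 (0, a) (0, b)"
  by (simp add: j0_app AB.t_closed inc(2) r0_def eR_def eU_def eV_def unit_simps(5))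
 have "KG_cup A B T (tm A B) x y = z" unfolding KG_cup_def
 proof (rule the_equality)
  show "z : carrier (KG T) & (\<exists>(R :: 'u lca) r j. proj_tensor (unz A) (unz B) R r & j : lca_hom (unz T) R &
    (\<forall>c. \<forall>a\<in>carrier A. \<forall>b\<in>carrier B. j (c, tm A B a b) =
     c \<odot>\<^sub>R r \<one>\<^bsub>unz A\<^esub> \<one>\<^bsub>unz B\<^esub> \<oplus>\<^sub>R r (0, a) (0, b)) & K0_map R j z = K0_cup R r x y)"
   using z r0_proj j0_hom j0t by blast
  fix z' assume "z' : carrier (KG T) & (\<exists>(R :: 'u lca) r j. proj_tensor (unz A) (unz B) R r & j : lca_hom (unz T) R &
    (\<forall>c. \<forall>a\<in>carrier A. \<forall>b\<in>carrier B. j (c, tm A B a b) =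
     c \<odot>\<^sub>R r \<one>\<^bsub>unz A\<^esub> \<one>\<^bsub>unz B\<^esub> \<oplus>\<^sub>R r (0, a) (0, b)) & K0_map R j z' = K0_cup R r x y)"
  then obtain R' :: "'u lca" and r j where z': "z' : carrier (KG T)"
   and R': "proj_tensor (unz A) (unz B) R' r" "j : lca_hom (unz T) R'"
    "\<forall>c. \<forall>a\<in>carrier A. \<forall>b\<in>carrier B. j (c, tm A B a b) =
     c \<odot>\<^sub>R' r \<one>\<^bsub>unz A\<^esub> \<one>\<^bsub>unz B\<^esub> \<oplus>\<^sub>R' r (0, a) (0, b)"
    "K0_map R' j z' = K0_cup R' r x y" by blast
  have "K0_map R j0 z' = K0_cup R r0 x y"
   by (rule j_transport[OF R'(1-3) xc yc _ R'(4)]) (use z' in \<open>simp add: KG_def kernel_def\<close>)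
  then show "z' = z" using K0_j0_inj[OF z' z(1)] z(2) by simp
 qed
 then show "KG_cup A B T (tm A B) x y : carrier (KG T)"
  "K0_map R j0 (KG_cup A B T (tm A B) x y) = K0_cup R (tm U V) (K0_map U (uu' A) x) (K0_map V (uu' B) y)"
  using z cup_r0[OF xc yc] by simp_all
qed

end

context lca_setting
begin

lemma tensor_assoc:
 assumes Obj: "A : Obj" "B : Obj" "C : Obj"
 shows "tensor_assoc tens tm A B C : lca_hom (tens (tens A B) C) (tens A (tens B C))"
  "[|a : carrier A; b : carrier B; c : carrier C|] ==>
   tensor_assoc tens tm A B C (tm (tens A B) C (tm A B a b) c) = tm A (tens B C) a (tm B C b c)"
proof -
 interpret tensor_triple A B "tens A B" "tm A B" C "tens (tens A B) C" "tm (tens A B) C"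
  "tens B C" "tm B C" "tens A (tens B C)" "tm A (tens B C)" by (intro tensor_triple.intro pair obj_tens Obj)
 have "\<exists>h. h : lca_iso (tens (tens A B) C) (tens A (tens B C)) &
    (\<forall>a\<in>carrier A. \<forall>b\<in>carrier B. \<forall>c\<in>carrier C. h (tm (tens A B) C (tm A B a b) c) = tm A (tens B C) a (tm B C b c))"
  using assoc_iso by blast
 note * = someI_ex[OF this, folded tensor_assoc_def]
 show "tensor_assoc tens tm A B C : lca_hom (tens (tens A B) C) (tens A (tens B C))"
  using * by (intro iso_hom) simp
 show "[|a : carrier A; b : carrier B; c : carrier C|] ==>
   tensor_assoc tens tm A B C (tm (tens A B) C (tm A B a b) c) = tm A (tens B C) a (tm B C b c)" using * by blast
qed

text \<open>Both sides are compared in \<open>H (A\<^sup>+ \<otimes> (B\<^sup>+ \<otimes> C))\<close>.\<close>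

lemma prd_assoc:
 assumes Obj: "A : Obj" "B : Obj" "C : Obj"
  and x: "x : carrier (KG A)" and y: "y : carrier (KG B)" and c: "c : carrier (H C)"
 shows "Hmap (tens (tens A B) C) (tens A (tens B C)) (tensor_assoc tens tm A B C)
   (prd (tens A B) C (KG_cup A B (tens A B) (tm A B) x y) c) = prd A (tens B C) x (prd B C y c)"
proof -
 interpret Q: unital_pair Obj tens tm A B by unfold_locales (fact Obj)+
 let ?T = "tens A B" and ?U = "UU A" and ?V = "UU B" and ?BC = "tens B C"
 let ?R = "tens ?U ?V" and ?VC = "tens ?V C"
 note U = UU(1)[OF Obj(1)] and V = UU(1)[OF Obj(2)]
 note T = obj_tens[OF Obj(1,2)] and BC = obj_tens[OF Obj(2,3)] and R = obj_tens[OF U V] and VC = obj_tens[OF V Obj(3)]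
 note W = UU(1)[OF T]
 note TC = obj_tens[OF T Obj(3)] and ABC = obj_tens[OF Obj(1) BC] and UBC = obj_tens[OF U BC]
  and UVC = obj_tens[OF U VC] and RC = obj_tens[OF R Obj(3)] and WC = obj_tens[OF W Obj(3)]
 define z where "z = KG_cup A B ?T (tm A B) x y"
 have z: "z : carrier (KG ?T)" and jz: "K0_map ?R Q.j0 z = K0_cup ?R (tm ?U ?V) (kx A x) (kx B y)"
  unfolding z_def using Q.KG_cup[OF x y] by auto
 have xc: "x : carrier (K0 (unz A))" using x by (simp add: KG_simps[OF Obj(1)])
 have yc: "y : carrier (K0 (unz B))" using y by (simp add: KG_simps[OF Obj(2)])
 have zc: "z : carrier (K0 (unz ?T))" using z by (simp add: KG_simps[OF T])
 note kX = kx_closed[OF Obj(1) xc] and kY = kx_closed[OF Obj(2) yc] and kZ = kx_closed[OF T zc]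
 note pz = prd[OF T Obj(3) z c] and py = prd[OF Obj(2,3) y c]
 note px = prd[OF Obj(1) BC x py(1)]
 note as = tensor_assoc[OF Obj] and as' = tensor_assoc[OF U V Obj(3)]
 let ?a = "tensor_assoc tens tm A B C" and ?a' = "tensor_assoc tens tm ?U ?V C"
 let ?i1 = "um A ?BC"
 \<comment> \<open>Unitises the second factor after \<open>?i1\<close> has unitised the first. Both
   are kernels of split extensions, so both are injective on \<open>H\<close>.\<close>
 define i2 where "i2 = tmap ?U ?BC ?U ?VC (%u. u) (um B C)"
 define i where "i = tmap ?T C ?R C Q.inc (%c. c)"
 have sd2: "sdata (tens ?U ?BC) (tens ?U ?VC) (tens ?U (tens CC C)) i2
   (tmap ?U ?VC ?U (tens CC C) (%x. x) (tmap ?V C CC C (uq B) (%b. b)))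
   (tmap ?U (tens CC C) ?U ?VC (%x. x) (tmap CC C ?V C (us B) (%b. b)))
   (tmap ?U ?VC ?U ?BC (%x. x) (tmap ?V C B C (snd \<circ> uu B) (%b. b)))"
  unfolding i2_def by (rule sdata_tmap_left[OF U BC VC obj_tens[OF CC(1) Obj(3)] um_split[OF Obj(2,3)]])
 have i1h: "?i1 : lca_hom (tens A ?BC) (tens ?U ?BC)" by (rule um_hom[OF Obj(1) BC])
 have i2h: "i2 : lca_hom (tens ?U ?BC) (tens ?U ?VC)" using sd2 by (simp add: sdata_def)
 have ih: "i : lca_hom (tens ?T C) (tens ?R C)" unfolding i_def by (rule tmap_hom[OF T Obj(3) R Obj(3) Q.inc(1) hom_ident])
 define G where "G = i2 \<circ> (?i1 \<circ> ?a)"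
 have G: "G : lca_hom (tens ?T C) (tens ?U ?VC)" unfolding G_def by (rule hom_comp[OF hom_comp[OF as(1) i1h] i2h])
 have G': "?a' \<circ> i : lca_hom (tens ?T C) (tens ?U ?VC)" by (rule hom_comp[OF ih as'(1)])
 have umb: "um B C : lca_hom ?BC ?VC" by (rule um_hom[OF Obj(2,3)])
 \<comment> \<open>Reassociating commutes with including the algebras into their
   unitisations.\<close>
 have GG: "(?a' \<circ> i) w = G w" if w: "w : carrier (tens ?T C)" for w
 proof -
  interpret tensor_triple A B ?T "tm A B" C "tens ?T C" "tm ?T C" ?BC "tm B C" "tens A ?BC" "tm A ?BC"
   by (intro tensor_triple.intro pair obj_tens Obj)
  interpret VCp: tpair ?V C ?VC "tm ?V C" by (rule pair[OF V Obj(3)])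
  show ?thesis
  proof (rule unique_left[OF obj_lca[OF UVC] homD(1)[OF G'] homD(1)[OF G] _ w])
   fix a b d assume abd: "a : carrier A" "b : carrier B" "d : carrier C"
   have tab: "tm A B a b : carrier ?T" and tbd: "tm B C b d : carrier ?BC" using abd by (auto intro: Q.AB.t_closed BC.t_closed)
   have uc: "ui A a : carrier ?U" "ui B b : carrier ?V" using Q.ui_closed abd by auto
   have "(?a' \<circ> i) (tm ?T C (tm A B a b) d) = ?a' (tm ?R C (tm ?U ?V (ui A a) (ui B b)) d)"
    using tmap(2)[OF T Obj(3) R Obj(3) homD(1)[OF Q.inc(1)] clin_ident tab abd(3)] Q.inc(2)[OF abd(1,2)]
    by (simp add: i_def)
   also have "... = tm ?U ?VC (ui A a) (tm ?V C (ui B b) d)" by (rule as'(2)[OF uc abd(3)])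
   also have "... = i2 (tm ?U ?BC (ui A a) (tm B C b d))"
    unfolding i2_def tmap(2)[OF U BC U VC clin_ident homD(1)[OF umb] uc(1) tbd]
     tmap(2)[OF Obj(2,3) V Obj(3) homD(1)[OF ui_hom[OF Obj(2)]] clin_ident abd(2,3)] ..
   also have "... = G (tm ?T C (tm A B a b) d)"
    using tmap(2)[OF Obj(1) BC U BC homD(1)[OF ui_hom[OF Obj(1)]] clin_ident abd(1) tbd]
    by (simp add: G_def as(2)[OF abd])
   finally show "(?a' \<circ> i) (tm ?T C (tm A B a b) d) = G (tm ?T C (tm A B a b) d)" .
  qed
 qed
 define L where "L = Hmap (tens ?T C) (tens A ?BC) ?a (prd ?T C z c)"
 have L: "L : carrier (H (tens A ?BC))" unfolding L_def by (rule H_closed[OF TC ABC as(1) pz(1)])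
 \<comment> \<open>Links the unitisation of the tensor product, over which the left product is
   defined, with the tensor product of the unitisations, in which the cup product is
   computed.\<close>
 have jU_ui: "Q.jU (ui ?T w) = Q.inc w" if "w : carrier ?T" for w
  using that ui_hom[OF T, THEN homD(3), OF that] homD(3)[OF Q.inc(1) that]
  by (simp add: Q.jU_def UU(5)[OF T] unit_simps Q.UV.T.sm_zero_left Q.eR_closed)
 have "Hmap (tens ?U ?BC) (tens ?U ?VC) i2 (Hmap (tens A ?BC) (tens ?U ?BC) ?i1 L) =
   Hmap (tens ?U ?BC) (tens ?U ?VC) i2 (Hmap (tens ?T C) (tens ?U ?BC) (?i1 \<circ> ?a) (prd ?T C z c))"
  unfolding L_def by (rule arg_cong[OF H_comp[OF TC ABC UBC as(1) i1h hom_comp[OF as(1) i1h] _ pz(1)]]) simp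
 also have "... = Hmap (tens ?T C) (tens ?U ?VC) G (prd ?T C z c)"
  by (rule H_comp[OF TC UBC UVC hom_comp[OF as(1) i1h] i2h G _ pz(1)]) (simp add: G_def)
 also have "... = Hmap (tens ?R C) (tens ?U ?VC) ?a' (Hmap (tens ?T C) (tens ?R C) i (prd ?T C z c))"
  by (rule H_comp[OF TC RC UVC ih as'(1) G _ pz(1), symmetric]) (use GG in simp)
 also have "Hmap (tens ?T C) (tens ?R C) i (prd ?T C z c) =
   Hmap (tens (UU ?T) C) (tens ?R C) (tmap (UU ?T) C ?R C Q.jU (%c. c)) (Hmap (tens ?T C) (tens (UU ?T) C) (um ?T C) (prd ?T C z c))"
  by (rule H_comp[OF TC WC RC um_hom[OF T Obj(3)] tmap_hom[OF W Obj(3) R Obj(3) Q.jU_hom hom_ident] ih _ pz(1), symmetric],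
    unfold i_def, rule tmap_comp[OF T Obj(3) W Obj(3) R Obj(3) homD(1)[OF ui_hom[OF T]] clin_ident homD(1)[OF Q.jU_hom] clin_ident
     homD(1)[OF Q.inc(1)] clin_ident jU_ui refl]) simp_all
 also have "... = Kp ?R C (K0_map ?R Q.jU (kx ?T z)) (Hmap C C (%c. c) c)"
  unfolding pz(2) by (rule Kp_natural[OF W Obj(3) R Obj(3) Q.jU_hom hom_ident kZ c])
 also have "Hmap C C (%c. c) c = c" by (rule map_id[OF Obj(3) c])
 also have "K0_map ?R Q.jU (kx ?T z) = K0_map ?R Q.j0 z"
 proof -
  have e: "Q.jU \<circ> uu' ?T = Q.j0" by (rule ext) (simp add: Q.jU_def Q.j0_def)
  show ?thesis
   using K0_map_comp[OF unitization_nr[OF T] nr[OF W] nr[OF R] uu'_nring_hom[OF T] nring_hom_of[OF Q.jU_hom] zc]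
   unfolding e .
 qed
 \<comment> \<open>By the defining property of the outer product, its image in \<open>K0\<close> of
   the tensor product of the unitisations is the product of idempotents there, for which
   associativity is \<open>Kp_assoc\<close>.\<close>
 also have "Hmap (tens ?R C) (tens ?U ?VC) ?a' (Kp ?R C (K0_map ?R Q.j0 z) c) = Kp ?U ?VC (kx A x) (Kp ?V C (kx B y) c)"
  unfolding jz by (rule Kp_assoc[OF U V Obj(3) as'(1) as'(2) kX kY c])
 also have "... = Hmap (tens ?U ?BC) (tens ?U ?VC) i2 (Kp ?U ?BC (kx A x) (prd B C y c))"
  unfolding i2_def Kp_natural[OF U BC U VC hom_ident umb kX py(1)] py(2)
   K0_map_ident[OF nr[OF U] nring_hom_of[OF hom_ident] refl kX] ..
 also have "... = Hmap (tens ?U ?BC) (tens ?U ?VC) i2 (Hmap (tens A ?BC) (tens ?U ?BC) ?i1 (prd A ?BC x (prd B C y c)))"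
  unfolding px(2) ..
 \<comment> \<open>Injectivity of \<open>i2\<close> and then of \<open>?i1\<close> on
   \<open>H\<close> descends from the unitisations to the algebras themselves.\<close>
 finally have "Hmap (tens A ?BC) (tens ?U ?BC) ?i1 L = Hmap (tens A ?BC) (tens ?U ?BC) ?i1 (prd A ?BC x (prd B C y c))"
  by (rule inj_onD[OF H_split(1)[OF UBC UVC obj_tens[OF U obj_tens[OF CC(1) Obj(3)]] sd2] _
     H_closed[OF ABC UBC i1h L] H_closed[OF ABC UBC i1h px(1)]])
 then have "L = prd A ?BC x (prd B C y c)" by (rule inj_onD[OF um_inj[OF Obj(1) BC] _ L px(1)])
 then show ?thesis by (simp add: L_def z_def)
qed

end

theorem proposition28:
  fixes Obj :: "'u lca set"
    and tens :: "'u lca \<Rightarrow> 'u lca \<Rightarrow> 'u lca"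
    and tm :: "'u lca \<Rightarrow> 'u lca \<Rightarrow> 'u \<Rightarrow> 'u \<Rightarrow> 'u"
    and H :: "'u lca \<Rightarrow> 'h monoid"
    and Hmap :: "'u lca \<Rightarrow> 'u lca \<Rightarrow> ('u \<Rightarrow> 'u) \<Rightarrow> 'h \<Rightarrow> 'h"
  assumes "lca_universe Obj tens tm"
    and "lca_functor Obj H Hmap"
    and "split_exact Obj H Hmap"
    and "M2_stable Obj H Hmap"
  shows "\<exists>prd :: 'u lca \<Rightarrow> 'u lca \<Rightarrow> (complex \<times> 'u) k0 \<Rightarrow> 'h \<Rightarrow> 'h.
    (\<forall>A\<in>Obj. \<forall>B\<in>Obj. biadditive (KG A) (H B) (H (tens A B)) (prd A B)) \<and>
    (\<forall>C\<in>Obj. \<forall>\<phi>\<in>lca_iso C complex_lca. \<forall>B\<in>Obj. \<forall>b\<in>carrier (H B).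
       Hmap (tens C B) B (tensor_lift C B (tens C B) (tm C B) B (\<lambda>z b. \<phi> z \<odot>\<^bsub>B\<^esub> b))
         (prd C B (KG_map C (inv_into (carrier C) \<phi>) KG_one) b) = b) \<and>
    (\<forall>A1\<in>Obj. \<forall>A2\<in>Obj. \<forall>B1\<in>Obj. \<forall>B2\<in>Obj. \<forall>f\<in>lca_hom A1 A2. \<forall>g\<in>lca_hom B1 B2.
       \<forall>x\<in>carrier (KG A1). \<forall>b\<in>carrier (H B1).
       prd A2 B2 (KG_map A2 f x) (Hmap B1 B2 g b) =
         Hmap (tens A1 B1) (tens A2 B2)
           (tensor_lift A1 B1 (tens A1 B1) (tm A1 B1) (tens A2 B2) (\<lambda>a b. tm A2 B2 (f a) (g b)))
           (prd A1 B1 x b)) \<and>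
    (\<forall>A\<in>Obj. \<forall>B\<in>Obj. \<forall>C\<in>Obj.
       \<forall>x\<in>carrier (KG A). \<forall>y\<in>carrier (KG B). \<forall>c\<in>carrier (H C).
       Hmap (tens (tens A B) C) (tens A (tens B C)) (tensor_assoc tens tm A B C)
         (prd (tens A B) C (KG_cup A B (tens A B) (tm A B) x y) c) =
       prd A (tens B C) x (prd B C y c))"
proof -
  interpret lca_setting Obj tens tm H Hmap
    by (intro lca_setting.intro lca_setting_axioms.intro assms)
  \<comment> \<open>The morphism of the statement is a \<open>tensor_lift\<close>, whereas
    \<open>prd_natural\<close> uses \<open>tmap\<close>; they agree on the carrier, hence induce the
    same map.\<close>
  have natural: "prd A2 B2 (KG_map A2 f x) (Hmap B1 B2 g b) =
         Hmap (tens A1 B1) (tens A2 B2)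
           (tensor_lift A1 B1 (tens A1 B1) (tm A1 B1) (tens A2 B2) (\<lambda>a b. tm A2 B2 (f a) (g b)))
           (prd A1 B1 x b)"
    if Obj: "A1 \<in> Obj" "A2 \<in> Obj" "B1 \<in> Obj" "B2 \<in> Obj" and fg: "f \<in> lca_hom A1 A2" "g \<in> lca_hom B1 B2"
      and xb: "x \<in> carrier (KG A1)" "b \<in> carrier (H B1)" for A1 A2 B1 B2 f g x b
    unfolding prd_natural[OF Obj fg xb]
    by (rule map_cong[OF obj_tens[OF Obj(1,3)] obj_tens[OF Obj(2,4)] tmap_hom[OF Obj(1,3,2,4) fg]
          tensor_lift_tmap(1)[OF Obj(1,3,2,4) fg] tensor_lift_tmap(2)[OF Obj(1,3,2,4) fg, symmetric] prd(1)[OF Obj(1,3) xb]])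
  show ?thesis
    using prd_biadditive prd_one natural prd_assoc by (intro exI[of _ prd] conjI ballI)
qed

end
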